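(* Let $\mathbf K^\pm(z)$, $\mathbf K(z)=\mathbf K^-(z)\mathbf K^+(z)$, $\mathbf T(z)$ and $\mathbf G^\pm(z)$ be the free-field operators defined in the context. Then in the sector ${\rm A}={\rm NS}$ or ${\rm R}$ they satisfy the following relations (rational factors read as Taylor series in the domain $|z|\ll|w|$): $$\mathbf K^\pm(z)\mathbf K^\pm(w)=\mathbf K^\pm(w)\mathbf K^\pm(z),$$ $$\mathbf K^-(z)\mathbf K^+(w)=\frac{(1-q^{2k+2}z/w)(1-q^{-2k-2}z/w)}{(1-q^2z/w)(1-q^{-2}z/w)}\mathbf K^+(w)\mathbf K^-(z),$$ $$\mathbf K^-(z)\mathbf T(w)=\frac{(1-q^{k+1}z/w)(1-q^{-k-1}z/w)}{(1-q^{k+3}z/w)(1-q^{-k-3}z/w)}\mathbf T(w)\mathbf K^-(z),$$ $$\mathbf T(z)\mathbf K^+(w)=\frac{(1-q^{k+1}z/w)(1-q^{-k-1}z/w)}{(1-q^{k+3}z/w)(1-q^{-k-3}z/w)}\mathbf K^+(w)\mathbf T(z),$$ $$\mathbf K^-(z)\mathbf G^\pm(w)=q^{\pm(k+2)}\frac{1-z/w}{1-q^{\pm2(k+2)}z/w}\mathbf G^\pm(w)\mathbf K^-(z),$$ $$\mathbf G^\pm(z)\mathbf K^+(w)=q^{\mp(k+2)}\frac{1-z/w}{1-q^{\mp2(k+2)}z/w}\mathbf K^+(w)\mathbf G^\pm(z),$$ $$\mathbf G^\pm(z)\mathbf G^\pm(w)+\mathbf G^\pm(w)\mathbf G^\pm(z)=0,$$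 $$\mathbf G^+(z)\mathbf G^-(w)+\mathbf G^-(w)\mathbf G^+(z)=\frac1{(q-q^{-1})^2}\Bigl(\delta^{\rm A}\bigl(q^{4(k+1)}\tfrac wz\bigr)\tfrac1{[k+1]}\mathbf K(q^{2(k+1)}w)-\delta^{\rm A}\bigl(q^{2(k+2)}\tfrac wz\bigr)+\delta^{\rm A}\bigl(q^{2(k+1)}\tfrac wz\bigr)\mathbf T(q^{k+1}w)\Bigr),$$ $$\mathbf G^\pm(z)\mathbf T(w)-\mathbf T(w)\mathbf G^\pm(z)=\pm(q-q^{-1})\frac{[k+2]}{[k+1]}\delta^{\rm A}\bigl(q^{\pm3(k+1)}\tfrac wz\bigr)\mathbf K^-(q^{\pm(k+1)}w)\mathbf G^\pm(q^{\pm(k+1)}w)\mathbf K^+(q^{\pm(k+1)}w),$$ $$\mathbf T(z)\mathbf T(w)-\mathbf T(w)\mathbf T(z)=(q-q^{-1})\frac{[k+2]^2}{[k+1]}\Bigl(\delta\bigl(q^{2(k+1)}\tfrac wz\bigr)\mathbf K^-(q^{k+1}w)\mathbf W(q^{k+1}w)\mathbf K^+(q^{k+1}w)-\delta\bigl(q^{-2(k+1)}\tfrac wz\bigr)\mathbf K^-(q^{-k-1}w)\mathbf W(q^{-k-1}w)\mathbf K^+(q^{-k-1}w)\Bigr),$$ where $$\mathbf W(z)=\frac1{[k+1]}\widetilde{\mathbf K}^{\rm A}(z)-c_0^{\rm A}(k+2)+\widetilde{\mathbf T}^{\rm A}(z)-(q-q^{-1})^3\sum_{m\in\mathbb Z}z^{-m}\sum_{\gamma\in\mathbb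 Z^{\rm A}}N(\mathbf G^+_{-\gamma}\mathbf G^-_{m+\gamma}),$$ $$\widetilde{\mathbf K}^{\rm A}(z)=c_0^{\rm A}(2k+2)\tfrac12\bigl(\mathbf K(z)+\mathbf K(-z)\bigr)+c_1^{\rm A}(2k+2)\tfrac12\bigl(\mathbf K(z)-\mathbf K(-z)\bigr),$$ $$\widetilde{\mathbf T}^{\rm A}(z)=c_0^{\rm A}(k+1)\tfrac12\bigl(\mathbf T(z)+\mathbf T(-z)\bigr)+c_1^{\rm A}(k+1)\tfrac12\bigl(\mathbf T(z)-\mathbf T(-z)\bigr).$$ That is, they give a Heisenberg (twisted Wakimoto) representation of the algebra $\mathcal{SV}ir_{q,k}$, whose defining relations these are.
   Context: Conventions. $q,k$ are generic complex numbers with $|q|\le1$, $|q^k|\le1$; $k\ne-2$ and $q$ is not a root of unity. $[u]=(q^u-q^{-u})/(q-q^{-1})$. $\mathbb Z^{\rm R}=\mathbb Z$, $\mathbb Z^{\rm NS}=\mathbb Z+\frac12$, $\delta^{\rm A}(z)=\sum_{m\in\mathbb Z^{\rm A}}z^m$, $\delta=\delta^{\rm R}$. Coefficients: $c^{\rm NS}_\alpha(u)=\frac1{[u]}$ ($\alpha$ even), $\frac1{[u]}\frac{q^u+q^{-u}}2$ ($\alpha$ odd); $c^{\rm R}_\alpha(u)=\frac1{[u]}\frac{q^u+q^{-u}}2$ ($\alpha$ even), $\frac1{[u]}$ ($\alpha$ odd). Mode normal ordering: $N(\mathbf G^+_m\mathbf G^-_n)=\mathbf G^+_m\mathbf G^-_n$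 if $m<n$, $\frac12(\mathbf G^+_m\mathbf G^-_m-\mathbf G^-_m\mathbf G^+_m)$ if $m=n$, $-\mathbf G^-_n\mathbf G^+_m$ if $m>n$, where $\mathbf G^\pm(z)=\sum_{m\in\mathbb Z^{\rm A}}\mathbf G^\pm_mz^{-m}$. Heisenberg algebra. Generators $\widetilde\alpha_n,\overline\alpha_n,\beta_n$ ($n\in\mathbb Z$), $Q_{\widetilde\alpha},Q_{\overline\alpha},Q_\beta$ with $[\widetilde\alpha_n,\widetilde\alpha_m]=\frac{[(k+2)n][kn]}n\delta_{n+m,0}$, $[\widetilde\alpha_n,Q_{\widetilde\alpha}]=\delta_{n,0}$; $[\overline\alpha_n,\overline\alpha_m]=-\frac{[2n][kn]}n\delta_{n+m,0}$, $[\overline\alpha_n,Q_{\overline\alpha}]=-\delta_{n,0}$; $[\beta_n,\beta_m]=\frac{[2n][(k+2)n]}n\delta_{n+m,0}$, $[\beta_n,Q_\beta]=\delta_{n,0}$; all other commutators zero (right-hand sides are $0$ at $n=0$ in the first of each pair). Modes with $n\ge0$ are annihilation operators; modes with $n<0$ and the $Q$'s are creation operators; $:\bullet:$ moves creation operators to the left of annihilation operators. Vertex operators. $\widetilde V^\pm(z)=e^{\pm(k+2)Q_{\widetilde\alpha}}z^{\pm\frac1k\widetilde\alpha_0}:\exp\bigl(\mp\sum_{m\ne0}\frac{z^{-m}}{[km]}\widetilde\alpha_m\bigr):$, $Y^\pm(z)=e^{\pm2Q_{\overline\alpha}}z^{\pm\frac1k\overline\alpha_0}:\exp\bigl(\mp\sum_{m\ne0}q^{\mp\frac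 k2|m|}\frac{z^{-m}}{[km]}\overline\alpha_m\bigr):$, $Z_\pm(z)=\exp\bigl(\mp(q-q^{-1})\sum_{m\ge1}z^{\mp m}\frac{[m]}{[2m]}\overline\alpha_{\pm m}\bigr)q^{\mp\frac12\overline\alpha_0}$, $W_\pm(z)=\exp\bigl(\mp(q-q^{-1})\sum_{m\ge1}z^{\mp m}\frac{[m]}{[2m]}\beta_{\pm m}\bigr)q^{\mp\frac12\beta_0}$, $e_\pm(z)=:Y^+(z)Z_\pm(q^{\mp\frac{k+2}2}z)W_\pm(q^{\mp\frac k2}z):$, $f_\pm(z)=:Y^-(z)Z_\pm(q^{\pm\frac{k+2}2}z)W_\pm(q^{\pm\frac k2}z)^{-1}:$. Currents. $\mathbf K^\pm(z)=q^{\widetilde\alpha_0}\exp\bigl((q-q^{-1})\sum_{\pm m>0}\widetilde\alpha_mz^{-m}\bigr)$, $\mathbf K(z)=\mathbf K^-(z)\mathbf K^+(z)$, $\mathbf T(z)=:\widetilde V^+(q^{-1}z)\widetilde V^-(qz):\mathbf T_{\rm PF}(z)$, where $\mathbf T_{\rm PF}(z)=q^{-1}:e_+(q^{-\frac{k+2}2}z)f_-(q^{\frac{k+2}2}z):-\frac{[k+2]}{[k+1]}:e_+(q^{-\frac{k+2}2}z)f_+(q^{\frac{k+2}2}z):+q:e_-(q^{-\frac{k+2}2}z)f_+(q^{\frac{k+2}2}z):$, $\mathbf G^\pm(z)=z^{1/2}\bigl(\mathbf G^\pm_+(z)-\mathbf G^\pm_-(z)\bigr)$ with, for $\epsilon=\pm$,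 $\mathbf G^+_\epsilon(z)=\frac1{q-q^{-1}}\widetilde V^+(q^{-k-2}z)e_\epsilon(q^{-\frac{3k+4}2}z)$, $\mathbf G^-_\epsilon(z)=-\frac1{q-q^{-1}}\widetilde V^-(q^{k+2}z)f_\epsilon(q^{\frac{3k+4}2}z)$. Sectors. In the NS sector $\mathbf G^\pm(z)$ is expanded in half-integral powers of $z$ (operators act on Fock modules where $\frac1k(\widetilde\alpha_0+\overline\alpha_0)$ has eigenvalues in $\mathbb Z$); in the R sector $\mathbf G^\pm(z)$ is expanded in integral powers of $z$ (eigenvalues in $\mathbb Z+\frac12$). *)

theory Defs
  imports
    Complex_Main
    "HOL-Library.Poly_Mapping"
    "HOL-Computational_Algebra.Formal_Power_Series"
begin

section \<open>Parameters\<close>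

text \<open>
  Complex powers of \<open>q\<close> need a logarithm.  Everything depends on a number \<open>h\<close> with \<open>q = exp h\<close>
  (an arbitrary branch), and \<open>q\<close> to the power \<open>u\<close> is \<open>exp (h u)\<close>.
\<close>

definition qpow :: "complex \<Rightarrow> complex \<Rightarrow> complex" where
  "qpow h u = exp (h * u)"

definition qn :: "complex \<Rightarrow> complex \<Rightarrow> complex" where
  "qn h u = (qpow h u - qpow h (- u)) / (qpow h 1 - qpow h (- 1))"

definition dq :: "complex \<Rightarrow> complex" where
  "dq h = qpow h 1 - qpow h (- 1)"

datatype sector = Neveu_Schwarz | Ramond

definition ZZ :: "sector \<Rightarrow> complex set" where
  "ZZ A = (case A of Ramond \<Rightarrow> \<int> | Neveu_Schwarz \<Rightarrow> {s. s - 1/2 \<in> \<int>})"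

definition cA :: "complex \<Rightarrow> sector \<Rightarrow> nat \<Rightarrow> complex \<Rightarrow> complex" where
  "cA h A \<alpha> u =
    (case A of
       Neveu_Schwarz \<Rightarrow> (if even \<alpha> then 1 / qn h u else 1 / qn h u * ((qpow h u + qpow h (- u)) / 2))
     | Ramond \<Rightarrow> (if even \<alpha> then 1 / qn h u * ((qpow h u + qpow h (- u)) / 2) else 1 / qn h u))"


section \<open>The Heisenberg algebra on Fock modules\<close>

text \<open>The three families \<open>\<alpha>\<close>-tilde, \<open>\<alpha>\<close>-bar and \<open>\<beta>\<close>.\<close>

datatype boson = ATilde | ABar | Beta

abbreviation bosons :: "boson set" where
  "bosons \<equiv> {ATilde, ABar, Beta}"

text \<open>
  A charge lists the eigenvalues of the three zero modes.  An occupation number \<open>N (i, n)\<close> counts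
  the creation operators of family \<open>i\<close> and mode \<open>- (n + 1)\<close>.  The type \<open>fock\<close> is the direct
  sum of the Fock modules over all charges; its basis vector \<open>(p, N)\<close> is the product of creation
  operators with occupation numbers \<open>N\<close> applied to the highest weight vector of charge \<open>p\<close>.
\<close>

type_synonym charge = "boson \<Rightarrow> complex"
type_synonym occ = "(boson \<times> nat) \<Rightarrow>\<^sub>0 nat"
type_synonym fock = "(charge \<times> occ) \<Rightarrow>\<^sub>0 complex"

definition scl :: "complex \<Rightarrow> fock \<Rightarrow> fock" where
  "scl c v = Poly_Mapping.map ((*) c) v"

definition linext :: "(charge \<times> occ \<Rightarrow> fock) \<Rightarrow> fock \<Rightarrow> fock" where
  "linext f v = (\<Sum>b\<in>Poly_Mapping.keys v. scl (Poly_Mapping.lookup v b) (f b))"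

text \<open>\<open>heis h k i n\<close> is the value of the commutator of the modes \<open>n\<close> and \<open>- n\<close>
  (at \<open>n = 0\<close> it is \<open>0\<close>, by division by zero).\<close>

definition heis :: "complex \<Rightarrow> complex \<Rightarrow> boson \<Rightarrow> int \<Rightarrow> complex" where
  "heis h k i n =
    (case i of
       ATilde \<Rightarrow> qn h ((k + 2) * of_int n) * qn h (k * of_int n) / of_int n
     | ABar \<Rightarrow> - (qn h (2 * of_int n) * qn h (k * of_int n) / of_int n)
     | Beta \<Rightarrow> qn h (2 * of_int n) * qn h ((k + 2) * of_int n) / of_int n)"

text \<open>\<open>Qsign i\<close> is the value of the commutator of the zero mode with \<open>Q\<close>.\<close>

definition Qsign :: "boson \<Rightarrow> complex" where
  "Qsign i = (case i of ATilde \<Rightarrow> 1 | ABar \<Rightarrow> - 1 | Beta \<Rightarrow> 1)"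

definition osc :: "complex \<Rightarrow> complex \<Rightarrow> boson \<Rightarrow> int \<Rightarrow> fock \<Rightarrow> fock" where
  "osc h k i n = linext (\<lambda>(p, N).
     if n < 0 then
       Poly_Mapping.single (p, N + Poly_Mapping.single (i, nat (- n) - 1) 1) 1
     else if n = 0 then
       Poly_Mapping.single (p, N) (p i)
     else
       Poly_Mapping.single (p, N - Poly_Mapping.single (i, nat n - 1) 1)
         (heis h k i n * of_nat (Poly_Mapping.lookup N (i, nat n - 1))))"

text \<open>\<open>expQ u\<close> is the exponential of the sum of the \<open>u i\<close> multiples of the \<open>Q\<close>'s; by the
  commutator of \<open>Q\<close> with the zero mode it shifts the charge.\<close>

definition expQ :: "(boson \<Rightarrow> complex) \<Rightarrow> fock \<Rightarrow> fock" where
  "expQ u = linext (\<lambda>(p, N). Poly_Mapping.single (\<lambda>i. p i + Qsign i * u i, N) 1)"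

lemma lookup_scl [simp]: "Poly_Mapping.lookup (scl c v) b = c * Poly_Mapping.lookup v b"
  by (simp add: scl_def Poly_Mapping.map.rep_eq when_def)

lemma linext_superset:
  assumes "finite S" "Poly_Mapping.keys v \<subseteq> S"
  shows "linext f v = (\<Sum>b\<in>S. scl (Poly_Mapping.lookup v b) (f b))"
  unfolding linext_def
proof (rule sum.mono_neutral_left [OF assms])
  show "\<forall>b\<in>S - Poly_Mapping.keys v. scl (Poly_Mapping.lookup v b) (f b) = 0"
    by (auto simp: in_keys_iff intro!: poly_mapping_eqI)
qed

lemma linext_add: "linext f (v + w) = linext f v + linext f w"
proof -
  let ?S = "Poly_Mapping.keys v \<union> Poly_Mapping.keys w"
  have S: "finite ?S" "Poly_Mapping.keys v \<subseteq> ?S" "Poly_Mapping.keys w \<subseteq> ?S"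
    "Poly_Mapping.keys (v + w) \<subseteq> ?S"
    using Poly_Mapping.keys_add[of v w] by auto
  have *: "scl (a + b) x = scl a x + scl b x" for a b x
    by (rule poly_mapping_eqI) (simp add: lookup_add algebra_simps)
  show ?thesis
    by (simp add: linext_superset[OF S(1) S(2)] linext_superset[OF S(1) S(3)]
        linext_superset[OF S(1) S(4)] lookup_add * sum.distrib)
qed

lemma linext_scl: "linext f (scl c v) = scl c (linext f v)"
proof -
  have S: "Poly_Mapping.keys (scl c v) \<subseteq> Poly_Mapping.keys v"
    by (auto simp: in_keys_iff)
  have "scl (c * Poly_Mapping.lookup v b) (f b) = scl c (scl (Poly_Mapping.lookup v b) (f b))" for b
    by (rule poly_mapping_eqI) simp
  moreover have "scl c (sum g B) = (\<Sum>b\<in>B. scl c (g b))" if "finite B" for g and B :: "(charge \<times> occ) set"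
    by (rule poly_mapping_eqI) (simp add: lookup_sum sum_distrib_left)
  ultimately show ?thesis
    by (simp only: linext_superset[OF finite_keys S] linext_def[of f v] lookup_scl finite_keys)
qed

lemma linext_single [simp]: "linext f (Poly_Mapping.single b c) = scl c (f b)"
  by (cases "c = 0") (auto simp: linext_def intro!: poly_mapping_eqI)

lemma scl_single [simp]: "scl c (Poly_Mapping.single b d) = Poly_Mapping.single b (c * d)"
  by (rule poly_mapping_eqI) (simp add: lookup_single when_def)

lemma scl_zero [simp]: "scl c 0 = 0" "scl 0 v = 0"
  by (rule poly_mapping_eqI, simp)+

lemma linext_zero [simp]: "linext f 0 = 0"
  by (simp add: linext_def)

lemma linear_eqI:
  assumes F: "\<And>v w. F (v + w) = F v + F w" "\<And>c v. F (scl c v) = scl c (F v)"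
    and G: "\<And>v w. G (v + w) = G v + G w" "\<And>c v. G (scl c v) = scl c (G v)"
    and eq: "\<And>b. F (Poly_Mapping.single b 1) = G (Poly_Mapping.single b 1)"
  shows "F v = (G v :: fock)"
proof -
  have *: "L (\<Sum>b\<in>B. scl (c b) (Poly_Mapping.single b 1)) =
      (\<Sum>b\<in>B. scl (c b) (L (Poly_Mapping.single b 1)))"
    if L: "\<And>v w. L (v + w) = L v + L w" "\<And>c v. L (scl c v) = scl c (L v)" and "finite B"
    for L :: "fock \<Rightarrow> fock" and B c
    using \<open>finite B\<close>
  proof (induction B rule: finite_induct)
    case empty
    show ?case using L(2)[of 0 0] by simp
  qed (simp add: L del: scl_single)
  have v: "v = (\<Sum>b\<in>Poly_Mapping.keys v. scl (Poly_Mapping.lookup v b) (Poly_Mapping.single b 1))"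
    by (rule poly_mapping_eqI)
      (simp add: lookup_sum lookup_single when_def in_keys_iff sum.delta[OF finite_keys])
  show ?thesis
    by (subst (1 2) v) (simp add: *[of F, OF F finite_keys] *[of G, OF G finite_keys] eq del: scl_single)
qed

lemma scl_add: "scl c (v + w) = scl c v + scl c w"
  by (rule poly_mapping_eqI) (simp add: lookup_add algebra_simps)

lemma scl_diff: "scl c (v - w) = scl c v - scl c w"
  by (rule poly_mapping_eqI) (simp add: lookup_minus algebra_simps)

lemma scl_scl: "scl c (scl d v) = scl (c * d) v"
  by (rule poly_mapping_eqI) simp

lemma heis_minus: "heis h k i (- n) = - heis h k i n"
proof -
  have qn: "qn h (- x) = - qn h x" for x
    by (simp add: qn_def minus_divide_left)
  show ?thesis
    by (cases i) (simp_all add: heis_def qn)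
qed

lemma heis_zero [simp]: "heis h k i 0 = 0"
  by (cases i) (simp_all add: heis_def)

lemma osc_add: "osc h k i n (v + w) = osc h k i n v + osc h k i n w"
  and osc_scl: "osc h k i n (scl c v) = scl c (osc h k i n v)"
  by (simp_all add: osc_def linext_add linext_scl)

text \<open>The defining relations of the Heisenberg algebra.\<close>

lemma osc_commutator:
  "osc h k i m (osc h k j n v) - osc h k j n (osc h k i m v) =
     scl (if i = j \<and> m + n = 0 then heis h k i m else 0) v"
proof (rule linear_eqI[where F = "\<lambda>v. osc h k i m (osc h k j n v) - osc h k j n (osc h k i m v)"])
  fix b :: "charge \<times> occ"
  obtain p N where b: "b = (p, N)" by (cases b)
  let ?e = "\<lambda>x :: boson \<times> nat. Poly_Mapping.single x (Suc 0)"
  let ?C = "\<lambda>i m j n. osc h k i m (osc h k j n (Poly_Mapping.single b 1)) -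
      osc h k j n (osc h k i m (Poly_Mapping.single b 1)) =
      scl (if i = j \<and> m + n = 0 then heis h k i m else 0) (Poly_Mapping.single b 1)"
  have c: "M + ?e x + ?e y = M + ?e y + ?e x" for M x y
    by (simp add: ac_simps)
  have d: "M - ?e x - ?e y = M - ?e y - ?e x" for M x y
    by (intro poly_mapping_eqI) (simp add: lookup_minus)
  have r: "M + ?e x - ?e y = M - ?e y + ?e x" if "Poly_Mapping.lookup M y \<noteq> 0" for M x y
    using that by (intro poly_mapping_eqI) (auto simp: lookup_add lookup_minus lookup_single when_def)
  have ix: "nat x - Suc 0 = nat y - Suc 0 \<longleftrightarrow> x = y" if "x > 0" "y > 0" for x y :: int
    using that by auto
  have CA: "?C i m j n" if "m < 0" "n > 0" for i m j n
  proof (cases "i = j \<and> m + n = 0")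
    case True
    then have "nat (- m) = nat n" "m = - n" by auto
    with True that show ?thesis
      using r[of N "(i, nat n - Suc 0)" "(i, nat n - Suc 0)"]
      by (cases "Poly_Mapping.lookup N (i, nat n - Suc 0) = 0")
        (auto simp: b osc_def lookup_add lookup_single heis_minus single_diff[symmetric]
          single_uminus[symmetric] single_add[symmetric] algebra_simps)
  next
    case False
    then have "(i, nat (- m) - Suc 0) \<noteq> (j, nat n - Suc 0)"
      using that ix[of "- m" n] by auto
    with False that show ?thesis
      using r[of N "(j, nat n - Suc 0)" "(i, nat (- m) - Suc 0)"]
      by (cases "Poly_Mapping.lookup N (j, nat n - Suc 0) = 0")
        (auto simp: b osc_def lookup_add lookup_single when_def)
  qed
  consider "m < 0" "n < 0" | "m < 0" "n > 0" | "m = 0" | "n = 0" | "m > 0" "n < 0" | "m > 0" "n > 0"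
    by linarith
  then show "?C i m j n"
  proof cases
    case 1
    then show ?thesis by (simp add: b osc_def c)
  next
    case 2
    then show ?thesis by (rule CA)
  next
    case 3
    then show ?thesis by (cases "n < 0"; cases "n = 0"; auto simp: b osc_def mult.commute)
  next
    case 4
    then show ?thesis by (cases "m < 0"; cases "m = 0"; auto simp: b osc_def mult.commute)
  next
    case 5
    have "osc h k i m (osc h k j n (Poly_Mapping.single b 1)) -
        osc h k j n (osc h k i m (Poly_Mapping.single b 1)) =
        - scl (if j = i \<and> n + m = 0 then heis h k j n else 0) (Poly_Mapping.single b 1)"
      using CA[OF 5(2,1), of j i] by (metis minus_diff_eq)
    also have "\<dots> = scl (if i = j \<and> m + n = 0 then heis h k i m else 0) (Poly_Mapping.single b 1)"
    proof -
      have "heis h k i m = - heis h k i n" if "m + n = 0"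
        using that heis_minus[of h k i n] by (metis eq_neg_iff_add_eq_0)
      then show ?thesis by (auto simp: single_uminus add.commute)
    qed
    finally show ?thesis .
  next
    case 6
    show ?thesis
    proof (cases "(i, nat m - Suc 0) = (j, nat n - Suc 0)")
      case True
      then have "i = j" "m = n" using 6 ix[of m n] by auto
      then show ?thesis using 6 by auto
    next
      case False
      then show ?thesis
        using 6 by (auto simp: b osc_def lookup_minus lookup_single when_def d mult.commute)
    qed
  qed
qed (auto simp: osc_add osc_scl scl_add scl_diff scl_scl mult.commute)

lemma osc_zero_expQ:
  "osc h k i 0 (expQ u v) - expQ u (osc h k i 0 v) = scl (Qsign i * u i) (expQ u v)"
proof (rule linear_eqI[where F = "\<lambda>v. osc h k i 0 (expQ u v) - expQ u (osc h k i 0 v)"])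
  fix b :: "charge \<times> occ"
  show "osc h k i 0 (expQ u (Poly_Mapping.single b 1)) - expQ u (osc h k i 0 (Poly_Mapping.single b 1)) =
      scl (Qsign i * u i) (expQ u (Poly_Mapping.single b 1))"
    by (cases b) (simp add: osc_def expQ_def single_diff[symmetric])
qed (auto simp: expQ_def osc_add osc_scl linext_add linext_scl scl_add scl_diff scl_scl mult.commute)

text \<open>The direct sum of the Fock modules belonging to the sector \<open>A\<close>.\<close>

definition sector_module :: "complex \<Rightarrow> sector \<Rightarrow> fock set" where
  "sector_module k A =
    {v. \<forall>(p, N)\<in>Poly_Mapping.keys v.
        (p ATilde + p ABar) / k \<in> (case A of Neveu_Schwarz \<Rightarrow> \<int> | Ramond \<Rightarrow> {x. x - 1/2 \<in> \<int>})}"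


section \<open>Formal currents\<close>

text \<open>
  A current \<open>A(z)\<close> is a formal sum of complex powers of \<open>z\<close>; \<open>A s\<close> is the
  coefficient of \<open>z\<close> to the power \<open>- s\<close>.  The scaled current \<open>A(q^u z)\<close> is obtained by
  substituting \<open>exp (h u) z\<close> in every power.
\<close>

type_synonym current = "complex \<Rightarrow> fock \<Rightarrow> fock"

definition cscale :: "complex \<Rightarrow> complex \<Rightarrow> current \<Rightarrow> current" where
  "cscale h u A s v = scl (qpow h (- (u * s))) (A s v)"

text \<open>\<open>A(- z)\<close>, used for currents with integral powers only.\<close>

definition creflect :: "current \<Rightarrow> current" where
  "creflect A s v = scl (exp (- (\<i> * of_real pi * s))) (A s v)"

text \<open>
  The product \<open>A(z) B(z)\<close> at one point.  In all its uses only finitely many summands are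
  nonzero on a given vector: \<open>A\<close> consists of creation operators only, or \<open>B\<close> of
  annihilation operators only, or the oscillators of \<open>A\<close> and \<open>B\<close> commute; and modes with
  large index annihilate a given vector.
\<close>

definition cmult :: "current \<Rightarrow> current \<Rightarrow> current" where
  "cmult A B s v = Sum_any (\<lambda>t. A t (B (s - t) v))"

text \<open>
  Exponents: a value of type \<open>lform\<close> stands for the linear expression
  \<open>\<Sum>\<^sub>i (cQ i Q\<^sub>i + clogz i log(z) a\<^sub>i\<^sub>,\<^sub>0 + clogq i log(q) a\<^sub>i\<^sub>,\<^sub>0 + \<Sum>\<^sub>m\<^sub>\<noteq>\<^sub>0 cosc i m z^(-m) a\<^sub>i\<^sub>,\<^sub>m)\<close>
  in the Heisenberg generators.  Under the normal ordering sign, exponentials commute, so the normally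
  ordered product of exponentials is the normally ordered exponential of the sum of the exponents.
\<close>

datatype lform = LForm
  (cQ: "boson \<Rightarrow> complex")
  (clogz: "boson \<Rightarrow> complex")
  (clogq: "boson \<Rightarrow> complex")
  (cosc: "boson \<Rightarrow> int \<Rightarrow> complex")

definition lf_add :: "lform \<Rightarrow> lform \<Rightarrow> lform"  (infixl \<open>\<oplus>\<^sub>l\<close> 65) where
  "F \<oplus>\<^sub>l G = LForm (\<lambda>i. cQ F i + cQ G i) (\<lambda>i. clogz F i + clogz G i)
     (\<lambda>i. clogq F i + clogq G i) (\<lambda>i m. cosc F i m + cosc G i m)"

definition lf_neg :: "lform \<Rightarrow> lform" where
  "lf_neg F = LForm (\<lambda>i. - cQ F i) (\<lambda>i. - clogz F i) (\<lambda>i. - clogq F i) (\<lambda>i m. - cosc F i m)"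

text \<open>Substitution of \<open>q^u z\<close> for \<open>z\<close>.\<close>

definition lf_scale :: "complex \<Rightarrow> complex \<Rightarrow> lform \<Rightarrow> lform" where
  "lf_scale h u F = LForm (cQ F) (clogz F) (\<lambda>i. clogq F i + u * clogz F i)
     (\<lambda>i m. qpow h (- (u * of_int m)) * cosc F i m)"

definition lf_single ::
  "boson \<Rightarrow> complex \<Rightarrow> complex \<Rightarrow> complex \<Rightarrow> (int \<Rightarrow> complex) \<Rightarrow> lform" where
  "lf_single i a b c x = LForm (\<lambda>j. if j = i then a else 0) (\<lambda>j. if j = i then b else 0)
     (\<lambda>j. if j = i then c else 0) (\<lambda>j m. if j = i then x m else 0)"

text \<open>
  \<open>fexp X d\<close> is the coefficient of \<open>t^d\<close> in the exponential of \<open>\<Sum>\<^sub>m\<^sub>\<ge>\<^sub>1 X m t^m\<close>, and \<open>fpow X j d\<close>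
  the one in the \<open>j\<close>-th power; powers \<open>j > d\<close> do not contribute.
\<close>

fun fpow :: "(nat \<Rightarrow> fock \<Rightarrow> fock) \<Rightarrow> nat \<Rightarrow> nat \<Rightarrow> fock \<Rightarrow> fock" where
  "fpow X 0 d v = (if d = 0 then v else 0)"
| "fpow X (Suc j) d v = (\<Sum>m\<in>{1..d}. X m (fpow X j (d - m) v))"

definition fexp :: "(nat \<Rightarrow> fock \<Rightarrow> fock) \<Rightarrow> nat \<Rightarrow> fock \<Rightarrow> fock" where
  "fexp X d v = (\<Sum>j\<le>d. scl (1 / fact j) (fpow X j d v))"

definition creation_part :: "complex \<Rightarrow> complex \<Rightarrow> lform \<Rightarrow> current" where
  "creation_part h k F s v =
    (if - s \<in> \<nat> then
       fexp (\<lambda>m w. \<Sum>i\<in>bosons. scl (cosc F i (- int m)) (osc h k i (- int m) w)) (nat \<lfloor>Re (- s)\<rfloor>) v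
     else 0)"

definition annihilation_part :: "complex \<Rightarrow> complex \<Rightarrow> lform \<Rightarrow> current" where
  "annihilation_part h k F s v =
    (if s \<in> \<nat> then
       fexp (\<lambda>m w. \<Sum>i\<in>bosons. scl (cosc F i (int m)) (osc h k i (int m) w)) (nat \<lfloor>Re s\<rfloor>) v
     else 0)"

text \<open>On charge \<open>p\<close>, the zero modes \<open>a\<^sub>i\<^sub>,\<^sub>0\<close> in the exponent become the numbers \<open>p i\<close>.\<close>

definition zero_mode_part :: "complex \<Rightarrow> lform \<Rightarrow> current" where
  "zero_mode_part h F s = linext (\<lambda>(p, N).
     if (\<Sum>i\<in>bosons. clogz F i * p i) = - s
     then Poly_Mapping.single (p, N) (qpow h (\<Sum>i\<in>bosons. clogq F i * p i))
     else 0)"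

text \<open>The normally ordered exponential.\<close>

definition nexp :: "complex \<Rightarrow> complex \<Rightarrow> lform \<Rightarrow> current" where
  "nexp h k F s v = expQ (cQ F)
     (cmult (creation_part h k F) (cmult (zero_mode_part h F) (annihilation_part h k F)) s v)"


section \<open>Vertex operators and free-field currents\<close>

text \<open>In this section \<open>e\<close> and \<open>\<epsilon>\<close> are signs \<open>1\<close> or \<open>-1\<close>.  The vertex operators are given by
  their exponents.\<close>

definition Vt :: "complex \<Rightarrow> complex \<Rightarrow> int \<Rightarrow> lform" where
  "Vt h k e = lf_single ATilde (of_int e * (k + 2)) (of_int e / k) 0
     (\<lambda>m. - of_int e / qn h (k * of_int m))"

definition Yv :: "complex \<Rightarrow> complex \<Rightarrow> int \<Rightarrow> lform" where
  "Yv h k e = lf_single ABar (of_int e * 2) (of_int e / k) 0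
     (\<lambda>m. - of_int e * qpow h (- (of_int e * (k / 2) * of_int \<bar>m\<bar>)) / qn h (k * of_int m))"

definition ZWv :: "complex \<Rightarrow> boson \<Rightarrow> int \<Rightarrow> lform" where
  "ZWv h i e = lf_single i 0 0 (- of_int e / 2)
     (\<lambda>m. if e * m > 0 then - of_int e * dq h * (qn h (of_int \<bar>m\<bar>) / qn h (2 * of_int \<bar>m\<bar>)) else 0)"

abbreviation Zv :: "complex \<Rightarrow> int \<Rightarrow> lform" where
  "Zv h \<equiv> ZWv h ABar"

abbreviation Wv :: "complex \<Rightarrow> int \<Rightarrow> lform" where
  "Wv h \<equiv> ZWv h Beta"

definition ev :: "complex \<Rightarrow> complex \<Rightarrow> int \<Rightarrow> lform" where
  "ev h k \<epsilon> = Yv h k 1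
     \<oplus>\<^sub>l lf_scale h (- (of_int \<epsilon> * (k + 2) / 2)) (Zv h \<epsilon>)
     \<oplus>\<^sub>l lf_scale h (- (of_int \<epsilon> * k / 2)) (Wv h \<epsilon>)"

definition fv :: "complex \<Rightarrow> complex \<Rightarrow> int \<Rightarrow> lform" where
  "fv h k \<epsilon> = Yv h k (- 1)
     \<oplus>\<^sub>l lf_scale h (of_int \<epsilon> * (k + 2) / 2) (Zv h \<epsilon>)
     \<oplus>\<^sub>l lf_neg (lf_scale h (of_int \<epsilon> * k / 2) (Wv h \<epsilon>))"

text \<open>\<open>KK h k 1\<close> and \<open>KK h k (- 1)\<close> are the currents \<open>K\<^sup>+\<close> and \<open>K\<^sup>-\<close>; they involve only
  annihilation, respectively only creation oscillators.\<close>

definition KK :: "complex \<Rightarrow> complex \<Rightarrow> int \<Rightarrow> current" where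
  "KK h k e = nexp h k (lf_single ATilde 0 0 1 (\<lambda>m. if e * m > 0 then dq h else 0))"

definition K0 :: "complex \<Rightarrow> complex \<Rightarrow> current" where
  "K0 h k = cmult (KK h k (- 1)) (KK h k 1)"

definition ef :: "complex \<Rightarrow> complex \<Rightarrow> int \<Rightarrow> int \<Rightarrow> current" where
  "ef h k \<epsilon> \<epsilon>' = nexp h k
     (lf_scale h (- ((k + 2) / 2)) (ev h k \<epsilon>) \<oplus>\<^sub>l lf_scale h ((k + 2) / 2) (fv h k \<epsilon>'))"

definition TPF :: "complex \<Rightarrow> complex \<Rightarrow> current" where
  "TPF h k s v =
     scl (qpow h (- 1)) (ef h k 1 (- 1) s v)
     - scl (qn h (k + 2) / qn h (k + 1)) (ef h k 1 1 s v)
     + scl (qpow h 1) (ef h k (- 1) 1 s v)"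

definition TT :: "complex \<Rightarrow> complex \<Rightarrow> current" where
  "TT h k = cmult (nexp h k (lf_scale h (- 1) (Vt h k 1) \<oplus>\<^sub>l lf_scale h 1 (Vt h k (- 1)))) (TPF h k)"

text \<open>\<open>Gpart h k e \<epsilon>\<close> has upper sign \<open>e\<close> and lower sign \<open>\<epsilon>\<close>.\<close>

definition Gpart :: "complex \<Rightarrow> complex \<Rightarrow> int \<Rightarrow> int \<Rightarrow> current" where
  "Gpart h k e \<epsilon> s v = scl (of_int e / dq h)
     (cmult
        (cscale h (- (of_int e * (k + 2))) (nexp h k (Vt h k e)))
        (cscale h (- (of_int e * (3 * k + 4) / 2))
           (nexp h k (if e = 1 then ev h k \<epsilon> else fv h k \<epsilon>))) s v)"

text \<open>The factor \<open>z^(1/2)\<close> shifts the index of the mode.\<close>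

definition GG :: "complex \<Rightarrow> complex \<Rightarrow> int \<Rightarrow> current" where
  "GG h k e s v = Gpart h k e 1 (s + 1/2) v - Gpart h k e (- 1) (s + 1/2) v"


section \<open>Ingredients of the relations\<close>

text \<open>Normal ordering of two modes; the indices have integral difference.\<close>

definition normal_GG :: "current \<Rightarrow> current \<Rightarrow> complex \<Rightarrow> complex \<Rightarrow> fock \<Rightarrow> fock" where
  "normal_GG Gp Gm m n v =
    (if m = n then scl (1/2) (Gp m (Gm m v) - Gm m (Gp m v))
     else if Re m < Re n then Gp m (Gm n v)
     else - Gm n (Gp m v))"

definition parity_split :: "complex \<Rightarrow> sector \<Rightarrow> complex \<Rightarrow> current \<Rightarrow> current" where
  "parity_split h A u X s v =
     scl (cA h A 0 u) (scl (1/2) (X s v + creflect X s v))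
     + scl (cA h A 1 u) (scl (1/2) (X s v - creflect X s v))"

definition WW :: "complex \<Rightarrow> complex \<Rightarrow> sector \<Rightarrow> current" where
  "WW h k A s v =
     scl (1 / qn h (k + 1)) (parity_split h A (2 * k + 2) (K0 h k) s v)
     - (if s = 0 then scl (cA h A 0 (k + 2)) v else 0)
     + parity_split h A (k + 1) (TT h k) s v
     - scl (dq h ^ 3)
         (if s \<in> \<int> then
            Sum_any (\<lambda>\<gamma>. if \<gamma> \<in> ZZ A then normal_GG (GG h k 1) (GG h k (- 1)) (- \<gamma>) (s + \<gamma>) v else 0)
          else 0)"

text \<open>
  Two-point expressions in \<open>z, w\<close> are given by the coefficient of \<open>z^(-s) w^(-t)\<close>, applied to a vector.
\<close>

type_synonym current2 = "complex \<Rightarrow> complex \<Rightarrow> fock \<Rightarrow> fock"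

text \<open>\<open>A(z) B(w)\<close> and \<open>A(w) B(z)\<close>.\<close>

definition prod_zw :: "current \<Rightarrow> current \<Rightarrow> current2" where
  "prod_zw A B s t v = A s (B t v)"

definition prod_wz :: "current \<Rightarrow> current \<Rightarrow> current2" where
  "prod_wz A B s t v = A t (B s v)"

text \<open>\<open>f(z/w) X(z,w)\<close> for a power series \<open>f\<close>.\<close>

definition series_mult :: "complex fps \<Rightarrow> current2 \<Rightarrow> current2" where
  "series_mult f X s t v = Sum_any (\<lambda>j::nat. scl (fps_nth f j) (X (s + of_nat j) (t - of_nat j) v))"

text \<open>\<open>1 - q^u x\<close> as a power series in \<open>x = z/w\<close>.\<close>

definition lin :: "complex \<Rightarrow> complex \<Rightarrow> complex fps" where
  "lin h u = 1 - fps_const (qpow h u) * fps_X"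

text \<open>\<open>\<delta>\<^sup>A(q^u w/z) X(w)\<close>; the summand \<open>(q^u w/z)^m\<close> contributes for \<open>m = s\<close>.\<close>

definition delta_mult :: "complex \<Rightarrow> sector \<Rightarrow> complex \<Rightarrow> current \<Rightarrow> current2" where
  "delta_mult h A u X s t v = (if s \<in> ZZ A then scl (qpow h (u * s)) (X (s + t) v) else 0)"

definition cone :: current where
  "cone s v = (if s = 0 then v else 0)"

text \<open>The modes of \<open>X\<close> are linear endomorphisms of the module \<open>M\<close>, and only powers with exponents
  in \<open>S\<close> occur on \<open>M\<close>.\<close>

definition acts_on :: "fock set \<Rightarrow> complex set \<Rightarrow> current \<Rightarrow> bool" where
  "acts_on M S X \<longleftrightarrow>
     (\<forall>s. \<forall>v\<in>M. X s v \<in> M \<and> (s \<notin> S \<longrightarrow> X s v = 0)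
        \<and> (\<forall>w\<in>M. X s (v + w) = X s v + X s w) \<and> (\<forall>c. X s (scl c v) = scl c (X s v)))"

end

theory Submission
  imports Defs
begin

text \<open>
  Every current is a finite linear combination of normally ordered exponentials.  The product of two of
  them is \<open>q\<close> and \<open>z\<close> to some powers times \<open>\<gamma>(w/z)\<close> times the normally ordered product, where the
  contraction \<open>\<gamma>\<close> is determined by its logarithmic derivative and is a rational function with a few
  simple zeros and poles at powers of \<open>q\<close>.  The two orders of a product expand the same rational
  function at \<open>0\<close> and at \<open>\<infinity>\<close>; hence (anti)commutators are sums of delta functions at the poles, and at
  each pole the normally ordered product collapses by fusion identities such as
  \<open>:G\<^sup>+(q\<^bsup>2k+2\<^esup>z) G\<^sup>-(q\<^bsup>-2k-2\<^esup>z): = K(z)\<close> for suitable summands of the supercurrents.  For the commutator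
  of \<open>T\<close> with itself one also needs the mode normal ordered product of \<open>G\<^sup>+\<close> and \<open>G\<^sup>-\<close>.  Its modes are
  truncations of bilateral geometric series; summed explicitly, they consist of the ordinary normally
  ordered product and of boundary terms at the poles, and the latter cancel the terms with \<open>K\<close>, \<open>1\<close>
  and \<open>T\<close> in \<open>W\<close>.
\<close>

text \<open>Mode indices are complex numbers, and most formal sums are finite only vector by vector.
  Both obstacles disappear on vectors of one charge \<open>p\<close> and bounded level: there the
  zero modes are numbers, the relevant indices lie in one coset of the integers, and a two-point
  product is encoded by an integer sequence of contraction coefficients (\<open>BB\<close>). Each
  relation becomes an identity between such sequences, and linearity carries it to the whole sector
  module. Supercurrents contract with an extra odd power of z. It shifts one of the two orders by
  one place, so that for G^+ and G^- the two orders fill exactly the places n >= 1 and n <= 0 of one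
  bilateral series. The coefficients c^A have the following origin. A bilateral geometric series of
  ratio q^{2u}, cut at half the total mode, leaves a boundary term with the factor (q^u + q^{-u})/2
  if the cut meets a mode, which then counts half, and without this factor if the cut falls between
  two modes. Sector and parity of the total mode decide which case occurs; hence the exchange of c_0
  and c_1 between the sectors.\<close>

unbundle fps_syntax

section \<open>The ring of linear endomorphisms\<close>

text \<open>Linear maps form a type, and not only a predicate, so that series with operator
  coefficients are of type \<open>fop fps\<close> and the calculus of \<open>fps\<close> over
  noncommutative rings applies to them.\<close>

typedef fop = "{f :: fock \<Rightarrow> fock. (\<forall>v w. f (v + w) = f v + f w) \<and> (\<forall>c v. f (scl c v) = scl c (f v))}"
  morphisms app Fop
  by (rule exI[of _ id]) simp

setup_lifting type_definition_fop

lemma app_add: "app f (v + w) = app f v + app f w"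
  and app_scl: "app f (scl c v) = scl c (app f v)"
  using app[of f] by auto

lemma app_zero [simp]: "app f 0 = 0"
  using app_scl[of f 0 0] by simp

lemma fop_eqI: "(\<And>v. app f v = app g v) \<Longrightarrow> f = g"
  by (simp add: app_inject[symmetric] fun_eq_iff)

lemma scl_sum: "scl c (sum g B) = (\<Sum>b\<in>B. scl c (g b))"
  by (induction B rule: infinite_finite_induct) (auto simp: scl_add)

lemma scl_one [simp]: "scl 1 v = v"
  by (rule poly_mapping_eqI) simp

lemma scl_minus: "scl c (- v) = - scl c v"
  by (rule poly_mapping_eqI) simp

lemma scl_add_left: "scl (c + d) v = scl c v + scl d v"
  by (rule poly_mapping_eqI) (simp add: lookup_add algebra_simps)

lemma scl_minus_left: "scl (- c) v = - scl c v"
  by (rule poly_mapping_eqI) simp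

lemma scl_sum_left: "scl (sum g B) v = (\<Sum>b\<in>B. scl (g b) v)"
  by (induction B rule: infinite_finite_induct) (auto simp: scl_add_left)

instantiation fop :: ring_1
begin

lift_definition zero_fop :: fop is "\<lambda>v. 0" by simp
lift_definition one_fop :: fop is "\<lambda>v. v" by simp
lift_definition plus_fop :: "fop \<Rightarrow> fop \<Rightarrow> fop" is "\<lambda>f g v. f v + g v"
  by (auto simp: scl_add algebra_simps)
lift_definition minus_fop :: "fop \<Rightarrow> fop \<Rightarrow> fop" is "\<lambda>f g v. f v - g v"
  by (auto simp: scl_diff algebra_simps)
lift_definition uminus_fop :: "fop \<Rightarrow> fop" is "\<lambda>f v. - f v"
  by (auto simp: scl_minus algebra_simps)
lift_definition times_fop :: "fop \<Rightarrow> fop \<Rightarrow> fop" is "\<lambda>f g v. f (g v)"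
  by auto

instance
proof
  have "app 0 = app (1 :: fop) \<Longrightarrow> False"
  proof -
    assume "app 0 = app (1 :: fop)"
    then have "app 0 (Poly_Mapping.single undefined 1) = app 1 (Poly_Mapping.single undefined 1)"
      by simp
    then show False
      by (simp add: zero_fop.rep_eq one_fop.rep_eq) (metis lookup_single_eq lookup_zero zero_neq_one)
  qed
  then show "(0 :: fop) \<noteq> 1" by auto
qed (transfer; auto simp: algebra_simps)+

end

lemma app_plus: "app (f + g) v = app f v + app g v"
  and app_times: "app (f * g) v = app f (app g v)"
  and app_0: "app 0 v = 0"
  and app_1: "app 1 v = v"
  by (transfer; simp)+

lemma app_sum: "app (sum f B) v = (\<Sum>b\<in>B. app (f b) v)"
  by (induction B rule: infinite_finite_induct) (auto simp: app_plus app_0)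

lemma app_sum_arg: "app f (sum g B) = (\<Sum>b\<in>B. app f (g b))"
  by (induction B rule: infinite_finite_induct) (auto simp: app_add)

lift_definition scal :: "complex \<Rightarrow> fop" is "\<lambda>c v. scl c v"
  by (auto simp: scl_add scl_scl mult.commute)

lemma app_scal: "app (scal c) v = scl c v"
  by (simp add: scal.rep_eq)

lemma scal_commute: "f * scal c = scal c * f"
  by (rule fop_eqI) (simp add: app_times app_scal app_scl)

lemma scal_add: "scal (a + b) = scal a + scal b"
  and scal_mult: "scal (a * b) = scal a * scal b"
  and scal_0 [simp]: "scal 0 = 0"
  and scal_1 [simp]: "scal 1 = 1"
  by (rule fop_eqI, simp add: app_scal app_plus app_times app_0 app_1 scl_add_left scl_scl)+

lemma scal_of_nat: "scal (of_nat n) = of_nat n"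
  by (induction n) (auto simp: scal_add)

lemma scal_sum: "scal (sum f B) = (\<Sum>b\<in>B. scal (f b))"
  by (induction B rule: infinite_finite_induct) (auto simp: scal_add)

text \<open>Characteristic zero in the form needed to solve differential equations coefficientwise:
  the natural number is inverted through \<open>scal\<close>.\<close>

lemma fop_of_nat_cancel: "of_nat (Suc n) * (f :: fop) = 0 \<Longrightarrow> f = 0"
proof -
  assume *: "of_nat (Suc n) * f = 0"
  have "f = scal (1 / of_nat (Suc n)) * (scal (of_nat (Suc n)) * f)"
    by (simp add: mult.assoc[symmetric] scal_mult[symmetric] del: of_nat_Suc)
  also have "\<dots> = 0" using * by (simp only: scal_of_nat mult_zero_right)
  finally show ?thesis .
qed

section \<open>Exponentials of formal power series with operator coefficients\<close>

text \<open>The equation expresses n+1 times the coefficient n+1 through lower ones, so all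
  coefficients vanish. Cancellation is a hypothesis because the coefficient ring is
  \<open>complex\<close>, \<open>fop\<close> or \<open>fop fps\<close> in the applications.\<close>

lemma fps_linear_ode_zero:
  fixes D Z :: "'a::ring_1 fps"
  assumes cancel: "\<And>n a. of_nat (Suc n) * (a :: 'a) = 0 \<Longrightarrow> a = 0"
    and "fps_deriv D = Z * D" "D $ 0 = 0"
  shows "D = 0"
proof -
  have "D $ n = 0" for n
  proof (induction n rule: less_induct)
    case (less n)
    show ?case
    proof (cases n)
      case 0
      then show ?thesis using assms by simp
    next
      case (Suc m)
      have "of_nat (Suc m) * D $ Suc m = fps_deriv D $ m" by simp
      also have "\<dots> = (\<Sum>i=0..m. Z $ i * D $ (m - i))" using assms by (simp add: fps_mult_nth)
      also have "\<dots> = 0" using less Suc by (intro sum.neutral) auto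
      finally show ?thesis using cancel Suc by blast
    qed
  qed
  then show ?thesis by (simp add: fps_ext)
qed

lemma fps_linear_ode_unique:
  fixes D E Z :: "'a::ring_1 fps"
  assumes cancel: "\<And>n a. of_nat (Suc n) * (a :: 'a) = 0 \<Longrightarrow> a = 0"
    and "fps_deriv D = Z * D" "fps_deriv E = Z * E" "D $ 0 = E $ 0"
  shows "D = E"
  using fps_linear_ode_zero[OF cancel, where D = "D - E" and Z = Z] assms(2-4) by (simp add: algebra_simps)

lemmas fop_ode_unique = fps_linear_ode_unique[where 'a = fop, OF fop_of_nat_cancel]

lemma fps_op_of_nat_cancel:
  fixes f :: "fop fps"
  shows "of_nat (Suc n) * f = 0 \<Longrightarrow> f = 0"
proof (rule fps_ext)
  fix m assume "of_nat (Suc n) * f = 0"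
  then have "(of_nat (Suc n) * f) $ m = 0" by simp
  then have "of_nat (Suc n) * f $ m = 0"
    by (simp only: fps_of_nat[symmetric] fps_mult_left_const_nth)
  then show "f $ m = 0 $ m" using fop_of_nat_cancel by simp
qed

text \<open>If \<open>X\<close> has no constant term, its j-th power starts in degree j, so the cut
  at \<open>j \<le> d\<close> loses nothing. It is the same cut as in \<open>fexp\<close>;
  \<open>fexp_opexp\<close> connects the two.\<close>

definition opexp :: "fop fps \<Rightarrow> fop fps" where
  "opexp X = Abs_fps (\<lambda>d. \<Sum>j\<le>d. scal (1 / fact j) * (X ^ j) $ d)"

lemma opexp_0: "opexp X $ 0 = 1"
  by (simp add: opexp_def)

lemma fps_power_nth_zero:
  fixes X :: "'a::ring_1 fps"
  assumes "X $ 0 = 0" "d < j"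
  shows "(X ^ j) $ d = 0"
  using assms(2)
proof (induction j arbitrary: d)
  case (Suc j)
  have "X $ i * (X ^ j) $ (d - i) = 0" if "i \<le> d" for i
    using Suc assms(1) that by (cases "i = 0") auto
  then show ?case by (auto simp: fps_mult_nth intro!: sum.neutral)
qed simp

lemma fps_deriv_power_commuting:
  fixes X :: "'a::ring_1 fps"
  assumes "fps_deriv X * X = X * fps_deriv X"
  shows "fps_deriv (X ^ Suc j) = of_nat (Suc j) * (fps_deriv X * X ^ j)"
proof (induction j)
  case (Suc j)
  have c: "X * fps_deriv X = fps_deriv X * X" using assms by simp
  have "fps_deriv (X ^ Suc (Suc j)) = X * (of_nat (Suc j) * (fps_deriv X * X ^ j)) + fps_deriv X * X ^ Suc j"
    using Suc by (simp del: of_nat_Suc)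
  also have "X * (of_nat (Suc j) * (fps_deriv X * X ^ j)) = of_nat (Suc j) * (X * fps_deriv X * X ^ j)"
    by (metis mult.assoc mult_of_nat_commute)
  also have "\<dots> = of_nat (Suc j) * (fps_deriv X * X ^ Suc j)"
    by (simp only: c power_Suc mult.assoc)
  finally show ?case by (simp add: algebra_simps)
qed simp

text \<open>Termwise differentiation is legitimate since \<open>X\<close> commutes with its
  derivative; the factor j+1 produced by the power cancels against the factorial.\<close>

lemma opexp_deriv:
  assumes X0: "X $ 0 = 0" and c: "fps_deriv X * X = X * fps_deriv X"
  shows "fps_deriv (opexp X) = fps_deriv X * opexp X"
proof (rule fps_ext)
  fix d
  \<comment> \<open>In degrees e up to d the cut at d may replace the cut at e, because the
    additional powers vanish there.\<close>
  have *: "(\<Sum>j\<le>d. scal (1 / fact j) * (X ^ j) $ e) = opexp X $ e" if "e \<le> d" for e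
    unfolding opexp_def fps_nth_Abs_fps
    by (rule sum.mono_neutral_right) (use that in \<open>auto simp: fps_power_nth_zero[of X, OF X0] not_le\<close>)
  have t: "of_nat (Suc d) * (scal (1 / fact (Suc j)) * (X ^ Suc j) $ Suc d) =
      scal (1 / fact j) * (fps_deriv X * X ^ j) $ d" for j
  proof -
    have "of_nat (Suc d) * (X ^ Suc j) $ Suc d = fps_deriv (X ^ Suc j) $ d"
      by (simp only: fps_deriv_nth Suc_eq_plus1)
    also have "\<dots> = (of_nat (Suc j) * (fps_deriv X * X ^ j)) $ d"
      using fps_deriv_power_commuting[OF c] by metis
    also have "\<dots> = of_nat (Suc j) * (fps_deriv X * X ^ j) $ d"
      by (simp only: fps_of_nat[symmetric] fps_mult_left_const_nth)
    finally have e: "of_nat (Suc d) * (X ^ Suc j) $ Suc d = of_nat (Suc j) * (fps_deriv X * X ^ j) $ d" .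
    have "of_nat (Suc d) * (scal (1 / fact (Suc j)) * (X ^ Suc j) $ Suc d)
        = scal (1 / fact (Suc j)) * (of_nat (Suc d) * (X ^ Suc j) $ Suc d)"
      by (metis mult.assoc mult_of_nat_commute)
    also have "\<dots> = scal (1 / fact (Suc j)) * scal (of_nat (Suc j)) * (fps_deriv X * X ^ j) $ d"
      by (simp only: e scal_of_nat mult.assoc)
    also have "scal (1 / fact (Suc j)) * scal (of_nat (Suc j)) = scal (1 / fact j)"
      unfolding scal_mult[symmetric] fact_Suc by (simp del: of_nat_Suc)
    finally show ?thesis .
  qed
  have "fps_deriv (opexp X) $ d = of_nat (Suc d) * (\<Sum>j\<le>Suc d. scal (1 / fact j) * (X ^ j) $ Suc d)"
    by (simp add: opexp_def)
  also have "\<dots> = (\<Sum>j\<le>d. of_nat (Suc d) * (scal (1 / fact (Suc j)) * (X ^ Suc j) $ Suc d))"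
    by (subst sum.atMost_Suc_shift) (simp add: sum_distrib_left del: of_nat_Suc fact_Suc power_Suc)
  also have "\<dots> = (\<Sum>j\<le>d. scal (1 / fact j) * (fps_deriv X * X ^ j) $ d)"
    by (simp only: t)
  also have "\<dots> = (\<Sum>j\<le>d. \<Sum>i=0..d. fps_deriv X $ i * (scal (1 / fact j) * (X ^ j) $ (d - i)))"
    unfolding fps_mult_nth sum_distrib_left
    by (intro sum.cong refl) (metis mult.assoc scal_commute)
  also have "\<dots> = (\<Sum>i=0..d. fps_deriv X $ i * opexp X $ (d - i))"
    by (subst sum.swap) (simp only: sum_distrib_left[symmetric] * diff_le_self)
  finally show "fps_deriv (opexp X) $ d = (fps_deriv X * opexp X) $ d"
    by (simp add: fps_mult_nth)
qed

lemma fps_commuteI: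
  assumes "\<And>m n. X $ m * Y $ n = Y $ n * X $ m"
  shows "(X :: 'a::ring_1 fps) * Y = Y * X"
proof (rule fps_ext)
  fix n
  have "(X * Y) $ n = (\<Sum>i=0..n. Y $ (n - i) * X $ i)"
    using assms by (simp add: fps_mult_nth)
  also have "\<dots> = (\<Sum>i=0..n. Y $ i * X $ (n - i))"
    by (subst sum.atLeastAtMost_rev) (auto intro!: sum.cong)
  finally show "(X * Y) $ n = (Y * X) $ n" by (simp add: fps_mult_nth)
qed

lemma opexp_ext_commute:
  assumes "\<And>n. f * X $ n = X $ n * f"
  shows "f * opexp X $ d = opexp X $ d * f"
proof -
  have p: "f * (X ^ j) $ d = (X ^ j) $ d * f" for j d
  proof (induction j arbitrary: d)
    case (Suc j)
    have "f * (X $ i * (X ^ j) $ (d - i)) = X $ i * (X ^ j) $ (d - i) * f" for i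
      using assms Suc by (metis mult.assoc)
    then show ?case by (simp add: fps_mult_nth sum_distrib_left sum_distrib_right)
  qed simp
  have "f * (scal (1 / fact j) * (X ^ j) $ d) = scal (1 / fact j) * (X ^ j) $ d * f" for j
    using p scal_commute by (metis mult.assoc)
  then show ?thesis by (simp add: opexp_def sum_distrib_left sum_distrib_right)
qed

text \<open>Both sides solve y' = (X' + Y') y with value 1 at the origin.\<close>

lemma opexp_add:
  assumes X: "X $ 0 = 0" "\<And>m n. X $ m * X $ n = X $ n * X $ m"
    and Y: "Y $ 0 = 0" "\<And>m n. Y $ m * Y $ n = Y $ n * Y $ m"
    and XY: "\<And>m n. X $ m * Y $ n = Y $ n * X $ m"
  shows "opexp (X + Y) = opexp X * opexp Y"
proof (rule fop_ode_unique)
  have d: "fps_deriv U $ n * U $ m = U $ m * fps_deriv U $ n"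
    if "\<And>m n. U $ m * U $ n = U $ n * U $ m" for U :: "fop fps" and m n
    using that[of "Suc n" m] by (simp del: of_nat_Suc) (metis mult.assoc mult_of_nat_commute)
  have dX: "fps_deriv (opexp X) = fps_deriv X * opexp X"
    by (rule opexp_deriv[OF X(1)]) (rule fps_commuteI, rule d, rule X(2))
  have dY: "fps_deriv (opexp Y) = fps_deriv Y * opexp Y"
    by (rule opexp_deriv[OF Y(1)]) (rule fps_commuteI, rule d, rule Y(2))
  have sumc: "(X + Y) $ m * (X + Y) $ n = (X + Y) $ n * (X + Y) $ m" for m n
    using X(2)[of m n] Y(2)[of m n] XY[of m n] XY[of n m] by (simp add: algebra_simps)
  show "fps_deriv (opexp (X + Y)) = (fps_deriv X + fps_deriv Y) * opexp (X + Y)"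
  proof -
    have "fps_deriv (X + Y) * (X + Y) = (X + Y) * fps_deriv (X + Y)"
      by (rule fps_commuteI) (rule d, rule sumc)
    then show ?thesis using X(1) Y(1) by (subst opexp_deriv) auto
  qed
  have "fps_deriv Y $ m * opexp X $ n = opexp X $ n * fps_deriv Y $ m" for m n
  proof (rule opexp_ext_commute)
    fix n show "fps_deriv Y $ m * X $ n = X $ n * fps_deriv Y $ m"
      using XY[of n "Suc m"] by (simp del: of_nat_Suc) (metis mult.assoc mult_of_nat_commute)
  qed
  then have c: "fps_deriv Y * opexp X = opexp X * fps_deriv Y" by (rule fps_commuteI)
  have "fps_deriv (opexp X * opexp Y) = opexp X * (fps_deriv Y * opexp Y) + fps_deriv X * opexp X * opexp Y"
    by (simp add: dX dY)
  also have "opexp X * (fps_deriv Y * opexp Y) = fps_deriv Y * opexp X * opexp Y"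
    by (simp only: c mult.assoc)
  finally show "fps_deriv (opexp X * opexp Y) = (fps_deriv X + fps_deriv Y) * (opexp X * opexp Y)"
    by (simp only: distrib_right mult.assoc add.commute)
  show "opexp (X + Y) $ 0 = (opexp X * opexp Y) $ 0"
    unfolding fps_mult_nth_0 opexp_0 by simp
qed

lemma fps_const_sum: "fps_const (sum f B) = (\<Sum>b\<in>B. fps_const (f b))"
  by (rule fps_ext) (simp add: fps_sum_nth)

lemma fps_central_commute:
  fixes P Q :: "'a::ring_1 fps"
  assumes "\<And>n a. P $ n * a = a * P $ n"
  shows "P * Q = Q * P"
  by (rule fps_commuteI) (rule assms)

text \<open>The commutator of \<open>a\<close> with \<open>Y\<close> is the central series p = c
  x^m, so commuting \<open>a\<close> through the exponential costs p times the exponential. The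
  difference D of the two sides satisfies D' = Y' D and vanishes at the origin.\<close>

lemma opexp_exchange_mode:
  assumes Y: "Y $ 0 = 0" "\<And>m n. Y $ m * Y $ n = Y $ n * Y $ m"
    and a: "\<And>n. a * Y $ n = Y $ n * a + (if n = m then scal c else 0)"
  shows "fps_const a * opexp Y = opexp Y * fps_const a + fps_const (scal c) * fps_X ^ m * opexp Y"
proof -
  define E where "E = opexp Y"
  define p :: "fop fps" where "p = fps_const (scal c) * fps_X ^ m"
  define D where "D = fps_const a * E - E * fps_const a - p * E"
  have pc: "p * Z = Z * p" for Z :: "fop fps"
    unfolding p_def by (rule fps_central_commute) (auto simp: fps_X_power_iff scal_commute)
  have dE: "fps_deriv E = fps_deriv Y * E"
    unfolding E_def
  proof (rule opexp_deriv[OF Y(1)], rule fps_commuteI)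
    fix m n show "fps_deriv Y $ m * Y $ n = Y $ n * fps_deriv Y $ m"
      using Y(2)[of "Suc m" n] by (simp del: of_nat_Suc) (metis mult.assoc mult_of_nat_commute)
  qed
  have aY: "fps_const a * Y = Y * fps_const a + p"
    by (rule fps_ext) (simp add: a p_def fps_X_power_iff)
  have "fps_deriv (fps_const a * Y) = fps_deriv (Y * fps_const a + p)"
    by (simp only: aY)
  then have aY': "fps_const a * fps_deriv Y = fps_deriv Y * fps_const a + fps_deriv p"
    by simp
  have "fps_deriv D = fps_const a * fps_deriv Y * E - fps_deriv Y * E * fps_const a
      - (p * fps_deriv Y * E + fps_deriv p * E)"
    by (simp add: D_def dE mult.assoc)
  also have "\<dots> = fps_deriv Y * fps_const a * E - fps_deriv Y * E * fps_const a - fps_deriv Y * p * E"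
    by (simp only: aY' pc[of "fps_deriv Y"]) (simp add: algebra_simps)
  also have "\<dots> = fps_deriv Y * D" by (simp add: D_def algebra_simps)
  finally have D': "fps_deriv D = fps_deriv Y * D" .
  \<comment> \<open>For m = 0 the hypothesis at n = 0, together with the vanishing constant term of
    \<open>Y\<close>, forces \<open>scal c\<close> to be 0.\<close>
  have p0: "p $ 0 = 0"
    using a[of 0] Y(1) by (auto simp: p_def split: if_splits)
  have "D $ 0 = 0" by (simp add: D_def E_def opexp_0 p0)
  then have "D = 0" using fps_linear_ode_zero[where 'a = fop, OF fop_of_nat_cancel D'] by simp
  then show ?thesis by (simp add: D_def E_def p_def algebra_simps)
qed

text \<open>The Baker-Campbell-Hausdorff formula for central commutators, in two variables. These
  are modelled by series over series, so that a single linear differential equation in the outer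
  variable, over the ring \<open>fop fps\<close>, decides the identity.\<close>

lemma opexp_exchange:
  fixes \<kappa> \<gamma> :: "complex fps"
  assumes X: "X $ 0 = 0" "\<And>m n. X $ m * X $ n = X $ n * X $ m"
    and Y: "Y $ 0 = 0" "\<And>m n. Y $ m * Y $ n = Y $ n * Y $ m"
    and XY: "\<And>m n. X $ m * Y $ n = Y $ n * X $ m + (if n = m then scal (\<kappa> $ m) else 0)"
    and \<gamma>: "\<gamma> $ 0 = 1" "fps_deriv \<gamma> = fps_deriv \<kappa> * \<gamma>"
  shows "opexp X $ d * opexp Y $ e =
    (\<Sum>j\<le>d. if j \<le> e then scal (\<gamma> $ j) * (opexp Y $ (e - j) * opexp X $ (d - j)) else 0)"
proof -
  \<comment> \<open>The outer variable records the degree in \<open>X\<close>, the inner one the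
    degree in \<open>Y\<close>. \<open>G\<close> and \<open>K\<close> are \<gamma> and \<kappa>
    evaluated at the product of the two variables.\<close>
  define B where "B = Abs_fps (\<lambda>d. fps_const (opexp X $ d))"
  define C where "C = fps_const (opexp Y)"
  define XX where "XX = Abs_fps (\<lambda>d. fps_const (X $ d))"
  define G :: "fop fps fps" where "G = Abs_fps (\<lambda>j. fps_const (scal (\<gamma> $ j)) * fps_X ^ j)"
  define K :: "fop fps fps" where "K = Abs_fps (\<lambda>j. fps_const (scal (\<kappa> $ j)) * fps_X ^ j)"
  define D where "D = B * C - C * G * B"
  have cen: "fps_const (scal c) * fps_X ^ j * Z = Z * (fps_const (scal c) * fps_X ^ j)" for c j and Z :: "fop fps"
    by (rule fps_central_commute) (auto simp: fps_X_power_iff scal_commute)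
  have Gc: "G * Z = Z * G" for Z :: "fop fps fps"
    unfolding G_def by (rule fps_central_commute) (simp add: cen)
  have K'c: "fps_deriv K * Z = Z * fps_deriv K" for Z :: "fop fps fps"
  proof (rule fps_central_commute)
    fix n and a :: "fop fps"
    have "of_nat (Suc n) * (K $ Suc n * a) = of_nat (Suc n) * (a * K $ Suc n)"
      by (simp add: K_def cen del: of_nat_Suc power_Suc)
    then show "fps_deriv K $ n * a = a * fps_deriv K $ n"
      by (simp del: of_nat_Suc) (metis mult.assoc mult_of_nat_commute)
  qed
  have dX: "fps_deriv (opexp X) = fps_deriv X * opexp X"
  proof (rule opexp_deriv[OF X(1)], rule fps_commuteI)
    fix m n show "fps_deriv X $ m * X $ n = X $ n * fps_deriv X $ m"
      using X(2)[of "Suc m" n] by (simp del: of_nat_Suc) (metis mult.assoc mult_of_nat_commute)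
  qed
  have of_nat_const: "of_nat n * fps_const x = fps_const (of_nat n * x)" for n and x :: fop
    by (simp add: fps_of_nat[symmetric] del: fps_of_nat)
  have dB: "fps_deriv B = fps_deriv XX * B"
  proof (rule fps_ext)
    fix n
    have "fps_deriv B $ n = fps_const (fps_deriv (opexp X) $ n)"
      by (simp add: B_def of_nat_const del: of_nat_Suc)
    also have "\<dots> = (\<Sum>i=0..n. fps_const (of_nat (Suc i) * X $ Suc i) * fps_const (opexp X $ (n - i)))"
      unfolding dX fps_mult_nth fps_const_sum by (simp del: of_nat_Suc)
    also have "\<dots> = (fps_deriv XX * B) $ n"
      by (simp add: XX_def B_def fps_mult_nth of_nat_const del: of_nat_Suc)
    finally show "fps_deriv B $ n = (fps_deriv XX * B) $ n" .
  qed
  have dG: "fps_deriv G = fps_deriv K * G"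
  proof (rule fps_ext)
    fix n
    have "fps_deriv G $ n = fps_const (scal (fps_deriv \<gamma> $ n)) * fps_X ^ Suc n"
      by (simp add: G_def scal_mult scal_of_nat of_nat_const mult.assoc[symmetric] del: of_nat_Suc power_Suc)
    also have "\<dots> = (\<Sum>i=0..n. fps_const (scal (of_nat (Suc i) * \<kappa> $ Suc i * \<gamma> $ (n - i))) * fps_X ^ Suc n)"
      unfolding \<gamma>(2) fps_mult_nth scal_sum fps_const_sum sum_distrib_right
      by (simp del: of_nat_Suc power_Suc)
    also have "\<dots> = (\<Sum>i=0..n. fps_deriv K $ i * G $ (n - i))"
    proof (rule sum.cong[OF refl])
      fix i assume "i \<in> {0..n}"
      then have e: "Suc n = Suc i + (n - i)" by simp
      have "fps_deriv K $ i * G $ (n - i) = fps_const (of_nat (Suc i) * scal (\<kappa> $ Suc i)) *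
          (fps_X ^ Suc i * (fps_const (scal (\<gamma> $ (n - i))) * fps_X ^ (n - i)))"
        by (simp add: K_def G_def of_nat_const mult.assoc[symmetric] del: of_nat_Suc power_Suc fps_const_mult)
      also have "fps_X ^ Suc i * (fps_const (scal (\<gamma> $ (n - i))) * fps_X ^ (n - i)) =
          fps_const (scal (\<gamma> $ (n - i))) * fps_X ^ (n - i) * fps_X ^ Suc i"
        by (simp only: cen)
      also have "\<dots> = fps_const (scal (\<gamma> $ (n - i))) * fps_X ^ Suc n"
        by (metis e mult.assoc power_add add.commute)
      finally show "fps_const (scal (of_nat (Suc i) * \<kappa> $ Suc i * \<gamma> $ (n - i))) * fps_X ^ Suc n =
          fps_deriv K $ i * G $ (n - i)"
        by (simp add: scal_mult scal_of_nat mult.assoc[symmetric] del: of_nat_Suc power_Suc)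
    qed
    finally show "fps_deriv G $ n = (fps_deriv K * G) $ n" by (simp add: fps_mult_nth)
  qed
  have XC: "XX * C = C * XX + K * C"
  proof (rule fps_ext)
    fix m
    have "X $ m * Y $ n = Y $ n * X $ m + (if n = m then scal (\<kappa> $ m) else 0)" for n by (rule XY)
    from opexp_exchange_mode[OF Y this]
    show "(XX * C) $ m = (C * XX + K * C) $ m"
      by (simp add: XX_def C_def K_def)
  qed
  have "fps_deriv (XX * C) = fps_deriv (C * XX + K * C)" by (simp only: XC)
  then have XC': "fps_deriv XX * C = C * fps_deriv XX + fps_deriv K * C" by (simp add: C_def)
  have dC: "fps_deriv C = 0" by (simp add: C_def)
  have "fps_deriv D = fps_deriv XX * B * C - C * (G * (fps_deriv XX * B) + fps_deriv K * G * B)"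
    by (simp add: D_def dB dG dC mult.assoc distrib_left)
  also have "\<dots> = fps_deriv XX * B * C - (C * fps_deriv XX + fps_deriv K * C) * G * B"
  proof -
    have "C * (G * (fps_deriv XX * B) + fps_deriv K * G * B) = C * (G * fps_deriv XX) * B + (C * fps_deriv K) * G * B"
      by (simp only: distrib_left mult.assoc)
    also have "\<dots> = C * (fps_deriv XX * G) * B + (fps_deriv K * C) * G * B"
      by (simp only: Gc[of "fps_deriv XX"] K'c[of C])
    also have "\<dots> = (C * fps_deriv XX + fps_deriv K * C) * G * B"
      by (simp only: distrib_right mult.assoc)
    finally show ?thesis by simp
  qed
  also have "\<dots> = fps_deriv XX * D"
    by (simp only: XC'[symmetric]) (simp add: D_def algebra_simps)
  finally have D': "fps_deriv D = fps_deriv XX * D" .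
  have "D $ 0 = 0" by (simp add: D_def B_def C_def G_def opexp_0 \<gamma>)
  then have "D = 0" using fps_linear_ode_zero[where 'a = "fop fps", OF fps_op_of_nat_cancel D'] by simp
  then have "(B * C) $ d $ e = (C * (G * B)) $ d $ e" by (simp add: D_def mult.assoc)
  also have "\<dots> = (opexp Y * (\<Sum>j=0..d. fps_const (scal (\<gamma> $ j)) * fps_X ^ j * fps_const (opexp X $ (d - j)))) $ e"
  proof -
    have "(C * (G * B)) $ d = opexp Y * (G * B) $ d" by (simp add: C_def)
    also have "(G * B) $ d = (\<Sum>j=0..d. fps_const (scal (\<gamma> $ j)) * fps_X ^ j * fps_const (opexp X $ (d - j)))"
      by (simp add: G_def B_def fps_mult_nth)
    finally show ?thesis by simp
  qed
  also have "\<dots> = (\<Sum>j=0..d. (opexp Y * (fps_const (scal (\<gamma> $ j)) * fps_X ^ j) * fps_const (opexp X $ (d - j))) $ e)"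
    by (simp add: sum_distrib_left fps_sum_nth mult.assoc)
  also have "\<dots> = (\<Sum>j=0..d. (fps_const (scal (\<gamma> $ j)) * (fps_X ^ j * opexp Y) * fps_const (opexp X $ (d - j))) $ e)"
    by (simp only: cen[symmetric] mult.assoc)
  also have "\<dots> = (\<Sum>j=0..d. if j \<le> e then scal (\<gamma> $ j) * (opexp Y $ (e - j) * opexp X $ (d - j)) else 0)"
    by (rule sum.cong) (auto simp: fps_X_power_mult_nth mult.assoc)
  finally show ?thesis by (simp add: B_def C_def atMost_atLeast0)
qed

section \<open>Oscillator exponentials on Fock modules\<close>

locale fock_rep =
  fixes h k :: complex
begin

definition OSC :: "boson \<Rightarrow> int \<Rightarrow> fop" where
  "OSC i n = Fop (osc h k i n)"

lemma app_OSC: "app (OSC i n) v = osc h k i n v"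
  unfolding OSC_def by (subst Fop_inverse) (auto simp: osc_add osc_scl)

lemma OSC_exchange: "OSC i m * OSC j n = OSC j n * OSC i m + scal (if i = j \<and> m + n = 0 then heis h k i m else 0)"
proof (rule fop_eqI)
  fix v show "app (OSC i m * OSC j n) v = app (OSC j n * OSC i m + scal (if i = j \<and> m + n = 0 then heis h k i m else 0)) v"
    using osc_commutator[of h k i m j n v]
    by (simp add: app_plus app_times app_OSC app_scal algebra_simps)
qed

definition osc_sum :: "(boson \<Rightarrow> complex) \<Rightarrow> int \<Rightarrow> fop" where
  "osc_sum c m = (\<Sum>i\<in>bosons. scal (c i) * OSC i m)"

lemma osc_sum_exchange:
  assumes "m \<noteq> 0"
  shows "osc_sum c m * osc_sum d n = osc_sum d n * osc_sum c m +
    (if m + n = 0 then scal (\<Sum>i\<in>bosons. c i * d i * heis h k i m) else 0)"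
proof -
  have e: "(scal a * OSC i m) * (scal b * OSC j n) = (scal b * OSC j n) * (scal a * OSC i m)
      + scal (if i = j \<and> m + n = 0 then a * b * heis h k i m else 0)" for a b i j
  proof -
    have "(scal a * OSC i m) * (scal b * OSC j n) = scal a * (scal b * (OSC i m * OSC j n))"
      by (metis mult.assoc scal_commute)
    also have "\<dots> = scal a * (scal b * (OSC j n * OSC i m))
        + scal a * (scal b * scal (if i = j \<and> m + n = 0 then heis h k i m else 0))"
      by (simp only: OSC_exchange[of i m j n] distrib_left)
    also have "scal a * (scal b * (OSC j n * OSC i m)) = (scal b * OSC j n) * (scal a * OSC i m)"
      by (metis mult.assoc scal_commute)
    also have "scal a * (scal b * scal (if i = j \<and> m + n = 0 then heis h k i m else 0))
        = scal (if i = j \<and> m + n = 0 then a * b * heis h k i m else 0)"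
      by (auto simp: scal_mult mult.assoc)
    finally show ?thesis .
  qed
  have "osc_sum c m * osc_sum d n = (\<Sum>i\<in>bosons. \<Sum>j\<in>bosons. (scal (c i) * OSC i m) * (scal (d j) * OSC j n))"
    unfolding osc_sum_def by (rule sum_product)
  also have "\<dots> = (\<Sum>i\<in>bosons. \<Sum>j\<in>bosons. (scal (d j) * OSC j n) * (scal (c i) * OSC i m))
      + (\<Sum>i\<in>bosons. \<Sum>j\<in>bosons. scal (if i = j \<and> m + n = 0 then c i * d j * heis h k i m else 0))"
    by (simp only: e sum.distrib)
  also have "(\<Sum>i\<in>bosons. \<Sum>j\<in>bosons. (scal (d j) * OSC j n) * (scal (c i) * OSC i m)) = osc_sum d n * osc_sum c m"
    unfolding osc_sum_def sum_product by (rule sum.swap)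
  also have "(\<Sum>i\<in>bosons. \<Sum>j\<in>bosons. scal (if i = j \<and> m + n = 0 then c i * d j * heis h k i m else 0))
      = (if m + n = 0 then scal (\<Sum>i\<in>bosons. c i * d i * heis h k i m) else 0)"
    by (simp add: scal_add)
  finally show ?thesis .
qed

definition XA :: "lform \<Rightarrow> fop fps" where
  "XA F = Abs_fps (\<lambda>m. if m = 0 then 0 else osc_sum (\<lambda>i. cosc F i (int m)) (int m))"

definition XC :: "lform \<Rightarrow> fop fps" where
  "XC F = Abs_fps (\<lambda>m. if m = 0 then 0 else osc_sum (\<lambda>i. cosc F i (- int m)) (- int m))"

definition kap :: "lform \<Rightarrow> lform \<Rightarrow> complex fps" where
  "kap F G = Abs_fps (\<lambda>m. if m = 0 then 0 else
     (\<Sum>i\<in>bosons. cosc F i (int m) * cosc G i (- int m) * heis h k i (int m)))"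

text \<open>The contraction of \<open>:exp F(z):\<close> with \<open>:exp G(w):\<close>, as a series in \<open>w/z\<close>.\<close>

definition gam :: "lform \<Rightarrow> lform \<Rightarrow> complex fps" where
  "gam F G = fps_exp 1 oo kap F G"

lemma XA_0 [simp]: "XA F $ 0 = 0" and XC_0 [simp]: "XC F $ 0 = 0" and kap_0 [simp]: "kap F G $ 0 = 0"
  by (simp_all add: XA_def XC_def kap_def)

lemma gam_0 [simp]: "gam F G $ 0 = 1"
  by (simp add: gam_def)

lemma gam_deriv: "fps_deriv (gam F G) = fps_deriv (kap F G) * gam F G"
  unfolding gam_def by (subst fps_compose_deriv) (simp_all add: mult.commute)

lemma XA_commute: "XA F $ m * XA G $ n = XA G $ n * XA F $ m"
  by (auto simp: XA_def osc_sum_exchange[of "int m" "\<lambda>i. cosc F i (int m)" "\<lambda>i. cosc G i (int n)" "int n"])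

lemma XC_commute: "XC F $ m * XC G $ n = XC G $ n * XC F $ m"
  by (auto simp: XC_def osc_sum_exchange[of "- int m" "\<lambda>i. cosc F i (- int m)" "\<lambda>i. cosc G i (- int n)" "- int n"])

lemma XA_XC_exchange:
  "XA F $ m * XC G $ n = XC G $ n * XA F $ m + (if n = m then scal (kap F G $ m) else 0)"
  by (auto simp: XA_def XC_def kap_def
      osc_sum_exchange[of "int m" "\<lambda>i. cosc F i (int m)" "\<lambda>i. cosc G i (- int n)" "- int n"]
      osc_sum_exchange[of "int m" "\<lambda>i. cosc F i (int m)" "\<lambda>i. cosc G i (- int m)" "- int m"])

text \<open>Degrees are integers, with value 0 at negative ones, so that shifted degrees such as
  \<open>d - int j\<close> need no side conditions. The same holds for \<open>cc\<close>.\<close>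

definition aa :: "lform \<Rightarrow> int \<Rightarrow> fop" where
  "aa F d = (if d < 0 then 0 else opexp (XA F) $ nat d)"

definition cc :: "lform \<Rightarrow> int \<Rightarrow> fop" where
  "cc F d = (if d < 0 then 0 else opexp (XC F) $ nat d)"

lemma opexp_commute:
  assumes "\<And>m n. X $ m * Y $ n = Y $ n * X $ m"
  shows "opexp X $ d * opexp Y $ e = opexp Y $ e * opexp X $ d"
proof (rule opexp_ext_commute)
  fix n
  show "opexp X $ d * Y $ n = Y $ n * opexp X $ d"
    by (rule opexp_ext_commute[symmetric]) (rule assms[symmetric])
qed

lemma aa_commute: "aa F d * aa G e = aa G e * aa F d"
  by (auto simp: aa_def intro!: opexp_commute XA_commute)

lemma cc_commute: "cc F d * cc G e = cc G e * cc F d"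
  by (auto simp: cc_def intro!: opexp_commute XC_commute)

text \<open>Terms with j > d vanish because of \<open>aa\<close>, so every \<open>J\<close> above
  \<open>d\<close> is a valid summation bound; \<open>MM_MM\<close> uses one \<open>J\<close> for a
  whole range of \<open>d\<close>.\<close>

lemma aa_cc_exchange:
  assumes "d \<le> int J"
  shows "aa F d * cc G e = (\<Sum>j\<le>J. scal (gam F G $ j) * (cc G (e - int j) * aa F (d - int j)))"
proof (cases "d < 0")
  case True
  then show ?thesis by (simp add: aa_def)
next
  case d: False
  show ?thesis
  proof (cases "e < 0")
    case True
    then show ?thesis by (simp add: cc_def)
  next
    case e: False
    have "aa F d * cc G e = (\<Sum>j\<le>nat d. if j \<le> nat e then scal (gam F G $ j) *
        (opexp (XC G) $ (nat e - j) * opexp (XA F) $ (nat d - j)) else 0)"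
      using d e by (simp add: aa_def cc_def
          opexp_exchange[OF XA_0 XA_commute XC_0 XC_commute XA_XC_exchange gam_0 gam_deriv])
    also have "\<dots> = (\<Sum>j\<le>nat d. scal (gam F G $ j) * (cc G (e - int j) * aa F (d - int j)))"
      using d e by (intro sum.cong) (auto simp: aa_def cc_def nat_diff_distrib)
    also have "\<dots> = (\<Sum>j\<le>J. scal (gam F G $ j) * (cc G (e - int j) * aa F (d - int j)))"
      by (rule sum.mono_neutral_left) (use assms in \<open>auto simp: aa_def\<close>)
    finally show ?thesis .
  qed
qed

lemma osc_sum_add: "osc_sum (\<lambda>i. c i + d i) m = osc_sum c m + osc_sum d m"
  by (simp add: osc_sum_def scal_add algebra_simps)

lemma XA_lf_add: "XA (F \<oplus>\<^sub>l G) = XA F + XA G" and XC_lf_add: "XC (F \<oplus>\<^sub>l G) = XC F + XC G"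
  by (rule fps_ext, simp add: XA_def XC_def lf_add_def osc_sum_add)+

lemma int_interval_sum:
  assumes "a \<ge> 0"
  shows "(\<Sum>i=0..a. f i) = (\<Sum>i=0..nat a. f (int i))"
  by (rule sum.reindex_bij_witness[of _ int nat]) (use assms in auto)

lemma aa_lf_add:
  assumes "d \<le> a" "0 \<le> a"
  shows "aa (F \<oplus>\<^sub>l G) d = (\<Sum>i\<in>{0..a}. aa F i * aa G (d - i))"
proof (cases "d < 0")
  case False
  have "aa (F \<oplus>\<^sub>l G) d = (\<Sum>i=0..nat d. opexp (XA F) $ i * opexp (XA G) $ (nat d - i))"
    using False by (simp add: aa_def XA_lf_add opexp_add[OF XA_0 XA_commute XA_0 XA_commute XA_commute] fps_mult_nth)
  also have "\<dots> = (\<Sum>i=0..d. aa F i * aa G (d - i))"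
    using False by (subst int_interval_sum) (auto simp: aa_def nat_diff_distrib intro!: sum.cong)
  also have "\<dots> = (\<Sum>i\<in>{0..a}. aa F i * aa G (d - i))"
    by (rule sum.mono_neutral_left) (use assms in \<open>auto simp: aa_def\<close>)
  finally show ?thesis .
qed (auto simp: aa_def)

lemma cc_lf_add:
  assumes "d \<le> a" "0 \<le> a"
  shows "cc (F \<oplus>\<^sub>l G) d = (\<Sum>i\<in>{0..a}. cc F i * cc G (d - i))"
proof (cases "d < 0")
  case False
  have "cc (F \<oplus>\<^sub>l G) d = (\<Sum>i=0..nat d. opexp (XC F) $ i * opexp (XC G) $ (nat d - i))"
    using False by (simp add: cc_def XC_lf_add opexp_add[OF XC_0 XC_commute XC_0 XC_commute XC_commute] fps_mult_nth)
  also have "\<dots> = (\<Sum>i=0..d. cc F i * cc G (d - i))"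
    using False by (subst int_interval_sum) (auto simp: cc_def nat_diff_distrib intro!: sum.cong)
  also have "\<dots> = (\<Sum>i\<in>{0..a}. cc F i * cc G (d - i))"
    by (rule sum.mono_neutral_left) (use assms in \<open>auto simp: cc_def\<close>)
  finally show ?thesis .
qed (auto simp: cc_def)

lemma opexp_rescale:
  assumes "\<And>m. Y $ m = scal (c ^ m) * X $ m"
  shows "opexp Y $ d = scal (c ^ d) * opexp X $ d"
proof -
  have p: "(Y ^ j) $ d = scal (c ^ d) * (X ^ j) $ d" for j d
  proof (induction j arbitrary: d)
    case (Suc j)
    have "scal (c ^ i) * X $ i * (scal (c ^ (d - i)) * (X ^ j) $ (d - i)) = scal (c ^ d) * (X $ i * (X ^ j) $ (d - i))"
      if "i \<le> d" for i
    proof -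
      have "c ^ i * c ^ (d - i) = c ^ d" using that by (simp add: power_add[symmetric])
      then show ?thesis by (metis mult.assoc scal_commute scal_mult)
    qed
    then show ?case by (auto simp: fps_mult_nth assms Suc sum_distrib_left intro!: sum.cong)
  qed auto
  have "scal (1 / fact j) * (scal (c ^ d) * (X ^ j) $ d) = scal (c ^ d) * (scal (1 / fact j) * (X ^ j) $ d)" for j
    by (metis mult.assoc scal_commute)
  then show ?thesis by (simp add: opexp_def p sum_distrib_left)
qed

lemma qpow_add: "qpow h (a + b) = qpow h a * qpow h b"
  by (simp add: qpow_def distrib_left exp_add)

lemma qpow_0 [simp]: "qpow h 0 = 1"
  by (simp add: qpow_def)

lemma qpow_of_nat_mult: "qpow h (of_nat n * u) = qpow h u ^ n"
  by (simp add: qpow_def exp_of_nat_mult[symmetric] algebra_simps)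

lemma osc_sum_scale: "osc_sum (\<lambda>i. c i * x) m = scal x * osc_sum c m"
  by (simp add: osc_sum_def mult.commute[of _ x] scal_mult algebra_simps)

lemma aa_scale: "aa (lf_scale h u F) d = scal (qpow h (- (u * of_int d))) * aa F d"
proof -
  have "XA (lf_scale h u F) $ m = scal (qpow h (- u) ^ m) * XA F $ m" for m
    by (simp add: XA_def lf_scale_def osc_sum_scale qpow_of_nat_mult[symmetric] mult.commute)
  from opexp_rescale[OF this] show ?thesis
    by (auto simp: aa_def qpow_of_nat_mult[symmetric] mult.commute)
qed

lemma cc_scale: "cc (lf_scale h u F) d = scal (qpow h (u * of_int d)) * cc F d"
proof -
  have "XC (lf_scale h u F) $ m = scal (qpow h u ^ m) * XC F $ m" for m
    by (simp add: XC_def lf_scale_def osc_sum_scale qpow_of_nat_mult[symmetric] mult.commute)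
  from opexp_rescale[OF this] show ?thesis
    by (auto simp: cc_def qpow_of_nat_mult[symmetric] mult.commute)
qed

lemma fexp_opexp:
  assumes "X $ 0 = 0" "\<And>m w. m \<ge> 1 \<Longrightarrow> Y m w = app (X $ m) w"
  shows "fexp Y d v = app (opexp X $ d) v"
proof -
  have "fpow Y j d v = app ((X ^ j) $ d) v" for j d
  proof (induction j arbitrary: d)
    case 0
    then show ?case by (simp add: app_0 app_1)
  next
    case (Suc j)
    have "fpow Y (Suc j) d v = (\<Sum>m\<in>{1..d}. app (X $ m) (app ((X ^ j) $ (d - m)) v))"
      using Suc assms by simp
    also have "\<dots> = (\<Sum>m\<in>{0..d}. app (X $ m) (app ((X ^ j) $ (d - m)) v))"
      by (rule sum.mono_neutral_left) (use assms in \<open>auto simp: app_0 Suc_le_eq\<close>)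
    finally show ?case by (simp add: fps_mult_nth app_sum app_times)
  qed
  then show ?thesis by (simp add: fexp_def opexp_def app_sum app_times app_scal)
qed

lemma creation_part_eq:
  "creation_part h k F s v = (if - s \<in> \<nat> then app (cc F (\<lfloor>Re (- s)\<rfloor>)) v else 0)"
proof (cases "- s \<in> \<nat>")
  case True
  then obtain n where n: "- s = of_nat n" by (elim Nats_cases)
  show ?thesis using True unfolding creation_part_def
    by (subst fexp_opexp[where X = "XC F"])
      (auto simp: XC_def osc_sum_def app_sum app_plus app_times app_scal app_OSC cc_def n)
qed (simp add: creation_part_def)

lemma annihilation_part_eq:
  "annihilation_part h k F s v = (if s \<in> \<nat> then app (aa F (\<lfloor>Re s\<rfloor>)) v else 0)"
proof (cases "s \<in> \<nat>")
  case True
  then obtain n where n: "s = of_nat n" by (elim Nats_cases)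
  show ?thesis using True unfolding annihilation_part_def
    by (subst fexp_opexp[where X = "XA F"])
      (auto simp: XA_def osc_sum_def app_sum app_plus app_times app_scal app_OSC aa_def n)
qed (simp add: annihilation_part_def)

end

subsection \<open>Charge and level\<close>

definition lev :: "occ \<Rightarrow> int" where
  "lev N = (\<Sum>x\<in>Poly_Mapping.keys N. int (Poly_Mapping.lookup N x) * int (snd x + 1))"

lemma lev_superset:
  assumes "finite S" "Poly_Mapping.keys N \<subseteq> S"
  shows "lev N = (\<Sum>x\<in>S. int (Poly_Mapping.lookup N x) * int (snd x + 1))"
  unfolding lev_def by (rule sum.mono_neutral_left [OF assms]) (auto simp: in_keys_iff)

lemma lev_nonneg: "0 \<le> lev N"
  by (simp add: lev_def sum_nonneg)

lemma lev_add: "lev (M + N) = lev M + lev N"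
proof -
  let ?S = "Poly_Mapping.keys M \<union> Poly_Mapping.keys N"
  have "Poly_Mapping.keys (M + N) \<subseteq> ?S" by (rule Poly_Mapping.keys_add)
  then show ?thesis
    by (simp add: lev_superset[of ?S] lookup_add sum.distrib algebra_simps)
qed

lemma lev_single: "lev (Poly_Mapping.single x n) = int n * int (snd x + 1)"
  by (simp add: lev_superset[of "{x}"])

text \<open>Vectors of one charge and bounded level: zero modes act on them as numbers, and lowering
  the level by more than \<open>L\<close> gives 0. A negative \<open>L\<close> is allowed and leaves
  only the zero vector, which is how vanishing is detected.\<close>

definition VV :: "charge \<Rightarrow> int \<Rightarrow> fock set" where
  "VV p L = {v. \<forall>b\<in>Poly_Mapping.keys v. fst b = p \<and> lev (snd b) \<le> L}"

lemma VV_0 [simp]: "0 \<in> VV p L"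
  by (simp add: VV_def)

lemma VV_add: "v \<in> VV p L \<Longrightarrow> w \<in> VV p L \<Longrightarrow> v + w \<in> VV p L"
  using Poly_Mapping.keys_add[of v w] by (auto simp: VV_def)

lemma VV_scl: "v \<in> VV p L \<Longrightarrow> scl c v \<in> VV p L"
  by (auto simp: VV_def in_keys_iff)

lemma VV_sum: "(\<And>b. b \<in> B \<Longrightarrow> f b \<in> VV p L) \<Longrightarrow> sum f B \<in> VV p L"
  by (induction B rule: infinite_finite_induct) (auto intro: VV_add)

lemma VV_single: "lev N \<le> L \<Longrightarrow> Poly_Mapping.single (p, N) c \<in> VV p L"
  by (auto simp: VV_def)

lemma VV_mono: "v \<in> VV p L \<Longrightarrow> L \<le> L' \<Longrightarrow> v \<in> VV p L'"
  by (fastforce simp: VV_def)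

lemma VV_neg: "v \<in> VV p L \<Longrightarrow> L < 0 \<Longrightarrow> v = 0"
proof (rule ccontr)
  assume a: "v \<in> VV p L" "L < 0" "v \<noteq> 0"
  then obtain b where "b \<in> Poly_Mapping.keys v" by (metis keys_eq_empty ex_in_conv)
  then have "lev (snd b) \<le> L" using a by (auto simp: VV_def)
  then show False using lev_nonneg[of "snd b"] a by linarith
qed

lemma VV_linext:
  assumes "v \<in> VV p L" "\<And>N. lev N \<le> L \<Longrightarrow> f (p, N) \<in> VV p' L'"
  shows "linext f v \<in> VV p' L'"
  unfolding linext_def using assms by (fastforce simp: VV_def[of p] intro!: VV_sum VV_scl)

definition shift :: "(boson \<Rightarrow> complex) \<Rightarrow> charge \<Rightarrow> charge" where
  "shift u p = (\<lambda>i. p i + Qsign i * u i)"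

lemma VV_osc:
  assumes "v \<in> VV p L" "n \<noteq> 0"
  shows "osc h k i n v \<in> VV p (L - n)"
proof (cases "n < 0")
  case True
  show ?thesis unfolding osc_def using assms(1)
    by (rule VV_linext) (use True in \<open>auto intro!: VV_single simp: lev_add lev_single\<close>)
next
  case False
  show ?thesis unfolding osc_def using assms(1)
  proof (rule VV_linext)
    fix N assume N: "lev N \<le> L"
    let ?e = "Poly_Mapping.single (i, nat n - 1) (1 :: nat)"
    show "(case (p, N) of (p, N) \<Rightarrow>
         if n < 0 then Poly_Mapping.single (p, N + Poly_Mapping.single (i, nat (- n) - 1) 1) 1
         else if n = 0 then Poly_Mapping.single (p, N) (p i)
         else Poly_Mapping.single (p, N - Poly_Mapping.single (i, nat n - 1) 1)
               (heis h k i n * of_nat (Poly_Mapping.lookup N (i, nat n - 1)))) \<in> VV p (L - n)"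
    proof (cases "Poly_Mapping.lookup N (i, nat n - 1) = 0")
      case True
      then show ?thesis using False assms by simp
    next
      case nz: False
      have "N = (N - ?e) + ?e"
        by (rule poly_mapping_eqI) (use nz in \<open>auto simp: lookup_add lookup_minus lookup_single when_def\<close>)
      then have "lev N = lev (N - ?e) + lev ?e" using lev_add by metis
      moreover have "lev ?e = n" using False assms by (simp add: lev_single)
      ultimately have "lev (N - ?e) \<le> L - n" using N by simp
      then show ?thesis using False assms by (auto intro!: VV_single)
    qed
  qed
qed

lemma VV_expQ: "v \<in> VV p L \<Longrightarrow> expQ u v \<in> VV (shift u p) L"
  unfolding expQ_def by (rule VV_linext) (auto intro!: VV_single simp: shift_def)

text \<open>The sign \<open>\<sigma>\<close> is -1 for annihilation series, whose coefficient m
  lowers the level by m, and 1 for creation series.\<close>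

lemma VV_opexp:
  assumes X: "\<And>m L w. w \<in> VV p L \<Longrightarrow> app (X $ m) w \<in> VV p (L + \<sigma> * int m)" and v: "v \<in> VV p L"
  shows "app (opexp X $ d) v \<in> VV p (L + \<sigma> * int d)"
proof -
  have "app ((X ^ j) $ d) v \<in> VV p (L + \<sigma> * int d)" for j d
  proof (induction j arbitrary: d)
    case 0
    then show ?case using v by (auto simp: app_0 app_1)
  next
    case (Suc j)
    have "app (X $ i) (app ((X ^ j) $ (d - i)) v) \<in> VV p (L + \<sigma> * int d)" if "i \<le> d" for i
      using X[OF Suc, of i "d - i"] that by (simp add: of_nat_diff algebra_simps)
    then show ?case by (auto simp: fps_mult_nth app_sum app_times intro!: VV_sum)
  qed
  then show ?thesis by (auto simp: opexp_def app_sum app_times app_scal intro!: VV_sum VV_scl)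
qed

context fock_rep
begin

lemma VV_osc_sum: "v \<in> VV p L \<Longrightarrow> n \<noteq> 0 \<Longrightarrow> app (osc_sum c n) v \<in> VV p (L - n)"
  unfolding osc_sum_def app_sum app_times app_scal app_OSC by (intro VV_sum VV_scl VV_osc)

lemma VV_aa: "v \<in> VV p L \<Longrightarrow> app (aa F d) v \<in> VV p (L - d)"
proof (cases "d < 0")
  case False
  assume v: "v \<in> VV p L"
  have "app (XA F $ m) w \<in> VV p (L + (-1) * int m)" if "w \<in> VV p L" for m L w
    using that VV_osc_sum[OF that, of "int m"] by (auto simp: XA_def app_0)
  from VV_opexp[of p "XA F", OF this v, of "nat d"] show ?thesis using False by (simp add: aa_def)
qed (simp add: aa_def app_0)

lemma VV_cc: "v \<in> VV p L \<Longrightarrow> app (cc F d) v \<in> VV p (L + d)"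
proof (cases "d < 0")
  case False
  assume v: "v \<in> VV p L"
  have "app (XC F $ m) w \<in> VV p (L + 1 * int m)" if "w \<in> VV p L" for m L w
    using that VV_osc_sum[OF that, of "- int m"] by (auto simp: XC_def app_0)
  from VV_opexp[of p "XC F", OF this v, of "nat d"] show ?thesis using False by (simp add: cc_def)
qed (simp add: cc_def app_0)

definition EQ :: "(boson \<Rightarrow> complex) \<Rightarrow> fop" where
  "EQ u = Fop (expQ u)"

lemma app_EQ: "app (EQ u) v = expQ u v"
  unfolding EQ_def by (subst Fop_inverse) (auto simp: expQ_def linext_add linext_scl)

lemma fop_eq_basisI:
  assumes "\<And>b. app f (Poly_Mapping.single b 1) = app g (Poly_Mapping.single b 1)"
  shows "f = g"
  by (rule fop_eqI) (rule linear_eqI[OF app_add app_scl app_add app_scl assms])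

lemma EQ_mult: "EQ u * EQ w = EQ (\<lambda>i. u i + w i)"
  by (rule fop_eq_basisI) (auto simp: app_times app_EQ expQ_def algebra_simps)

lemma EQ_OSC: "n \<noteq> 0 \<Longrightarrow> EQ u * OSC i n = OSC i n * EQ u"
proof (rule fop_eq_basisI)
  fix b :: "charge \<times> occ"
  assume "n \<noteq> 0"
  then show "app (EQ u * OSC i n) (Poly_Mapping.single b 1) = app (OSC i n * EQ u) (Poly_Mapping.single b 1)"
    by (cases b) (auto simp: app_times app_EQ app_OSC expQ_def osc_def)
qed

lemma EQ_osc_sum: "n \<noteq> 0 \<Longrightarrow> EQ u * osc_sum c n = osc_sum c n * EQ u"
proof -
  assume n: "n \<noteq> 0"
  have "EQ u * (scal (c i) * OSC i n) = scal (c i) * OSC i n * EQ u" for i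
    using EQ_OSC[OF n] by (metis mult.assoc scal_commute)
  then show ?thesis by (simp add: osc_sum_def distrib_left distrib_right)
qed

lemma EQ_aa: "EQ u * aa F d = aa F d * EQ u"
  unfolding aa_def by (auto intro!: opexp_ext_commute simp: XA_def EQ_osc_sum)

lemma EQ_cc: "EQ u * cc F d = cc F d * EQ u"
  unfolding cc_def by (auto intro!: opexp_ext_commute simp: XC_def EQ_osc_sum)

end

section \<open>Products of normally ordered exponentials\<close>

definition zcoeff :: "complex fps \<Rightarrow> int \<Rightarrow> complex" where
  "zcoeff f n = (if n < 0 then 0 else f $ nat n)"

lemma Sum_any_nat_int:
  assumes "\<And>n. n < 0 \<Longrightarrow> f n = 0"
  shows "Sum_any (\<lambda>j::nat. f (int j)) = (Sum_any (f :: int \<Rightarrow> fock))"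
proof (cases "finite {n. f n \<noteq> 0}")
  case True
  have e: "{n. f n \<noteq> 0} = int ` {j. f (int j) \<noteq> 0}"
  proof -
    have "n \<in> int ` {j. f (int j) \<noteq> 0}" if "f n \<noteq> 0" for n
      using that assms[of n] by (intro image_eqI[of _ _ "nat n"]) force+
    then show ?thesis by auto
  qed
  show ?thesis
    unfolding Sum_any.expand_set e by (subst sum.reindex) auto
next
  case False
  have "\<not> finite {j. f (int j) \<noteq> 0}"
  proof
    assume "finite {j. f (int j) \<noteq> 0}"
    then have "finite (int ` {j. f (int j) \<noteq> 0})" by simp
    moreover have "{n. f n \<noteq> 0} \<subseteq> int ` {j. f (int j) \<noteq> 0}"
    proof
      fix n assume "n \<in> {n. f n \<noteq> 0}"
      then show "n \<in> int ` {j. f (int j) \<noteq> 0}"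
        using assms[of n] by (intro image_eqI[of _ _ "nat n"]) force+
    qed
    ultimately show False using False finite_subset by blast
  qed
  with False show ?thesis by simp
qed

context fock_rep
begin

lemma aa_nz: "app (aa F d) v \<noteq> 0 \<Longrightarrow> v \<in> VV p L \<Longrightarrow> 0 \<le> d \<and> d \<le> L"
  using VV_neg[OF VV_aa[of v p L F d]] by (cases "L < d") (auto simp: aa_def app_0 split: if_splits)

lemma cc_nz: "app (cc F d) v \<noteq> 0 \<Longrightarrow> 0 \<le> d"
  by (auto simp: cc_def app_0 split: if_splits)

text \<open>Oscillator part of one mode of a normally ordered exponential. The annihilation degree
  is \<open>d\<close> and the creation degree \<open>d - r\<close>, so the level drops by
  \<open>r\<close>; on \<open>VV p L\<close> only degrees from 0 to \<open>L\<close>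
  contribute.\<close>

definition MM :: "lform \<Rightarrow> int \<Rightarrow> fock \<Rightarrow> fock" where
  "MM F r v = Sum_any (\<lambda>d. app (cc F (d - r) * aa F d) v)"

text \<open>Two exponentials under one ordering sign; the level drops \<open>m\<close> and
  \<open>n\<close> at the two points are kept apart, since they are the exponents of two
  variables.\<close>

definition M2 :: "lform \<Rightarrow> lform \<Rightarrow> int \<Rightarrow> int \<Rightarrow> fock \<Rightarrow> fock" where
  "M2 F G m n v = Sum_any (\<lambda>(d, d'). app (cc F (d - m) * cc G (d' - n) * aa F d * aa G d') v)"

lemma MM_sum:
  assumes "v \<in> VV p L" "finite S" "{0..L} \<subseteq> S"
  shows "MM F r v = (\<Sum>d\<in>S. app (cc F (d - r) * aa F d) v)"
  unfolding MM_def
proof (rule Sum_any.expand_superset[OF assms(2)], rule subsetI)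
  fix d assume "d \<in> {d. app (cc F (d - r) * aa F d) v \<noteq> 0}"
  then have "app (aa F d) v \<noteq> 0" by (auto simp: app_times)
  then show "d \<in> S" using aa_nz assms by auto
qed

lemma M2_nz:
  assumes "app (cc F a * cc G b * aa F d * aa G d') v \<noteq> 0" "v \<in> VV p L"
  shows "0 \<le> a \<and> 0 \<le> b \<and> 0 \<le> d \<and> 0 \<le> d' \<and> d + d' \<le> L"
proof -
  have *: "app (cc F a) (app (cc G b) (app (aa F d) (app (aa G d') v))) \<noteq> 0"
    using assms by (simp add: app_times)
  have 0: "0 \<le> a" "0 \<le> b"
  proof -
    have "app (cc G b) (app (aa F d) (app (aa G d') v)) \<noteq> 0" using * by auto
    then show "0 \<le> a" "0 \<le> b" using cc_nz[OF *] cc_nz by auto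
  qed
  have "app (aa F d) (app (aa G d') v) \<noteq> 0" using * by auto
  from aa_nz[OF this VV_aa[OF assms(2)]] have 1: "0 \<le> d" "d \<le> L - d'" by auto
  have "app (aa G d') v \<noteq> 0" using * by auto
  from aa_nz[OF this assms(2)] 0 1 show ?thesis by auto
qed

lemma M2_sum:
  assumes "v \<in> VV p L" "finite S" "\<And>d d'. 0 \<le> d \<Longrightarrow> 0 \<le> d' \<Longrightarrow> d + d' \<le> L \<Longrightarrow> m \<le> d \<Longrightarrow> n \<le> d' \<Longrightarrow> (d, d') \<in> S"
  shows "M2 F G m n v = (\<Sum>(d, d')\<in>S. app (cc F (d - m) * cc G (d' - n) * aa F d * aa G d') v)"
  unfolding M2_def
proof (rule Sum_any.expand_superset[OF assms(2)], rule subsetI, clarsimp simp: app_times[symmetric])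
  fix d d' assume "app (cc F (d - m) * cc G (d' - n) * aa F d * aa G d') v \<noteq> 0"
  from M2_nz[OF this assms(1)] show "(d, d') \<in> S" using assms(3) by auto
qed

lemma M2_swap: "M2 F G m n v = M2 G F n m v"
  unfolding M2_def
proof (rule Sum_any.reindex_cong[of prod.swap])
  show "(\<lambda>(d, d'). app (cc F (d - m) * cc G (d' - n) * aa F d * aa G d') v) \<circ> prod.swap =
      (\<lambda>(d, d'). app (cc G (d - n) * cc F (d' - m) * aa G d * aa F d') v)"
  proof (rule ext, clarsimp)
    fix a b
    have "cc F (b - m) * cc G (a - n) * aa F b * aa G a = cc G (a - n) * cc F (b - m) * aa G a * aa F b"
      using cc_commute[of F "b - m" G "a - n"] aa_commute[of F b G a] by (metis mult.assoc)
    then show "app (cc F (b - m) * cc G (a - n) * aa F b * aa G a) v =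
        app (cc G (a - n) * cc F (b - m) * aa G a * aa F b) v" by simp
  qed
qed (simp add: bij_swap)

lemma VV_MM: "v \<in> VV p L \<Longrightarrow> MM F r v \<in> VV p (L - r)"
proof -
  assume v: "v \<in> VV p L"
  have "app (cc F (d - r) * aa F d) v \<in> VV p (L - r)" for d
    using VV_cc[OF VV_aa[OF v, of F d], of F "d - r"] by (simp add: app_times)
  then show ?thesis by (subst MM_sum[OF v, of "{0..L}"]) (auto intro!: VV_sum)
qed

lemma M2_eq_0:
  assumes "v \<in> VV p L" "L < m \<or> L < n"
  shows "M2 F G m n v = 0"
  by (subst M2_sum[OF assms(1), of "{}"]) (use assms in auto)

text \<open>Wick's theorem for modes: moving the annihilation part of \<open>F\<close> past the
  creation part of \<open>G\<close> costs the contraction, and its j-th term turns the modes (m, n)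
  into (m - j, n + j).\<close>

lemma MM_MM:
  assumes v: "v \<in> VV p L"
  shows "MM F m (MM G n v) = Sum_any (\<lambda>j. scl (zcoeff (gam F G) j) (M2 F G (m - j) (n + j) v))"
proof -
  \<comment> \<open>The window from -D to D contains the degrees of all nonzero terms both before
    and after the exchange, so every sum below may run over it.\<close>
  define D where "D = \<bar>L\<bar> + \<bar>n\<bar>"
  define J where "J = nat D"
  have D: "0 \<le> D" "L \<le> D" "L - n \<le> D" "D \<le> int J" by (auto simp: D_def J_def)
  let ?I = "{-D..D}"
  let ?t = "\<lambda>d d' j. scl (gam F G $ j) (app (cc F (d - m) * cc G (d' - n - int j) * aa F (d - int j) * aa G d') v)"
  let ?u = "\<lambda>d d' j. scl (gam F G $ j) (app (cc F (d - (m - int j)) * cc G (d' - (n + int j)) * aa F d * aa G d') v)"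
  have "MM F m (MM G n v) = (\<Sum>d\<in>?I. app (cc F (d - m) * aa F d) (MM G n v))"
    by (rule MM_sum[OF VV_MM[OF v]]) (use D in auto)
  also have "\<dots> = (\<Sum>d\<in>?I. \<Sum>d'\<in>?I. app (cc F (d - m) * (aa F d * cc G (d' - n)) * aa G d') v)"
    by (subst MM_sum[OF v, of ?I]) (use D in \<open>auto simp: app_sum_arg app_times\<close>)
  also have "\<dots> = (\<Sum>d\<in>?I. \<Sum>d'\<in>?I. \<Sum>j\<le>J. ?t d d' j)"
  proof (intro sum.cong refl)
    fix d d' assume d: "d \<in> ?I"
    show "app (cc F (d - m) * (aa F d * cc G (d' - n)) * aa G d') v = (\<Sum>j\<le>J. ?t d d' j)"
      using d D by (subst aa_cc_exchange[of d J]) (auto simp: app_sum app_sum_arg app_times app_scal app_scl)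
  qed
  also have "\<dots> = (\<Sum>(d, d', j)\<in>?I \<times> ?I \<times> {..J}. ?t d d' j)"
    by (simp add: sum.cartesian_product)
  \<comment> \<open>The substitution of d by d - j leaves the window only at vanishing terms; hence
    the bijection is required for nonzero terms alone.\<close>
  also have "\<dots> = (\<Sum>(j, d, d')\<in>{..J} \<times> ?I \<times> ?I. ?u d d' j)"
  proof (rule sum.reindex_bij_witness_not_neutral[where
        S' = "{x \<in> ?I \<times> ?I \<times> {..J}. (case x of (d, d', j) \<Rightarrow> ?t d d' j) = 0}" and
        T' = "{x \<in> {..J} \<times> ?I \<times> ?I. (case x of (j, d, d') \<Rightarrow> ?u d d' j) = 0}" and
        j = "\<lambda>(d, d', j). (j, d - int j, d')" and i = "\<lambda>(j, d, d'). (d + int j, d', j)"])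
    have nz: "app (cc F a * cc G b * aa F d * aa G d') v \<noteq> 0" if
      "scl c (app (cc F a * cc G b * aa F d * aa G d') v) \<noteq> 0" for a b c d d'
      using that by auto
    {
      fix x assume x: "x \<in> ?I \<times> ?I \<times> {..J} - {x \<in> ?I \<times> ?I \<times> {..J}. (case x of (d, d', j) \<Rightarrow> ?t d d' j) = 0}"
      obtain d d' j where [simp]: "x = (d, d', j)" by (cases x)
      have t: "?t d d' j \<noteq> 0" using x by auto
      from M2_nz[OF nz[OF t] v] have "0 \<le> d - int j" "d - int j \<le> L" "0 \<le> d'" by auto
      then show "(case x of (d, d', j) \<Rightarrow> (j, d - int j, d')) \<in>
        {..J} \<times> ?I \<times> ?I - {x \<in> {..J} \<times> ?I \<times> ?I. (case x of (j, d, d') \<Rightarrow> ?u d d' j) = 0}"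
        using x D t by (auto simp: algebra_simps)
    }
    {
      fix x assume x: "x \<in> {..J} \<times> ?I \<times> ?I - {x \<in> {..J} \<times> ?I \<times> ?I. (case x of (j, d, d') \<Rightarrow> ?u d d' j) = 0}"
      obtain d d' j where [simp]: "x = (j, d, d')" by (cases x)
      have t: "?u d d' j \<noteq> 0" using x by auto
      from M2_nz[OF nz[OF t] v] have "0 \<le> d" "d + d' \<le> L" "0 \<le> d' - (n + int j)" by auto
      then show "(case x of (j, d, d') \<Rightarrow> (d + int j, d', j)) \<in>
        ?I \<times> ?I \<times> {..J} - {x \<in> ?I \<times> ?I \<times> {..J}. (case x of (d, d', j) \<Rightarrow> ?t d d' j) = 0}"
        using x D t by (auto simp: algebra_simps)
    }
  qed (auto simp: algebra_simps)
  also have "\<dots> = (\<Sum>j\<le>J. scl (gam F G $ j) (\<Sum>(d, d')\<in>?I \<times> ?I.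
      app (cc F (d - (m - int j)) * cc G (d' - (n + int j)) * aa F d * aa G d') v))"
    unfolding scl_sum sum.cartesian_product by (intro sum.cong) auto
  also have "\<dots> = (\<Sum>j\<le>J. scl (gam F G $ j) (M2 F G (m - int j) (n + int j) v))"
  proof (intro sum.cong refl arg_cong[of _ _ "scl _"])
    fix j
    show "(\<Sum>(d, d')\<in>?I \<times> ?I. app (cc F (d - (m - int j)) * cc G (d' - (n + int j)) * aa F d * aa G d') v)
        = M2 F G (m - int j) (n + int j) v"
      by (rule M2_sum[OF v, symmetric]) (use D in auto)
  qed
  also have "\<dots> = Sum_any (\<lambda>j::nat. scl (gam F G $ j) (M2 F G (m - int j) (n + int j) v))"
  proof (rule Sum_any.expand_superset[symmetric], simp, rule subsetI)
    fix j assume "j \<in> {j. scl (gam F G $ j) (M2 F G (m - int j) (n + int j) v) \<noteq> 0}"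
    then have "M2 F G (m - int j) (n + int j) v \<noteq> 0" by auto
    then have "n + int j \<le> L" using M2_eq_0[OF v] by force
    then show "j \<in> {..J}" using D by auto
  qed
  also have "\<dots> = Sum_any (\<lambda>j. scl (zcoeff (gam F G) j) (M2 F G (m - j) (n + j) v))"
    by (subst Sum_any_nat_int[symmetric]) (auto simp: zcoeff_def)
  finally show ?thesis .
qed

text \<open>Creation parts commute among themselves, and so do annihilation parts; therefore the
  exponential of a sum is a convolution, in which the mode \<open>r\<close> is distributed over the
  two factors in all ways.\<close>

lemma MM_lf_add:
  assumes v: "v \<in> VV p L"
  shows "MM (F \<oplus>\<^sub>l G) r v = Sum_any (\<lambda>m. M2 F G m (r - m) v)"
proof -
  define D where "D = 2 * \<bar>L\<bar> + \<bar>r\<bar>"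
  have D: "0 \<le> D" "L \<le> D" "L - r \<le> D" "2 * L - r \<le> D" "2 * L \<le> D" "r \<le> D" "r - L \<le> D" "2 * \<bar>L\<bar> \<le> D"
    by (auto simp: D_def)
  let ?I = "{-D..D}"
  let ?t = "\<lambda>d i a. app (cc F i * cc G (d - r - i) * aa F a * aa G (d - a)) v"
  let ?u = "\<lambda>m d d'. app (cc F (d - m) * cc G (d' - (r - m)) * aa F d * aa G d') v"
  let ?S = "{0..L} \<times> {0..D} \<times> {0..D}" and ?T = "?I \<times> ?I \<times> ?I"
  have "MM (F \<oplus>\<^sub>l G) r v = (\<Sum>d\<in>{0..L}. app (cc (F \<oplus>\<^sub>l G) (d - r) * aa (F \<oplus>\<^sub>l G) d) v)"
    by (rule MM_sum[OF v]) auto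
  also have "\<dots> = (\<Sum>d\<in>{0..L}. \<Sum>i\<in>{0..D}. \<Sum>a\<in>{0..D}. ?t d i a)"
  proof (intro sum.cong refl)
    fix d assume "d \<in> {0..L}"
    then have "d - r \<le> D" "d \<le> D" using D by auto
    from cc_lf_add[OF this(1) D(1)] aa_lf_add[OF this(2) D(1)]
    show "app (cc (F \<oplus>\<^sub>l G) (d - r) * aa (F \<oplus>\<^sub>l G) d) v = (\<Sum>i\<in>{0..D}. \<Sum>a\<in>{0..D}. ?t d i a)"
      by (simp add: sum_product app_sum mult.assoc)
  qed
  also have "\<dots> = (\<Sum>(d, i, a)\<in>?S. ?t d i a)"
    by (simp add: sum.cartesian_product)
  also have "\<dots> = (\<Sum>(m, d, d')\<in>?T. ?u m d d')"
  proof (rule sum.reindex_bij_witness_not_neutral[where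
        S' = "{x \<in> ?S. (case x of (d, i, a) \<Rightarrow> ?t d i a) = 0}" and
        T' = "{x \<in> ?T. (case x of (m, d, d') \<Rightarrow> ?u m d d') = 0}" and
        j = "\<lambda>(d, i, a). (a - i, a, d - a)" and i = "\<lambda>(m, d, d'). (d + d', d - m, d)"])
    {
      fix x assume x: "x \<in> ?S - {x \<in> ?S. (case x of (d, i, a) \<Rightarrow> ?t d i a) = 0}"
      obtain d i a where [simp]: "x = (d, i, a)" by (cases x)
      have t: "?t d i a \<noteq> 0" using x by auto
      from M2_nz[OF t v] have "0 \<le> i" "0 \<le> d - r - i" "0 \<le> a" "0 \<le> d - a" "a + (d - a) \<le> L" by auto
      then show "(case x of (d, i, a) \<Rightarrow> (a - i, a, d - a)) \<in> ?T - {x \<in> ?T. (case x of (m, d, d') \<Rightarrow> ?u m d d') = 0}"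
        using x D t by (auto simp: algebra_simps)
    }
    {
      fix x assume x: "x \<in> ?T - {x \<in> ?T. (case x of (m, d, d') \<Rightarrow> ?u m d d') = 0}"
      obtain m d d' where [simp]: "x = (m, d, d')" by (cases x)
      have t: "?u m d d' \<noteq> 0" using x by auto
      from M2_nz[OF t v] have "0 \<le> d - m" "0 \<le> d' - (r - m)" "0 \<le> d" "0 \<le> d'" "d + d' \<le> L" by auto
      then show "(case x of (m, d, d') \<Rightarrow> (d + d', d - m, d)) \<in> ?S - {x \<in> ?S. (case x of (d, i, a) \<Rightarrow> ?t d i a) = 0}"
        using x D t by (auto simp: algebra_simps)
    }
  qed (auto simp: algebra_simps)
  also have "\<dots> = (\<Sum>m\<in>?I. \<Sum>(d, d')\<in>?I \<times> ?I. ?u m d d')"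
    by (simp add: sum.cartesian_product[symmetric])
  also have "\<dots> = (\<Sum>m\<in>?I. M2 F G m (r - m) v)"
  proof (intro sum.cong refl)
    fix m
    show "(\<Sum>(d, d')\<in>?I \<times> ?I. ?u m d d') = M2 F G m (r - m) v"
      by (rule M2_sum[OF v, symmetric]) (use D in auto)
  qed
  also have "\<dots> = Sum_any (\<lambda>m. M2 F G m (r - m) v)"
  proof (rule Sum_any.expand_superset[symmetric], simp, rule subsetI)
    fix m assume "m \<in> {m. M2 F G m (r - m) v \<noteq> 0}"
    then have "\<not> (L < m \<or> L < r - m)" using M2_eq_0[OF v] by auto
    then show "m \<in> ?I" using D by auto
  qed
  finally show ?thesis .
qed

lemma M2_scale: "M2 (lf_scale h u F) G m n v = scl (qpow h (- (u * of_int m))) (M2 F G m n v)"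
proof -
  have "cc (lf_scale h u F) (d - m) * cc G (d' - n) * aa (lf_scale h u F) d * aa G d' =
      scal (qpow h (- (u * of_int m))) * (cc F (d - m) * cc G (d' - n) * aa F d * aa G d')" for d d'
  proof -
    have "qpow h (- (u * of_int m)) = qpow h (u * of_int (d - m)) * qpow h (- (u * of_int d))"
      by (simp add: qpow_add[symmetric] algebra_simps)
    moreover have "(scal x * A) * B * (scal y * C) * E = scal (x * y) * (A * B * C * E)" for x y A B C E
    proof -
      have "A * B * (scal y * C) * E = scal y * (A * B * C * E)"
        using scal_commute[of "A * B" y] by (simp only: mult.assoc[symmetric])
      then show ?thesis by (simp only: scal_mult mult.assoc)
    qed
    ultimately show ?thesis
      unfolding aa_scale cc_scale by simp
  qed
  then have *: "M2 (lf_scale h u F) G m n v = Sum_any (\<lambda>x. scl (qpow h (- (u * of_int m)))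
      (case x of (d, d') \<Rightarrow> app (cc F (d - m) * cc G (d' - n) * aa F d * aa G d') v))"
    unfolding M2_def by (intro Sum_any.cong) (simp add: app_times app_scal split: prod.split)
  have nz: "qpow h (- (u * of_int m)) \<noteq> 0" by (simp add: qpow_def)
  have "scl c x = 0 \<longleftrightarrow> x = 0" if "c \<noteq> 0" for c x
  proof
    assume "scl c x = 0"
    then have "scl (1 / c) (scl c x) = 0" by simp
    then show "x = 0" using that by (simp add: scl_scl)
  qed simp
  then show ?thesis
    unfolding * unfolding M2_def Sum_any.expand_set using nz by (simp add: scl_sum)
qed

lemma EQ_MM: "v \<in> VV p L \<Longrightarrow> app (EQ u) (MM F r v) = MM F r (app (EQ u) v)"
proof -
  assume v: "v \<in> VV p L"
  have "EQ u * (cc F (d - r) * aa F d) = cc F (d - r) * aa F d * EQ u" for d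
    by (metis EQ_aa EQ_cc mult.assoc)
  then have "app (EQ u) (app (cc F (d - r) * aa F d) v) = app (cc F (d - r) * aa F d) (app (EQ u) v)" for d
    by (metis app_times)
  moreover have "app (EQ u) v \<in> VV (shift u p) L" using v by (simp add: app_EQ VV_expQ)
  ultimately show ?thesis
    by (simp add: MM_sum[OF v, of "{0..L}"] MM_sum[of _ _ L "{0..L}"] app_sum_arg)
qed

lemma MM_scl:
  assumes v: "v \<in> VV p L"
  shows "MM F r (scl c v) = scl c (MM F r v)"
  by (simp add: MM_sum[OF v, of "{0..L}"] MM_sum[OF VV_scl[OF v], of "{0..L}"] scl_sum app_scl)

end

section \<open>Two-point calculus\<close>

lemma linext_cong: "(\<And>b. b \<in> Poly_Mapping.keys v \<Longrightarrow> f b = g b) \<Longrightarrow> linext f v = linext g v"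
  by (simp add: linext_def cong: sum.cong)

lemma linext_const_single: "linext (\<lambda>b. Poly_Mapping.single b c) v = scl c v"
  by (rule linear_eqI[where F = "linext (\<lambda>b. Poly_Mapping.single b c)" and G = "scl c"])
    (simp_all add: linext_add linext_scl scl_add scl_scl mult.commute)

lemma scl_eq_0_iff [simp]: "scl c v = 0 \<longleftrightarrow> c = 0 \<or> v = 0"
proof
  assume *: "scl c v = 0"
  have "v = 0" if "c \<noteq> 0"
  proof -
    have "scl (1 / c) (scl c v) = 0" using * by simp
    then show ?thesis using that by (simp add: scl_scl)
  qed
  then show "c = 0 \<or> v = 0" by blast
qed auto

lemma Sum_any_scl: "Sum_any (\<lambda>x. scl c (f x)) = scl c (Sum_any f)"
  by (cases "c = 0") (simp_all add: Sum_any.expand_set scl_sum)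

lemma Sum_any_shift_int: "Sum_any (\<lambda>n::int. f (n + c)) = Sum_any f"
  by (rule Sum_any.reindex_cong[of "\<lambda>n. n + c", symmetric])
    (auto intro!: bij_betwI[of _ _ _ "\<lambda>n. n - c"])

lemma Sum_any_uminus_int: "Sum_any (\<lambda>n::int. f (- n)) = Sum_any f"
  by (rule Sum_any.reindex_cong[of uminus, symmetric]) (auto intro!: bij_betwI[of _ _ _ uminus])

text \<open>Exponent of z contributed by the zero modes of \<open>F\<close> on charge
  \<open>p\<close>; \<open>clq\<close> is the exponent of q. The increments \<open>lam\<close> and
  \<open>kq\<close> of the two arise when \<open>G\<close> has shifted the charge before, and give
  the powers of z and q in front of a contraction.\<close>

definition zeta :: "lform \<Rightarrow> charge \<Rightarrow> complex" where
  "zeta F p = (\<Sum>i\<in>bosons. clogz F i * p i)"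

definition clq :: "lform \<Rightarrow> charge \<Rightarrow> complex" where
  "clq F p = (\<Sum>i\<in>bosons. clogq F i * p i)"

definition lam :: "lform \<Rightarrow> lform \<Rightarrow> complex" where
  "lam F G = (\<Sum>i\<in>bosons. clogz F i * (Qsign i * cQ G i))"

definition kq :: "lform \<Rightarrow> lform \<Rightarrow> complex" where
  "kq F G = (\<Sum>i\<in>bosons. clogq F i * (Qsign i * cQ G i))"

lemma zeta_shift: "zeta F (shift (cQ G) p) = zeta F p + lam F G"
  and clq_shift: "clq F (shift (cQ G) p) = clq F p + kq F G"
  by (simp_all add: zeta_def clq_def lam_def kq_def shift_def algebra_simps)

lemma zeta_lf_add: "zeta (F \<oplus>\<^sub>l G) p = zeta F p + zeta G p"
  and clq_lf_add: "clq (F \<oplus>\<^sub>l G) p = clq F p + clq G p"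
  and lam_lf_add_left: "lam (F \<oplus>\<^sub>l G) H = lam F H + lam G H"
  and kq_lf_add_left: "kq (F \<oplus>\<^sub>l G) H = kq F H + kq G H"
  and kq_lf_add_right: "kq H (F \<oplus>\<^sub>l G) = kq H F + kq H G"
  by (simp_all add: zeta_def clq_def lam_def kq_def lf_add_def algebra_simps)

lemma zeta_scale: "zeta (lf_scale h u F) p = zeta F p"
  and clq_scale: "clq (lf_scale h u F) p = clq F p + u * zeta F p"
  and lam_scale_left: "lam (lf_scale h u F) G = lam F G"
  and kq_scale_left: "kq (lf_scale h u F) G = kq F G + u * lam F G"
  by (simp_all add: zeta_def clq_def lam_def kq_def lf_scale_def algebra_simps)

lemma Ints_Re_floor: "x \<in> \<int> \<Longrightarrow> x = of_int \<lfloor>Re x\<rfloor>"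
  by (auto elim: Ints_cases)

lemma VV_zero_mode:
  assumes "v \<in> VV p L"
  shows "zero_mode_part h F s v = (if s = - zeta F p then scl (qpow h (clq F p)) v else 0)"
proof -
  have e: "zeta F p = - s \<longleftrightarrow> s = - zeta F p" by (metis minus_minus)
  have "zero_mode_part h F s v = linext (\<lambda>b. if s = - zeta F p then Poly_Mapping.single b (qpow h (clq F p)) else 0) v"
    unfolding zero_mode_part_def
  proof (rule linext_cong)
    fix b assume b: "b \<in> Poly_Mapping.keys v"
    obtain p' N where pN: "b = (p', N)" by (cases b)
    then have "p' = p" using b assms by (auto simp: VV_def)
    then show "(case b of (p, N) \<Rightarrow> if (\<Sum>i\<in>bosons. clogz F i * p i) = - s
        then Poly_Mapping.single (p, N) (qpow h (\<Sum>i\<in>bosons. clogq F i * p i)) else 0) =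
      (if s = - zeta F p then Poly_Mapping.single b (qpow h (clq F p)) else 0)"
      by (simp add: pN zeta_def[symmetric] clq_def[symmetric] e del: sum.insert)
  qed
  then show ?thesis by (simp add: linext_const_single) (simp add: linext_def)
qed

context fock_rep
begin

lemma VV_annihilation_part:
  assumes v: "v \<in> VV p L"
  shows "annihilation_part h k F \<tau> v \<in> VV p (max L 0)"
proof (cases "\<tau> \<in> \<nat>")
    case True
    then have "0 \<le> \<lfloor>Re \<tau>\<rfloor>" by (elim Nats_cases) auto
    then have "L - \<lfloor>Re \<tau>\<rfloor> \<le> max L 0" by linarith
    then show ?thesis using True VV_mono[OF VV_aa[OF v, of F "\<lfloor>Re \<tau>\<rfloor>"], of "max L 0"]
      by (auto simp: annihilation_part_eq)
qed (simp add: annihilation_part_eq)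

lemma cmult_zero_mode_annihilation:
  assumes v: "v \<in> VV p L"
  shows "zero_mode_part h F t (annihilation_part h k F (\<tau> - t) v) =
      (if t = - zeta F p then scl (qpow h (clq F p)) (annihilation_part h k F (\<tau> + zeta F p) v) else 0)"
    and "cmult (zero_mode_part h F) (annihilation_part h k F) \<tau> v =
      scl (qpow h (clq F p)) (annihilation_part h k F (\<tau> + zeta F p) v)"
proof -
  show *: "zero_mode_part h F t (annihilation_part h k F (\<tau> - t) v) =
      (if t = - zeta F p then scl (qpow h (clq F p)) (annihilation_part h k F (\<tau> + zeta F p) v) else 0)" for t
    using VV_zero_mode[OF VV_annihilation_part[OF v]] by auto
  show "cmult (zero_mode_part h F) (annihilation_part h k F) \<tau> v =
      scl (qpow h (clq F p)) (annihilation_part h k F (\<tau> + zeta F p) v)"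
    unfolding cmult_def * by simp
qed

lemma creation_annihilation_support:
  assumes v: "v \<in> VV p L" and "creation_part h k F t (annihilation_part h k F (s - t) v) \<noteq> 0"
  shows "\<exists>d. 0 \<le> d \<and> d \<le> L \<and> t = s - of_int d \<and> s \<in> \<int>"
proof -
  let ?A = "annihilation_part h k F" and ?C = "creation_part h k F"
  have n: "- t \<in> \<nat>" using assms(2) by (auto simp: creation_part_eq split: if_splits)
  have "?A (s - t) v \<noteq> 0" using assms(2) by (metis creation_part_eq app_zero)
  then have d: "s - t \<in> \<nat>" "app (aa F \<lfloor>Re (s - t)\<rfloor>) v \<noteq> 0"
    by (auto simp: annihilation_part_eq split: if_splits)
  from aa_nz[OF d(2) v] have "0 \<le> \<lfloor>Re (s - t)\<rfloor>" "\<lfloor>Re (s - t)\<rfloor> \<le> L" by auto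
  moreover
  have ints: "s - t \<in> \<int>" "- t \<in> \<int>" using d(1) n Nats_subset_Ints by blast+
  define dd where "dd = \<lfloor>Re (s - t)\<rfloor>"
  have "s - t = of_int dd" unfolding dd_def by (rule Ints_Re_floor[OF ints(1)])
  then have "t = s - of_int dd" by (simp add: eq_diff_eq diff_eq_eq add.commute)
  moreover have "s \<in> \<int>" using Ints_diff[OF ints] by simp
  ultimately show ?thesis unfolding dd_def[symmetric] by blast
qed

text \<open>On a fixed charge the zero modes yield a single monomial in z, so the triple formal
  product collapses to a sum over one integer, the annihilation degree. All nonzero modes have an
  index in one coset of the integers.\<close>

lemma nexp_eq:
  assumes v: "v \<in> VV p L"
  shows "nexp h k F s v = (if s + zeta F p \<in> \<int> then
    scl (qpow h (clq F p)) (app (EQ (cQ F)) (MM F \<lfloor>Re (s + zeta F p)\<rfloor> v)) else 0)"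
proof -
  let ?A = "annihilation_part h k F" and ?C = "creation_part h k F" and ?Z = "zero_mode_part h F"
  define \<zeta> where "\<zeta> = zeta F p"
  define c where "c = qpow h (clq F p)"
  define f where "f t = ?C t (?A (s + \<zeta> - t) v)" for t
  have "?C t (scl c w) = scl c (?C t w)" for t w
    by (simp add: creation_part_eq app_scl)
  then have "cmult ?C (cmult ?Z ?A) s v = Sum_any (\<lambda>t. scl c (f t))"
    unfolding cmult_def[of ?C] by (simp add: cmult_zero_mode_annihilation(2)[OF v] c_def[symmetric] \<zeta>_def[symmetric] f_def algebra_simps)
  then have 1: "nexp h k F s v = scl c (app (EQ (cQ F)) (Sum_any f))"
    unfolding nexp_def by (simp add: Sum_any_scl app_EQ[symmetric] app_scl)
  have fnz: "\<exists>d. 0 \<le> d \<and> d \<le> L \<and> t = s + \<zeta> - of_int d \<and> s + \<zeta> \<in> \<int>" if "f t \<noteq> 0" for t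
    using creation_annihilation_support[OF v] that unfolding f_def by blast
  show ?thesis
  proof (cases "s + \<zeta> \<in> \<int>")
    case False
    then have "f = (\<lambda>t. 0)" using fnz by blast
    then have "Sum_any f = 0" by simp
    then show ?thesis using 1 False by (simp add: \<zeta>_def)
  next
    case True
    define r where "r = \<lfloor>Re (s + \<zeta>)\<rfloor>"
    have r: "s + \<zeta> = of_int r" unfolding r_def by (rule Ints_Re_floor[OF True])
    have "Sum_any f = (\<Sum>t\<in>(\<lambda>d. s + \<zeta> - of_int d) ` {0..L}. f t)"
    proof (rule Sum_any.expand_superset)
      show "{t. f t \<noteq> 0} \<subseteq> (\<lambda>d. s + \<zeta> - of_int d) ` {0..L}"
        using fnz by fastforce
    qed simp
    also have "\<dots> = (\<Sum>d\<in>{0..L}. f (s + \<zeta> - of_int d))"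
      by (subst sum.reindex) (auto simp: inj_on_def)
    also have "\<dots> = (\<Sum>d\<in>{0..L}. app (cc F (d - r) * aa F d) v)"
    proof (intro sum.cong refl)
      fix d assume d: "d \<in> {0..L}"
      have a: "?A (of_int d) v = app (aa F d) v"
        using d by (auto simp: annihilation_part_eq) (metis nat_0_le of_int_of_nat_eq of_nat_in_Nats)
      have "- (of_int r - of_int d :: complex) \<in> \<nat> \<longleftrightarrow> 0 \<le> d - r"
      proof
        assume "- (of_int r - of_int d :: complex) \<in> \<nat>"
        then obtain n where "- (of_int r - of_int d :: complex) = of_nat n" by (elim Nats_cases)
        then have "of_int (d - r) = (of_int (int n) :: complex)" by simp
        then have "d - r = int n" by (simp only: of_int_eq_iff)
        then show "0 \<le> d - r" by simp
      next
        assume "0 \<le> d - r"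
        then have "- (of_int r - of_int d :: complex) = of_nat (nat (d - r))" by simp
        then show "- (of_int r - of_int d :: complex) \<in> \<nat>" by (metis of_nat_in_Nats)
      qed
      then show "f (s + \<zeta> - of_int d) = app (cc F (d - r) * aa F d) v"
        unfolding f_def by (simp add: a r creation_part_eq app_times) (simp add: cc_def app_0)
    qed
    also have "\<dots> = MM F r v" by (rule MM_sum[OF v, symmetric]) auto
    finally show ?thesis using 1 True by (simp add: \<zeta>_def c_def r_def)
  qed
qed

lemma VV_nexp:
  assumes "v \<in> VV p L"
  shows "\<exists>L'. nexp h k F s v \<in> VV (shift (cQ F) p) L'"
  using assms by (auto simp: nexp_eq app_EQ intro!: exI[of _ "L - \<lfloor>Re (s + zeta F p)\<rfloor>"] VV_scl VV_expQ VV_MM)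

text \<open>The coefficient of \<open>z\<^sup>-\<^sup>s w\<^sup>-\<^sup>t\<close> in \<open>:exp F(z) exp G(w):\<close> on vectors of charge \<open>p\<close>.\<close>

definition N2 :: "charge \<Rightarrow> lform \<Rightarrow> lform \<Rightarrow> complex \<Rightarrow> complex \<Rightarrow> fock \<Rightarrow> fock" where
  "N2 p F G s t v = (if s + zeta F p \<in> \<int> \<and> t + zeta G p \<in> \<int> then
     scl (qpow h (clq F p + clq G p)) (app (EQ (\<lambda>i. cQ F i + cQ G i))
       (M2 F G \<lfloor>Re (s + zeta F p)\<rfloor> \<lfloor>Re (t + zeta G p)\<rfloor> v)) else 0)"

text \<open>The coefficient of \<open>z\<^sup>-\<^sup>s w\<^sup>-\<^sup>t\<close> in \<open>g(w/z) :exp F(z) exp G(w):\<close> for a bilateral series \<open>g\<close>.\<close>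

definition BB :: "charge \<Rightarrow> lform \<Rightarrow> lform \<Rightarrow> (int \<Rightarrow> complex) \<Rightarrow> complex \<Rightarrow> complex \<Rightarrow> fock \<Rightarrow> fock" where
  "BB p F G g s t v = Sum_any (\<lambda>n. scl (g n) (N2 p F G (s - of_int n) (t + of_int n) v))"

lemma N2_swap: "N2 p F G s t v = N2 p G F t s v"
  by (simp add: N2_def M2_swap[of F] add.commute conj_commute)

lemma N2_nz:
  assumes "N2 p F G s t v \<noteq> 0" "v \<in> VV p L"
  obtains m n where "s + zeta F p = of_int m" "t + zeta G p = of_int n" "m \<le> L" "n \<le> L"
proof -
  have i: "s + zeta F p \<in> \<int>" "t + zeta G p \<in> \<int>" using assms by (auto simp: N2_def split: if_splits)
  have "M2 F G \<lfloor>Re (s + zeta F p)\<rfloor> \<lfloor>Re (t + zeta G p)\<rfloor> v \<noteq> 0"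
    using assms i by (auto simp: N2_def)
  then have "\<lfloor>Re (s + zeta F p)\<rfloor> \<le> L" "\<lfloor>Re (t + zeta G p)\<rfloor> \<le> L"
    using M2_eq_0[OF assms(2), of "\<lfloor>Re (s + zeta F p)\<rfloor>" "\<lfloor>Re (t + zeta G p)\<rfloor>" F G] by force+
  with that Ints_Re_floor[OF i(1)] Ints_Re_floor[OF i(2)] show ?thesis by blast
qed

lemma finite_N2:
  assumes v: "v \<in> VV p L"
  shows "finite {n::int. N2 p F G (s - of_int n) (t + of_int n) v \<noteq> 0}"
proof (rule finite_subset)
  show "{n::int. N2 p F G (s - of_int n) (t + of_int n) v \<noteq> 0} \<subseteq>
      {\<lfloor>Re (s + zeta F p)\<rfloor> - L .. \<lceil>of_int L - Re (t + zeta G p)\<rceil>}"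
  proof
    fix n assume "n \<in> {n::int. N2 p F G (s - of_int n) (t + of_int n) v \<noteq> 0}"
    then have nz: "N2 p F G (s - of_int n) (t + of_int n) v \<noteq> 0" by simp
    obtain a b where ab: "s - of_int n + zeta F p = of_int a" "t + of_int n + zeta G p = of_int b" "a \<le> L" "b \<le> L"
      by (rule N2_nz[OF nz v])
    have "s + zeta F p = of_int (a + n)" "t + zeta G p = of_int (b - n)"
      unfolding of_int_add of_int_diff ab(1,2)[symmetric] by simp_all
    then show "n \<in> {\<lfloor>Re (s + zeta F p)\<rfloor> - L .. \<lceil>of_int L - Re (t + zeta G p)\<rceil>}"
      using ab(3,4) by (simp add: le_ceiling_iff)
  qed
qed simp

lemma finite_N2_complex:
  assumes v: "v \<in> VV p L"
  shows "finite {t. N2 p F G t (S - t) v \<noteq> 0}"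
proof (rule finite_subset)
  show "{t. N2 p F G t (S - t) v \<noteq> 0} \<subseteq>
    (\<lambda>n. - zeta F p - of_int n) ` {n::int. N2 p F G (- zeta F p - of_int n) (S + zeta F p + of_int n) v \<noteq> 0}"
  proof
    fix t assume "t \<in> {t. N2 p F G t (S - t) v \<noteq> 0}"
    then have t: "N2 p F G t (S - t) v \<noteq> 0" by simp
    obtain m where m: "t + zeta F p = of_int m" using N2_nz[OF t v] by metis
    then have "t = - zeta F p - of_int (- m)" by (simp flip: m)
    with t show "t \<in> (\<lambda>n. - zeta F p - of_int n) ` {n::int. N2 p F G (- zeta F p - of_int n) (S + zeta F p + of_int n) v \<noteq> 0}"
      by (intro image_eqI[of _ _ "- m"]) (auto simp: algebra_simps)
  qed
  show "finite ((\<lambda>n. - zeta F p - of_int n) ` {n::int. N2 p F G (- zeta F p - of_int n) (S + zeta F p + of_int n) v \<noteq> 0})"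
    by (rule finite_imageI, rule finite_N2[OF v])
qed

lemma finite_BB:
  assumes v: "v \<in> VV p L"
  shows "finite {n. scl (g n) (N2 p F G (s - of_int n) (t + of_int n) v) \<noteq> 0}"
  by (rule finite_subset[OF _ finite_N2[OF v, of F G s t]]) auto

lemma finite_M2:
  assumes v: "v \<in> VV p L"
  shows "finite {j. M2 F G (m - j) (n + j) v \<noteq> 0}"
proof (rule finite_subset[of _ "{m - L..L - n}"], rule subsetI)
  fix j assume "j \<in> {j. M2 F G (m - j) (n + j) v \<noteq> 0}"
  then have "\<not> (L < m - j \<or> L < n + j)" using M2_eq_0[OF v] by blast
  then show "j \<in> {m - L..L - n}" by auto
qed simp

lemma BB_add:
  assumes v: "v \<in> VV p L"
  shows "BB p F G (\<lambda>n. g n + g' n) s t v = BB p F G g s t v + BB p F G g' s t v"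
  unfolding BB_def scl_add_left by (rule Sum_any.distrib) (rule finite_BB[OF v])+

lemma BB_scl: "BB p F G (\<lambda>n. c * g n) s t v = scl c (BB p F G g s t v)"
  by (simp add: BB_def scl_scl[symmetric] Sum_any_scl)

lemma BB_zero [simp]: "BB p F G (\<lambda>n. 0) s t v = 0"
  by (simp add: BB_def)

text \<open>An integral shift of the exponents is absorbed into the coefficient sequence. This
  brings the two orders of a product with \<open>lam\<close> equal to 1 or -1 to the same pair of
  exponents, where their sequences can be added.\<close>

lemma BB_shift: "BB p F G g (s + of_int c) t v = BB p F G (\<lambda>n. g (n + c)) s (t + of_int c) v"
  unfolding BB_def by (subst Sum_any_shift_int[of _ c, symmetric]) (simp add: algebra_simps)

lemma BB_swap: "BB p F G g s t v = BB p G F (\<lambda>n. g (- n)) t s v"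
  unfolding BB_def by (subst Sum_any_uminus_int[symmetric]) (simp add: N2_swap[of p F])

text \<open>The right factor is evaluated on charge \<open>p\<close> and the left one on the charge
  shifted by \<open>G\<close>, whence the shift by \<open>lam\<close> and the factor with
  \<open>kq\<close>; the oscillators contribute the contraction through
  \<open>MM_MM\<close>.\<close>

lemma nexp_nexp:
  assumes v: "v \<in> VV p L"
  shows "nexp h k F s (nexp h k G t v) =
    BB p F G (\<lambda>n. qpow h (kq F G) * zcoeff (gam F G) n) (s + lam F G) t v"
proof (cases "s + lam F G + zeta F p \<in> \<int> \<and> t + zeta G p \<in> \<int>")
  case True
  define m where "m = \<lfloor>Re (s + lam F G + zeta F p)\<rfloor>"
  define n where "n = \<lfloor>Re (t + zeta G p)\<rfloor>"
  have m: "s + lam F G + zeta F p = of_int m" and n: "t + zeta G p = of_int n"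
    unfolding m_def n_def using True by (blast intro: Ints_Re_floor)+
  let ?w = "MM G n v"
  have w: "?w \<in> VV p (L - n)" by (rule VV_MM[OF v])
  have "nexp h k G t v = scl (qpow h (clq G p)) (app (EQ (cQ G)) ?w)"
    using True by (simp add: nexp_eq[OF v] n_def)
  moreover have w': "scl (qpow h (clq G p)) (app (EQ (cQ G)) ?w) \<in> VV (shift (cQ G) p) (L - n)"
    by (intro VV_scl) (simp add: app_EQ VV_expQ w)
  ultimately have "nexp h k F s (nexp h k G t v) = scl (qpow h (clq F p + kq F G))
      (app (EQ (cQ F)) (MM F m (scl (qpow h (clq G p)) (app (EQ (cQ G)) ?w))))"
    using True by (simp add: nexp_eq[OF w'] zeta_shift clq_shift m_def add.assoc add.commute[of "lam F G"])
  also have "\<dots> = scl (qpow h (clq F p + kq F G) * qpow h (clq G p))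
      (app (EQ (cQ F)) (app (EQ (cQ G)) (MM F m ?w)))"
    by (simp add: MM_scl[OF VV_expQ[OF w], folded app_EQ] EQ_MM[OF w] app_scl scl_scl)
  also have "\<dots> = scl (qpow h (clq F p + kq F G) * qpow h (clq G p))
      (app (EQ (\<lambda>i. cQ F i + cQ G i)) (Sum_any (\<lambda>j. scl (zcoeff (gam F G) j) (M2 F G (m - j) (n + j) v))))"
    by (simp add: app_times[symmetric] EQ_mult MM_MM[OF v])
  also have "\<dots> = BB p F G (\<lambda>n. qpow h (kq F G) * zcoeff (gam F G) n) (s + lam F G) t v"
  proof -
    let ?g = "zcoeff (gam F G)"
    have fin: "finite {j. scl (?g j) (M2 F G (m - j) (n + j) v) \<noteq> 0}"
      by (rule finite_subset[OF _ finite_M2[OF v, of F G m n]]) auto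
    have i: "of_int (m - j) = s + lam F G - of_int j + zeta F p" "of_int (n + j) = t + of_int j + zeta G p" for j
      unfolding of_int_add of_int_diff m[symmetric] n[symmetric] by simp_all
    have N: "N2 p F G (s + lam F G - of_int j) (t + of_int j) v =
      scl (qpow h (clq F p + clq G p)) (app (EQ (\<lambda>i. cQ F i + cQ G i)) (M2 F G (m - j) (n + j) v))" for j
      unfolding N2_def i[symmetric] by simp
    have app_Sum: "app f (Sum_any (\<lambda>j. scl (?g j) (M2 F G (m - j) (n + j) v))) =
        Sum_any (\<lambda>j. scl (?g j) (app f (M2 F G (m - j) (n + j) v)))" for f
    proof -
      have "app f (Sum_any (\<lambda>j. scl (?g j) (M2 F G (m - j) (n + j) v))) =
        (\<Sum>j\<in>{j. scl (?g j) (M2 F G (m - j) (n + j) v) \<noteq> 0}. scl (?g j) (app f (M2 F G (m - j) (n + j) v)))"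
        by (simp add: Sum_any.expand_set app_sum_arg app_scl)
      also have "\<dots> = Sum_any (\<lambda>j. scl (?g j) (app f (M2 F G (m - j) (n + j) v)))"
        by (rule Sum_any.expand_superset[OF fin, symmetric]) auto
      finally show ?thesis .
    qed
    show ?thesis
      unfolding BB_def N app_Sum
      by (simp add: Sum_any_scl[symmetric] scl_scl qpow_add mult_ac)
  qed
  finally show ?thesis .
next
  case False
  have "nexp h k F s (nexp h k G t v) = 0"
  proof (cases "t + zeta G p \<in> \<int>")
    case True
    then have nf: "s + lam F G + zeta F p \<notin> \<int>" using False by blast
    obtain L' where "nexp h k G t v \<in> VV (shift (cQ G) p) L'" using VV_nexp[OF v] by blast
    then show ?thesis using nf by (simp add: nexp_eq zeta_shift add.assoc add.commute[of "lam F G"])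
  next
    case ni: False
    have "(0 :: fock) \<in> VV p 0" by simp
    then show ?thesis using ni by (simp add: nexp_eq[OF v] nexp_eq[of 0 p 0] MM_def)
  qed
  moreover have "N2 p F G (s + lam F G - of_int n) (t + of_int n) v = 0" for n
  proof -
    have "s + lam F G - of_int n + zeta F p \<in> \<int> \<longleftrightarrow> s + lam F G + zeta F p \<in> \<int>"
      by (metis Ints_of_int Ints_add Ints_diff add_diff_eq diff_add_cancel diff_add_eq)
    moreover have "t + of_int n + zeta G p \<in> \<int> \<longleftrightarrow> t + zeta G p \<in> \<int>"
      by (metis Ints_of_int Ints_add Ints_diff add.assoc add.commute add_diff_cancel_left')
    ultimately show ?thesis using False by (auto simp: N2_def)
  qed
  ultimately show ?thesis by (simp add: BB_def)
qed

lemma nexp_nexp_reverse: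
  assumes v: "v \<in> VV p L"
  shows "nexp h k G t (nexp h k F s v) =
    BB p F G (\<lambda>n. qpow h (kq G F) * zcoeff (gam G F) (- n)) s (t + lam G F) v"
  by (simp add: nexp_nexp[OF v] BB_swap[of p G F])

text \<open>At coinciding points one sums over all splittings of the mode. They form one coset of
  the integers, in which the hypothesis on \<open>s\<close> chooses a starting point.\<close>

lemma nexp_lf_add:
  assumes v: "v \<in> VV p L" and s: "s + zeta F p \<in> \<int>"
  shows "nexp h k (F \<oplus>\<^sub>l G) (s + t) v = Sum_any (\<lambda>n. N2 p F G (s - of_int n) (t + of_int n) v)"
proof -
  define m where "m = \<lfloor>Re (s + zeta F p)\<rfloor>"
  have m: "s + zeta F p = of_int m" unfolding m_def by (rule Ints_Re_floor[OF s])
  show ?thesis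
  proof (cases "t + zeta G p \<in> \<int>")
    case True
    define n where "n = \<lfloor>Re (t + zeta G p)\<rfloor>"
    have n: "t + zeta G p = of_int n" unfolding n_def by (rule Ints_Re_floor[OF True])
    have e: "s + t + zeta (F \<oplus>\<^sub>l G) p = of_int (m + n)"
      unfolding zeta_lf_add of_int_add m[symmetric] n[symmetric] by (simp add: algebra_simps)
    have i: "s - of_int j + zeta F p = of_int (m - j)" "t + of_int j + zeta G p = of_int (n + j)" for j
      unfolding of_int_add of_int_diff m[symmetric] n[symmetric] by simp_all
    have c: "cQ (F \<oplus>\<^sub>l G) = (\<lambda>i. cQ F i + cQ G i)" by (simp add: lf_add_def)
    have "nexp h k (F \<oplus>\<^sub>l G) (s + t) v = scl (qpow h (clq F p + clq G p))
        (app (EQ (\<lambda>i. cQ F i + cQ G i)) (Sum_any (\<lambda>j. M2 F G j (m + n - j) v)))"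
      unfolding nexp_eq[OF v] e c by (simp add: clq_lf_add MM_lf_add[OF v])
    also have "Sum_any (\<lambda>j. M2 F G j (m + n - j) v) = Sum_any (\<lambda>j. M2 F G (m - j) (n + j) v)"
      by (rule Sum_any.reindex_cong[of "\<lambda>j. m - j"])
        (auto intro!: bij_betwI[of _ _ _ "\<lambda>j. m - j"] simp: fun_eq_iff algebra_simps)
    also have "app (EQ (\<lambda>i. cQ F i + cQ G i)) (Sum_any (\<lambda>j. M2 F G (m - j) (n + j) v)) =
      Sum_any (\<lambda>j. app (EQ (\<lambda>i. cQ F i + cQ G i)) (M2 F G (m - j) (n + j) v))"
    proof -
      note fin = finite_M2[OF v, of F G m n]
      show ?thesis
        by (subst (2) Sum_any.expand_superset[OF fin]) (auto simp: Sum_any.expand_set app_sum_arg)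
    qed
    also have "scl (qpow h (clq F p + clq G p)) \<dots> = Sum_any (\<lambda>n. N2 p F G (s - of_int n) (t + of_int n) v)"
      unfolding N2_def i by (simp add: Sum_any_scl)
    finally show ?thesis .
  next
    case False
    have "t + zeta G p = s + t + zeta (F \<oplus>\<^sub>l G) p - (s + zeta F p)" by (simp add: zeta_lf_add)
    then have "s + t + zeta (F \<oplus>\<^sub>l G) p \<notin> \<int>" using False s Ints_diff by metis
    then have 1: "nexp h k (F \<oplus>\<^sub>l G) (s + t) v = 0" by (simp add: nexp_eq[OF v])
    have "t + zeta G p = t + of_int n + zeta G p - of_int n" for n by simp
    then have "t + of_int n + zeta G p \<notin> \<int>" for n using False Ints_diff Ints_of_int by metis
    then show ?thesis using 1 by (simp add: N2_def)
  qed
qed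

lemma N2_scale: "N2 p (lf_scale h u F) G s t v = scl (qpow h (- (u * s))) (N2 p F G s t v)"
proof (cases "s + zeta F p \<in> \<int> \<and> t + zeta G p \<in> \<int>")
  case True
  then have "s + zeta F p = of_int \<lfloor>Re (s + zeta F p)\<rfloor>" by (intro Ints_Re_floor) auto
  then have e: "qpow h (- (u * s)) = qpow h (u * zeta F p) * qpow h (- (u * of_int \<lfloor>Re (s + zeta F p)\<rfloor>))"
    by (metis (no_types, lifting) add_diff_cancel_right' minus_diff_eq mult_minus_right qpow_add
        right_diff_distrib uminus_add_conv_diff)
  have c: "cQ (lf_scale h u F) = cQ F" by (simp add: lf_scale_def)
  show ?thesis using True
    unfolding N2_def zeta_scale clq_scale M2_scale c e
    by (simp add: app_scl scl_scl qpow_add mult_ac del: plus_complex.sel)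
qed (auto simp: N2_def zeta_scale)

text \<open>The sequence is that of delta(q^a w/z), which sets z = q^a w; the powers of q are
  absorbed into the rescaling of \<open>F\<close> term by term.\<close>

lemma BB_geometric:
  assumes v: "v \<in> VV p L" and s: "s + zeta F p \<in> \<int>"
  shows "BB p F G (\<lambda>n. qpow h (a * of_int n)) s t v =
    scl (qpow h (a * s)) (nexp h k (lf_scale h a F \<oplus>\<^sub>l G) (s + t) v)"
proof -
  have "qpow h (a * s) * qpow h (- (a * (s - of_int n))) = qpow h (a * of_int n)" for n
    by (simp add: qpow_add[symmetric] algebra_simps)
  then show ?thesis
    using s by (simp add: nexp_lf_add[OF v] zeta_scale BB_def N2_scale Sum_any_scl[symmetric] scl_scl)
qed

lemma nexp_cong:
  assumes "cQ F = cQ G" "clogz F = clogz G" "clogq F = clogq G" "\<And>i m. m \<noteq> 0 \<Longrightarrow> cosc F i m = cosc G i m"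
  shows "nexp h k F s v = nexp h k G s v"
proof -
  have "XA F = XA G" "XC F = XC G"
    by (rule fps_ext; use assms(4) in \<open>simp add: XA_def XC_def\<close>)+
  then have "creation_part h k F = creation_part h k G" "annihilation_part h k F = annihilation_part h k G"
    by (intro ext; simp add: creation_part_eq annihilation_part_eq aa_def cc_def)+
  moreover have "zero_mode_part h F = zero_mode_part h G"
    by (intro ext) (simp only: zero_mode_part_def assms(1-3))
  ultimately show ?thesis by (simp add: nexp_def assms)
qed

text \<open>Without a contraction the product of two modes is already a mode of the normally ordered
  product, up to a power of q. So the product at one point is a finite sum on each vector.\<close>

lemma cmult_nexp:
  assumes v: "v \<in> VV p L" and l: "lam F G = 0" and g: "gam F G = 1"
  shows "cmult (nexp h k F) (nexp h k G) s v = scl (qpow h (kq F G)) (nexp h k (F \<oplus>\<^sub>l G) s v)"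
    and "finite {t. nexp h k F t (nexp h k G (s - t) v) \<noteq> 0}"
proof -
  have z: "zcoeff 1 n = (if n = 0 then 1 else 0)" for n by (auto simp: zcoeff_def)
  have e: "nexp h k F t (nexp h k G (s - t) v) = scl (qpow h (kq F G)) (N2 p F G t (s - t) v)" for t
  proof -
    have "nexp h k F t (nexp h k G (s - t) v) = Sum_any (\<lambda>n::int. if n = 0 then scl (qpow h (kq F G)) (N2 p F G t (s - t) v) else 0)"
      unfolding nexp_nexp[OF v] l g z BB_def by (rule arg_cong[of _ _ Sum_any]) auto
    then show ?thesis by simp
  qed
  show "finite {t. nexp h k F t (nexp h k G (s - t) v) \<noteq> 0}"
    unfolding e by (rule finite_subset[OF _ finite_N2_complex[OF v, of F G s]]) auto
  let ?\<zeta> = "zeta F p"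
  have "cmult (nexp h k F) (nexp h k G) s v = scl (qpow h (kq F G)) (Sum_any (\<lambda>t. N2 p F G t (s - t) v))"
    by (simp add: cmult_def e Sum_any_scl)
  also have "Sum_any (\<lambda>t. N2 p F G t (s - t) v) = Sum_any (\<lambda>n::int. N2 p F G (- ?\<zeta> - of_int n) (s + ?\<zeta> + of_int n) v)"
  proof -
    let ?f = "\<lambda>t. N2 p F G t (s - t) v" and ?r = "\<lambda>n::int. - ?\<zeta> - of_int n"
    have "{t. ?f t \<noteq> 0} = ?r ` {n. ?f (?r n) \<noteq> 0}"
    proof (intro subset_antisym subsetI)
      fix t assume "t \<in> {t. ?f t \<noteq> 0}"
      then have t: "?f t \<noteq> 0" by simp
      obtain m where m: "t + zeta F p = of_int m" using N2_nz[OF t v] by metis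
      then have "t = ?r (- m)" by (simp flip: m)
      with t show "t \<in> ?r ` {n. ?f (?r n) \<noteq> 0}" by (intro image_eqI[of _ _ "- m"]) auto
    qed auto
    then have "Sum_any ?f = sum ?f (?r ` {n. ?f (?r n) \<noteq> 0})" by (simp add: Sum_any.expand_set)
    also have "\<dots> = Sum_any (\<lambda>n. ?f (?r n))"
      by (subst sum.reindex) (auto simp: inj_on_def Sum_any.expand_set)
    finally show ?thesis by (simp add: algebra_simps)
  qed
  also have "\<dots> = nexp h k (F \<oplus>\<^sub>l G) (- ?\<zeta> + (s + ?\<zeta>)) v"
    by (rule nexp_lf_add[OF v, symmetric]) simp
  finally show "cmult (nexp h k F) (nexp h k G) s v = scl (qpow h (kq F G)) (nexp h k (F \<oplus>\<^sub>l G) s v)"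
    by simp
qed

end

section \<open>Contractions as rational functions\<close>

text \<open>\<open>l\<close> is x times the logarithmic derivative of \<gamma>, which turns products
  of linear factors into sums; the normalisation at 0 makes \<gamma> unique.\<close>

definition logderiv :: "complex fps \<Rightarrow> complex fps \<Rightarrow> bool" where
  "logderiv \<gamma> l \<longleftrightarrow> \<gamma> $ 0 = 1 \<and> fps_X * fps_deriv \<gamma> = l * \<gamma>"

lemma logderiv_mult: "logderiv \<gamma> l \<Longrightarrow> logderiv \<gamma>' l' \<Longrightarrow> logderiv (\<gamma> * \<gamma>') (l + l')"
proof -
  assume a: "logderiv \<gamma> l" "logderiv \<gamma>' l'"
  have "fps_X * fps_deriv (\<gamma> * \<gamma>') = (fps_X * fps_deriv \<gamma>) * \<gamma>' + (fps_X * fps_deriv \<gamma>') * \<gamma>"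
    by (simp add: algebra_simps)
  also have "\<dots> = (l + l') * (\<gamma> * \<gamma>')"
    using a by (simp add: logderiv_def algebra_simps)
  finally show ?thesis using a by (simp add: logderiv_def)
qed

lemma logderiv_inverse: "logderiv \<gamma> l \<Longrightarrow> logderiv (inverse \<gamma>) (- l)"
proof -
  assume a: "logderiv \<gamma> l"
  then have i: "\<gamma> * inverse \<gamma> = 1" by (intro inverse_mult_eq_1') (simp add: logderiv_def)
  have "fps_X * fps_deriv (inverse \<gamma>) = - (fps_X * fps_deriv \<gamma>) * inverse \<gamma> * inverse \<gamma>"
    using a by (subst fps_inverse_deriv) (auto simp: logderiv_def power2_eq_square mult.assoc)
  also have "\<dots> = - l * (\<gamma> * inverse \<gamma>) * inverse \<gamma>"
    using a by (simp add: logderiv_def algebra_simps)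
  finally show ?thesis using a i by (simp add: logderiv_def)
qed

text \<open>Since \<gamma> is 1 at the origin, \<open>l\<close> has no constant term; dividing by x
  leaves a linear differential equation.\<close>

lemma logderiv_unique:
  assumes "logderiv \<gamma> l" "logderiv \<gamma>' l"
  shows "\<gamma> = \<gamma>'"
proof -
  have "(l * \<gamma>) $ 0 = 0"
    using assms(1) by (metis fps_X_mult_nth logderiv_def)
  then have "l $ 0 = 0" using assms(1) by (simp add: logderiv_def)
  then have l_eq: "l = fps_X * fps_shift 1 l"
    by (intro fps_ext) auto
  have "fps_deriv \<gamma> = fps_shift 1 l * \<gamma>" "fps_deriv \<gamma>' = fps_shift 1 l * \<gamma>'"
    using assms l_eq unfolding logderiv_def by (metis mult.assoc mult_left_cancel fps_X_neq_zero)+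
  then show ?thesis
    using assms by (intro fps_linear_ode_unique[of \<gamma> "fps_shift 1 l" \<gamma>'])
      (auto simp: logderiv_def simp del: of_nat_Suc)
qed

text \<open>The expansion of q^a x / (1 - q^a x), which is -x times the logarithmic derivative of 1
  - q^a x.\<close>

definition pw :: "complex \<Rightarrow> complex \<Rightarrow> complex fps" where
  "pw h a = Abs_fps (\<lambda>m. if m = 0 then 0 else qpow h (a * of_nat m))"

definition num :: "complex \<Rightarrow> complex list \<Rightarrow> complex fps" where
  "num h as = (\<Prod>a\<leftarrow>as. lin h a)"

lemma lin_0 [simp]: "lin h a $ 0 = 1"
  by (simp add: lin_def)

lemma num_0 [simp]: "num h as $ 0 = 1"
  by (induction as) (auto simp: num_def)

lemma logderiv_lin: "logderiv (lin h a) (- pw h a)"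
proof -
  have "fps_X * fps_deriv (lin h a) = - fps_const (qpow h a) * fps_X"
    by (simp add: lin_def mult.commute)
  also have "\<dots> = - pw h a * lin h a"
  proof (rule fps_ext)
    fix n
    have q: "qpow h (a * (1 + of_nat m)) = qpow h a * qpow h (a * of_nat m)" for m
      by (simp add: qpow_def exp_add[symmetric] algebra_simps)
    have e: "pw h a * lin h a = pw h a - fps_const (qpow h a) * (fps_X * pw h a)"
      by (simp add: lin_def algebra_simps)
    show "(- fps_const (qpow h a) * fps_X) $ n = (- pw h a * lin h a) $ n"
      unfolding mult_minus_left e
      by (cases n; cases "n = 1") (auto simp: pw_def q)
  qed
  finally show ?thesis by (simp add: logderiv_def)
qed

lemma logderiv_num: "logderiv (num h as) (- (\<Sum>a\<leftarrow>as. pw h a))"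
proof (induction as)
  case Nil
  then show ?case by (simp add: num_def logderiv_def)
next
  case (Cons a as)
  then show ?case using logderiv_mult[OF logderiv_lin[of h a] Cons] by (simp add: num_def)
qed

context fock_rep
begin

text \<open>Coefficient of (w/z)^m in the logarithmic derivative of the contraction. Unlike the
  contraction it is additive in both exponents, so composite currents reduce to their
  constituents.\<close>

definition el :: "lform \<Rightarrow> lform \<Rightarrow> nat \<Rightarrow> complex" where
  "el F G m = of_nat m * (\<Sum>i\<in>bosons. cosc F i (int m) * cosc G i (- int m) * heis h k i (int m))"

text \<open>A monomial q^{am} with sign + stands for a factor 1 - q^a w/z in the denominator, one
  with sign - for such a factor in the numerator. Zeros and poles are thus read off from
  \<open>el\<close>.\<close>

lemma gam_eqI:
  assumes "\<And>m. m > 0 \<Longrightarrow> el F G m = (\<Sum>a\<leftarrow>as. qpow h (a * of_nat m)) - (\<Sum>b\<leftarrow>bs. qpow h (b * of_nat m))"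
  shows "gam F G = num h bs * inverse (num h as)"
proof (rule logderiv_unique)
  show "logderiv (gam F G) (fps_X * fps_deriv (kap F G))"
    by (simp add: logderiv_def gam_deriv mult.assoc)
  have s: "(\<Sum>a\<leftarrow>as. pw h a) $ m = (\<Sum>a\<leftarrow>as. qpow h (a * of_nat m))" if "m > 0" for m as
    using that by (induction as) (auto simp: pw_def)
  have s0: "(\<Sum>a\<leftarrow>as. pw h a) $ 0 = 0" for as
    by (induction as) (auto simp: pw_def)
  have "fps_X * fps_deriv (kap F G) = - (\<Sum>b\<leftarrow>bs. pw h b) + - (- (\<Sum>a\<leftarrow>as. pw h a))"
  proof (rule fps_ext)
    fix m
    show "(fps_X * fps_deriv (kap F G)) $ m = (- (\<Sum>b\<leftarrow>bs. pw h b) + - (- (\<Sum>a\<leftarrow>as. pw h a))) $ m"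
      using assms[of m] by (cases m) (auto simp: s s0 el_def kap_def simp del: of_nat_Suc)
  qed
  then show "logderiv (num h bs * inverse (num h as)) (fps_X * fps_deriv (kap F G))"
    using logderiv_mult[OF logderiv_num logderiv_inverse[OF logderiv_num]] by metis
qed

lemma el_lf_add_left: "el (F \<oplus>\<^sub>l F') G m = el F G m + el F' G m"
  and el_lf_add_right: "el F (G \<oplus>\<^sub>l G') m = el F G m + el F G' m"
  and el_scale_left: "el (lf_scale h u F) G m = qpow h (- (u * of_nat m)) * el F G m"
  and el_scale_right: "el F (lf_scale h u G) m = qpow h (u * of_nat m) * el F G m"
  by (simp_all add: el_def lf_add_def lf_scale_def algebra_simps)

text \<open>The exponent of the vertex operator in \<open>Gpart h k e \<epsilon>\<close>.\<close>

definition Gl :: "int \<Rightarrow> int \<Rightarrow> lform" where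
  "Gl e \<epsilon> = lf_scale h (- (of_int e * (k + 2))) (Vt h k e) \<oplus>\<^sub>l
     lf_scale h (- (of_int e * (3 * k + 4) / 2)) (if e = 1 then ev h k \<epsilon> else fv h k \<epsilon>)"

definition Kl :: "int \<Rightarrow> lform" where
  "Kl e = lf_single ATilde 0 0 1 (\<lambda>m. if e * m > 0 then dq h else 0)"

end

text \<open>\<open>q_ne\<close> and \<open>qk_ne\<close> keep the denominators [2m] and [km] of the
  vertex operators nonzero. The other conditions keep q^{2k+2}, q^{2k+4} and q^{4k+4} different from
  1, hence the poles of G^+ G^- away from z = w and the two poles of a single contraction
  apart.\<close>

locale fock_generic = fock_rep +
  assumes q_ne: "\<And>n::nat. n > 0 \<Longrightarrow> exp h ^ n \<noteq> 1"
    and qk_ne: "\<And>n::nat. n > 0 \<Longrightarrow> qn h (k * of_nat n) \<noteq> 0"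
    and k1_ne: "qn h (k + 1) \<noteq> 0" and k2_ne: "qn h (k + 2) \<noteq> 0" and k22_ne: "qn h (2 * k + 2) \<noteq> 0"
begin

lemma qpow_ne [simp]: "qpow h a \<noteq> 0"
  by (simp add: qpow_def)

lemma qpow_minus: "qpow h (- a) = 1 / qpow h a"
  by (simp add: qpow_def exp_minus inverse_eq_divide)

lemma k_ne: "k \<noteq> 0"
  using qk_ne[of 1] by (auto simp: qn_def)

lemma qpow_nat_ne: "n > 0 \<Longrightarrow> qpow h (of_nat n) \<noteq> 1"
  using q_ne[of n] by (simp add: qpow_def exp_of_nat_mult[symmetric] mult.commute)

lemma dq_ne: "dq h \<noteq> 0"
proof
  assume "dq h = 0"
  then have "qpow h 1 * qpow h 1 = 1" by (simp add: dq_def qpow_minus field_simps)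
  then have "qpow h (of_nat 2) = 1" by (simp add: qpow_add[symmetric])
  then show False using qpow_nat_ne[of 2] by simp
qed

lemma qn_eq: "qn h u = (qpow h u - 1 / qpow h u) / dq h"
  by (simp add: qn_def dq_def qpow_minus)

lemma qn_minus: "qn h (- u) = - qn h u"
  by (simp add: qn_eq qpow_minus minus_divide_left)

lemma qn_nonzero_iff: "qn h u \<noteq> 0 \<longleftrightarrow> qpow h u ^ 2 \<noteq> 1"
  using dq_ne by (auto simp: qn_eq field_simps power2_eq_square)

lemma qm_facts:
  assumes "m > 0"
  shows "qpow h (of_nat m) ^ 2 \<noteq> 1" "qpow h (of_nat m) ^ 2 + 1 \<noteq> 0" "qpow h (k * of_nat m) ^ 2 \<noteq> 1"
proof -
  have a: "qpow h (of_nat m) ^ j = qpow h (of_nat (j * m))" for j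
    by (simp add: qpow_of_nat_mult[symmetric])
  show 1: "qpow h (of_nat m) ^ 2 \<noteq> 1" using assms qpow_nat_ne[of "2 * m"] a[of 2] by simp
  have "qpow h (of_nat m) ^ 4 \<noteq> 1" using assms qpow_nat_ne[of "4 * m"] a[of 4] by simp
  moreover have "z ^ 4 = 1" if "z ^ 2 + 1 = 0" for z :: complex
  proof -
    have "z ^ 4 = (z ^ 2) ^ 2" by simp
    also have "z ^ 2 = - 1" using that by (simp add: eq_neg_iff_add_eq_0)
    finally show ?thesis by simp
  qed
  ultimately show "qpow h (of_nat m) ^ 2 + 1 \<noteq> 0" by blast
  show "qpow h (k * of_nat m) ^ 2 \<noteq> 1" using qk_ne[OF assms] qn_nonzero_iff by blast
qed

lemma qmerge: "qpow h a * qpow h b = qpow h (a + b)" "qpow h a * (qpow h b * z) = qpow h (a + b) * z"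
  by (simp_all add: qpow_add)

section \<open>Oscillator coefficients, contractions and fusion of the vertex operators\<close>

lemmas lform_defs = Gl_def Vt_def Yv_def ZWv_def ev_def fv_def lf_add_def lf_scale_def lf_single_def lf_neg_def

text \<open>\<open>KI\<close> and \<open>DD\<close> are the coefficients recurring in V, Y and in Z,
  W. They stay folded while powers of q are merged and are expanded only for the final rational
  identities.\<close>

definition KI :: "nat \<Rightarrow> complex" where "KI m = 1 / qn h (k * of_nat m)"
definition DD :: "nat \<Rightarrow> complex" where "DD m = dq h * (qn h (of_nat m) / qn h (2 * of_nat m))"

lemma div_qn: "x / qn h (k * of_nat m) = x * KI m"
  by (simp add: KI_def)

lemma DD_fold: "dq h * (qn h (of_nat m) / qn h (2 * of_nat m)) = DD m"
  by (simp add: DD_def)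

lemma cosc_Gl_plus:
  assumes "m > 0" "\<epsilon> \<in> {1, - 1}"
  shows "cosc (Gl 1 \<epsilon>) ATilde (int m) = - (qpow h ((k + 2) * of_nat m) * KI m)"
    "cosc (Gl 1 \<epsilon>) ATilde (- int m) = qpow h (- ((k + 2) * of_nat m)) * KI m"
    "cosc (Gl 1 \<epsilon>) ABar (int m) = - (qpow h ((k + 2) * of_nat m) * KI m)
       - (if \<epsilon> = 1 then qpow h ((2 * k + 3) * of_nat m) * DD m else 0)"
    "cosc (Gl 1 \<epsilon>) ABar (- int m) = qpow h (- ((2 * k + 2) * of_nat m)) * KI m
       + (if \<epsilon> = - 1 then qpow h (- ((k + 1) * of_nat m)) * DD m else 0)"
    "cosc (Gl 1 \<epsilon>) Beta (int m) = - (if \<epsilon> = 1 then qpow h ((2 * k + 2) * of_nat m) * DD m else 0)"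
    "cosc (Gl 1 \<epsilon>) Beta (- int m) = (if \<epsilon> = - 1 then qpow h (- ((k + 2) * of_nat m)) * DD m else 0)"
  using assms(2)
  by (auto simp: lform_defs div_qn DD_fold assms(1) qn_minus algebra_simps qmerge add_divide_distrib diff_divide_distrib)
    (simp_all add: DD_def mult_ac minus_diff_commute)

lemma cosc_Gl_minus:
  assumes "m > 0" "\<epsilon> \<in> {1, - 1}"
  shows "cosc (Gl (- 1) \<epsilon>) ATilde (int m) = qpow h (- ((k + 2) * of_nat m)) * KI m"
    "cosc (Gl (- 1) \<epsilon>) ATilde (- int m) = - (qpow h ((k + 2) * of_nat m) * KI m)"
    "cosc (Gl (- 1) \<epsilon>) ABar (int m) = qpow h (- ((k + 2) * of_nat m)) * KI m
       - (if \<epsilon> = 1 then qpow h (- ((2 * k + 3) * of_nat m)) * DD m else 0)"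
    "cosc (Gl (- 1) \<epsilon>) ABar (- int m) = - (qpow h ((2 * k + 2) * of_nat m) * KI m)
       + (if \<epsilon> = - 1 then qpow h ((k + 1) * of_nat m) * DD m else 0)"
    "cosc (Gl (- 1) \<epsilon>) Beta (int m) = (if \<epsilon> = 1 then qpow h (- ((2 * k + 2) * of_nat m)) * DD m else 0)"
    "cosc (Gl (- 1) \<epsilon>) Beta (- int m) = - (if \<epsilon> = - 1 then qpow h ((k + 2) * of_nat m) * DD m else 0)"
  using assms(2)
  by (auto simp: lform_defs div_qn DD_fold assms(1) qn_minus algebra_simps qmerge add_divide_distrib diff_divide_distrib)
    (simp_all add: DD_def mult_ac minus_diff_commute)

text \<open>At mode m all powers of q are monomials in x = q^m and y = q^{km}. A statement about all
  m thereby becomes one identity of rational functions in two variables.\<close>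

lemma qpow_xy:
  "qpow h ((k + 2) * of_nat m) = qpow h (of_nat m) ^ 2 * qpow h (k * of_nat m)"
  "qpow h ((2 * k + 3) * of_nat m) = qpow h (of_nat m) ^ 3 * qpow h (k * of_nat m) ^ 2"
  "qpow h ((2 * k + 2) * of_nat m) = qpow h (of_nat m) ^ 2 * qpow h (k * of_nat m) ^ 2"
  "qpow h ((k + 1) * of_nat m) = qpow h (of_nat m) * qpow h (k * of_nat m)"
  "qpow h (2 * of_nat m) = qpow h (of_nat m) ^ 2"
  "qpow h ((4 * k + 4) * of_nat m) = qpow h (of_nat m) ^ 4 * qpow h (k * of_nat m) ^ 4"
  "qpow h ((4 * k + 6) * of_nat m) = qpow h (of_nat m) ^ 6 * qpow h (k * of_nat m) ^ 4"
  "qpow h ((2 * k + 4) * of_nat m) = qpow h (of_nat m) ^ 4 * qpow h (k * of_nat m) ^ 2"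
  by (simp_all add: qpow_of_nat_mult[of 2, symmetric, simplified] qpow_of_nat_mult[of 3, symmetric, simplified]
      qpow_of_nat_mult[of 4, symmetric, simplified] qpow_of_nat_mult[of 6, symmetric, simplified] qmerge algebra_simps)

lemma m_heis:
  assumes "m > 0"
  shows "of_nat m * heis h k ATilde (int m) = qn h ((k + 2) * of_nat m) * qn h (k * of_nat m)"
    "of_nat m * heis h k ABar (int m) = - (qn h (2 * of_nat m) * qn h (k * of_nat m))"
    "of_nat m * heis h k Beta (int m) = qn h (2 * of_nat m) * qn h ((k + 2) * of_nat m)"
  using assms by (simp_all add: heis_def)

lemma el_eq:
  assumes "m > 0"
  shows "el F G m = cosc F ATilde (int m) * cosc G ATilde (- int m) * (qn h ((k + 2) * of_nat m) * qn h (k * of_nat m))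
    - cosc F ABar (int m) * cosc G ABar (- int m) * (qn h (2 * of_nat m) * qn h (k * of_nat m))
    + cosc F Beta (int m) * cosc G Beta (- int m) * (qn h (2 * of_nat m) * qn h ((k + 2) * of_nat m))"
proof -
  have "el F G m = cosc F ATilde (int m) * cosc G ATilde (- int m) * (of_nat m * heis h k ATilde (int m))
    + cosc F ABar (int m) * cosc G ABar (- int m) * (of_nat m * heis h k ABar (int m))
    + cosc F Beta (int m) * cosc G Beta (- int m) * (of_nat m * heis h k Beta (int m))"
    by (simp add: el_def algebra_simps)
  then show ?thesis by (simp add: m_heis[OF assms])
qed

lemma KI_DD_xy:
  assumes "m > 0" and "x = qpow h (of_nat m)" "y = qpow h (k * of_nat m)"
  shows "KI m = dq h * y / (y ^ 2 - 1)" "DD m = dq h * x / (x ^ 2 + 1)"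
    "qn h (k * of_nat m) = (y ^ 2 - 1) / (y * dq h)" "qn h (2 * of_nat m) = (x ^ 2 - 1) * (x ^ 2 + 1) / (x ^ 2 * dq h)"
    "qn h ((k + 2) * of_nat m) = (x ^ 2 * y - 1 / (x ^ 2 * y)) / dq h"
proof -
  have ne: "x \<noteq> 0" "y \<noteq> 0" "dq h \<noteq> 0" "x ^ 2 - 1 \<noteq> 0" "x ^ 2 + 1 \<noteq> 0" "y ^ 2 - 1 \<noteq> 0"
    using qm_facts[OF assms(1)] dq_ne by (auto simp: assms)
  show a: "qn h (k * of_nat m) = (y ^ 2 - 1) / (y * dq h)"
    using ne by (simp add: qn_eq flip: assms(3)) (simp add: field_simps power2_eq_square)
  show "KI m = dq h * y / (y ^ 2 - 1)" unfolding KI_def a using ne by simp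
  show b: "qn h (2 * of_nat m) = (x ^ 2 - 1) * (x ^ 2 + 1) / (x ^ 2 * dq h)"
    using ne by (simp add: qn_eq qpow_xy flip: assms(2)) (simp add: field_simps power2_eq_square)
  have c: "qn h (of_nat m) = (x ^ 2 - 1) / (x * dq h)"
    using ne by (simp add: qn_eq flip: assms(2)) (simp add: field_simps power2_eq_square)
  show "DD m = dq h * x / (x ^ 2 + 1)"
  proof -
    have "dq h * (A / (x * dq h) / (A * B / (x ^ 2 * dq h))) = dq h * x / B" if "A \<noteq> 0" "B \<noteq> 0" for A B
      using ne that by (simp add: field_simps power2_eq_square)
    then show ?thesis unfolding DD_def b c using ne by blast
  qed
  show "qn h ((k + 2) * of_nat m) = (x ^ 2 * y - 1 / (x ^ 2 * y)) / dq h"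
    by (simp add: qn_eq qpow_xy flip: assms(2,3))
qed

context
  fixes m :: nat and x y :: complex
  assumes m: "m > 0" and xy: "x = qpow h (of_nat m)" "y = qpow h (k * of_nat m)"
begin

lemma xy_nonzero: "x \<noteq> 0" "y \<noteq> 0" "dq h \<noteq> 0" "x ^ 2 - 1 \<noteq> 0" "x ^ 2 + 1 \<noteq> 0" "y ^ 2 - 1 \<noteq> 0" "x ^ 2 \<noteq> 1" "y ^ 2 \<noteq> 1"
  using qm_facts[OF m] dq_ne by (auto simp: xy)

lemmas cosc_Gl = cosc_Gl_plus[OF m, of 1, simplified] cosc_Gl_plus[OF m, of "- 1", simplified]
  cosc_Gl_minus[OF m, of 1, simplified] cosc_Gl_minus[OF m, of "- 1", simplified]
lemmas cosc_xy = el_eq[OF m] cosc_Gl KI_DD_xy[OF m xy] qpow_minus qpow_xy[of m, folded xy]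

text \<open>The denominators of \<open>KI\<close> and \<open>DD\<close> cancel, and Laurent
  polynomials with coefficients 1 and -1 remain. Their monomials are the poles and zeros; x^4 y^4 is
  the pole at which K appears.\<close>

lemma el_GG_xy:
  "el (Gl 1 1) (Gl 1 1) m = - 1" "el (Gl 1 1) (Gl 1 (- 1)) m = - 1 / x ^ 2"
  "el (Gl 1 (- 1)) (Gl 1 1) m = - (x ^ 2)" "el (Gl 1 (- 1)) (Gl 1 (- 1)) m = - 1"
  "el (Gl (- 1) 1) (Gl (- 1) 1) m = - 1" "el (Gl (- 1) 1) (Gl (- 1) (- 1)) m = - (x ^ 2)"
  "el (Gl (- 1) (- 1)) (Gl (- 1) 1) m = - 1 / x ^ 2" "el (Gl (- 1) (- 1)) (Gl (- 1) (- 1)) m = - 1"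
  "el (Gl 1 1) (Gl (- 1) 1) m = x ^ 2 * y ^ 2 + x ^ 4 * y ^ 4 - x ^ 6 * y ^ 4"
  "el (Gl 1 1) (Gl (- 1) (- 1)) m = x ^ 2 * y ^ 2" "el (Gl 1 (- 1)) (Gl (- 1) 1) m = x ^ 2 * y ^ 2"
  "el (Gl 1 (- 1)) (Gl (- 1) (- 1)) m = x ^ 4 * y ^ 2"
  "el (Gl (- 1) 1) (Gl 1 1) m = 1 / (x ^ 2 * y ^ 2) + 1 / (x ^ 4 * y ^ 4) - 1 / (x ^ 6 * y ^ 4)"
  "el (Gl (- 1) 1) (Gl 1 (- 1)) m = 1 / (x ^ 2 * y ^ 2)" "el (Gl (- 1) (- 1)) (Gl 1 1) m = 1 / (x ^ 2 * y ^ 2)"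
  "el (Gl (- 1) (- 1)) (Gl 1 (- 1)) m = 1 / (x ^ 4 * y ^ 2)"
  by (unfold cosc_xy; simp add: divide_simps xy_nonzero; algebra?)+

lemma cosc_K_fusion:
  "cosc (lf_scale h (2 * k + 2) (Gl 1 1)) i (int m) + cosc (lf_scale h (- (2 * k + 2)) (Gl (- 1) 1)) i (int m) = (if i = ATilde then dq h else 0)"
  "cosc (lf_scale h (2 * k + 2) (Gl 1 1)) i (- int m) + cosc (lf_scale h (- (2 * k + 2)) (Gl (- 1) 1)) i (- int m) = (if i = ATilde then dq h else 0)"
  by (cases i; unfold lf_scale_def lform.sel of_int_minus mult_minus_left mult_minus_right minus_minus of_int_of_nat_eq;
      simp only: cosc_xy boson.distinct if_True if_False; erule thin_rl; simp add: divide_simps xy_nonzero; algebra?)+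

lemma cosc_one_fusion:
  "cosc (lf_scale h (k + 2) (Gl 1 (- 1))) i (int m) + cosc (lf_scale h (- (k + 2)) (Gl (- 1) (- 1))) i (int m) = 0"
  "cosc (lf_scale h (k + 2) (Gl 1 (- 1))) i (- int m) + cosc (lf_scale h (- (k + 2)) (Gl (- 1) (- 1))) i (- int m) = 0"
  by (cases i; unfold lf_scale_def lform.sel of_int_minus mult_minus_left mult_minus_right minus_minus of_int_of_nat_eq;
      simp only: cosc_xy; erule thin_rl; simp add: divide_simps xy_nonzero; algebra?)+

end

lemmas el_GG = el_GG_xy[OF _ refl refl]

text \<open>A summand of T is a summand of G^+ at q^{k+1} z normally ordered with one of G^- at
  q^{-k-1} z. In this form its contractions follow from \<open>el_GG\<close> by bilinearity;
  \<open>TT_aux\<close> compares it with the definition of T.\<close>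

definition Tl :: "int \<Rightarrow> int \<Rightarrow> lform" where
  "Tl a b = lf_scale h (k + 1) (Gl 1 a) \<oplus>\<^sub>l lf_scale h (- (k + 1)) (Gl (- 1) b)"

lemma el_Kl_left_minus: "m > 0 \<Longrightarrow> el (Kl (- 1)) G m = 0"
  and el_Kl_right_plus: "m > 0 \<Longrightarrow> el F (Kl 1) m = 0"
  by (simp_all add: el_eq Kl_def lf_single_def)

lemma el_Kl:
  assumes m: "m > 0"
  shows "el (Kl 1) (Kl (- 1)) m = qpow h ((2 * k + 2) * of_nat m) + qpow h (- ((2 * k + 2) * of_nat m))
      - qpow h (2 * of_nat m) - qpow h (- (2 * of_nat m))"
    and "\<epsilon> \<in> {1, - 1} \<Longrightarrow> el (Kl 1) (Gl 1 \<epsilon>) m = 1 - qpow h (- ((2 * k + 4) * of_nat m))"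
    and "\<epsilon> \<in> {1, - 1} \<Longrightarrow> el (Kl 1) (Gl (- 1) \<epsilon>) m = 1 - qpow h ((2 * k + 4) * of_nat m)"
    and "\<epsilon> \<in> {1, - 1} \<Longrightarrow> el (Gl 1 \<epsilon>) (Kl (- 1)) m = 1 - qpow h ((2 * k + 4) * of_nat m)"
    and "\<epsilon> \<in> {1, - 1} \<Longrightarrow> el (Gl (- 1) \<epsilon>) (Kl (- 1)) m = 1 - qpow h (- ((2 * k + 4) * of_nat m))"
proof -
  define x y where xy: "x = qpow h (of_nat m)" "y = qpow h (k * of_nat m)"
  note ne = xy_nonzero(1-6)[OF m xy] and e = KI_DD_xy[OF m xy] and q = qpow_minus qpow_xy[of m, folded xy]
  show "el (Kl 1) (Kl (- 1)) m = qpow h ((2 * k + 2) * of_nat m) + qpow h (- ((2 * k + 2) * of_nat m))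
      - qpow h (2 * of_nat m) - qpow h (- (2 * of_nat m))"
    unfolding el_eq[OF m] e q using m ne by (simp add: Kl_def lf_single_def divide_simps) algebra
  assume \<epsilon>: "\<epsilon> \<in> {1, - 1}"
  note c = cosc_Gl_plus[OF m \<epsilon>] cosc_Gl_minus[OF m \<epsilon>]
  have K: "cosc (Kl 1) i (int m) = (if i = ATilde then dq h else 0)"
    "cosc (Kl (- 1)) i (- int m) = (if i = ATilde then dq h else 0)" for i
    using m by (simp_all add: Kl_def lf_single_def)
  show "el (Kl 1) (Gl 1 \<epsilon>) m = 1 - qpow h (- ((2 * k + 4) * of_nat m))"
    "el (Kl 1) (Gl (- 1) \<epsilon>) m = 1 - qpow h ((2 * k + 4) * of_nat m)"
    "el (Gl 1 \<epsilon>) (Kl (- 1)) m = 1 - qpow h ((2 * k + 4) * of_nat m)"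
    "el (Gl (- 1) \<epsilon>) (Kl (- 1)) m = 1 - qpow h (- ((2 * k + 4) * of_nat m))"
    unfolding el_eq[OF m] c K e q using ne by (simp_all add: divide_simps; algebra)+
qed

text \<open>Supercurrents of equal upper sign contract with a factor z, those of opposite sign with
  1/z. These odd powers cause anticommutators in place of commutators.\<close>

lemma lam_GG: "e \<in> {1, - 1} \<Longrightarrow> e' \<in> {1, - 1} \<Longrightarrow> lam (Gl e \<epsilon>) (Gl e' \<epsilon>') = of_int (e * e')"
  and kq_GG: "e \<in> {1, - 1} \<Longrightarrow> e' \<in> {1, - 1} \<Longrightarrow> kq (Gl e \<epsilon>) (Gl e' \<epsilon>') = of_int e' * (of_int \<epsilon> - k - 1)"
  and kq_KG: "e' \<in> {1, - 1} \<Longrightarrow> kq (Kl s) (Gl e' \<epsilon>') = of_int e' * (k + 2)"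
  using k_ne by (auto simp: lam_def kq_def lform_defs Kl_def Qsign_def field_simps)

lemma lam_K [simp]: "lam (Kl s) G = 0" "lam G (Kl s) = 0"
  and kq_K [simp]: "kq G (Kl s) = 0"
  by (simp_all add: lam_def kq_def Kl_def lf_single_def)

text \<open>Equality of exponents as far as \<open>nexp\<close> can see, since its oscillator sums
  run over nonzero m.\<close>

definition lf_eqv :: "lform \<Rightarrow> lform \<Rightarrow> bool" where
  "lf_eqv F G \<longleftrightarrow> cQ F = cQ G \<and> clogz F = clogz G \<and> clogq F = clogq G \<and> (\<forall>i m. m \<noteq> 0 \<longrightarrow> cosc F i m = cosc G i m)"

lemma nexp_eqv: "lf_eqv F G \<Longrightarrow> nexp h k F = nexp h k G"
  by (intro ext nexp_cong) (auto simp: lf_eqv_def)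

lemma lf_eqv_refl [simp]: "lf_eqv F F"
  by (simp add: lf_eqv_def)

lemma lf_eqv_add: "lf_eqv F F' \<Longrightarrow> lf_eqv G G' \<Longrightarrow> lf_eqv (F \<oplus>\<^sub>l G) (F' \<oplus>\<^sub>l G')"
  and lf_eqv_scale: "lf_eqv F F' \<Longrightarrow> lf_eqv (lf_scale h u F) (lf_scale h u F')"
  by (simp_all add: lf_eqv_def lf_add_def lf_scale_def fun_eq_iff)

lemma lf_add_assoc: "F \<oplus>\<^sub>l G \<oplus>\<^sub>l H = F \<oplus>\<^sub>l (G \<oplus>\<^sub>l H)"
  and lf_add_commute: "F \<oplus>\<^sub>l G = G \<oplus>\<^sub>l F"
  and lf_add_left_commute: "F \<oplus>\<^sub>l (G \<oplus>\<^sub>l H) = G \<oplus>\<^sub>l (F \<oplus>\<^sub>l H)"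
  and lf_scale_add: "lf_scale h u (F \<oplus>\<^sub>l G) = lf_scale h u F \<oplus>\<^sub>l lf_scale h u G"
  and lf_scale_scale: "lf_scale h u (lf_scale h w F) = lf_scale h (u + w) F"
  by (simp_all add: lf_add_def lf_scale_def algebra_simps qmerge)

lemma lf_scale_0 [simp]: "lf_scale h 0 F = F"
  by (simp add: lf_scale_def)

lemmas lf_ac = lf_add_assoc lf_add_commute lf_add_left_commute

definition Ol :: lform where "Ol = lf_single ATilde 0 0 0 (\<lambda>_. 0)"

lemma lf_eqvI:
  assumes "\<And>i. cQ F i = cQ G i" "\<And>i. clogz F i = clogz G i" "\<And>i. clogq F i = clogq G i"
    and "\<And>i m. m > 0 \<Longrightarrow> cosc F i (int m) = cosc G i (int m)"
    and "\<And>i m. m > 0 \<Longrightarrow> cosc F i (- int m) = cosc G i (- int m)"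
  shows "lf_eqv F G"
proof -
  have "cosc F i m = cosc G i m" if "m \<noteq> 0" for i m
    using assms(4)[of "nat m" i] assms(5)[of "nat (- m)" i] that by (cases "m > 0") auto
  then show ?thesis using assms by (simp add: lf_eqv_def fun_eq_iff)
qed

text \<open>At this distance the \<open>ABar\<close> and \<open>Beta\<close> parts cancel, and the
  \<open>ATilde\<close> coefficients with denominator [km] combine to the constant q - q^{-1}. The
  zero mode occurs with total exponent 2, one unit for each of K^- and K^+.\<close>

lemma K_fusion:
  "lf_eqv (lf_scale h (2 * k + 2) (Gl 1 1) \<oplus>\<^sub>l lf_scale h (- (2 * k + 2)) (Gl (- 1) 1)) (Kl (- 1) \<oplus>\<^sub>l Kl 1)"
  (is "lf_eqv ?F ?G")
proof (rule lf_eqvI)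
  fix i and m :: nat assume m: "m > 0"
  show "cosc ?F i (int m) = cosc ?G i (int m)" "cosc ?F i (- int m) = cosc ?G i (- int m)"
    using cosc_K_fusion[OF m refl refl, of i] m by (simp_all add: lf_add_def Kl_def lf_single_def)
next
  fix i show "clogq ?F i = clogq ?G i"
    using k_ne by (cases i) (auto simp: lform_defs Kl_def divide_simps; algebra)+
qed (auto simp: lform_defs Kl_def fun_eq_iff)

text \<open>Here every part cancels: at this distance the two summands with lower sign - are inverse
  to each other. This is the source of the delta function without an operator in the anticommutator
  of G^+ and G^-.\<close>

lemma one_fusion:
  "lf_eqv (lf_scale h (k + 2) (Gl 1 (- 1)) \<oplus>\<^sub>l lf_scale h (- (k + 2)) (Gl (- 1) (- 1))) Ol" (is "lf_eqv ?F _")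
proof (rule lf_eqvI)
  fix i and m :: nat assume m: "m > 0"
  show "cosc ?F i (int m) = cosc Ol i (int m)" "cosc ?F i (- int m) = cosc Ol i (- int m)"
    using cosc_one_fusion[OF m refl refl, of i] by (simp_all add: lf_add_def Ol_def lf_single_def)
next
  fix i show "clogq ?F i = clogq Ol i"
    using k_ne by (cases i) (auto simp: lform_defs Ol_def divide_simps; algebra)+
qed (auto simp: lform_defs Ol_def fun_eq_iff)

end

section \<open>Partial fractions\<close>

lemma lin_mult_nth: "(lin h a * f) $ n = f $ n - (if n = 0 then 0 else qpow h a * f $ (n - 1))"
  by (simp add: lin_def left_diff_distrib mult.assoc)

lemma lin_nth: "lin h a $ n = (if n = 0 then 1 else if n = 1 then - qpow h a else 0)"
  using lin_mult_nth[of h a 1 n] by auto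

definition geom :: "complex \<Rightarrow> complex \<Rightarrow> complex fps" where
  "geom h a = Abs_fps (\<lambda>n. qpow h (a * of_nat n))"

lemma geom_nth: "geom h a $ n = qpow h (a * of_nat n)"
  by (simp add: geom_def)

lemma lin_geom: "lin h a * geom h a = 1"
proof (rule fps_ext)
  fix n
  have "qpow h (a * of_nat n) = qpow h a * qpow h (a * of_nat (n - 1))" if "n > 0"
    using that by (simp add: qpow_def exp_add[symmetric] of_nat_diff algebra_simps)
  then show "(lin h a * geom h a) $ n = 1 $ n"
    by (auto simp: lin_mult_nth geom_nth) (simp add: qpow_def)
qed

lemma inverse_lin: "inverse (lin h a) = geom h a"
  using lin_geom by (intro fps_inverse_unique) (simp add: mult.commute)

lemma fps_eq_mult_cancel: "(Q :: complex fps) $ 0 = 1 \<Longrightarrow> P = Q * R \<Longrightarrow> P * inverse Q = R"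
proof -
  assume a: "Q $ 0 = 1" "P = Q * R"
  then have "Q * inverse Q = 1" by (intro inverse_mult_eq_1') simp
  then show ?thesis using a by (metis mult.assoc mult.commute mult_1_right)
qed

lemma num_Cons: "num h (a # as) = lin h a * num h as" and num_Nil: "num h [] = 1"
  by (simp_all add: num_def)

text \<open>B/A is the value of the function at infinity, and the remainder is the simple pole
  expanded at 0. The identity is checked after multiplication by the denominator.\<close>

lemma partial_fraction_11:
  fixes h a b
  defines "A \<equiv> qpow h a" and "B \<equiv> qpow h b"
  shows "num h [b] * inverse (num h [a]) = fps_const (B / A) + fps_const (1 - B / A) * geom h a"
proof (rule fps_eq_mult_cancel)
  have A: "A \<noteq> 0" by (simp add: A_def qpow_def)
  have "num h [a] * (fps_const (B / A) + fps_const (1 - B / A) * geom h a) =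
      fps_const (B / A) * lin h a + fps_const (1 - B / A) * (lin h a * geom h a)"
    by (simp add: num_def algebra_simps)
  also have "\<dots> = num h [b]"
    unfolding lin_geom using A
    by (intro fps_ext) (auto simp: num_def lin_nth A_def[symmetric] B_def[symmetric])
  finally show "num h [b] = num h [a] * (fps_const (B / A) + fps_const (1 - B / A) * geom h a)" ..
qed simp

lemma partial_fraction_22:
  fixes h a b c d
  defines "A \<equiv> qpow h a" and "B \<equiv> qpow h b" and "C \<equiv> qpow h c" and "D \<equiv> qpow h d"
  assumes AC: "A \<noteq> C"
  shows "num h [b, d] * inverse (num h [a, c]) = fps_const (B * D / (A * C))
    + fps_const ((1 - B / A) * (1 - D / A) / (1 - C / A)) * geom h a
    + fps_const ((1 - B / C) * (1 - D / C) / (1 - A / C)) * geom h c"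
    (is "_ = fps_const ?z + fps_const ?x * _ + fps_const ?y * _")
proof (rule fps_eq_mult_cancel)
  have A: "A \<noteq> 0" "C \<noteq> 0" "A - C \<noteq> 0" "C - A \<noteq> 0" using AC by (auto simp: A_def C_def qpow_def)
  have e: "?x = (A - B) * (A - D) / (A * (A - C))" "?y = - ((C - B) * (C - D) / (C * (A - C)))"
    using A by (simp_all add: divide_simps; algebra)+
  \<comment> \<open>The comparison of the coefficients of 1, x and x^2 after multiplication by the
    denominator.\<close>
  have s: "?z + ?x + ?y = 1" "?z * (A + C) + ?x * C + ?y * A = B + D" "?z * (A * C) = B * D"
    unfolding e using A by (simp_all add: divide_simps; algebra?)+
  have key: "z + x + y = 1 \<and> z * (- C - A) - x * C - y * A = - D - B \<and> z * (A * C) = B * D"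
    if "z + x + y = 1" "z * (A + C) + x * C + y * A = B + D" "z * (A * C) = B * D" for z x y
    using that by (auto simp: algebra_simps)
  have "num h [a, c] * (fps_const ?z + fps_const ?x * geom h a + fps_const ?y * geom h c) =
      fps_const ?z * (lin h a * lin h c) + fps_const ?x * (lin h a * geom h a) * lin h c
      + fps_const ?y * (lin h c * geom h c) * lin h a"
    by (simp add: num_def algebra_simps)
  also have "\<dots> = num h [b, d]"
  proof (rule fps_ext)
    fix n :: nat
    consider "n = 0" | "n = 1" | "n = 2" | "n > 2" by linarith
    then show "(fps_const ?z * (lin h a * lin h c) + fps_const ?x * (lin h a * geom h a) * lin h c
      + fps_const ?y * (lin h c * geom h c) * lin h a) $ n = num h [b, d] $ n"
      unfolding lin_geom using key[OF s]
      by cases (simp_all add: num_Cons num_Nil lin_mult_nth lin_nth A_def[symmetric] B_def[symmetric] C_def[symmetric]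
          D_def[symmetric] del: times_divide_eq_left times_divide_eq_right)
  qed
  finally show "num h [b, d] = num h [a, c] * (fps_const ?z + fps_const ?x * geom h a + fps_const ?y * geom h c)" ..
qed simp

text \<open>The numerator has smaller degree than the denominator, so the function vanishes at
  infinity and no constant term appears.\<close>

lemma partial_fraction_12:
  fixes h a b c
  defines "A \<equiv> qpow h a" and "B \<equiv> qpow h b" and "C \<equiv> qpow h c"
  assumes AC: "A \<noteq> C"
  shows "num h [b] * inverse (num h [a, c]) =
    fps_const ((1 - B / A) / (1 - C / A)) * geom h a + fps_const ((1 - B / C) / (1 - A / C)) * geom h c"
    (is "_ = fps_const ?x * _ + fps_const ?y * _")
proof (rule fps_eq_mult_cancel)
  have A: "A \<noteq> 0" "C \<noteq> 0" "A - C \<noteq> 0" "C - A \<noteq> 0" using AC by (auto simp: A_def C_def qpow_def)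
  have e: "?x = (A - B) / (A - C)" "?y = - ((C - B) / (A - C))"
    using A by (simp_all add: divide_simps; algebra)+
  have s: "?x + ?y = 1" "?x * C + ?y * A = B"
    unfolding e using A by (simp_all add: divide_simps; algebra?)+
  have key: "x + y = 1 \<and> - (x * C) - y * A = - B" if "x + y = 1" "x * C + y * A = B" for x y
    using that by (auto simp: algebra_simps)
  have "num h [a, c] * (fps_const ?x * geom h a + fps_const ?y * geom h c) =
      fps_const ?x * (lin h a * geom h a) * lin h c + fps_const ?y * (lin h c * geom h c) * lin h a"
    by (simp add: num_def algebra_simps)
  also have "\<dots> = num h [b]"
  proof (rule fps_ext)
    fix n :: nat
    consider "n = 0" | "n = 1" | "n > 1" by linarith
    then show "(fps_const ?x * (lin h a * geom h a) * lin h c + fps_const ?y * (lin h c * geom h c) * lin h a) $ n = num h [b] $ n"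
      unfolding lin_geom using key[OF s]
      by cases (simp_all add: num_def lin_nth A_def[symmetric] B_def[symmetric] C_def[symmetric]
          del: times_divide_eq_left times_divide_eq_right)
  qed
  finally show "num h [b] = num h [a, c] * (fps_const ?x * geom h a + fps_const ?y * geom h c)" ..
qed simp

lemma zcoeff_geom: "zcoeff (geom h a) n = (if n < 0 then 0 else qpow h (a * of_int n))"
  by (simp add: zcoeff_def geom_nth)

lemma zcoeff_add: "zcoeff (f + g) n = zcoeff f n + zcoeff g n"
  and zcoeff_const_mult: "zcoeff (fps_const c * f) n = c * zcoeff f n"
  and zcoeff_const: "zcoeff (fps_const c) n = (if n = 0 then c else 0)"
  by (auto simp: zcoeff_def)

section \<open>Commutators of normally ordered exponentials\<close>

context fock_generic
begin

text \<open>The two orders of a product expand the same rational function of \<open>w/z\<close> at zero and at infinity,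
  so their difference is a sum of delta functions at its poles.\<close>

lemma commutator_no_poles:
  assumes v: "v \<in> VV p L" and "lam F G = 0" "lam G F = 0"
    and "gam F G = 1" "gam G F = 1" "qpow h (kq G F) = qpow h (kq F G)"
  shows "nexp h k F s (nexp h k G t v) - nexp h k G t (nexp h k F s v) = 0"
proof -
  have "zcoeff 1 (- n) = zcoeff 1 n" for n by (auto simp: zcoeff_def)
  then show ?thesis by (simp add: nexp_nexp[OF v] BB_swap[of p G F] assms)
qed

text \<open>Inverting q in the zero and the pole and exchanging z with w multiplies the rational
  function by q^{a-b}. Hypothesis \<open>k\<close> compensates this, so that the two contractions,
  with their powers of q, expand the same function.\<close>

lemma commutator_one_pole:
  assumes v: "v \<in> VV p L" and s: "s + zeta F p \<in> \<int>" and l: "lam F G = 0" "lam G F = 0"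
    and g: "gam F G = num h [b] * inverse (num h [a])" "gam G F = num h [- b] * inverse (num h [- a])"
    and k: "qpow h (kq G F) = qpow h (kq F G + b - a)"
  shows "nexp h k F s (nexp h k G t v) - nexp h k G t (nexp h k F s v) =
    scl (qpow h (kq F G) * (1 - qpow h (b - a)) * qpow h (a * s)) (nexp h k (lf_scale h a F \<oplus>\<^sub>l G) (s + t) v)"
proof -
  define A B where AB: "A = qpow h a" "B = qpow h b"
  have ne: "A \<noteq> 0" "B \<noteq> 0" by (simp_all add: AB)
  have qBA: "qpow h (b - a) = B / A" by (simp add: AB qpow_add[of b "- a", simplified] qpow_minus)
  have k': "qpow h (kq G F) = qpow h (kq F G) * (B / A)"
    unfolding k qBA[symmetric] by (simp add: qmerge add_diff_eq)
  let ?g = "\<lambda>n. qpow h (kq F G) * zcoeff (gam F G) n"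
  let ?g' = "\<lambda>n. qpow h (kq G F) * zcoeff (gam G F) (- n)"
  have "?g n = qpow h (kq F G) * (1 - qpow h (b - a)) * qpow h (a * of_int n) + ?g' n" for n
  proof -
    have 1: "zcoeff (gam F G) n = (if n = 0 then B / A else 0) + (1 - B / A) * (if n < 0 then 0 else qpow h (a * of_int n))"
      unfolding g partial_fraction_11 by (simp add: zcoeff_add zcoeff_const_mult zcoeff_const zcoeff_geom AB)
    have 2: "zcoeff (gam G F) (- n) = (if n = 0 then A / B else 0) + (1 - A / B) * (if n > 0 then 0 else qpow h (a * of_int n))"
      unfolding g partial_fraction_11 by (simp add: zcoeff_add zcoeff_const_mult zcoeff_const zcoeff_geom AB qpow_minus)
    have "B / A * (1 - A / B) = - (1 - B / A)" "B / A * (A / B) = 1" using ne by (simp_all add: field_simps)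
    then show ?thesis unfolding 1 2 k' qBA
      by (cases n "0::int" rule: linorder_cases) (simp_all add: algebra_simps ne)
  qed
  then have "nexp h k F s (nexp h k G t v) =
      BB p F G (\<lambda>n. (qpow h (kq F G) * (1 - qpow h (b - a))) * qpow h (a * of_int n) + ?g' n) s t v"
    by (simp add: nexp_nexp[OF v] l)
  also have "\<dots> = scl (qpow h (kq F G) * (1 - qpow h (b - a))) (BB p F G (\<lambda>n. qpow h (a * of_int n)) s t v)
      + nexp h k G t (nexp h k F s v)"
    by (simp add: BB_add[OF v] BB_scl nexp_nexp_reverse[OF v, of G t F s] l)
  finally show ?thesis by (simp add: BB_geometric[OF v s] scl_scl mult.assoc)
qed

lemma commutator_two_poles:
  assumes v: "v \<in> VV p L" and s: "s + zeta F p \<in> \<int>" and l: "lam F G = 0" "lam G F = 0"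
    and g: "gam F G = num h [b, d] * inverse (num h [a, c])" "gam G F = num h [- b, - d] * inverse (num h [- a, - c])"
    and k: "qpow h (kq G F) = qpow h (kq F G + b + d - a - c)" and ac: "qpow h a \<noteq> qpow h c"
  shows "nexp h k F s (nexp h k G t v) - nexp h k G t (nexp h k F s v) =
    scl (qpow h (kq F G) * ((1 - qpow h (b - a)) * (1 - qpow h (d - a)) / (1 - qpow h (c - a))) * qpow h (a * s))
      (nexp h k (lf_scale h a F \<oplus>\<^sub>l G) (s + t) v)
    + scl (qpow h (kq F G) * ((1 - qpow h (b - c)) * (1 - qpow h (d - c)) / (1 - qpow h (a - c))) * qpow h (c * s))
      (nexp h k (lf_scale h c F \<oplus>\<^sub>l G) (s + t) v)"
proof -
  define A B C D where AB: "A = qpow h a" "B = qpow h b" "C = qpow h c" "D = qpow h d"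
  have ne: "A \<noteq> 0" "B \<noteq> 0" "C \<noteq> 0" "D \<noteq> 0" "A - C \<noteq> 0" "C - A \<noteq> 0" using ac by (auto simp: AB)
  have qd: "qpow h (x - y) = qpow h x / qpow h y" for x y
    using qpow_add[of x "- y"] by (simp add: qpow_minus)
  have k': "qpow h (kq G F) = qpow h (kq F G) * (B * D / (A * C))"
    unfolding k qd qpow_add by (simp add: AB)
  define x y where xy: "x = (1 - B / A) * (1 - D / A) / (1 - C / A)" "y = (1 - B / C) * (1 - D / C) / (1 - A / C)"
  define x' y' where xy': "x' = (1 - A / B) * (1 - A / D) / (1 - A / C)" "y' = (1 - C / B) * (1 - C / D) / (1 - C / A)"
  have e: "x = (A - B) * (A - D) / (A * (A - C))" "y = - ((C - B) * (C - D) / (C * (A - C)))"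
    "x' = - (C * ((A - B) * (A - D)) / (B * D * (A - C)))" "y' = A * ((C - B) * (C - D)) / (B * D * (A - C))"
    unfolding xy xy' using ne by (simp_all add: divide_simps; algebra)+
  \<comment> \<open>Expanded at infinity, a simple pole yields minus the complementary half of the
    same bilateral series; so, after rescaling, the coefficients for the reversed order are -x and
    -y.\<close>
  have r: "B * D / (A * C) * x' = - x" "B * D / (A * C) * y' = - y"
    unfolding e using ne by (simp_all add: divide_simps)
  have r0: "B * D / (A * C) + x + y = 1"
    unfolding e using ne by (simp add: divide_simps) algebra
  let ?g = "\<lambda>n. qpow h (kq F G) * zcoeff (gam F G) n"
  let ?g' = "\<lambda>n. qpow h (kq G F) * zcoeff (gam G F) (- n)"
  have gg: "?g n = qpow h (kq F G) * x * qpow h (a * of_int n) + (qpow h (kq F G) * y * qpow h (c * of_int n) + ?g' n)" for n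
  proof -
    have 1: "zcoeff (gam F G) n = (if n = 0 then B * D / (A * C) else 0) + x * (if n < 0 then 0 else qpow h (a * of_int n))
        + y * (if n < 0 then 0 else qpow h (c * of_int n))"
      unfolding g partial_fraction_22[OF ac] by (simp add: zcoeff_add zcoeff_const_mult zcoeff_const zcoeff_geom AB xy)
    have ac': "qpow h (- a) \<noteq> qpow h (- c)" using ac by (simp add: qpow_minus)
    have "1 / (B * D) / (1 / (A * C)) = A * C / (B * D)" by simp
    then have 2: "zcoeff (gam G F) (- n) = (if n = 0 then A * C / (B * D) else 0) + x' * (if n > 0 then 0 else qpow h (a * of_int n))
        + y' * (if n > 0 then 0 else qpow h (c * of_int n))"
      unfolding g partial_fraction_22[OF ac']
      by (simp add: zcoeff_add zcoeff_const_mult zcoeff_const zcoeff_geom AB xy' qpow_minus)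
    have 3: "?g' n = qpow h (kq F G) * ((if n = 0 then 1 else 0) - x * (if n > 0 then 0 else qpow h (a * of_int n))
        - y * (if n > 0 then 0 else qpow h (c * of_int n)))"
    proof -
      have "B * D / (A * C) * zcoeff (gam G F) (- n) = (if n = 0 then B * D / (A * C) * (A * C / (B * D)) else 0)
          + B * D / (A * C) * x' * (if n > 0 then 0 else qpow h (a * of_int n))
          + B * D / (A * C) * y' * (if n > 0 then 0 else qpow h (c * of_int n))"
        unfolding 2 by (simp add: distrib_left mult.assoc)
      then have "B * D / (A * C) * zcoeff (gam G F) (- n) = (if n = 0 then 1 else 0)
          - x * (if n > 0 then 0 else qpow h (a * of_int n)) - y * (if n > 0 then 0 else qpow h (c * of_int n))"
        unfolding r using ne by simp
      then show ?thesis unfolding k' by (simp only: mult.assoc)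
    qed
    show ?thesis unfolding 3 1 using r0
      by (cases n "0::int" rule: linorder_cases) (simp_all add: distrib_left[symmetric] right_diff_distrib' algebra_simps)
  qed
  have "nexp h k F s (nexp h k G t v) =
      BB p F G (\<lambda>n. qpow h (kq F G) * x * qpow h (a * of_int n) + (qpow h (kq F G) * y * qpow h (c * of_int n) + ?g' n)) s t v"
    unfolding gg[symmetric] by (simp add: nexp_nexp[OF v] l)
  also have "\<dots> = scl (qpow h (kq F G) * x) (BB p F G (\<lambda>n. qpow h (a * of_int n)) s t v)
      + (scl (qpow h (kq F G) * y) (BB p F G (\<lambda>n. qpow h (c * of_int n)) s t v) + nexp h k G t (nexp h k F s v))"
    by (simp add: BB_add[OF v] BB_scl nexp_nexp_reverse[OF v, of G t F s] l)
  finally show ?thesis by (simp add: BB_geometric[OF v s] scl_scl mult.assoc qd xy AB)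
qed

end

section \<open>Linearity\<close>

text \<open>Currents are plain functions, so linearity has to be tracked: it extends identities from
  vectors of one charge to arbitrary ones, and products at one point are linear only if their
  support on each basis vector is finite.\<close>

definition linr :: "(fock \<Rightarrow> fock) \<Rightarrow> bool" where
  "linr f \<longleftrightarrow> (\<forall>v w. f (v + w) = f v + f w) \<and> (\<forall>c v. f (scl c v) = scl c (f v))"

lemma linr_add: "linr f \<Longrightarrow> f (v + w) = f v + f w"
  and linr_scl: "linr f \<Longrightarrow> f (scl c v) = scl c (f v)"
  by (auto simp: linr_def)

lemma linr_zero: "linr f \<Longrightarrow> f 0 = 0"
  using linr_scl[of f 0 0] by simp

lemma linr_sum: "linr f \<Longrightarrow> f (\<Sum>x\<in>I. g x) = (\<Sum>x\<in>I. f (g x))"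
  by (induction I rule: infinite_finite_induct) (auto simp: linr_add linr_zero)

lemma linr_app: "linr (app f)"
  by (simp add: linr_def app_add app_scl)

lemma linr_linext: "linr (linext f)"
  by (simp add: linr_def linext_add linext_scl)

lemma linr_expQ: "linr (expQ u)"
  by (simp add: expQ_def linr_linext)

lemma linr_const_zero: "linr (\<lambda>v. 0)"
  and linr_id: "linr (\<lambda>v. v)"
  and linr_compose: "linr f \<Longrightarrow> linr g \<Longrightarrow> linr (\<lambda>v. f (g v))"
  and linr_plus: "linr f \<Longrightarrow> linr g \<Longrightarrow> linr (\<lambda>v. f v + g v)"
  and linr_minus: "linr f \<Longrightarrow> linr g \<Longrightarrow> linr (\<lambda>v. f v - g v)"
  and linr_uminus: "linr f \<Longrightarrow> linr (\<lambda>v. - f v)"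
  and linr_scale: "linr f \<Longrightarrow> linr (\<lambda>v. scl c (f v))"
  and linr_if: "(P \<Longrightarrow> linr f) \<Longrightarrow> (\<not> P \<Longrightarrow> linr g) \<Longrightarrow> linr (\<lambda>v. if P then f v else g v)"
  by (auto simp: linr_def scl_add scl_diff scl_scl scl_minus mult.commute algebra_simps)

lemma fock_expand: "v = (\<Sum>b\<in>Poly_Mapping.keys v. scl (Poly_Mapping.lookup v b) (Poly_Mapping.single b 1))"
  by (rule poly_mapping_eqI)
    (simp add: lookup_sum lookup_single when_def in_keys_iff sum.delta[OF finite_keys])

lemma linr_expand:
  assumes "linr f"
  shows "f v = (\<Sum>b\<in>Poly_Mapping.keys v. scl (Poly_Mapping.lookup v b) (f (Poly_Mapping.single b 1)))"
  by (subst fock_expand) (simp add: linr_sum[OF assms] linr_scl[OF assms] del: scl_single)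

lemma linr_eqI:
  assumes "linr f" "linr g" "\<And>b. b \<in> Poly_Mapping.keys v \<Longrightarrow> f (Poly_Mapping.single b 1) = g (Poly_Mapping.single b 1)"
  shows "f v = g v"
  unfolding linr_expand[OF assms(1), of v] linr_expand[OF assms(2), of v] using assms(3) by simp

lemma linr_finite_support:
  assumes l: "\<And>t. linr (f t)" and fin: "\<And>b. finite {t. f t (Poly_Mapping.single b 1) \<noteq> 0}"
  shows "finite {t. f t v \<noteq> 0}"
proof (rule finite_subset)
  show "{t. f t v \<noteq> 0} \<subseteq> (\<Union>b\<in>Poly_Mapping.keys v. {t. f t (Poly_Mapping.single b 1) \<noteq> 0})"
  proof
    fix t assume "t \<in> {t. f t v \<noteq> 0}"
    then have "(\<Sum>b\<in>Poly_Mapping.keys v. scl (Poly_Mapping.lookup v b) (f t (Poly_Mapping.single b 1))) \<noteq> 0"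
      using linr_expand[OF l[of t], of v] by simp
    then obtain b where "b \<in> Poly_Mapping.keys v" "scl (Poly_Mapping.lookup v b) (f t (Poly_Mapping.single b 1)) \<noteq> 0"
      by (meson sum.neutral)
    then show "t \<in> (\<Union>b\<in>Poly_Mapping.keys v. {t. f t (Poly_Mapping.single b 1) \<noteq> 0})" by auto
  qed
qed (use fin in auto)

lemma linr_Sum_any:
  assumes l: "\<And>t. linr (f t)" and fin: "\<And>b. finite {t. f t (Poly_Mapping.single b 1) \<noteq> 0}"
  shows "linr (\<lambda>v. Sum_any (\<lambda>t. f t v))"
  unfolding linr_def
proof (intro conjI allI)
  fix v w c
  show "Sum_any (\<lambda>t. f t (v + w)) = Sum_any (\<lambda>t. f t v) + Sum_any (\<lambda>t. f t w)"
    by (simp add: linr_add[OF l] Sum_any.distrib linr_finite_support[OF l fin])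
  show "Sum_any (\<lambda>t. f t (scl c v)) = scl c (Sum_any (\<lambda>t. f t v))"
    by (simp add: linr_scl[OF l] Sum_any_scl)
qed

lemma linr_cmult:
  assumes "\<And>t. linr (A t)" "\<And>t. linr (B t)"
    and "\<And>b s. finite {t. A t (B (s - t) (Poly_Mapping.single b 1)) \<noteq> 0}"
  shows "linr (cmult A B s)"
proof -
  have "linr (\<lambda>v. Sum_any (\<lambda>t. A t (B (s - t) v)))"
    by (rule linr_Sum_any) (use assms in \<open>auto intro: linr_compose\<close>)
  then show ?thesis by (simp add: cmult_def[abs_def])
qed

lemma VV_basis: "Poly_Mapping.single b 1 \<in> VV (fst b) (lev (snd b))"
  by (cases b) (auto intro: VV_single)

lemma linr_cscale: "linr (A s) \<Longrightarrow> linr (cscale h u A s)"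
  unfolding cscale_def[abs_def] by (intro linr_scale)

lemma finite_sum_support:
  assumes "finite I" "\<And>x. x \<in> I \<Longrightarrow> finite {t. f x t \<noteq> (0 :: fock)}"
  shows "finite {t. (\<Sum>x\<in>I. f x t) \<noteq> 0}"
proof (rule finite_subset)
  show "{t. (\<Sum>x\<in>I. f x t) \<noteq> 0} \<subseteq> (\<Union>x\<in>I. {t. f x t \<noteq> 0})"
    by (auto dest: sum.not_neutral_contains_not_neutral)
qed (use assms in auto)

lemma Sum_any_sum:
  assumes "finite I" "\<And>x. x \<in> I \<Longrightarrow> finite {t. f x t \<noteq> 0}"
  shows "Sum_any (\<lambda>t. \<Sum>x\<in>I. f x t) = (\<Sum>x\<in>I. Sum_any (\<lambda>t. f x t :: fock))"
  using assms
proof (induction I rule: finite_induct)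
  case (insert x I)
  have "finite {t. (\<Sum>x\<in>I. f x t) \<noteq> 0}"
    by (rule finite_sum_support) (use insert in auto)
  then show ?case using insert by (simp add: Sum_any.distrib)
qed simp

lemma Sum_any_translate: "Sum_any (\<lambda>t::complex. f (t + a)) = Sum_any f"
  by (rule Sum_any.reindex_cong[of "\<lambda>n. n + a", symmetric])
    (auto intro!: bij_betwI[of _ _ _ "\<lambda>n. n - a"])

context fock_rep
begin

lemma linr_creation: "linr (creation_part h k F s)" and linr_annihilation: "linr (annihilation_part h k F s)"
  by (auto simp: creation_part_eq[abs_def] annihilation_part_eq[abs_def] intro!: linr_if linr_app linr_const_zero)

lemma linr_nexp: "linr (nexp h k F s)"
proof -
  let ?A = "annihilation_part h k F" and ?C = "creation_part h k F" and ?Z = "zero_mode_part h F"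
  have lZ: "linr (?Z t)" for t by (simp add: zero_mode_part_def linr_linext)
  have 1: "linr (cmult ?Z ?A \<tau>)" for \<tau>
  proof (rule linr_cmult[OF lZ linr_annihilation])
    fix b \<tau>
    show "finite {t. ?Z t (?A (\<tau> - t) (Poly_Mapping.single b 1)) \<noteq> 0}"
      by (rule finite_subset[of _ "{- zeta F (fst b)}"])
        (auto simp: cmult_zero_mode_annihilation(1)[OF VV_basis] split: if_splits)
  qed
  have "linr (cmult ?C (cmult ?Z ?A) s)"
  proof (rule linr_cmult[OF linr_creation 1])
    fix b s
    let ?v = "Poly_Mapping.single b (1 :: complex) :: fock" and ?\<zeta> = "zeta F (fst b)"
    have "{t. ?C t (cmult ?Z ?A (s - t) ?v) \<noteq> 0} \<subseteq> (\<lambda>d. s + ?\<zeta> - of_int d) ` {0..lev (snd b)}"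
    proof
      fix t assume "t \<in> {t. ?C t (cmult ?Z ?A (s - t) ?v) \<noteq> 0}"
      then have "?C t (?A (s + ?\<zeta> - t) ?v) \<noteq> 0"
        by (auto simp: cmult_zero_mode_annihilation(2)[OF VV_basis] linr_scl[OF linr_creation] algebra_simps)
      from creation_annihilation_support[OF VV_basis this]
      show "t \<in> (\<lambda>d. s + ?\<zeta> - of_int d) ` {0..lev (snd b)}" by auto
    qed
    then show "finite {t. ?C t (cmult ?Z ?A (s - t) ?v) \<noteq> 0}" by (rule finite_subset) simp
  qed
  then show ?thesis unfolding nexp_def[abs_def] by (rule linr_compose[OF linr_expQ])
qed

lemma nexp_nz:
  assumes v: "v \<in> VV p L" and "nexp h k F s v \<noteq> 0"
  shows "\<exists>r \<le> L. s + zeta F p = of_int r"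
proof -
  let ?r = "\<lfloor>Re (s + zeta F p)\<rfloor>"
  have i: "s + zeta F p \<in> \<int>" using assms by (auto simp: nexp_eq[OF v] split: if_splits)
  have "MM F ?r v \<noteq> 0" using assms i by (auto simp: nexp_eq[OF v])
  then have "\<not> L - ?r < 0" using VV_neg[OF VV_MM[OF v]] by blast
  then show ?thesis using Ints_Re_floor[OF i] by (intro exI[of _ ?r]) auto
qed

lemma finite_nexp_right:
  assumes v: "v \<in> VV p L"
  shows "finite {j::nat. nexp h k F (s + of_nat j) v \<noteq> 0}"
proof (rule finite_subset)
  show "{j::nat. nexp h k F (s + of_nat j) v \<noteq> 0} \<subseteq> {..nat \<lceil>of_int L - Re (s + zeta F p)\<rceil>}"
  proof
    fix j assume "j \<in> {j::nat. nexp h k F (s + of_nat j) v \<noteq> 0}"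
    then obtain r where r: "r \<le> L" "s + of_nat j + zeta F p = of_int r" using nexp_nz[OF v] by blast
    have "Re s + real j + Re (zeta F p) = of_int r" using arg_cong[OF r(2), of Re] by simp
    moreover have "(of_int r :: real) \<le> of_int L" using r(1) by simp
    ultimately have "real j \<le> of_int L - Re (s + zeta F p)" by simp
    then show "j \<in> {..nat \<lceil>of_int L - Re (s + zeta F p)\<rceil>}" by (simp add: le_nat_iff le_ceiling_iff)
  qed
qed simp

lemma cscale_nexp:
  assumes v: "v \<in> VV p L"
  shows "cscale h u (nexp h k F) s v = nexp h k (lf_scale h u F) s v"
proof (cases "s + zeta F p \<in> \<int>")
  case True
  define r where "r = \<lfloor>Re (s + zeta F p)\<rfloor>"
  have r: "s + zeta F p = of_int r" unfolding r_def by (rule Ints_Re_floor[OF True])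
  have c: "cQ (lf_scale h u F) = cQ F" by (simp add: lf_scale_def)
  have M: "MM (lf_scale h u F) r v = scl (qpow h (- (u * of_int r))) (MM F r v)"
  proof -
    have q: "qpow h (- (u * of_int r)) = qpow h (u * of_int (d - r)) * qpow h (- (u * of_int d))" for d
      by (simp add: qpow_add[symmetric] algebra_simps)
    have "cc (lf_scale h u F) (d - r) * aa (lf_scale h u F) d = scal (qpow h (- (u * of_int r))) * (cc F (d - r) * aa F d)" for d
    proof -
      have "scal x * A * (scal y * B) = scal x * scal y * (A * B)" for x y A B
        using scal_commute[of A y] by (metis mult.assoc)
      then show ?thesis unfolding aa_scale cc_scale q[of d] scal_mult .
    qed
    then show ?thesis
      by (simp add: MM_sum[OF v, of "{0..L}"] app_times app_scal scl_sum)
  qed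
  have "qpow h (clq F p + u * zeta F p) * qpow h (- (u * of_int r)) = qpow h (- (u * s)) * qpow h (clq F p)"
    unfolding r[symmetric] by (simp add: qpow_add[symmetric] algebra_simps)
  then show ?thesis
    using True unfolding cscale_def nexp_eq[OF v] zeta_scale clq_scale c r_def[symmetric] M
    by (simp add: app_scl scl_scl)
next
  case False
  then show ?thesis by (simp add: cscale_def nexp_eq[OF v] zeta_scale)
qed

text \<open>F(z) G(w) has no contraction, while G(w) F(z) contracts to a series in z/w. The factor
  \<open>f\<close> cancels this series up to the constant \<open>c\<close>, which accounts for the
  powers of q from the zero modes; only the term n = 0 survives.\<close>

lemma series_exchange:
  assumes v: "v \<in> VV p L" and l: "lam F G = 0" "lam G F = 0" and g: "gam F G = 1"
    and f: "f * gam G F = fps_const c" "c * qpow h (kq G F) = qpow h (kq F G)"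
  shows "Sum_any (\<lambda>j::nat. scl (f $ j) (nexp h k G (t - of_nat j) (nexp h k F (s + of_nat j) v))) =
    nexp h k F s (nexp h k G t v)"
proof -
  let ?\<gamma> = "zcoeff (gam G F)" and ?q = "qpow h (kq G F)"
  define S where "S = {n::int. N2 p F G (s - of_int n) (t + of_int n) v \<noteq> 0}"
  define N where "N n = N2 p F G (s - of_int n) (t + of_int n) v" for n :: int
  have S: "finite S" unfolding S_def by (rule finite_N2[OF v])
  have BS: "BB p F G g s t v = (\<Sum>n\<in>S. scl (g n) (N n))" for g
    unfolding BB_def N_def by (rule Sum_any.expand_superset[OF S]) (auto simp: S_def)
  have R: "nexp h k G (t - of_nat j) (nexp h k F (s + of_nat j) v) =
      (\<Sum>n\<in>S. scl (?q * ?\<gamma> (- n - int j)) (N n))" for j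
  proof -
    have "nexp h k G (t - of_nat j) (nexp h k F (s + of_nat j) v) =
        BB p F G (\<lambda>n. ?q * ?\<gamma> (- n)) (s + of_int (int j)) (t - of_nat j) v"
      by (simp add: nexp_nexp_reverse[OF v] l)
    also have "\<dots> = BB p F G (\<lambda>n. ?q * ?\<gamma> (- n - int j)) s t v"
      unfolding BB_shift by (simp add: minus_add_distrib)
    finally show ?thesis by (simp add: BS)
  qed
  \<comment> \<open>Contraction coefficients vanish once -n - j is negative, so j needs to run only
    up to the largest -n with n in S.\<close>
  define J where "J = nat (Max (insert 0 (uminus ` S)))"
  have J: "- n \<le> int J" if "n \<in> S" for n
  proof -
    have "- n \<le> Max (insert 0 (uminus ` S))" using that S by (intro Max_ge) auto
    then show ?thesis by (simp add: J_def)
  qed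
  have "Sum_any (\<lambda>j::nat. scl (f $ j) (nexp h k G (t - of_nat j) (nexp h k F (s + of_nat j) v))) =
      Sum_any (\<lambda>j::nat. \<Sum>n\<in>S. scl (f $ j * (?q * ?\<gamma> (- n - int j))) (N n))"
    unfolding R scl_sum scl_scl ..
  also have "\<dots> = (\<Sum>j\<le>J. \<Sum>n\<in>S. scl (f $ j * (?q * ?\<gamma> (- n - int j))) (N n))"
  proof (rule Sum_any.expand_superset, simp, rule subsetI, rule ccontr)
    fix j assume j: "j \<in> {j. (\<Sum>n\<in>S. scl (f $ j * (?q * ?\<gamma> (- n - int j))) (N n)) \<noteq> 0}" "j \<notin> {..J}"
    have "?\<gamma> (- n - int j) = 0" if "n \<in> S" for n
      using J[OF that] j(2) by (auto simp: zcoeff_def)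
    then have "(\<Sum>n\<in>S. scl (f $ j * (?q * ?\<gamma> (- n - int j))) (N n)) = 0" by simp
    then show False using j(1) by blast
  qed
  also have "\<dots> = (\<Sum>n\<in>S. scl (\<Sum>j\<le>J. f $ j * (?q * ?\<gamma> (- n - int j))) (N n))"
    unfolding scl_sum_left by (rule sum.swap)
  also have "\<dots> = (\<Sum>n\<in>S. scl (qpow h (kq F G) * zcoeff (gam F G) n) (N n))"
  proof (intro sum.cong refl arg_cong[of _ _ "\<lambda>c. scl c _"])
    fix n assume n: "n \<in> S"
    show "(\<Sum>j\<le>J. f $ j * (?q * ?\<gamma> (- n - int j))) = qpow h (kq F G) * zcoeff (gam F G) n"
    proof (cases "n > 0")
      case True
      then show ?thesis using g by (auto simp: zcoeff_def)
    next
      case False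
      define m where "m = nat (- n)"
      have m: "- n = int m" "m \<le> J" using False J[OF n] by (auto simp: m_def)
      have "(\<Sum>j\<le>J. f $ j * (?q * ?\<gamma> (- n - int j))) = (\<Sum>j\<le>m. f $ j * (?q * gam G F $ (m - j)))"
        unfolding m(1)
        by (rule sum.mono_neutral_cong_right) (use m(2) in \<open>auto simp: zcoeff_def nat_diff_distrib\<close>)
      also have "\<dots> = ?q * (f * gam G F) $ m"
        by (simp add: fps_mult_nth sum_distrib_left atMost_atLeast0 algebra_simps)
      also have "\<dots> = (if n = 0 then qpow h (kq F G) else 0)"
        unfolding f(1) using m f(2) by (auto simp: mult.commute)
      finally show ?thesis using g False by (auto simp: zcoeff_def)
    qed
  qed
  also have "\<dots> = nexp h k F s (nexp h k G t v)"
    unfolding BS[symmetric] by (simp add: nexp_nexp[OF v] l)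
  finally show ?thesis .
qed

text \<open>\<open>rep p X I c F u\<close>: on vectors of charge \<open>p\<close>, \<open>X(z)\<close> is \<open>z\<^sup>u\<close> times a linear combination of normally
  ordered exponentials.\<close>

definition rep :: "charge \<Rightarrow> current \<Rightarrow> 'i set \<Rightarrow> ('i \<Rightarrow> complex) \<Rightarrow> ('i \<Rightarrow> lform) \<Rightarrow> complex \<Rightarrow> bool" where
  "rep p X I c F u \<longleftrightarrow> finite I \<and>
    (\<forall>L v s. v \<in> VV p L \<longrightarrow> X s v = (\<Sum>x\<in>I. scl (c x) (nexp h k (F x) (s + u) v)))"

lemma repD: "rep p X I c F u \<Longrightarrow> v \<in> VV p L \<Longrightarrow> X s v = (\<Sum>x\<in>I. scl (c x) (nexp h k (F x) (s + u) v))"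
  and rep_finite: "rep p X I c F u \<Longrightarrow> finite I"
  by (auto simp: rep_def)

lemma rep_nexp: "rep p (nexp h k F) {()} (\<lambda>_. 1) (\<lambda>_. F) 0"
  by (simp add: rep_def)

lemma rep_cong:
  assumes "rep p X I c F u" "\<And>x. x \<in> I \<Longrightarrow> c x = c' x" "\<And>x. x \<in> I \<Longrightarrow> nexp h k (F x) = nexp h k (F' x)"
  shows "rep p X I c' F' u"
  unfolding rep_def
proof (intro conjI allI impI)
  fix L v s assume v: "v \<in> VV p L"
  show "X s v = (\<Sum>x\<in>I. scl (c' x) (nexp h k (F' x) (s + u) v))"
    unfolding repD[OF assms(1) v]
    by (intro sum.cong refl) (simp add: assms(2,3))
qed (rule rep_finite[OF assms(1)])

lemma finite_cmult_nexp_rep: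
  assumes X: "rep p X I c F u" and v: "v \<in> VV p L"
    and g: "\<And>x. x \<in> I \<Longrightarrow> lam G (F x) = 0" "\<And>x. x \<in> I \<Longrightarrow> gam G (F x) = 1"
  shows "finite {t. nexp h k G t (X (s - t) v) \<noteq> 0}"
proof -
  have e: "nexp h k G t (X (s - t) v) = (\<Sum>x\<in>I. scl (c x) (nexp h k G t (nexp h k (F x) (s + u - t) v)))" for t
    unfolding repD[OF X v] by (simp add: linr_sum[OF linr_nexp] linr_scl[OF linr_nexp] algebra_simps)
  show ?thesis unfolding e
  proof (rule finite_sum_support[OF rep_finite[OF X]])
    fix x assume "x \<in> I"
    then show "finite {t. scl (c x) (nexp h k G t (nexp h k (F x) (s + u - t) v)) \<noteq> 0}"
      by (intro finite_subset[OF _ cmult_nexp(2)[OF v g(1) g(2)]]) auto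
  qed
qed

lemma rep_cmult_left:
  assumes X: "rep p X I c F u"
    and g: "\<And>x. x \<in> I \<Longrightarrow> lam G (F x) = 0" "\<And>x. x \<in> I \<Longrightarrow> gam G (F x) = 1"
  shows "rep p (cmult (nexp h k G) X) I (\<lambda>x. c x * qpow h (kq G (F x))) (\<lambda>x. G \<oplus>\<^sub>l F x) u"
  unfolding rep_def
proof (intro conjI allI impI)
  fix L v s assume v: "v \<in> VV p L"
  have e: "nexp h k G t (X (s - t) v) = (\<Sum>x\<in>I. scl (c x) (nexp h k G t (nexp h k (F x) (s + u - t) v)))" for t
    unfolding repD[OF X v] by (simp add: linr_sum[OF linr_nexp] linr_scl[OF linr_nexp] algebra_simps)
  have "cmult (nexp h k G) X s v = (\<Sum>x\<in>I. Sum_any (\<lambda>t. scl (c x) (nexp h k G t (nexp h k (F x) (s + u - t) v))))"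
    unfolding cmult_def e
  proof (rule Sum_any_sum[OF rep_finite[OF X]])
    fix x assume "x \<in> I"
    then show "finite {t. scl (c x) (nexp h k G t (nexp h k (F x) (s + u - t) v)) \<noteq> 0}"
      by (intro finite_subset[OF _ cmult_nexp(2)[OF v g(1) g(2)]]) auto
  qed
  also have "\<dots> = (\<Sum>x\<in>I. scl (c x) (cmult (nexp h k G) (nexp h k (F x)) (s + u) v))"
    by (simp add: Sum_any_scl cmult_def)
  also have "\<dots> = (\<Sum>x\<in>I. scl (c x * qpow h (kq G (F x))) (nexp h k (G \<oplus>\<^sub>l F x) (s + u) v))"
    by (intro sum.cong refl) (simp add: cmult_nexp(1)[OF v g(1) g(2)] scl_scl)
  finally show "cmult (nexp h k G) X s v = (\<Sum>x\<in>I. scl (c x * qpow h (kq G (F x))) (nexp h k (G \<oplus>\<^sub>l F x) (s + u) v))" .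
qed (rule rep_finite[OF X])

lemma shift_zero: "(\<And>i. w i = 0) \<Longrightarrow> shift w p = p"
  by (simp add: shift_def)

lemma finite_cmult_rep_nexp:
  assumes X: "rep p X I c F u" and v: "v \<in> VV p L" and G: "\<And>i. cQ G i = 0"
    and g: "\<And>x. x \<in> I \<Longrightarrow> lam (F x) G = 0" "\<And>x. x \<in> I \<Longrightarrow> gam (F x) G = 1"
  shows "finite {t. X t (nexp h k G (s - t) v) \<noteq> 0}"
    and "Sum_any (\<lambda>t. X t (nexp h k G (s - t) v)) =
      (\<Sum>x\<in>I. scl (c x) (cmult (nexp h k (F x)) (nexp h k G) (s + u) v))"
proof -
  have e: "X t (nexp h k G (s - t) v) = (\<Sum>x\<in>I. scl (c x) (nexp h k (F x) (t + u) (nexp h k G (s - t) v)))" for t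
  proof -
    obtain L' where "nexp h k G (s - t) v \<in> VV p L'"
      using VV_nexp[OF v, of G "s - t"] shift_zero[of "cQ G" p] G by auto
    from repD[OF X this] show ?thesis .
  qed
  have fin: "finite {t. scl (c x) (nexp h k (F x) (t + u) (nexp h k G (s - t) v)) \<noteq> 0}" if "x \<in> I" for x
  proof -
    have "finite ((\<lambda>t. t - u) ` {t. nexp h k (F x) t (nexp h k G (s + u - t) v) \<noteq> 0})"
      by (rule finite_imageI, rule cmult_nexp(2)[OF v g(1)[OF that] g(2)[OF that]])
    moreover have "{t. scl (c x) (nexp h k (F x) (t + u) (nexp h k G (s - t) v)) \<noteq> 0} \<subseteq>
        (\<lambda>t. t - u) ` {t. nexp h k (F x) t (nexp h k G (s + u - t) v) \<noteq> 0}"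
    proof
      fix t assume "t \<in> {t. scl (c x) (nexp h k (F x) (t + u) (nexp h k G (s - t) v)) \<noteq> 0}"
      then show "t \<in> (\<lambda>t. t - u) ` {t. nexp h k (F x) t (nexp h k G (s + u - t) v) \<noteq> 0}"
        by (intro image_eqI[of _ _ "t + u"]) auto
    qed
    ultimately show ?thesis using finite_subset by blast
  qed
  show "finite {t. X t (nexp h k G (s - t) v) \<noteq> 0}"
    unfolding e by (rule finite_sum_support[OF rep_finite[OF X] fin])
  have "Sum_any (\<lambda>t. X t (nexp h k G (s - t) v)) =
      (\<Sum>x\<in>I. Sum_any (\<lambda>t. scl (c x) (nexp h k (F x) (t + u) (nexp h k G (s - t) v))))"
    unfolding e by (rule Sum_any_sum[OF rep_finite[OF X] fin])
  also have "\<dots> = (\<Sum>x\<in>I. scl (c x) (cmult (nexp h k (F x)) (nexp h k G) (s + u) v))"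
  proof (intro sum.cong refl)
    fix x
    have "Sum_any (\<lambda>t. nexp h k (F x) (t + u) (nexp h k G (s - t) v)) =
      Sum_any (\<lambda>t. nexp h k (F x) t (nexp h k G (s + u - t) v))"
      using Sum_any_translate[of "\<lambda>t. nexp h k (F x) t (nexp h k G (s + u - t) v)" u]
      by simp
    then show "Sum_any (\<lambda>t. scl (c x) (nexp h k (F x) (t + u) (nexp h k G (s - t) v))) =
        scl (c x) (cmult (nexp h k (F x)) (nexp h k G) (s + u) v)"
      by (simp add: Sum_any_scl cmult_def)
  qed
  finally show "Sum_any (\<lambda>t. X t (nexp h k G (s - t) v)) =
      (\<Sum>x\<in>I. scl (c x) (cmult (nexp h k (F x)) (nexp h k G) (s + u) v))" .
qed

lemma rep_cmult_right:
  assumes X: "rep p X I c F u" and G: "\<And>i. cQ G i = 0"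
    and g: "\<And>x. x \<in> I \<Longrightarrow> lam (F x) G = 0" "\<And>x. x \<in> I \<Longrightarrow> gam (F x) G = 1"
  shows "rep p (cmult X (nexp h k G)) I c (\<lambda>x. F x \<oplus>\<^sub>l G) u"
  unfolding rep_def
proof (intro conjI allI impI)
  fix L v s assume v: "v \<in> VV p L"
  have k0: "kq F' G = 0" for F' using G by (simp add: kq_def)
  have "cmult X (nexp h k G) s v = (\<Sum>x\<in>I. scl (c x) (cmult (nexp h k (F x)) (nexp h k G) (s + u) v))"
    unfolding cmult_def[of X] by (rule finite_cmult_rep_nexp(2)[OF X v G g])
  also have "\<dots> = (\<Sum>x\<in>I. scl (c x) (nexp h k (F x \<oplus>\<^sub>l G) (s + u) v))"
    by (intro sum.cong refl) (simp add: cmult_nexp(1)[OF v g(1) g(2)] k0)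
  finally show "cmult X (nexp h k G) s v = (\<Sum>x\<in>I. scl (c x) (nexp h k (F x \<oplus>\<^sub>l G) (s + u) v))" .
qed (rule rep_finite[OF X])

text \<open>The representation of \<open>X\<close> is assumed at every charge because
  \<open>Y\<close> shifts the charge before \<open>X\<close> acts.\<close>

lemma rep_product:
  assumes X: "\<And>p. rep p X I c F u" and lX: "\<And>s. linr (X s)" and Y: "rep p Y J d G u'" and v: "v \<in> VV p L"
  shows "X s (Y t v) = (\<Sum>x\<in>I. \<Sum>y\<in>J. scl (c x * d y) (nexp h k (F x) (s + u) (nexp h k (G y) (t + u') v)))"
proof -
  have "X s (Y t v) = (\<Sum>y\<in>J. scl (d y) (X s (nexp h k (G y) (t + u') v)))"
    unfolding repD[OF Y v] by (simp add: linr_sum[OF lX] linr_scl[OF lX])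
  also have "\<dots> = (\<Sum>y\<in>J. \<Sum>x\<in>I. scl (c x * d y) (nexp h k (F x) (s + u) (nexp h k (G y) (t + u') v)))"
  proof (intro sum.cong refl)
    fix y
    obtain L' where "nexp h k (G y) (t + u') v \<in> VV (shift (cQ (G y)) p) L'" using VV_nexp[OF v] by blast
    from repD[OF X this, of s]
    show "scl (d y) (X s (nexp h k (G y) (t + u') v)) =
      (\<Sum>x\<in>I. scl (c x * d y) (nexp h k (F x) (s + u) (nexp h k (G y) (t + u') v)))"
      by (simp add: scl_sum scl_scl mult.commute)
  qed
  finally show ?thesis by (subst sum.swap)
qed

end

section \<open>The contractions and representations of the currents\<close>

context fock_generic
begin

lemma qpow_xy_more:
  "qpow h ((k + 3) * of_nat m) = qpow h (of_nat m) ^ 3 * qpow h (k * of_nat m)"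
  "qpow h ((3 * k + 3) * of_nat m) = qpow h (of_nat m) ^ 3 * qpow h (k * of_nat m) ^ 3"
  "qpow h ((3 * k + 5) * of_nat m) = qpow h (of_nat m) ^ 5 * qpow h (k * of_nat m) ^ 3"
  "qpow h ((k - 1) * of_nat m) = qpow h (k * of_nat m) / qpow h (of_nat m)"
proof -
  show "qpow h ((k - 1) * of_nat m) = qpow h (k * of_nat m) / qpow h (of_nat m)"
  proof -
    have "qpow h (k * of_nat m) = qpow h ((k - 1) * of_nat m) * qpow h (of_nat m)"
      by (simp add: qmerge algebra_simps)
    then show ?thesis by simp
  qed
qed (simp_all add: qpow_of_nat_mult[of 3, symmetric, simplified] qpow_of_nat_mult[of 5, symmetric, simplified] qmerge algebra_simps)

lemma qpow_0_mult: "qpow h (0 * z) = 1"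
  by simp

lemmas el_bilinear = el_lf_add_left el_lf_add_right el_scale_left el_scale_right
lemmas qpow_monomials = mult_minus_left minus_minus qpow_minus qpow_xy qpow_xy_more qpow_0_mult

lemma num_inverse_nil: "num h bs * inverse (num h []) = num h bs"
  by (simp add: num_Nil)

lemma gam_Kl_left: "gam (Kl (- 1)) G = 1"
  using gam_eqI[of "Kl (- 1)" G "[]" "[]"] el_Kl_left_minus by (simp add: num_Nil)

lemma gam_Kl_right: "gam F (Kl 1) = 1"
  using gam_eqI[of F "Kl 1" "[]" "[]"] el_Kl_right_plus by (simp add: num_Nil)

lemma gam_GG_same:
  assumes "e \<in> {1, - 1}" "\<epsilon> \<in> {1, - 1}" "\<epsilon>' \<in> {1, - 1}"
  shows "gam (Gl e \<epsilon>) (Gl e \<epsilon>') = num h [of_int (e * (\<epsilon>' - \<epsilon>))]"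
proof -
  have "gam (Gl e \<epsilon>) (Gl e \<epsilon>') = num h [of_int (e * (\<epsilon>' - \<epsilon>))] * inverse (num h [])"
    by (rule gam_eqI) (use assms in \<open>auto simp: el_GG qpow_xy qpow_minus\<close>)
  then show ?thesis by (simp add: num_inverse_nil)
qed

text \<open>The poles q^{4k+4}, q^{2k+4} and q^{2k+2} are the supports of the three delta functions
  in the anticommutator, which carry K, 1 and T.\<close>

lemma gam_GG_pm:
  "gam (Gl 1 1) (Gl (- 1) 1) = num h [4 * k + 6] * inverse (num h [2 * k + 2, 4 * k + 4])"
  "gam (Gl 1 1) (Gl (- 1) (- 1)) = num h [] * inverse (num h [2 * k + 2])"
  "gam (Gl 1 (- 1)) (Gl (- 1) 1) = num h [] * inverse (num h [2 * k + 2])"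
  "gam (Gl 1 (- 1)) (Gl (- 1) (- 1)) = num h [] * inverse (num h [2 * k + 4])"
  "gam (Gl (- 1) 1) (Gl 1 1) = num h [- (4 * k + 6)] * inverse (num h [- (2 * k + 2), - (4 * k + 4)])"
  "gam (Gl (- 1) 1) (Gl 1 (- 1)) = num h [] * inverse (num h [- (2 * k + 2)])"
  "gam (Gl (- 1) (- 1)) (Gl 1 1) = num h [] * inverse (num h [- (2 * k + 2)])"
  "gam (Gl (- 1) (- 1)) (Gl 1 (- 1)) = num h [] * inverse (num h [- (2 * k + 4)])"
  by (rule gam_eqI; unfold el_GG qpow_monomials list.map sum_list.Cons sum_list.Nil; simp)+

lemma gam_GT:
  "gam (Gl 1 1) (Tl 1 (- 1)) = num h [] * inverse (num h [])"
  "gam (Gl 1 1) (Tl 1 1) = num h [3 * k + 5] * inverse (num h [3 * k + 3])"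
  "gam (Gl 1 1) (Tl (- 1) 1) = num h [k - 1, 3 * k + 5] * inverse (num h [k + 1, 3 * k + 3])"
  "gam (Gl 1 (- 1)) (Tl 1 (- 1)) = num h [] * inverse (num h [])"
  "gam (Gl 1 (- 1)) (Tl 1 1) = num h [k + 3] * inverse (num h [k + 1])"
  "gam (Gl 1 (- 1)) (Tl (- 1) 1) = num h [] * inverse (num h [])"
  "gam (Gl (- 1) 1) (Tl (- 1) 1) = num h [] * inverse (num h [])"
  "gam (Gl (- 1) 1) (Tl 1 1) = num h [- (3 * k + 5)] * inverse (num h [- (3 * k + 3)])"
  "gam (Gl (- 1) 1) (Tl 1 (- 1)) = num h [- (k - 1), - (3 * k + 5)] * inverse (num h [- (k + 1), - (3 * k + 3)])"
  "gam (Gl (- 1) (- 1)) (Tl (- 1) 1) = num h [] * inverse (num h [])"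
  "gam (Gl (- 1) (- 1)) (Tl 1 1) = num h [- (k + 3)] * inverse (num h [- (k + 1)])"
  "gam (Gl (- 1) (- 1)) (Tl 1 (- 1)) = num h [] * inverse (num h [])"
  by (rule gam_eqI; unfold Tl_def el_bilinear; simp only: el_GG qpow_monomials list.map sum_list.Cons sum_list.Nil;
      simp add: divide_simps; algebra?)+

lemma gam_TG:
  "gam (Tl 1 (- 1)) (Gl 1 1) = num h [] * inverse (num h [])"
  "gam (Tl 1 1) (Gl 1 1) = num h [- (3 * k + 5)] * inverse (num h [- (3 * k + 3)])"
  "gam (Tl (- 1) 1) (Gl 1 1) = num h [- (k - 1), - (3 * k + 5)] * inverse (num h [- (k + 1), - (3 * k + 3)])"
  "gam (Tl 1 (- 1)) (Gl 1 (- 1)) = num h [] * inverse (num h [])"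
  "gam (Tl 1 1) (Gl 1 (- 1)) = num h [- (k + 3)] * inverse (num h [- (k + 1)])"
  "gam (Tl (- 1) 1) (Gl 1 (- 1)) = num h [] * inverse (num h [])"
  "gam (Tl (- 1) 1) (Gl (- 1) 1) = num h [] * inverse (num h [])"
  "gam (Tl 1 1) (Gl (- 1) 1) = num h [3 * k + 5] * inverse (num h [3 * k + 3])"
  "gam (Tl 1 (- 1)) (Gl (- 1) 1) = num h [k - 1, 3 * k + 5] * inverse (num h [k + 1, 3 * k + 3])"
  "gam (Tl (- 1) 1) (Gl (- 1) (- 1)) = num h [] * inverse (num h [])"
  "gam (Tl 1 1) (Gl (- 1) (- 1)) = num h [k + 3] * inverse (num h [k + 1])"
  "gam (Tl 1 (- 1)) (Gl (- 1) (- 1)) = num h [] * inverse (num h [])"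
  by (rule gam_eqI; unfold Tl_def el_bilinear; simp only: el_GG qpow_monomials list.map sum_list.Cons sum_list.Nil;
      simp add: divide_simps; algebra?)+

text \<open>Different summands of T contract with poles at 1 and at q^{2k+2} or its inverse. No
  delta function at z = w occurs in the commutator of T with itself, so the contributions of the
  pole 1 have to cancel between pairs.\<close>

lemma gam_TT:
  "gam (Tl 1 (- 1)) (Tl 1 (- 1)) = num h [] * inverse (num h [])"
  "gam (Tl (- 1) 1) (Tl (- 1) 1) = num h [] * inverse (num h [])"
  "gam (Tl 1 1) (Tl 1 1) = num h [2 * k + 4, - (2 * k + 4)] * inverse (num h [2 * k + 2, - (2 * k + 2)])"
  "gam (Tl 1 (- 1)) (Tl 1 1) = num h [- 2, 2 * k + 4] * inverse (num h [0, 2 * k + 2])"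
  "gam (Tl 1 (- 1)) (Tl (- 1) 1) = num h [- 2, 2 * k + 4] * inverse (num h [0, 2 * k + 2])"
  "gam (Tl 1 1) (Tl (- 1) 1) = num h [- 2, 2 * k + 4] * inverse (num h [0, 2 * k + 2])"
  "gam (Tl 1 1) (Tl 1 (- 1)) = num h [2, - (2 * k + 4)] * inverse (num h [0, - (2 * k + 2)])"
  "gam (Tl (- 1) 1) (Tl 1 (- 1)) = num h [2, - (2 * k + 4)] * inverse (num h [0, - (2 * k + 2)])"
  "gam (Tl (- 1) 1) (Tl 1 1) = num h [2, - (2 * k + 4)] * inverse (num h [0, - (2 * k + 2)])"
  by (rule gam_eqI; unfold Tl_def el_bilinear; simp only: el_GG qpow_monomials list.map sum_list.Cons sum_list.Nil;
      simp add: divide_simps; algebra?)+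

lemma gam_KK: "gam (Kl 1) (Kl (- 1)) = num h [2, - 2] * inverse (num h [2 * k + 2, - (2 * k + 2)])"
  by (rule gam_eqI; simp only: el_Kl qpow_monomials list.map sum_list.Cons sum_list.Nil; simp)

lemma gam_KG:
  assumes "\<epsilon> \<in> {1, - 1}"
  shows "gam (Kl 1) (Gl 1 \<epsilon>) = num h [- (2 * k + 4)] * inverse (num h [0])"
    "gam (Kl 1) (Gl (- 1) \<epsilon>) = num h [2 * k + 4] * inverse (num h [0])"
    "gam (Gl 1 \<epsilon>) (Kl (- 1)) = num h [2 * k + 4] * inverse (num h [0])"
    "gam (Gl (- 1) \<epsilon>) (Kl (- 1)) = num h [- (2 * k + 4)] * inverse (num h [0])"
  using assms by - (rule gam_eqI; simp only: el_Kl qpow_monomials list.map sum_list.Cons sum_list.Nil; simp)+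

lemma gam_KT:
  assumes "a \<in> {1, - 1}" "b \<in> {1, - 1}"
  shows "gam (Kl 1) (Tl a b) = num h [k + 3, - (k + 3)] * inverse (num h [k + 1, - (k + 1)])"
    "gam (Tl a b) (Kl (- 1)) = num h [k + 3, - (k + 3)] * inverse (num h [k + 1, - (k + 1)])"
  by (rule gam_eqI; unfold Tl_def el_bilinear; simp only: el_Kl(2,4)[OF _ assms(1)] el_Kl(3,5)[OF _ assms(2)]
      qpow_monomials list.map sum_list.Cons sum_list.Nil; simp add: divide_simps; algebra?)+

section \<open>The currents as finite combinations of normally ordered exponentials\<close>

lemma zeta_Gl: "e \<in> {1, - 1} \<Longrightarrow> zeta (Gl e \<epsilon>) p = of_int e * ((p ATilde + p ABar) / k)"
  using k_ne by (auto simp: zeta_def lform_defs field_simps)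

lemma zeta_Kl [simp]: "zeta (Kl s) p = 0"
  by (simp add: zeta_def Kl_def lf_single_def)

lemma zeta_Tl [simp]: "zeta (Tl a b) p = 0"
  by (simp add: Tl_def zeta_lf_add zeta_scale zeta_Gl minus_divide_left[symmetric] del: minus_add_distrib minus_divide_left)

lemma cQ_Kl [simp]: "cQ (Kl s) i = 0"
  by (simp add: Kl_def lf_single_def)

lemma cQ_Tl [simp]: "cQ (Tl a b) i = 0"
  by (cases i) (simp_all add: Tl_def lform_defs)

lemma lam_GT [simp]: "lam F (Tl a b) = 0" and kq_GT [simp]: "kq F (Tl a b) = 0"
  by (simp_all add: lam_def kq_def)

lemma lam_TG: "e \<in> {1, - 1} \<Longrightarrow> lam (Tl a b) (Gl e \<epsilon>) = 0"
  and kq_TG: "e \<in> {1, - 1} \<Longrightarrow> kq (Tl a b) (Gl e \<epsilon>) = of_int (e * (a + b))"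
  by (auto simp: Tl_def lam_lf_add_left lam_scale_left kq_lf_add_left kq_scale_left lam_GG kq_GG algebra_simps)

lemma cmult_cscale_nexp:
  assumes v: "v \<in> VV p L"
  shows "cmult (cscale h a (nexp h k F)) (cscale h b (nexp h k G)) s v =
      cmult (nexp h k (lf_scale h a F)) (nexp h k (lf_scale h b G)) s v"
    and "cscale h a (nexp h k F) t (cscale h b (nexp h k G) s v) =
      nexp h k (lf_scale h a F) t (nexp h k (lf_scale h b G) s v)"
proof -
  show *: "cscale h a (nexp h k F) t (cscale h b (nexp h k G) s v) =
      nexp h k (lf_scale h a F) t (nexp h k (lf_scale h b G) s v)" for t s
  proof -
    obtain L' where "nexp h k (lf_scale h b G) s v \<in> VV (shift (cQ (lf_scale h b G)) p) L'"
      using VV_nexp[OF v] by blast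
    then show ?thesis by (simp add: cscale_nexp[OF v] cscale_nexp)
  qed
  show "cmult (cscale h a (nexp h k F)) (cscale h b (nexp h k G)) s v =
      cmult (nexp h k (lf_scale h a F)) (nexp h k (lf_scale h b G)) s v"
    unfolding cmult_def * ..
qed

lemma gam_disjoint:
  assumes "\<And>i m. cosc F i m = 0 \<or> cosc G i (- m) = 0"
  shows "gam F G = 1"
proof -
  have "el F G m = 0" for m
    unfolding el_def by (intro mult_eq_0_iff[THEN iffD2] disjI2 sum.neutral) (use assms in auto)
  then show ?thesis using gam_eqI[of F G "[]" "[]"] by (simp add: num_Nil)
qed

text \<open>The boson of V-tilde does not occur in e and f. Hence the two factors of a supercurrent
  do not contract, and their product at one point is normally ordered.\<close>

lemma Gpart_aux:
  fixes e \<epsilon> :: int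
  defines "F \<equiv> lf_scale h (- (of_int e * (k + 2))) (Vt h k e)"
    and "G \<equiv> lf_scale h (- (of_int e * (3 * k + 4) / 2)) (if e = 1 then ev h k \<epsilon> else fv h k \<epsilon>)"
  shows "lam F G = 0" "gam F G = 1" "kq F G = 0"
proof -
  show "gam F G = 1"
    by (rule gam_disjoint) (auto simp: F_def G_def lform_defs)
  show "lam F G = 0" "kq F G = 0"
    by (auto simp: lam_def kq_def F_def G_def lform_defs)
qed

lemma Gpart_eq:
  assumes v: "v \<in> VV p L"
  shows "Gpart h k e \<epsilon> s v = scl (of_int e / dq h) (nexp h k (Gl e \<epsilon>) s v)"
  unfolding Gpart_def Gl_def
  by (simp add: cmult_cscale_nexp(1)[OF v] cmult_nexp(1)[OF v Gpart_aux(1,2)] Gpart_aux(3))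

lemma rep_GG: "rep p (GG h k e) {1, - 1} (\<lambda>\<epsilon>. of_int \<epsilon> * (of_int e / dq h)) (Gl e) (1/2)"
  unfolding rep_def GG_def
  by (auto simp: Gpart_eq scl_minus_left[symmetric] diff_conv_add_uminus simp del: add_uminus_conv_diff)

lemma linr_GG: "linr (GG h k e s)"
proof -
  have "linr (Gpart h k e \<epsilon> s)" for \<epsilon> s
    unfolding Gpart_def[abs_def]
  proof (intro linr_scale linr_cmult linr_cscale linr_nexp)
    fix b s
    show "finite {t. cscale h (- (of_int e * (k + 2))) (nexp h k (Vt h k e)) t
        (cscale h (- (of_int e * (3 * k + 4) / 2)) (nexp h k (if e = 1 then ev h k \<epsilon> else fv h k \<epsilon>)) (s - t)
          (Poly_Mapping.single b 1)) \<noteq> 0}"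
      unfolding cmult_cscale_nexp(2)[OF VV_basis]
      by (rule cmult_nexp(2)[OF VV_basis Gpart_aux(1,2)])
  qed
  then show ?thesis unfolding GG_def[abs_def] by (intro linr_minus)
qed

lemma linr_KK: "linr (KK h k e s)"
  unfolding KK_def by (rule linr_nexp)

lemma KK_eq: "KK h k e = nexp h k (Kl e)"
  by (simp add: KK_def Kl_def)

text \<open>The index (a, b) belongs to :e_a f_b: in T_PF, with coefficient \<open>\<tau>\<close>;
  the pair of two lower signs - does not occur there.\<close>

definition Tset :: "(int \<times> int) set" where "Tset = {(1, - 1), (1, 1), (- 1, 1)}"

definition \<tau> :: "int \<times> int \<Rightarrow> complex" where
  "\<tau> = (\<lambda>(a, b). if a = b then - (qn h (k + 2) / qn h (k + 1)) else qpow h (of_int b))"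

lemma rep_TPF:
  "rep p (TPF h k) Tset \<tau> (\<lambda>(a, b). lf_scale h (- ((k + 2) / 2)) (ev h k a) \<oplus>\<^sub>l lf_scale h ((k + 2) / 2) (fv h k b)) 0"
  unfolding rep_def TPF_def
  by (auto simp: Tset_def \<tau>_def ef_def scl_minus_left diff_conv_add_uminus simp del: add_uminus_conv_diff)

text \<open>The arguments match because (k+1) - (k+2) = -1 for V-tilde and (k+1) - (3k+4)/2 =
  -(k+2)/2 for e; f and the opposite V-tilde carry the opposite shifts.\<close>

lemma TT_aux:
  fixes a b :: int
  defines "F \<equiv> lf_scale h (- 1) (Vt h k 1) \<oplus>\<^sub>l lf_scale h 1 (Vt h k (- 1))"
    and "G \<equiv> lf_scale h (- ((k + 2) / 2)) (ev h k a) \<oplus>\<^sub>l lf_scale h ((k + 2) / 2) (fv h k b)"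
  shows "lam F G = 0" "gam F G = 1" "kq F G = 0" "F \<oplus>\<^sub>l G = Tl a b"
proof -
  show "gam F G = 1"
    by (rule gam_disjoint) (auto simp: F_def G_def lform_defs)
  show "lam F G = 0" "kq F G = 0"
    by (auto simp: lam_def kq_def F_def G_def lform_defs)
  have s: "lf_scale h u (lf_scale h w H) = lf_scale h z H" if "u + w = z" for u w z H
    using that by (simp add: lf_scale_scale)
  have "Tl a b = lf_scale h (- 1) (Vt h k 1) \<oplus>\<^sub>l lf_scale h (- ((k + 2) / 2)) (ev h k a) \<oplus>\<^sub>l
      (lf_scale h 1 (Vt h k (- 1)) \<oplus>\<^sub>l lf_scale h ((k + 2) / 2) (fv h k b))"
    unfolding Tl_def Gl_def lf_scale_add
    by (subst (1 2 3 4) s) (auto simp: field_simps)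
  then show "F \<oplus>\<^sub>l G = Tl a b" unfolding F_def G_def by (simp only: lf_ac)
qed

lemma rep_TT: "rep p (TT h k) Tset \<tau> (\<lambda>(a, b). Tl a b) 0"
  unfolding TT_def
  by (rule rep_cong[OF rep_cmult_left[OF rep_TPF]]) (auto simp: TT_aux)

lemma linr_TT: "linr (TT h k s)"
proof -
  have lT: "linr (TPF h k s)" for s
    unfolding TPF_def[abs_def] ef_def by (intro linr_plus linr_minus linr_scale linr_nexp)
  show ?thesis unfolding TT_def
    by (intro linr_cmult linr_nexp lT finite_cmult_nexp_rep[OF rep_TPF VV_basis]) (auto simp: TT_aux)
qed

lemma rep_K0: "rep p (K0 h k) {()} (\<lambda>_. 1) (\<lambda>_. Kl (- 1) \<oplus>\<^sub>l Kl 1) 0"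
  unfolding K0_def KK_eq
  by (rule rep_cong[OF rep_cmult_left[OF rep_nexp]]) (auto simp: gam_Kl_left)

lemma linr_K0: "linr (K0 h k s)"
  unfolding K0_def KK_eq
  by (intro linr_cmult linr_nexp cmult_nexp(2)[OF VV_basis]) (auto simp: gam_Kl_left)

lemma rep_KXK:
  assumes X: "rep p X I c F u" and l: "\<And>x. x \<in> I \<Longrightarrow> lam (F x) (Kl 1) = 0"
  shows "rep p (cmult (KK h k (- 1)) (cmult X (KK h k 1))) I (\<lambda>x. c x * qpow h (kq (Kl (- 1)) (F x)))
    (\<lambda>x. Kl (- 1) \<oplus>\<^sub>l (F x \<oplus>\<^sub>l Kl 1)) u"
  unfolding KK_eq
  by (rule rep_cong[OF rep_cmult_left[OF rep_cmult_right[OF X]]]) (auto simp: gam_Kl_left gam_Kl_right kq_lf_add_right)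

lemma linr_KXK:
  assumes lX: "\<And>s. linr (X s)" and X: "\<And>p. rep p X I c F u" and l: "\<And>x. x \<in> I \<Longrightarrow> lam (F x) (Kl 1) = 0"
  shows "linr (cmult (KK h k (- 1)) (cmult X (KK h k 1)) s)"
  unfolding KK_eq
proof (intro linr_cmult linr_nexp lX)
  fix b s
  show "finite {t. X t (nexp h k (Kl 1) (s - t) (Poly_Mapping.single b 1)) \<noteq> 0}"
    by (rule finite_cmult_rep_nexp(1)[OF X VV_basis]) (auto simp: gam_Kl_right)
  show "finite {t. nexp h k (Kl (- 1)) t (cmult X (nexp h k (Kl 1)) (s - t) (Poly_Mapping.single b 1)) \<noteq> 0}"
    by (rule finite_cmult_nexp_rep[OF rep_cmult_right[OF X] VV_basis]) (auto simp: gam_Kl_left gam_Kl_right)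
qed

text \<open>A current prescribed by its exponentials; on a sector, W will be replaced by one of
  these.\<close>

definition lincomb :: "'i set \<Rightarrow> ('i \<Rightarrow> complex) \<Rightarrow> ('i \<Rightarrow> lform) \<Rightarrow> complex \<Rightarrow> current" where
  "lincomb I c F u s v = (\<Sum>x\<in>I. scl (c x) (nexp h k (F x) (s + u) v))"

lemma rep_lincomb: "finite I \<Longrightarrow> rep p (lincomb I c F u) I c F u"
  by (simp add: rep_def lincomb_def)

lemma linr_sum_fun: "(\<And>x. x \<in> I \<Longrightarrow> linr (f x)) \<Longrightarrow> linr (\<lambda>v. \<Sum>x\<in>I. f x v)"
  by (induction I rule: infinite_finite_induct) (auto intro: linr_const_zero linr_plus)

lemma linr_lincomb: "linr (lincomb I c F u s)"
  unfolding lincomb_def[abs_def] by (intro linr_sum_fun linr_scale linr_nexp)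

lemma rep_cscale:
  assumes "rep p X I c F u"
  shows "rep p (cscale h w X) I (\<lambda>x. c x * qpow h (w * u)) (\<lambda>x. lf_scale h w (F x)) u"
  unfolding rep_def
proof (intro conjI allI impI)
  fix L v s assume v: "v \<in> VV p L"
  have q: "qpow h (- (w * s)) = qpow h (w * u) * qpow h (- (w * (s + u)))"
    by (simp add: qmerge algebra_simps)
  show "cscale h w X s v = (\<Sum>x\<in>I. scl (c x * qpow h (w * u)) (nexp h k (lf_scale h w (F x)) (s + u) v))"
    unfolding cscale_nexp[OF v, symmetric] cscale_def repD[OF assms v] q
    by (simp add: scl_sum scl_scl mult_ac)
qed (rule rep_finite[OF assms])

section \<open>Relations with the Heisenberg currents\<close>

lemma nexp_zero:
  assumes v: "v \<in> VV p L" and "s + zeta F p \<notin> \<int>"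
  shows "nexp h k F s v = 0"
  using assms by (simp add: nexp_eq[OF v])

lemma Ints_add_int: "x + of_int n \<in> \<int> \<longleftrightarrow> (x :: complex) \<in> \<int>"
  by (metis Ints_add Ints_diff Ints_of_int add_diff_cancel_right')

lemma nexp_nexp_zero:
  assumes v: "v \<in> VV p L" and "s + zeta F p \<notin> \<int>" "lam F G = of_int l"
  shows "nexp h k F s (nexp h k G t v) = 0" "nexp h k G t (nexp h k F s v) = 0"
proof -
  have "s + lam F G - of_int n + zeta F p \<notin> \<int>" for n
    using assms(2) Ints_add_int[of "s + zeta F p" "l - n"] by (simp add: assms(3) algebra_simps)
  then show "nexp h k F s (nexp h k G t v) = 0"
    unfolding nexp_nexp[OF v] BB_def by (simp add: N2_def)
  show "nexp h k G t (nexp h k F s v) = 0"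
    by (simp add: nexp_zero[OF v assms(2)] linr_zero[OF linr_nexp])
qed

text \<open>One series \<open>f\<close> and one constant \<open>d\<close> serve all summands of
  \<open>X\<close>, because K contracts with all of them in the same way; so the exchange can be
  done summand by summand.\<close>

lemma series_rep_left:
  assumes X: "\<And>p. rep p X I c G u" and v: "v \<in> VV p L" and F: "\<And>i. cQ F i = 0"
    and "\<And>x. x \<in> I \<Longrightarrow> lam F (G x) = 0" "\<And>x. x \<in> I \<Longrightarrow> gam F (G x) = 1"
    and "\<And>x. x \<in> I \<Longrightarrow> f * gam (G x) F = fps_const d"
    and "\<And>x. x \<in> I \<Longrightarrow> d * qpow h (kq (G x) F) = qpow h (kq F (G x))"
  shows "Sum_any (\<lambda>j::nat. scl (f $ j) (X (t - of_nat j) (nexp h k F (s + of_nat j) v))) = nexp h k F s (X t v)"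
proof -
  have l0: "lam G' F = 0" for G' using F by (simp add: lam_def)
  have e: "X (t - of_nat j) (nexp h k F (s + of_nat j) v) =
      (\<Sum>x\<in>I. scl (c x) (nexp h k (G x) (t + u - of_nat j) (nexp h k F (s + of_nat j) v)))" for j
  proof -
    obtain L' where "nexp h k F (s + of_nat j) v \<in> VV (shift (cQ F) p) L'" using VV_nexp[OF v] by blast
    from repD[OF X this, of "t - of_nat j"] show ?thesis by (simp add: algebra_simps)
  qed
  have "Sum_any (\<lambda>j::nat. scl (f $ j) (X (t - of_nat j) (nexp h k F (s + of_nat j) v))) =
      Sum_any (\<lambda>j::nat. \<Sum>x\<in>I. scl (c x) (scl (f $ j) (nexp h k (G x) (t + u - of_nat j) (nexp h k F (s + of_nat j) v))))"
    unfolding e scl_sum by (simp add: scl_scl mult.commute)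
  also have "\<dots> = (\<Sum>x\<in>I. Sum_any (\<lambda>j::nat. scl (c x) (scl (f $ j) (nexp h k (G x) (t + u - of_nat j) (nexp h k F (s + of_nat j) v)))))"
    by (rule Sum_any_sum[OF rep_finite[OF X]])
      (auto intro!: finite_subset[OF _ finite_nexp_right[OF v, of F s]] simp: linr_zero[OF linr_nexp])
  also have "\<dots> = (\<Sum>x\<in>I. scl (c x) (nexp h k F s (nexp h k (G x) (t + u) v)))"
    by (intro sum.cong refl) (simp add: Sum_any_scl series_exchange[OF v _ l0] assms)
  also have "\<dots> = nexp h k F s (X t v)"
    unfolding repD[OF X v] by (simp add: linr_sum[OF linr_nexp] linr_scl[OF linr_nexp])
  finally show ?thesis .
qed

lemma series_rep_right:
  assumes X: "\<And>p. rep p X I c F u" and v: "v \<in> VV p L" and G: "\<And>i. cQ G i = 0"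
    and "\<And>x. x \<in> I \<Longrightarrow> lam G (F x) = 0" "\<And>x. x \<in> I \<Longrightarrow> gam (F x) G = 1"
    and "\<And>x. x \<in> I \<Longrightarrow> f * gam G (F x) = fps_const d"
    and "\<And>x. x \<in> I \<Longrightarrow> d * qpow h (kq G (F x)) = qpow h (kq (F x) G)"
  shows "Sum_any (\<lambda>j::nat. scl (f $ j) (nexp h k G (t - of_nat j) (X (s + of_nat j) v))) = X s (nexp h k G t v)"
proof -
  have l0: "lam F' G = 0" for F' using G by (simp add: lam_def)
  have e: "nexp h k G (t - of_nat j) (X (s + of_nat j) v) =
      (\<Sum>x\<in>I. scl (c x) (nexp h k G (t - of_nat j) (nexp h k (F x) (s + u + of_nat j) v)))" for j
    unfolding repD[OF X v] by (simp add: linr_sum[OF linr_nexp] linr_scl[OF linr_nexp] algebra_simps)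
  have "Sum_any (\<lambda>j::nat. scl (f $ j) (nexp h k G (t - of_nat j) (X (s + of_nat j) v))) =
      Sum_any (\<lambda>j::nat. \<Sum>x\<in>I. scl (c x) (scl (f $ j) (nexp h k G (t - of_nat j) (nexp h k (F x) (s + u + of_nat j) v))))"
    unfolding e scl_sum by (simp add: scl_scl mult.commute)
  also have "\<dots> = (\<Sum>x\<in>I. Sum_any (\<lambda>j::nat. scl (c x) (scl (f $ j) (nexp h k G (t - of_nat j) (nexp h k (F x) (s + u + of_nat j) v)))))"
  proof (rule Sum_any_sum[OF rep_finite[OF X]])
    fix x
    show "finite {j::nat. scl (c x) (scl (f $ j) (nexp h k G (t - of_nat j) (nexp h k (F x) (s + u + of_nat j) v))) \<noteq> 0}"
      by (rule finite_subset[OF _ finite_nexp_right[OF v, of "F x" "s + u"]]) (auto simp: linr_zero[OF linr_nexp])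
  qed
  also have "\<dots> = (\<Sum>x\<in>I. scl (c x) (nexp h k (F x) (s + u) (nexp h k G t v)))"
    by (intro sum.cong refl) (simp add: Sum_any_scl series_exchange[OF v l0] assms)
  also have "\<dots> = X s (nexp h k G t v)"
  proof -
    obtain L' where "nexp h k G t v \<in> VV (shift (cQ G) p) L'" using VV_nexp[OF v] by blast
    from repD[OF X this] show ?thesis by simp
  qed
  finally show ?thesis .
qed

lemma fps_quotient_cancel:
  fixes P Q :: "complex fps"
  assumes "P $ 0 = 1" "Q $ 0 = 1"
  shows "fps_const c * P / Q * (Q * inverse P) = fps_const c"
proof -
  have "P * inverse P = 1" "inverse Q * Q = 1"
    by (auto simp: assms inverse_mult_eq_1 inverse_mult_eq_1')
  moreover have "fps_const c * P / Q * (Q * inverse P) = fps_const c * (P * inverse P) * (inverse Q * Q)"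
    by (subst fps_divide_unit) (simp_all only: assms mult_ac one_neq_zero not_False_eq_True)
  ultimately show ?thesis by simp
qed

lemma lin_0_arg: "lin h 0 = 1 - fps_X"
  by (simp add: lin_def)

lemma rel_KK:
  assumes v: "v \<in> VV p L" and e: "e \<in> {1, - 1}"
  shows "prod_zw (KK h k e) (KK h k e) s t v = prod_wz (KK h k e) (KK h k e) s t v"
  using commutator_no_poles[OF v, of "Kl e" "Kl e" s t] e
  by (auto simp: prod_zw_def prod_wz_def KK_eq gam_Kl_left gam_Kl_right)

lemma rel_K_K:
  assumes v: "v \<in> VV p L"
  shows "prod_zw (KK h k (- 1)) (KK h k 1) s t v =
    series_mult ((lin h (2 * k + 2) * lin h (- 2 * k - 2)) / (lin h 2 * lin h (- 2)))
      (prod_wz (KK h k 1) (KK h k (- 1))) s t v"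
proof -
  have e: "- 2 * k - 2 = - (2 * k + 2)" by simp
  let ?P = "num h [2 * k + 2, - (2 * k + 2)]" and ?Q = "num h [2, - 2]"
  have f: "(lin h (2 * k + 2) * lin h (- 2 * k - 2)) / (lin h 2 * lin h (- 2)) = fps_const 1 * ?P / ?Q"
    unfolding e by (simp add: num_def)
  show ?thesis
    unfolding series_mult_def prod_zw_def prod_wz_def KK_eq f
    by (rule series_exchange[OF v, symmetric, where c = 1])
      (simp_all add: gam_Kl_left gam_KK fps_quotient_cancel[of ?P ?Q 1, simplified])
qed

lemma rel_KT_series:
  "(lin h (k + 1) * lin h (- k - 1)) / (lin h (k + 3) * lin h (- k - 3)) =
    fps_const 1 * num h [k + 1, - (k + 1)] / num h [k + 3, - (k + 3)]"
proof -
  have e: "- k - 1 = - (k + 1)" "- k - 3 = - (k + 3)" by simp_all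
  show ?thesis unfolding e by (simp add: num_def)
qed

lemma Tset_signs: "(a, b) \<in> Tset \<Longrightarrow> a \<in> {1, - 1} \<and> b \<in> {1, - 1}"
  by (auto simp: Tset_def)

lemma rel_K_T:
  assumes v: "v \<in> VV p L"
  shows "prod_zw (KK h k (- 1)) (TT h k) s t v =
    series_mult ((lin h (k + 1) * lin h (- k - 1)) / (lin h (k + 3) * lin h (- k - 3)))
      (prod_wz (TT h k) (KK h k (- 1))) s t v"
  unfolding series_mult_def prod_zw_def prod_wz_def KK_eq rel_KT_series
  by (rule series_rep_left[OF rep_TT v, symmetric, where d = 1])
    (auto dest!: Tset_signs simp: gam_Kl_left gam_KT fps_quotient_cancel[of "num h [k + 1, - (k + 1)]" "num h [k + 3, - (k + 3)]" 1, simplified])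

lemma rel_T_K:
  assumes v: "v \<in> VV p L"
  shows "prod_zw (TT h k) (KK h k 1) s t v =
    series_mult ((lin h (k + 1) * lin h (- k - 1)) / (lin h (k + 3) * lin h (- k - 3)))
      (prod_wz (KK h k 1) (TT h k)) s t v"
  unfolding series_mult_def prod_zw_def prod_wz_def KK_eq rel_KT_series
  by (rule series_rep_right[OF rep_TT v, symmetric, where d = 1])
    (auto dest!: Tset_signs simp: gam_Kl_right gam_KT fps_quotient_cancel[of "num h [k + 1, - (k + 1)]" "num h [k + 3, - (k + 3)]" 1, simplified])

lemma rel_K_G:
  assumes v: "v \<in> VV p L" and e: "e \<in> {1, - 1}"
  shows "prod_zw (KK h k (- 1)) (GG h k e) s t v =
    series_mult (fps_const (qpow h (of_int e * (k + 2))) * (1 - fps_X) / lin h (of_int e * 2 * (k + 2)))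
      (prod_wz (GG h k e) (KK h k (- 1))) s t v"
proof -
  have n: "lin h a = num h [a]" for a by (simp add: num_def)
  have g: "gam (Gl e \<epsilon>) (Kl (- 1)) = num h [of_int e * 2 * (k + 2)] * inverse (num h [0])" if "\<epsilon> \<in> {1, - 1}" for \<epsilon>
    using e gam_KG[OF that] by (auto simp: algebra_simps)
  show ?thesis
    unfolding series_mult_def prod_zw_def prod_wz_def KK_eq lin_0_arg[symmetric] unfolding n
    by (rule series_rep_left[OF rep_GG v, symmetric, where d = "qpow h (of_int e * (k + 2))"])
      (use e in \<open>simp_all only: gam_Kl_left g fps_quotient_cancel num_0 lam_K kq_K kq_KG cQ_Kl qpow_0 mult_1_right\<close>)
qed

lemma rel_G_K:
  assumes v: "v \<in> VV p L" and e: "e \<in> {1, - 1}"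
  shows "prod_zw (GG h k e) (KK h k 1) s t v =
    series_mult (fps_const (qpow h (- of_int e * (k + 2))) * (1 - fps_X) / lin h (- of_int e * 2 * (k + 2)))
      (prod_wz (KK h k 1) (GG h k e)) s t v"
proof -
  have n: "lin h a = num h [a]" for a by (simp add: num_def)
  have g: "gam (Kl 1) (Gl e \<epsilon>) = num h [- of_int e * 2 * (k + 2)] * inverse (num h [0])" if "\<epsilon> \<in> {1, - 1}" for \<epsilon>
    using e gam_KG[OF that] by (auto simp: algebra_simps)
  have q: "qpow h (- of_int e * (k + 2)) * qpow h (of_int e * (k + 2)) = 1"
    by (simp add: qmerge)
  show ?thesis
    unfolding series_mult_def prod_zw_def prod_wz_def KK_eq lin_0_arg[symmetric] unfolding n
    by (rule series_rep_right[OF rep_GG v, symmetric, where d = "qpow h (- of_int e * (k + 2))"])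
      (use e in \<open>simp_all only: gam_Kl_right g fps_quotient_cancel num_0 lam_K kq_K kq_KG cQ_Kl qpow_0 q\<close>)
qed

section \<open>Anticommutators\<close>

text \<open>Including the factor z or w in front, the two orders contract to the polynomials z - B w
  and w - z/B. The relative power B of q from the zero modes makes them opposite, and no delta
  function arises.\<close>

lemma anticommutator_same:
  assumes v: "v \<in> VV p L" and e: "e \<in> {1, - 1}" "\<epsilon> \<in> {1, - 1}" "\<epsilon>' \<in> {1, - 1}"
  shows "nexp h k (Gl e \<epsilon>) s (nexp h k (Gl e \<epsilon>') t v) + nexp h k (Gl e \<epsilon>') t (nexp h k (Gl e \<epsilon>) s v) = 0"
proof -
  let ?F = "Gl e \<epsilon>" and ?G = "Gl e \<epsilon>'"
  have l: "lam ?F ?G = of_int 1" "lam ?G ?F = of_int 1" using e by (auto simp: lam_GG)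
  let ?g = "\<lambda>n. qpow h (kq ?F ?G) * zcoeff (gam ?F ?G) n" and ?g' = "\<lambda>n. qpow h (kq ?G ?F) * zcoeff (gam ?G ?F) (- n)"
  have 1: "nexp h k ?F s (nexp h k ?G t v) = BB p ?F ?G (\<lambda>n. ?g (n + 1)) s (t + of_int 1) v"
    unfolding nexp_nexp[OF v] l by (rule BB_shift)
  have 2: "nexp h k ?G t (nexp h k ?F s v) = BB p ?F ?G ?g' s (t + of_int 1) v"
    unfolding nexp_nexp_reverse[OF v] l ..
  define B where "B = qpow h (of_int e * (of_int \<epsilon>' - of_int \<epsilon>))"
  have B': "qpow h (of_int e * (of_int \<epsilon> - of_int \<epsilon>')) = 1 / B"
    unfolding B_def by (simp add: qpow_minus[symmetric] algebra_simps)
  have kk: "qpow h (kq ?G ?F) = qpow h (kq ?F ?G) * B"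
    unfolding B_def using e by (simp add: kq_GG qmerge algebra_simps)
  have "B \<noteq> 0" by (simp add: B_def)
  then have "?g (n + 1) + ?g' n = 0" for n
    unfolding kk gam_GG_same[OF e] gam_GG_same[OF e(1,3,2)]
    by (auto simp: zcoeff_def num_def lin_nth B_def[symmetric] B' nat_eq_iff)
  then have "BB p ?F ?G (\<lambda>n. ?g (n + 1) + ?g' n) s (t + of_int 1) v = 0" by simp
  then show ?thesis unfolding 1 2 BB_add[OF v] .
qed

text \<open>The argument n - 1 comes from the factor 1/z of oppositely charged supercurrents. It
  lets one order fill the places n >= 1 and the other the places n <= 0, without overlap or
  gap.\<close>

lemma bilateral_one_pole:
  assumes g: "gam F G = num h [] * inverse (num h [a])" "gam G F = num h [] * inverse (num h [- a])"
    and k: "qpow h (kq G F) = qpow h (kq F G - a)"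
  shows "qpow h (kq F G) * zcoeff (gam F G) (n + - 1) + qpow h (kq G F) * zcoeff (gam G F) (- n) =
    qpow h (kq F G - a) * qpow h (a * of_int n)"
proof -
  have i: "num h [] * inverse (num h [c]) = geom h c" for c
    by (simp add: num_def inverse_lin)
  show ?thesis
  proof (cases "n \<le> 0")
    case True
    then show ?thesis unfolding g i k by (simp add: zcoeff_geom)
  next
    case False
    have "qpow h (kq F G) * qpow h (a * (of_int n - 1)) = qpow h (kq F G - a) * qpow h (a * of_int n)"
      by (simp add: qmerge algebra_simps)
    then show ?thesis using False unfolding g i by (simp add: zcoeff_geom)
  qed
qed

text \<open>The contraction vanishes at infinity, so there is no constant term to disturb the
  gluing, and each pole gives a complete bilateral geometric series.\<close>

lemma bilateral_two_poles:
  assumes g: "gam F G = num h [b] * inverse (num h [a, c])" "gam G F = num h [- b] * inverse (num h [- a, - c])"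
    and k: "qpow h (kq G F) = qpow h (kq F G + b - a - c)" and ac: "qpow h a \<noteq> qpow h c"
  shows "qpow h (kq F G) * zcoeff (gam F G) (n + - 1) + qpow h (kq G F) * zcoeff (gam G F) (- n) =
    qpow h (kq F G - a) * ((1 - qpow h (b - a)) / (1 - qpow h (c - a))) * qpow h (a * of_int n)
    + qpow h (kq F G - c) * ((1 - qpow h (b - c)) / (1 - qpow h (a - c))) * qpow h (c * of_int n)"
proof -
  define A B C where AB: "A = qpow h a" "B = qpow h b" "C = qpow h c"
  have ne: "A \<noteq> 0" "B \<noteq> 0" "C \<noteq> 0" "A - C \<noteq> 0" "C - A \<noteq> 0" using ac by (auto simp: AB)
  have qd: "qpow h (x - y) = qpow h x / qpow h y" for x y
    using qpow_add[of x "- y"] by (simp add: qpow_minus)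
  define x y where xy: "x = (1 - B / A) / (1 - C / A)" "y = (1 - B / C) / (1 - A / C)"
  define x' y' where xy': "x' = (1 - A / B) / (1 - A / C)" "y' = (1 - C / B) / (1 - C / A)"
  have e: "x = (A - B) / (A - C)" "y = - ((C - B) / (A - C))"
    "x' = C * (A - B) / (B * (A - C))" "y' = - (A * (C - B) / (B * (A - C)))"
    unfolding xy xy' using ne by (simp_all add: divide_simps; algebra)+
  have r: "B / (A * C) * x' = x / A" "B / (A * C) * y' = y / C"
    unfolding e using ne by (simp_all add: divide_simps)
  have k': "qpow h (kq G F) = qpow h (kq F G) * (B / (A * C))"
    unfolding k qd qpow_add by (simp add: AB)
  have ac': "qpow h (- a) \<noteq> qpow h (- c)" using ac by (simp add: qpow_minus)
  let ?g = "\<lambda>n. qpow h (kq F G) * zcoeff (gam F G) n" and ?g' = "\<lambda>n. qpow h (kq G F) * zcoeff (gam G F) (- n)"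
  have "?g (n + - 1) + ?g' n = qpow h (kq F G) * (x / A) * qpow h (a * of_int n)
      + qpow h (kq F G) * (y / C) * qpow h (c * of_int n)"
  proof (cases "n \<le> 0")
    case True
    have "zcoeff (gam G F) (- n) = x' * qpow h (a * of_int n) + y' * qpow h (c * of_int n)"
      using True unfolding g partial_fraction_12[OF ac']
      by (simp add: zcoeff_add zcoeff_const_mult zcoeff_geom xy' AB qpow_minus)
    then have "?g' n = qpow h (kq F G) * (B / (A * C) * x') * qpow h (a * of_int n)
        + qpow h (kq F G) * (B / (A * C) * y') * qpow h (c * of_int n)"
      unfolding k' by (simp only: distrib_left mult_ac)
    then have "?g' n = qpow h (kq F G) * (x / A) * qpow h (a * of_int n) + qpow h (kq F G) * (y / C) * qpow h (c * of_int n)"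
      unfolding r .
    moreover have "zcoeff f (n + - 1) = 0" for f using True by (simp add: zcoeff_def)
    ultimately show ?thesis by simp
  next
    case False
    have q: "qpow h (z * (of_int n - 1)) = qpow h (z * of_int n) / qpow h z" for z
      unfolding right_diff_distrib qd by simp
    have "zcoeff (gam F G) (n + - 1) = x / A * qpow h (a * of_int n) + y / C * qpow h (c * of_int n)"
      using False unfolding g partial_fraction_12[OF ac]
      by (simp add: zcoeff_add zcoeff_const_mult zcoeff_geom q xy AB)
    moreover have "zcoeff f (- n) = 0" for f using False by (simp add: zcoeff_def)
    ultimately show ?thesis by (simp add: algebra_simps)
  qed
  then show ?thesis by (simp add: qd xy AB mult_ac)
qed

section \<open>Relations among the supercurrents and the energy current\<close>

definition sec :: "sector \<Rightarrow> charge \<Rightarrow> bool" where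
  "sec A p \<longleftrightarrow> (p ATilde + p ABar) / k \<in> (case A of Neveu_Schwarz \<Rightarrow> \<int> | Ramond \<Rightarrow> {x. x - 1/2 \<in> \<int>})"

text \<open>The charge contributes an integer in the NS sector and a half-odd number in the R
  sector; the additional 1/2 from the factor z^{1/2} turns these into half-integral and integral
  modes.\<close>

lemma sec_Gl:
  assumes "sec A p" "e \<in> {1, - 1}"
  shows "s + 1 / 2 + zeta (Gl e \<epsilon>) p \<in> \<int> \<longleftrightarrow> s \<in> ZZ A"
proof -
  define z where "z = (p ATilde + p ABar) / k"
  have zeta: "zeta (Gl e \<epsilon>) p = of_int e * z" using assms by (simp add: zeta_Gl z_def)
  show ?thesis
  proof (cases A)
    case Neveu_Schwarz
    then obtain n where n: "z = of_int n" using assms(1) by (auto simp: sec_def z_def elim: Ints_cases)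
    have "s + 1 / 2 + zeta (Gl e \<epsilon>) p = (s - 1 / 2) + of_int (e * n + 1)"
      by (simp add: zeta n algebra_simps)
    then show ?thesis using Neveu_Schwarz by (simp only: Ints_add_int) (simp add: ZZ_def)
  next
    case Ramond
    then obtain n where n: "z - 1 / 2 = of_int n" using assms(1) by (auto simp: sec_def z_def elim: Ints_cases)
    then have z: "z = of_int n + 1 / 2" by (simp add: algebra_simps)
    obtain n' where n': "of_int e * z + 1 / 2 = of_int n'"
    proof -
      have "of_int (if e = 1 then n + 1 else - n) = of_int e * z + 1 / 2" using assms(2) by (auto simp: z algebra_simps)
      then show ?thesis using that by metis
    qed
    have "s + 1 / 2 + zeta (Gl e \<epsilon>) p = s + of_int n'"
      unfolding n'[symmetric] zeta by simp
    then show ?thesis using Ramond by (simp only: Ints_add_int) (simp add: ZZ_def)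
  qed
qed

lemma opexp_zero: "opexp 0 = 1"
proof (rule fps_ext)
  fix d
  show "opexp 0 $ d = 1 $ d"
    by (cases d) (auto simp: opexp_def fps_power_nth_zero power_0_left intro!: sum.neutral)
qed

lemma nexp_Ol:
  assumes v: "v \<in> VV p L"
  shows "nexp h k Ol s v = cone s v"
proof -
  have "XA Ol = 0" "XC Ol = 0"
    by (rule fps_ext; simp add: XA_def XC_def Ol_def lf_single_def osc_sum_def)+
  then have a: "aa Ol d = (if d = 0 then 1 else 0)" "cc Ol d = (if d = 0 then 1 else 0)" for d
    by (auto simp: aa_def cc_def opexp_zero)
  have "MM Ol r v = (if r = 0 then v else 0)" for r
  proof -
    have "MM Ol r v = Sum_any (\<lambda>d::int. if d = 0 then (if r = 0 then v else 0) else 0)"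
      unfolding MM_def by (rule arg_cong[of _ _ Sum_any]) (auto simp: a app_0 app_1)
    then show ?thesis by simp
  qed
  moreover have "EQ (cQ Ol) = 1"
    by (rule fop_eq_basisI) (simp add: app_EQ expQ_def Ol_def lf_single_def app_1 split: prod.split)
  moreover have "s = 0" if "s \<in> \<int>" "\<lfloor>Re s\<rfloor> = 0"
    using Ints_Re_floor[OF that(1)] that(2) by simp
  moreover have "zeta Ol p = 0" "clq Ol p = 0"
    by (simp_all add: zeta_def clq_def Ol_def lf_single_def)
  ultimately show ?thesis
    by (auto simp: nexp_eq[OF v] cone_def app_1)
qed

lemma qdiff: "qpow h (x - y) = qpow h x / qpow h y"
  using qpow_add[of x "- y"] by (simp add: qpow_minus)

text \<open>All remaining constants are monomials in P = q^{k+1} and Q = q. The scalar identities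
  between residues become rational identities in P and Q.\<close>

lemma qPQ:
  fixes P Q
  defines "P \<equiv> qpow h (k + 1)" and "Q \<equiv> qpow h 1"
  shows "qpow h k = P / Q" "qpow h (k + 2) = P * Q" "qpow h (2 * k + 2) = P ^ 2" "qpow h (4 * k + 4) = P ^ 4"
    "qpow h (2 * k + 4) = P ^ 2 * Q ^ 2" "qpow h (4 * k + 6) = P ^ 4 * Q ^ 2" "qpow h (3 * k + 3) = P ^ 3"
    "qpow h (3 * k + 5) = P ^ 3 * Q ^ 2" "qpow h (k + 3) = P * Q ^ 2" "qpow h (k - 1) = P / Q ^ 2" "qpow h 2 = Q ^ 2"
proof -
  have m: "qpow h (of_nat i * (k + 1) + of_nat j * 1) = P ^ i * Q ^ j" for i j
    unfolding P_def Q_def by (simp only: qpow_add qpow_of_nat_mult)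
  show "qpow h (k + 2) = P * Q" using m[of 1 1] by (simp add: algebra_simps)
  show "qpow h (2 * k + 2) = P ^ 2" using m[of 2 0] by (simp add: algebra_simps)
  show "qpow h (4 * k + 4) = P ^ 4" using m[of 4 0] by (simp add: algebra_simps)
  show "qpow h (2 * k + 4) = P ^ 2 * Q ^ 2" using m[of 2 2] by (simp add: algebra_simps)
  show "qpow h (4 * k + 6) = P ^ 4 * Q ^ 2" using m[of 4 2] by (simp add: algebra_simps)
  show "qpow h (3 * k + 3) = P ^ 3" using m[of 3 0] by (simp add: algebra_simps)
  show "qpow h (3 * k + 5) = P ^ 3 * Q ^ 2" using m[of 3 2] by (simp add: algebra_simps)
  show "qpow h (k + 3) = P * Q ^ 2" using m[of 1 2] by (simp add: algebra_simps)
  show 2: "qpow h 2 = Q ^ 2" using m[of 0 2] by simp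
  show "qpow h k = P / Q" using qdiff[of "k + 1" 1] by (simp add: P_def Q_def)
  show "qpow h (k - 1) = P / Q ^ 2" using qdiff[of "k + 1" 2] by (simp add: P_def 2)
qed

lemma PQ_facts:
  fixes P Q
  defines "P \<equiv> qpow h (k + 1)" and "Q \<equiv> qpow h 1"
  shows "P \<noteq> 0" "Q \<noteq> 0" "P ^ 2 \<noteq> 1" "P ^ 4 \<noteq> 1" "P ^ 2 * Q ^ 2 \<noteq> 1" "Q ^ 2 \<noteq> 1"
    "dq h = (Q ^ 2 - 1) / Q" "qn h (k + 1) = (P ^ 2 - 1) * Q / (P * (Q ^ 2 - 1))"
    "qn h (k + 2) = (P ^ 2 * Q ^ 2 - 1) / (P * (Q ^ 2 - 1))"
proof -
  show ne: "P \<noteq> 0" "Q \<noteq> 0" by (simp_all add: P_def Q_def)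
  show P2: "P ^ 2 \<noteq> 1" using k1_ne unfolding qn_nonzero_iff P_def .
  have "qpow h (2 * k + 2) ^ 2 \<noteq> 1" using k22_ne unfolding qn_nonzero_iff .
  then show "P ^ 4 \<noteq> 1" unfolding qPQ P_def[symmetric] by simp
  show "P ^ 2 * Q ^ 2 \<noteq> 1"
    using k2_ne unfolding qn_nonzero_iff qPQ P_def[symmetric] Q_def[symmetric] by (simp add: power_mult_distrib)
  show d: "dq h = (Q ^ 2 - 1) / Q"
    using ne by (simp add: dq_def qpow_minus Q_def[symmetric]) (simp add: field_simps power2_eq_square)
  then show Q2: "Q ^ 2 \<noteq> 1" using dq_ne by auto
  show "qn h (k + 1) = (P ^ 2 - 1) * Q / (P * (Q ^ 2 - 1))"
    unfolding qn_eq d P_def[symmetric] using ne Q2 by (simp add: divide_simps) algebra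
  show "qn h (k + 2) = (P ^ 2 * Q ^ 2 - 1) / (P * (Q ^ 2 - 1))"
    unfolding qn_eq d qPQ P_def[symmetric] Q_def[symmetric] using ne Q2 by (simp add: divide_simps) algebra
qed

lemma rel_GG_same:
  assumes v: "v \<in> VV p L" and e: "e \<in> {1, - 1}"
  shows "prod_zw (GG h k e) (GG h k e) s t v + prod_wz (GG h k e) (GG h k e) s t v = 0"
proof -
  let ?I = "{1, - 1 :: int}" and ?c = "\<lambda>\<epsilon>::int. of_int \<epsilon> * (of_int e / dq h)"
  note r = rep_product[OF rep_GG linr_GG rep_GG v]
  have "GG h k e s (GG h k e t v) + GG h k e t (GG h k e s v) =
      (\<Sum>x\<in>?I. \<Sum>y\<in>?I. scl (?c x * ?c y) (nexp h k (Gl e x) (s + 1/2) (nexp h k (Gl e y) (t + 1/2) v)))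
      + (\<Sum>x\<in>?I. \<Sum>y\<in>?I. scl (?c x * ?c y) (nexp h k (Gl e y) (t + 1/2) (nexp h k (Gl e x) (s + 1/2) v)))"
    unfolding r by (subst (2) sum.swap) (simp add: mult.commute)
  also have "\<dots> = (\<Sum>x\<in>?I. \<Sum>y\<in>?I. scl (?c x * ?c y) (nexp h k (Gl e x) (s + 1/2) (nexp h k (Gl e y) (t + 1/2) v)
      + nexp h k (Gl e y) (t + 1/2) (nexp h k (Gl e x) (s + 1/2) v)))"
    by (simp only: sum.distrib[symmetric] scl_add)
  also have "\<dots> = 0"
    by (intro sum.neutral ballI) (simp only: anticommutator_same[OF v e] scl_zero)
  finally show ?thesis by (simp add: prod_zw_def prod_wz_def)
qed

abbreviation fuse :: "complex \<Rightarrow> lform \<Rightarrow> lform \<Rightarrow> complex \<Rightarrow> fock \<Rightarrow> fock" where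
  "fuse a F G s v \<equiv> nexp h k (lf_scale h a F \<oplus>\<^sub>l G) s v"

text \<open>Poles and residues of the contraction of \<open>Gl 1 x\<close> with \<open>Gl (-1) y\<close>.\<close>

definition poles :: "int \<Rightarrow> int \<Rightarrow> complex set" where
  "poles x y = (if x = 1 \<and> y = 1 then {2 * k + 2, 4 * k + 4} else if x = - 1 \<and> y = - 1 then {2 * k + 4} else {2 * k + 2})"

definition resid :: "int \<Rightarrow> int \<Rightarrow> complex \<Rightarrow> complex" where
  "resid x y a =
    (if x = 1 \<and> y = 1 then
       if a = 2 * k + 2
       then qpow h (k - (2 * k + 2)) * ((1 - qpow h (4 * k + 6 - (2 * k + 2))) / (1 - qpow h (4 * k + 4 - (2 * k + 2))))
       else qpow h (k - (4 * k + 4)) * ((1 - qpow h (4 * k + 6 - (4 * k + 4))) / (1 - qpow h (2 * k + 2 - (4 * k + 4))))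
     else qpow h (k + 1 - of_int x - a))"

definition bil :: "int \<Rightarrow> int \<Rightarrow> int \<Rightarrow> complex" where
  "bil x y n = (\<Sum>a\<in>poles x y. resid x y a * qpow h (a * of_int n))"

lemma poles_finite [simp]: "finite (poles x y)"
  by (simp add: poles_def)

lemma pole_facts: "qpow h (2 * k + 2) \<noteq> 1" "qpow h (4 * k + 4) \<noteq> 1" "qpow h (2 * k + 4) \<noteq> 1"
  "qpow h (2 * k + 2) \<noteq> qpow h (4 * k + 4)" "2 * k + 2 \<noteq> 4 * k + 4"
proof -
  show a: "qpow h (2 * k + 2) \<noteq> 1" "qpow h (4 * k + 4) \<noteq> 1" "qpow h (2 * k + 4) \<noteq> 1"
    unfolding qPQ using PQ_facts by (simp_all add: power_mult_distrib)
  have "qpow h (4 * k + 4) = qpow h (2 * k + 2) * qpow h (2 * k + 2)"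
    by (simp add: qmerge)
  then show b: "qpow h (2 * k + 2) \<noteq> qpow h (4 * k + 4)" using a(1) by auto
  show "2 * k + 2 \<noteq> 4 * k + 4" using b by metis
qed

lemma pole_ne_one: "a \<in> poles x y \<Longrightarrow> qpow h a \<noteq> 1"
  using pole_facts by (auto simp: poles_def split: if_splits)

lemma bilateral_GG:
  assumes "x \<in> {1, - 1}" "y \<in> {1, - 1}"
  shows "qpow h (kq (Gl 1 x) (Gl (- 1) y)) * zcoeff (gam (Gl 1 x) (Gl (- 1) y)) (n + - 1)
    + qpow h (kq (Gl (- 1) y) (Gl 1 x)) * zcoeff (gam (Gl (- 1) y) (Gl 1 x)) (- n) = bil x y n"
proof -
  have kq1: "kq (Gl 1 1) (Gl (- 1) y) = k" "kq (Gl 1 (- 1)) (Gl (- 1) y) = k + 2"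
    "kq (Gl (- 1) 1) (Gl 1 y) = - k" "kq (Gl (- 1) (- 1)) (Gl 1 y) = - (k + 2)" for y
    by (simp_all add: kq_GG algebra_simps)
  consider "x = 1" "y = 1" | "x = 1" "y = - 1" | "x = - 1" "y = 1" | "x = - 1" "y = - 1" using assms by auto
  then show ?thesis
  proof cases
    case 1
    have "qpow h (kq (Gl (- 1) 1) (Gl 1 1)) = qpow h (kq (Gl 1 1) (Gl (- 1) 1) + (4 * k + 6) - (2 * k + 2) - (4 * k + 4))"
      unfolding kq1 by simp
    from bilateral_two_poles[OF gam_GG_pm(1,5) this pole_facts(4), of n]
    show ?thesis using pole_facts(5) unfolding 1 by (simp add: bil_def poles_def resid_def kq1)
  next
    case 2
    have "qpow h (kq (Gl (- 1) (- 1)) (Gl 1 1)) = qpow h (kq (Gl 1 1) (Gl (- 1) (- 1)) - (2 * k + 2))"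
      unfolding kq1 by simp
    from bilateral_one_pole[OF gam_GG_pm(2,7) this, of n]
    show ?thesis unfolding 2 by (simp add: bil_def poles_def resid_def kq1)
  next
    case 3
    have "qpow h (kq (Gl (- 1) 1) (Gl 1 (- 1))) = qpow h (kq (Gl 1 (- 1)) (Gl (- 1) 1) - (2 * k + 2))"
      unfolding kq1 by simp
    from bilateral_one_pole[OF gam_GG_pm(3,6) this, of n]
    show ?thesis unfolding 3 by (simp add: bil_def poles_def resid_def kq1)
  next
    case 4
    have "qpow h (kq (Gl (- 1) (- 1)) (Gl 1 (- 1))) = qpow h (kq (Gl 1 (- 1)) (Gl (- 1) (- 1)) - (2 * k + 4))"
      unfolding kq1 by simp
    from bilateral_one_pole[OF gam_GG_pm(4,8) this, of n]
    show ?thesis unfolding 4 by (simp add: bil_def poles_def resid_def kq1)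
  qed
qed

text \<open>Both orders truncate the same sequence \<open>bil\<close>, one to n >= 1 and the other
  to n <= 0. Their sum is the anticommutator, and mode normal ordering selects from the same two
  halves.\<close>

lemma GG_halves:
  assumes v: "v \<in> VV p L" and xy: "x \<in> {1, - 1}" "y \<in> {1, - 1}"
  shows "nexp h k (Gl 1 x) s (nexp h k (Gl (- 1) y) t v) =
      BB p (Gl 1 x) (Gl (- 1) y) (\<lambda>n. (if n \<ge> 1 then 1 else 0) * bil x y n) s (t - 1) v"
    and "nexp h k (Gl (- 1) y) t (nexp h k (Gl 1 x) s v) =
      BB p (Gl 1 x) (Gl (- 1) y) (\<lambda>n. (if n \<le> 0 then 1 else 0) * bil x y n) s (t - 1) v"
proof -
  let ?F = "Gl 1 x" and ?G = "Gl (- 1) y"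
  have l: "lam ?F ?G = of_int (- 1)" "lam ?G ?F = of_int (- 1)" by (simp_all add: lam_GG)
  have b: "qpow h (kq ?F ?G) * zcoeff (gam ?F ?G) (n + - 1) = (if n \<ge> 1 then 1 else 0) * bil x y n"
    "qpow h (kq ?G ?F) * zcoeff (gam ?G ?F) (- n) = (if n \<le> 0 then 1 else 0) * bil x y n" for n
    using bilateral_GG[OF xy, of n] by (auto simp: zcoeff_def)
  have "nexp h k ?F s (nexp h k ?G t v) = BB p ?F ?G (\<lambda>n. qpow h (kq ?F ?G) * zcoeff (gam ?F ?G) (n + - 1)) s (t + of_int (- 1)) v"
    unfolding nexp_nexp[OF v] l by (rule BB_shift)
  then show "nexp h k ?F s (nexp h k ?G t v) = BB p ?F ?G (\<lambda>n. (if n \<ge> 1 then 1 else 0) * bil x y n) s (t - 1) v"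
    unfolding b by simp
  have "nexp h k ?G t (nexp h k ?F s v) = BB p ?F ?G (\<lambda>n. qpow h (kq ?G ?F) * zcoeff (gam ?G ?F) (- n)) s (t + of_int (- 1)) v"
    unfolding nexp_nexp_reverse[OF v] l ..
  then show "nexp h k ?G t (nexp h k ?F s v) = BB p ?F ?G (\<lambda>n. (if n \<le> 0 then 1 else 0) * bil x y n) s (t - 1) v"
    unfolding b by simp
qed

lemma BB_sum:
  assumes v: "v \<in> VV p L" and "finite I"
  shows "BB p F G (\<lambda>n. \<Sum>a\<in>I. g a n) s t v = (\<Sum>a\<in>I. BB p F G (g a) s t v)"
  using assms(2) by (induction I rule: finite_induct) (simp_all add: BB_add[OF v])

text \<open>The factor q^{a/2} is due to z^{1/2}, which raises the index by 1/2. With it the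
  residues become, up to the signs of the summands of G^+ and G^-, the coefficients of T_PF, of K
  and of 1.\<close>

lemma resid_half:
  "resid 1 1 (2 * k + 2) * qpow h ((2 * k + 2) / 2) = qn h (k + 2) / qn h (k + 1)"
  "resid 1 1 (4 * k + 4) * qpow h ((4 * k + 4) / 2) = - (1 / qn h (k + 1))"
  "resid 1 (- 1) (2 * k + 2) * qpow h ((2 * k + 2) / 2) = qpow h (- 1)"
  "resid (- 1) 1 (2 * k + 2) * qpow h ((2 * k + 2) / 2) = qpow h 1"
  "resid (- 1) (- 1) (2 * k + 4) * qpow h ((2 * k + 4) / 2) = 1"
proof -
  define P Q where PQ: "P = qpow h (k + 1)" "Q = qpow h 1"
  note q = qPQ[folded PQ] and f = PQ_facts[folded PQ]
  have h: "(2 * k + 2) / 2 = k + 1" "(4 * k + 4) / 2 = 2 * k + 2" "(2 * k + 4) / 2 = k + 2"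
    by (simp_all add: add_divide_distrib)
  show "resid 1 1 (2 * k + 2) * qpow h ((2 * k + 2) / 2) = qn h (k + 2) / qn h (k + 1)"
    unfolding resid_def h qdiff q f(7-9) PQ[symmetric] using f(1-6) by (simp add: divide_simps) algebra
  show "resid 1 1 (4 * k + 4) * qpow h ((4 * k + 4) / 2) = - (1 / qn h (k + 1))"
    unfolding resid_def h using pole_facts(5) unfolding qdiff q f(7-9) using f(1-6)
    by (simp add: divide_simps del: eq_divide_eq_1 divide_eq_eq_1) algebra
  show "resid 1 (- 1) (2 * k + 2) * qpow h ((2 * k + 2) / 2) = qpow h (- 1)"
    "resid (- 1) 1 (2 * k + 2) * qpow h ((2 * k + 2) / 2) = qpow h 1"
    "resid (- 1) (- 1) (2 * k + 4) * qpow h ((2 * k + 4) / 2) = 1"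
    unfolding resid_def h by (simp_all add: qmerge algebra_simps)
qed

lemma poles_eq: "poles 1 1 = {2 * k + 2, 4 * k + 4}" "poles 1 (- 1) = {2 * k + 2}" "poles (- 1) 1 = {2 * k + 2}"
  "poles (- 1) (- 1) = {2 * k + 4}"
  by (simp_all add: poles_def)

lemma anticommutator_pm:
  assumes v: "v \<in> VV p L" and s: "s \<in> ZZ A" and p: "sec A p" and xy: "x \<in> {1, - 1}" "y \<in> {1, - 1}"
  shows "nexp h k (Gl 1 x) (s + 1/2) (nexp h k (Gl (- 1) y) (t + 1/2) v)
      + nexp h k (Gl (- 1) y) (t + 1/2) (nexp h k (Gl 1 x) (s + 1/2) v) =
    (\<Sum>a\<in>poles x y. scl (resid x y a * qpow h (a / 2) * qpow h (a * s)) (fuse a (Gl 1 x) (Gl (- 1) y) (s + t) v))"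
proof -
  have z: "s + 1 / 2 + zeta (Gl 1 x) p \<in> \<int>" using s sec_Gl[OF p] by simp
  have b: "(if n \<ge> 1 then 1 else 0) * bil x y n + (if n \<le> 0 then 1 else 0) * bil x y n = bil x y n" for n by simp
  have st: "s + 1 / 2 + (t + 1 / 2 - 1) = s + t" by simp
  have q: "resid x y a * qpow h (a * (s + 1 / 2)) = resid x y a * qpow h (a / 2) * qpow h (a * s)" for a
    by (simp add: qmerge algebra_simps)
  show ?thesis
    unfolding GG_halves[OF v xy] BB_add[OF v, symmetric] b unfolding bil_def BB_sum[OF v poles_finite] BB_scl
      BB_geometric[OF v z] st scl_scl q ..
qed

text \<open>\<open>fuse\<close> places the two points at q^a z and z, whereas the fusion identities
  use symmetric points; a rescaling by q^{a/2} connects the two, here with a/2 = 2(k+1).\<close>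

lemma fuse_K: "fuse (4 * k + 4) (Gl 1 1) (Gl (- 1) 1) s v = nexp h k (lf_scale h (2 * (k + 1)) (Kl (- 1) \<oplus>\<^sub>l Kl 1)) s v"
proof -
  have e: "2 * (k + 1) + (2 * k + 2) = 4 * k + 4" "2 * (k + 1) + - (2 * k + 2) = 0" by simp_all
  show ?thesis
    using nexp_eqv[OF lf_eqv_scale[OF K_fusion, of "2 * (k + 1)"]]
    by (simp only: lf_scale_add lf_scale_scale e lf_scale_0)
qed

lemma fuse_one: "v \<in> VV p L \<Longrightarrow> fuse (2 * k + 4) (Gl 1 (- 1)) (Gl (- 1) (- 1)) s v = cone s v"
proof -
  assume v: "v \<in> VV p L"
  have e: "(k + 2) + (k + 2) = 2 * k + 4" "(k + 2) + - (k + 2) = 0" by simp_all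
  have O: "lf_scale h u Ol = Ol" for u by (simp add: lf_scale_def Ol_def lf_single_def fun_eq_iff)
  show ?thesis
    using nexp_eqv[OF lf_eqv_scale[OF one_fusion, of "k + 2"]] nexp_Ol[OF v]
    by (simp only: lf_scale_add lf_scale_scale e lf_scale_0 O)
qed

lemma fuse_T: "fuse (2 * k + 2) (Gl 1 a) (Gl (- 1) b) s v = nexp h k (lf_scale h (k + 1) (Tl a b)) s v"
proof -
  have e: "(k + 1) + (k + 1) = 2 * k + 2" "(k + 1) + - (k + 1) = 0" by simp_all
  show ?thesis by (simp only: Tl_def lf_scale_add lf_scale_scale e lf_scale_0)
qed

lemma rel_GG_pm:
  assumes v: "v \<in> VV p L" and p: "sec A p"
  shows "prod_zw (GG h k 1) (GG h k (- 1)) s t v + prod_wz (GG h k (- 1)) (GG h k 1) s t v =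
        scl (1 / dq h ^ 2)
          (delta_mult h A (4 * (k + 1))
              (\<lambda>m x. scl (1 / qn h (k + 1)) (cscale h (2 * (k + 1)) (K0 h k) m x)) s t v
           - delta_mult h A (2 * (k + 2)) cone s t v
           + delta_mult h A (2 * (k + 1)) (cscale h (k + 1) (TT h k)) s t v)"
proof -
  let ?I = "{1, - 1 :: int}"
  define AC where "AC x y = nexp h k (Gl 1 x) (s + 1/2) (nexp h k (Gl (- 1) y) (t + 1/2) v)
      + nexp h k (Gl (- 1) y) (t + 1/2) (nexp h k (Gl 1 x) (s + 1/2) v)" for x y
  have "GG h k 1 s (GG h k (- 1) t v) + GG h k (- 1) t (GG h k 1 s v) =
      (\<Sum>x\<in>?I. \<Sum>y\<in>?I. scl (of_int x * (of_int 1 / dq h) * (of_int y * (of_int (- 1) / dq h))) (nexp h k (Gl 1 x) (s + 1/2) (nexp h k (Gl (- 1) y) (t + 1/2) v)))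
      + (\<Sum>x\<in>?I. \<Sum>y\<in>?I. scl (of_int x * (of_int 1 / dq h) * (of_int y * (of_int (- 1) / dq h))) (nexp h k (Gl (- 1) y) (t + 1/2) (nexp h k (Gl 1 x) (s + 1/2) v)))"
    unfolding rep_product[OF rep_GG linr_GG rep_GG v] by (subst (2) sum.swap) (simp only: mult.commute)
  also have "\<dots> = (\<Sum>x\<in>?I. \<Sum>y\<in>?I. scl (of_int x * (of_int 1 / dq h) * (of_int y * (of_int (- 1) / dq h))) (AC x y))"
    unfolding AC_def by (simp only: sum.distrib[symmetric] scl_add)
  also have "\<dots> = scl (1 / dq h ^ 2) (- AC 1 1 + AC 1 (- 1) + AC (- 1) 1 - AC (- 1) (- 1))"
    by (simp add: scl_add scl_diff scl_minus scl_minus_left power2_eq_square algebra_simps)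
  finally have L: "prod_zw (GG h k 1) (GG h k (- 1)) s t v + prod_wz (GG h k (- 1)) (GG h k 1) s t v =
      scl (1 / dq h ^ 2) (- AC 1 1 + AC 1 (- 1) + AC (- 1) 1 - AC (- 1) (- 1))"
    by (simp add: prod_zw_def prod_wz_def)
  show ?thesis
  proof (cases "s \<in> ZZ A")
    case True
    have ac: "AC 1 1 = scl (qn h (k + 2) / qn h (k + 1) * qpow h ((2 * k + 2) * s)) (fuse (2 * k + 2) (Gl 1 1) (Gl (- 1) 1) (s + t) v)
        + scl (- (1 / qn h (k + 1)) * qpow h ((4 * k + 4) * s)) (fuse (4 * k + 4) (Gl 1 1) (Gl (- 1) 1) (s + t) v)"
      "AC 1 (- 1) = scl (qpow h (- 1) * qpow h ((2 * k + 2) * s)) (fuse (2 * k + 2) (Gl 1 1) (Gl (- 1) (- 1)) (s + t) v)"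
      "AC (- 1) 1 = scl (qpow h 1 * qpow h ((2 * k + 2) * s)) (fuse (2 * k + 2) (Gl 1 (- 1)) (Gl (- 1) 1) (s + t) v)"
      "AC (- 1) (- 1) = scl (1 * qpow h ((2 * k + 4) * s)) (fuse (2 * k + 4) (Gl 1 (- 1)) (Gl (- 1) (- 1)) (s + t) v)"
      unfolding AC_def by (subst anticommutator_pm[OF v True p]; simp only: poles_eq sum.insert sum.empty finite_insert
        finite.emptyI insert_iff empty_iff pole_facts(5) simp_thms resid_half add_0_right not_False_eq_True)+
    have e: "4 * (k + 1) = 4 * k + 4" "2 * (k + 2) = 2 * k + 4" by simp_all
    have T: "cscale h (k + 1) (TT h k) (s + t) v =
        scl (qpow h (- 1)) (fuse (2 * k + 2) (Gl 1 1) (Gl (- 1) (- 1)) (s + t) v)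
        + scl (- (qn h (k + 2) / qn h (k + 1))) (fuse (2 * k + 2) (Gl 1 1) (Gl (- 1) 1) (s + t) v)
        + scl (qpow h 1) (fuse (2 * k + 2) (Gl 1 (- 1)) (Gl (- 1) 1) (s + t) v)"
      unfolding repD[OF rep_cscale[OF rep_TT] v] fuse_T by (simp add: Tset_def \<tau>_def)
    have K: "cscale h (2 * (k + 1)) (K0 h k) (s + t) v = fuse (4 * k + 4) (Gl 1 1) (Gl (- 1) 1) (s + t) v"
      unfolding repD[OF rep_cscale[OF rep_K0] v] fuse_K by simp
    have e2: "2 * (k + 1) = 2 * k + 2" by simp
    show ?thesis
      unfolding L ac delta_mult_def K T fuse_one[OF v] e
      using True by (simp add: e2 scl_add scl_diff scl_scl scl_minus_left mult_ac)
  next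
    case False
    have "s + 1 / 2 + zeta (Gl 1 x) p \<notin> \<int>" for x using False sec_Gl[OF p] by simp
    moreover have "lam (Gl 1 x) (Gl (- 1) y) = of_int (- 1)" for x y by (simp add: lam_GG)
    ultimately have "AC x y = 0" for x y
      unfolding AC_def using nexp_nexp_zero[OF v] by (metis add.right_neutral)
    then show ?thesis unfolding L using False by (simp add: delta_mult_def)
  qed
qed

text \<open>With this indexing of the summands of the energy current the relations of \<open>GG h k 1\<close> and
  \<open>GG h k (- 1)\<close> with it have the same form, up to inversion of \<open>q\<close>.\<close>

definition Te :: "int \<Rightarrow> int \<Rightarrow> lform" where
  "Te e x = (if e = 1 then Tl x 1 else Tl 1 x)"

text \<open>\<open>K_fusion\<close> is read backwards: K^- K^+ is replaced by a pair G^+ G^-, and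
  one member of the pair is regrouped with the given supercurrent into a summand of T.\<close>

lemma fuse_KGK:
  assumes e: "e \<in> {1, - 1}"
  shows "nexp h k (lf_scale h (of_int e * (k + 1)) (Kl (- 1) \<oplus>\<^sub>l (Gl e x \<oplus>\<^sub>l Kl 1))) s v =
    fuse (of_int e * (3 * k + 3)) (Gl e 1) (Te e x) s v"
proof -
  let ?w = "of_int e * (k + 1)"
  have a: "k + 1 + (2 * k + 2) = 3 * k + 3" "k + 1 + - (2 * k + 2) = - (k + 1)"
    "- (k + 1) + (2 * k + 2) = k + 1" "- (k + 1) + - (2 * k + 2) = - (3 * k + 3)" "((- 1 :: int) = 1) = False"
    by simp_all
  have "lf_eqv (lf_scale h ?w (lf_scale h (2 * k + 2) (Gl 1 1) \<oplus>\<^sub>l lf_scale h (- (2 * k + 2)) (Gl (- 1) 1) \<oplus>\<^sub>l Gl e x))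
      (lf_scale h ?w (Kl (- 1) \<oplus>\<^sub>l Kl 1 \<oplus>\<^sub>l Gl e x))"
    by (intro lf_eqv_scale lf_eqv_add K_fusion lf_eqv_refl)
  note E = nexp_eqv[OF this]
  have "e = 1 \<or> e = - 1" using e by simp
  then show ?thesis
    using E by (elim disjE) (simp_all only: of_int_1 of_int_minus mult_1_left mult_minus_left Te_def Tl_def
      lf_scale_add lf_scale_scale a lf_ac simp_thms if_True if_False)
qed

lemma gam_GTe:
  assumes e: "e \<in> {1, - 1}"
  defines "E \<equiv> of_int e"
  shows "gam (Gl e 1) (Te e 1) = num h [E * (3 * k + 5)] * inverse (num h [E * (3 * k + 3)])"
    "gam (Te e 1) (Gl e 1) = num h [- (E * (3 * k + 5))] * inverse (num h [- (E * (3 * k + 3))])"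
    "gam (Gl e (- 1)) (Te e 1) = num h [E * (k + 3)] * inverse (num h [E * (k + 1)])"
    "gam (Te e 1) (Gl e (- 1)) = num h [- (E * (k + 3))] * inverse (num h [- (E * (k + 1))])"
    "gam (Gl e 1) (Te e (- 1)) = num h [E * (k - 1), E * (3 * k + 5)] * inverse (num h [E * (k + 1), E * (3 * k + 3)])"
    "gam (Te e (- 1)) (Gl e 1) =
      num h [- (E * (k - 1)), - (E * (3 * k + 5))] * inverse (num h [- (E * (k + 1)), - (E * (3 * k + 3))])"
    "gam (Gl e (- 1)) (Te e (- 1)) = 1" "gam (Te e (- 1)) (Gl e (- 1)) = 1"
    "x \<in> {1, - 1} \<Longrightarrow> gam (Gl e x) (Te (- e) (- 1)) = 1" "x \<in> {1, - 1} \<Longrightarrow> gam (Te (- e) (- 1)) (Gl e x) = 1"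
    "kq (Te e 1) (Gl e x) = E * 2" "kq (Te e (- 1)) (Gl e x) = 0" "kq (Te (- e) (- 1)) (Gl e x) = 0"
    "lam (Te e' y) (Gl e x) = 0"
  using e by (auto simp: E_def Te_def gam_GT gam_TG num_Nil kq_TG lam_TG) (simp_all add: add.commute)

lemma rel_GT:
  assumes v: "v \<in> VV p L" and p: "sec A p" and e: "e \<in> {1, - 1}"
  shows "prod_zw (GG h k e) (TT h k) s t v - prod_wz (TT h k) (GG h k e) s t v =
    scl (of_int e * dq h * (qn h (k + 2) / qn h (k + 1)))
      (delta_mult h A (of_int e * 3 * (k + 1))
         (cscale h (of_int e * (k + 1)) (cmult (KK h k (- 1)) (cmult (GG h k e) (KK h k 1)))) s t v)"
proof -
  let ?I = "{1, - 1 :: int}"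
  define E :: complex where "E = of_int e"
  define r where "r = qn h (k + 2) / qn h (k + 1)"
  \<comment> \<open>For e = -1 every power of q is inverted, so the sign is built into
    \<open>P\<close> and \<open>Q\<close>. \<open>R\<close> is the contribution of z^{1/2} to the
    rescaling by q^{E(k+1)}.\<close>
  define P Q R where PQ: "P = qpow h (E * (k + 1))" "Q = qpow h E" "R = qpow h (E * (k + 1) / 2)"
  note facts = PQ_facts and g = gam_GTe[OF e, folded E_def]
  have EE: "E * E = 1" "E \<noteq> 0" using e by (auto simp: E_def)
  have f: "P \<noteq> 0" "Q \<noteq> 0" "R \<noteq> 0" "P ^ 2 \<noteq> 1" "Q ^ 2 \<noteq> 1" "P ^ 2 * Q ^ 2 \<noteq> 1"
    "E * dq h = (Q ^ 2 - 1) / Q" "E / dq h = Q / (Q ^ 2 - 1)" "r = (P ^ 2 * Q ^ 2 - 1) / ((P ^ 2 - 1) * Q)"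
  proof -
    have i: "P = qpow h (k + 1) \<and> Q = qpow h 1 \<or> P = 1 / qpow h (k + 1) \<and> Q = 1 / qpow h 1"
      using e by (auto simp: PQ E_def qpow_minus[symmetric])
    show ne: "P \<noteq> 0" "Q \<noteq> 0" "R \<noteq> 0" by (simp_all add: PQ)
    show P2: "P ^ 2 \<noteq> 1" and Q2: "Q ^ 2 \<noteq> 1" and PQ2: "P ^ 2 * Q ^ 2 \<noteq> 1"
      using i facts(1-6) by (elim disjE conjE; simp add: power_one_over)+
    show d: "E * dq h = (Q ^ 2 - 1) / Q"
      using e by (auto simp: E_def PQ dq_def qpow_minus power2_eq_square diff_divide_distrib)
    then show "E / dq h = Q / (Q ^ 2 - 1)"
      using EE dq_ne ne Q2 by (simp add: divide_simps) algebra
    have "r = (P ^ 2 * Q ^ 2 - 1) / ((P ^ 2 - 1) * Q)" if "P = qpow h (k + 1)" "Q = qpow h 1" for P Q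
      unfolding r_def facts(8,9) that[symmetric] using facts(1-6)[folded that] by (simp add: divide_simps power2_eq_square)
    moreover have "(X ^ 2 * Y ^ 2 - 1) / ((X ^ 2 - 1) * Y) = ((1 / X) ^ 2 * (1 / Y) ^ 2 - 1) / (((1 / X) ^ 2 - 1) * (1 / Y))"
      if "X \<noteq> 0" "Y \<noteq> 0" "X ^ 2 \<noteq> 1" for X Y :: complex
      using that by (simp add: divide_simps power2_eq_square) algebra
    ultimately show "r = (P ^ 2 * Q ^ 2 - 1) / ((P ^ 2 - 1) * Q)"
      using i facts(1-3) by metis
  qed
  define C where "C x T = nexp h k (Gl e x) (s + 1/2) (nexp h k T t v) - nexp h k T t (nexp h k (Gl e x) (s + 1/2) v)" for x T
  let ?c = "\<lambda>x::int. of_int x * (of_int e / dq h)"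
  have "GG h k e s (TT h k t v) - TT h k t (GG h k e s v) =
      (\<Sum>x\<in>?I. \<Sum>y\<in>Tset. scl (?c x * \<tau> y) (nexp h k (Gl e x) (s + 1/2) (nexp h k (case y of (a, b) \<Rightarrow> Tl a b) (t + 0) v)))
      - (\<Sum>x\<in>?I. \<Sum>y\<in>Tset. scl (?c x * \<tau> y) (nexp h k (case y of (a, b) \<Rightarrow> Tl a b) (t + 0) (nexp h k (Gl e x) (s + 1/2) v)))"
    unfolding rep_product[OF rep_GG linr_GG rep_TT v] rep_product[OF rep_TT linr_TT rep_GG v]
    by (subst (2) sum.swap) (simp only: mult.commute)
  also have "\<dots> = (\<Sum>x\<in>?I. \<Sum>y\<in>Tset. scl (?c x * \<tau> y) (C x (case y of (a, b) \<Rightarrow> Tl a b)))"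
    unfolding C_def by (simp only: sum_subtractf[symmetric] scl_diff[symmetric] add_0_right)
  also have "\<dots> = scl (E / dq h) (scl (qpow h (- E)) (C 1 (Te (- e) (- 1)) - C (- 1) (Te (- e) (- 1)))
      + scl (- r) (C 1 (Te e 1) - C (- 1) (Te e 1)) + scl Q (C 1 (Te e (- 1)) - C (- 1) (Te e (- 1))))"
    using e by (auto simp: Tset_def \<tau>_def Te_def E_def PQ r_def scl_add scl_diff scl_scl scl_minus scl_minus_left mult_ac)
  finally have LHS: "prod_zw (GG h k e) (TT h k) s t v - prod_wz (TT h k) (GG h k e) s t v = \<dots>"
    by (simp add: prod_zw_def prod_wz_def)
  show ?thesis
  proof (cases "s \<in> ZZ A")
    case False
    have "s + 1 / 2 + zeta (Gl e x) p \<notin> \<int>" for x using False sec_Gl[OF p e] by simp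
    moreover have "lam (Gl e x) (Te e' a) = of_int 0" for x e' a by (simp add: Te_def)
    ultimately have "C x (Te e' a) = 0" for x e' a
      unfolding C_def using nexp_nexp_zero[OF v] by (metis diff_zero)
    then show ?thesis unfolding LHS using False by (simp add: delta_mult_def)
  next
    case True
    have z: "s + 1 / 2 + zeta (Gl e x) p \<in> \<int>" for x using True sec_Gl[OF p e] by simp
    have st: "s + 1 / 2 + t = s + t + 1 / 2" by simp
    have l: "lam (Gl e x) (Te e' y) = 0" "kq (Gl e x) (Te e' y) = 0" for x e' y by (simp_all add: Te_def)
    let ?A = "\<lambda>x. fuse (E * (3 * k + 3)) (Gl e 1) (Te e x) (s + t + 1 / 2) v"
    let ?B = "fuse (E * (k + 1)) (Gl e 1) (Te e (- 1)) (s + t + 1 / 2) v"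
    \<comment> \<open>At this pole both summands of the supercurrent sit at the same point, one of
      them inside T, so they may be interchanged.\<close>
    have B: "fuse (E * (k + 1)) (Gl e (- 1)) (Te e 1) (s + t + 1 / 2) v = ?B"
    proof -
      have "e = 1 \<or> e = - 1" "((- 1 :: int) = 1) = False" using e by simp_all
      then show ?thesis
        by (elim disjE) (simp_all only: Te_def Tl_def E_def lf_ac of_int_1 of_int_minus mult_1_left mult_minus_left
          simp_thms if_True if_False)
    qed
    have q: "qpow h (E * (3 * k + 5) - E * (3 * k + 3)) = Q ^ 2" "qpow h (E * (k + 3) - E * (k + 1)) = Q ^ 2"
      "qpow h (E * (k - 1) - E * (k + 1)) = 1 / Q ^ 2" "qpow h (E * (3 * k + 5) - E * (k + 1)) = P ^ 2 * Q ^ 2"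
      "qpow h (E * (3 * k + 3) - E * (k + 1)) = P ^ 2" "qpow h (E * (k - 1) - E * (3 * k + 3)) = 1 / (P ^ 2 * Q ^ 2)"
      "qpow h (E * (k + 1) - E * (3 * k + 3)) = 1 / P ^ 2"
      "qpow h (E * (k + 1) * (s + 1 / 2)) = qpow h (E * (k + 1) * s) * R"
      "qpow h (E * (3 * k + 3) * (s + 1 / 2)) = qpow h (E * 3 * (k + 1) * s) * (R * P)"
      "qpow h (E * (k + 2)) = P * Q"
      unfolding PQ power2_eq_square by (simp_all add: qmerge qpow_minus[symmetric]) (simp_all add: field_simps)
    \<comment> \<open>This summand of T has neither zeros nor poles with either summand of the
      supercurrent.\<close>
    have c0: "C x (Te (- e) (- 1)) = 0" if "x \<in> ?I" for x
      unfolding C_def by (rule commutator_no_poles[OF v]) (use that in \<open>simp_all add: g l\<close>)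
    have c0': "C (- 1) (Te e (- 1)) = 0"
      unfolding C_def by (rule commutator_no_poles[OF v]) (simp_all add: g l)
    have k2: "qpow h (kq (Te e 1) (Gl e x)) = qpow h (kq (Gl e x) (Te e 1) + E * a - E * b)" if "a - b = 2" for x a b
      unfolding g l using that by (metis add_0 right_diff_distrib)
    have c1: "C 1 (Te e 1) = scl ((1 - Q ^ 2) * qpow h (E * (3 * k + 3) * (s + 1 / 2))) (?A 1)"
      unfolding C_def by (subst commutator_one_pole[OF v z l(1) g(14) g(1,2) k2]) (simp_all only: l qpow_0 mult_1_left q(1,2) st, simp)
    have c2: "C (- 1) (Te e 1) = scl ((1 - Q ^ 2) * qpow h (E * (k + 1) * (s + 1 / 2))) ?B"
      unfolding C_def B[symmetric] by (subst commutator_one_pole[OF v z l(1) g(14) g(3,4) k2]) (simp_all only: l qpow_0 mult_1_left q(1,2) st, simp)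
    have nP: "qpow h (E * (k + 1)) \<noteq> qpow h (E * (3 * k + 3))"
    proof
      assume "qpow h (E * (k + 1)) = qpow h (E * (3 * k + 3))"
      then have "qpow h (E * (3 * k + 3) - E * (k + 1)) = 1" unfolding qdiff by simp
      then show False using f(4) q(5) by simp
    qed
    have k3: "qpow h (kq (Te e (- 1)) (Gl e 1)) =
        qpow h (kq (Gl e 1) (Te e (- 1)) + E * (k - 1) + E * (3 * k + 5) - E * (k + 1) - E * (3 * k + 3))"
      unfolding g l by (rule arg_cong[of _ _ "qpow h"]) (simp add: algebra_simps)
    have c3: "C 1 (Te e (- 1)) = scl ((1 - 1 / Q ^ 2) * (1 - P ^ 2 * Q ^ 2) / (1 - P ^ 2) * qpow h (E * (k + 1) * (s + 1 / 2))) ?B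
        + scl ((1 - 1 / (P ^ 2 * Q ^ 2)) * (1 - Q ^ 2) / (1 - 1 / P ^ 2) * qpow h (E * (3 * k + 3) * (s + 1 / 2))) (?A (- 1))"
      unfolding C_def
      by (subst commutator_two_poles[OF v z l(1) g(14) g(5,6) k3 nP]) (simp only: l qpow_0 mult_1_left q(1-7) st)
    have s1: "- r * ((1 - Q ^ 2) * qpow h (E * (3 * k + 3) * (s + 1 / 2))) = E * dq h * r * (qpow h (E * 3 * (k + 1) * s) * (P * Q * R))"
      unfolding q f(7) using f(1-6) by (simp add: divide_simps) algebra
    have s2: "Q * ((1 - 1 / (P ^ 2 * Q ^ 2)) * (1 - Q ^ 2) / (1 - 1 / P ^ 2) * qpow h (E * (3 * k + 3) * (s + 1 / 2)))
        = - (E * dq h * r * (qpow h (E * 3 * (k + 1) * s) * (P * Q * R)))"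
      unfolding q f(7,9) using f(1-6) by (simp add: divide_simps) algebra
    \<comment> \<open>The two contributions at the pole q^{E(k+1)}, which fuse to the same operator
      by \<open>B\<close>, have equal coefficients and cancel; only the pole q^{3E(k+1)}
      remains.\<close>
    have s3: "Q * ((1 - 1 / Q ^ 2) * (1 - P ^ 2 * Q ^ 2) / (1 - P ^ 2) * qpow h (E * (k + 1) * (s + 1 / 2)))
        = - r * ((1 - Q ^ 2) * qpow h (E * (k + 1) * (s + 1 / 2)))"
      unfolding f(9) using f(1-6) by (simp add: divide_simps) algebra
    have RHS: "cscale h (E * (k + 1)) (cmult (KK h k (- 1)) (cmult (GG h k e) (KK h k 1))) (s + t) v =
        scl (E / dq h * (P * Q) * R) (?A 1) - scl (E / dq h * (P * Q) * R) (?A (- 1))"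
    proof -
      have "rep p (cmult (KK h k (- 1)) (cmult (GG h k e) (KK h k 1))) ?I (\<lambda>x. ?c x * qpow h (kq (Kl (- 1)) (Gl e x)))
          (\<lambda>x. Kl (- 1) \<oplus>\<^sub>l (Gl e x \<oplus>\<^sub>l Kl 1)) (1/2)"
        by (rule rep_KXK[OF rep_GG]) simp
      from repD[OF rep_cscale[OF this] v] show ?thesis
        by (simp only: kq_KG[OF e] E_def fuse_KGK[OF e])
          (simp add: q(10)[unfolded E_def] PQ(3)[unfolded E_def, symmetric] scl_minus_left E_def)
    qed
    have "scl (E / dq h) (scl (- r) (C 1 (Te e 1) - C (- 1) (Te e 1)) + scl Q (C 1 (Te e (- 1))))
        = scl (E * dq h * r) (scl (qpow h (E * 3 * (k + 1) * s)) (scl (E / dq h * (P * Q) * R) (?A 1) - scl (E / dq h * (P * Q) * R) (?A (- 1))))"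
      unfolding c1 c2 c3 scl_add scl_diff scl_scl s1 s2 s3 by (simp add: scl_minus_left mult_ac)
    then show ?thesis
      unfolding LHS delta_mult_def E_def[symmetric] RHS r_def[symmetric] using True by (simp add: c0 c0')
  qed
qed

end

section \<open>The normally ordered product of the supercurrents\<close>

text \<open>\<open>wt U j\<close> is the weight with which mode normal ordering at a fixed total mode counts the
  coefficient \<open>j\<close> of the bilateral contraction series: the sum of its parts \<open>j \<ge> 1\<close> and \<open>j \<le> 0\<close>
  is the delta function, and \<open>G\<^sup>+ G\<^sup>-\<close> contributes the former, \<open>- G\<^sup>- G\<^sup>+\<close> minus the latter.\<close>

definition wt :: "int \<Rightarrow> int \<Rightarrow> complex" where
  "wt U j = (if 2 * j < U then (if j \<ge> 1 then 1 else 0) else if 2 * j > U then - (if j \<le> 0 then 1 else 0)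
     else ((if j \<ge> 1 then 1 else 0) - (if j \<le> 0 then 1 else 0)) / 2)"

lemma finite_wt: "finite {j. wt U j \<noteq> 0}"
  by (rule finite_subset[of _ "{- \<bar>U\<bar>..\<bar>U\<bar>}"]) (auto simp: wt_def split: if_splits)

text \<open>Raising \<open>U\<close> by 2 moves the cut by one place and changes the weight at one
  or two places only. This permits an induction over \<open>U\<close> of fixed parity.\<close>

lemma wt_even_step: "wt (2 * (e + 1)) j = wt (2 * e) j + ((if j = e then 1 / 2 else 0) + (if j = e + 1 then 1 / 2 else 0))"
  and wt_odd_step: "wt (2 * (e + 1) + 1) j = wt (2 * e + 1) j + (if j = e + 1 then 1 else 0)"
  by (auto simp: wt_def)

lemma finite_wt_mult: "finite {j. wt U j * f j \<noteq> 0}"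
  by (rule finite_subset[OF _ finite_wt[of U]]) auto

context fock_generic
begin

text \<open>Boundary term of the geometric series cut at U/2. For even \<open>U\<close> the cut
  meets the place U/2, which counts half; for odd \<open>U\<close> it falls between two
  places.\<close>

definition wpole :: "complex \<Rightarrow> int \<Rightarrow> complex" where
  "wpole a U = qpow h (a * of_int U / 2) *
     (if even U then (1 + qpow h a) / (2 * (1 - qpow h a)) else qpow h (a / 2) / (1 - qpow h a))"

text \<open>The first term is the formal value of the sum over all j >= 1, the second the formal
  value of the tail beyond the cut. Both sides have the same increments in \<open>U\<close>, so it
  is enough to compare them at 0 and 1 and to step in both directions.\<close>

lemma wt_sum:
  assumes a: "qpow h a \<noteq> 1"
  shows "Sum_any (\<lambda>j. wt U j * qpow h (a * of_int j)) = qpow h a / (1 - qpow h a) - wpole a U"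
proof -
  define S where "S U = Sum_any (\<lambda>j. wt U j * qpow h (a * of_int j))" for U
  have ne: "1 - qpow h a \<noteq> 0" using a by simp
  have inc_even: "S (2 * (e + 1)) = S (2 * e) + (qpow h (a * of_int e) / 2 + qpow h (a * of_int (e + 1)) / 2)" for e
  proof -
    have "S (2 * (e + 1)) = Sum_any (\<lambda>j. wt (2 * e) j * qpow h (a * of_int j)
        + ((if j = e then qpow h (a * of_int j) / 2 else 0) + (if j = e + 1 then qpow h (a * of_int j) / 2 else 0)))"
      unfolding S_def wt_even_step by (rule arg_cong[of _ _ Sum_any]) (auto simp: algebra_simps)
    also have "\<dots> = S (2 * e) + Sum_any (\<lambda>j. (if j = e then qpow h (a * of_int j) / 2 else 0) + (if j = e + 1 then qpow h (a * of_int j) / 2 else 0))"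
      unfolding S_def
      by (rule Sum_any.distrib[OF finite_wt_mult], rule finite_subset[of _ "{e, e + 1}"]) auto
    also have "Sum_any (\<lambda>j. (if j = e then qpow h (a * of_int j) / 2 else 0) + (if j = e + 1 then qpow h (a * of_int j) / 2 else 0))
        = qpow h (a * of_int e) / 2 + qpow h (a * of_int (e + 1)) / 2"
      by (subst Sum_any.distrib) auto
    finally show ?thesis .
  qed
  have inc_odd: "S (2 * (e + 1) + 1) = S (2 * e + 1) + qpow h (a * of_int (e + 1))" for e
  proof -
    have "S (2 * (e + 1) + 1) = Sum_any (\<lambda>j. wt (2 * e + 1) j * qpow h (a * of_int j) + (if j = e + 1 then qpow h (a * of_int j) else 0))"
      unfolding S_def wt_odd_step by (rule arg_cong[of _ _ Sum_any]) (auto simp: algebra_simps)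
    also have "\<dots> = S (2 * e + 1) + Sum_any (\<lambda>j. if j = e + 1 then qpow h (a * of_int j) else 0)"
      unfolding S_def by (rule Sum_any.distrib[OF finite_wt_mult]) simp
    finally show ?thesis by simp
  qed
  define R where "R U = qpow h a / (1 - qpow h a) - wpole a U" for U
  have q1: "qpow h (a * of_int (e + 1)) = qpow h (a * of_int e) * qpow h a" for e
    by (simp add: qmerge algebra_simps)
  have even_eq: "wpole a (2 * e) = qpow h (a * of_int e) * ((1 + qpow h a) / (2 * (1 - qpow h a)))" for e
    by (simp add: wpole_def)
  have odd_eq: "wpole a (2 * e + 1) = qpow h (a * of_int e) * (qpow h a / (1 - qpow h a))" for e
  proof -
    have "qpow h (a * of_int (2 * e + 1) / 2) * qpow h (a / 2) = qpow h (a * of_int e) * qpow h a"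
      by (simp add: qmerge) (rule arg_cong[of _ _ "qpow h"], simp add: field_simps)
    then show ?thesis by (simp add: wpole_def)
  qed
  have R0: "R (2 * (e + 1)) = R (2 * e) + (qpow h (a * of_int e) / 2 + qpow h (a * of_int (e + 1)) / 2)" for e
    unfolding R_def even_eq q1 using ne by (simp add: divide_simps) algebra
  have R1: "R (2 * (e + 1) + 1) = R (2 * e + 1) + qpow h (a * of_int (e + 1))" for e
    unfolding R_def odd_eq q1 using ne by (simp add: divide_simps) algebra
  \<comment> \<open>At U = 0 only j = 0 counts, with half of its negative part; at U = 1 nothing
    counts.\<close>
  have S00: "S 0 = - 1 / 2"
  proof -
    have "S 0 = Sum_any (\<lambda>j::int. if j = 0 then - 1 / 2 else (0 :: complex))"
      unfolding S_def by (rule arg_cong[of _ _ Sum_any]) (auto simp: wt_def)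
    then show ?thesis by simp
  qed
  have S01: "S 1 = 0"
  proof -
    have "S 1 = Sum_any (\<lambda>j::int. (0 :: complex))"
      unfolding S_def by (rule arg_cong[of _ _ Sum_any]) (auto simp: wt_def)
    then show ?thesis by simp
  qed
  have base: "S (2 * 0) = R (2 * 0)" "S (2 * 0 + 1) = R (2 * 0 + 1)"
  proof -
    have "S (2 * 0) = - 1 / 2" "S (2 * 0 + 1) = 0" using S00 S01 by simp_all
    then show "S (2 * 0) = R (2 * 0)" "S (2 * 0 + 1) = R (2 * 0 + 1)"
      unfolding R_def even_eq odd_eq using ne by (simp_all add: divide_simps) algebra
  qed
  have ev: "S (2 * e) = R (2 * e)" for e
  proof (induction e rule: int_induct[where k = 0])
    case (step2 i)
    then show ?case using inc_even[of "i - 1"] R0[of "i - 1"] by simp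
  next
    case (step1 i)
    then show ?case using inc_even[of i] R0[of i] by simp
  qed (use base in simp)
  have od: "S (2 * e + 1) = R (2 * e + 1)" for e
  proof (induction e rule: int_induct[where k = 0])
    case (step2 i)
    then show ?case using inc_odd[of "i - 1"] R1[of "i - 1"] by simp
  next
    case (step1 i)
    then show ?case using inc_odd[of i] R1[of i] by simp
  qed (use base in simp)
  have "S U = R U"
    using ev[of "U div 2"] od[of "U div 2"] by (cases "even U") (auto elim!: evenE oddE)
  then show ?thesis by (simp add: S_def R_def)
qed

lemma wpole_shift: "wpole a (U + 2 * l) = wpole a U * qpow h (a * of_int l)"
proof -
  have "qpow h (a * of_int (U + 2 * l) / 2) = qpow h (a * of_int U / 2) * qpow h (a * of_int l)"
    by (simp add: qmerge) (rule arg_cong[of _ _ "qpow h"], simp add: field_simps)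
  then show ?thesis by (simp add: wpole_def)
qed

text \<open>On a given vector only finitely many coefficients matter, so the sum over i may be taken
  coefficient by coefficient, even if its support varies with the coefficient.\<close>

lemma BB_Sum_any:
  assumes v: "v \<in> VV p L" and fin: "\<And>l. finite {i. g i l \<noteq> 0}"
  shows "Sum_any (\<lambda>i. BB p F G (g i) s t v) = BB p F G (\<lambda>l. Sum_any (\<lambda>i. g i l)) s t v"
    and "finite {i. BB p F G (g i) s t v \<noteq> 0}"
proof -
  define S where "S = {n::int. N2 p F G (s - of_int n) (t + of_int n) v \<noteq> 0}"
  define N where "N n = N2 p F G (s - of_int n) (t + of_int n) v" for n :: int
  have S: "finite S" unfolding S_def by (rule finite_N2[OF v])
  have BS: "BB p F G f s t v = (\<Sum>n\<in>S. scl (f n) (N n))" for f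
    unfolding BB_def N_def by (rule Sum_any.expand_superset[OF S]) (auto simp: S_def)
  have f1: "finite {i. scl (g i n) (N n) \<noteq> 0}" for n
    by (rule finite_subset[OF _ fin[of n]]) auto
  show "finite {i. BB p F G (g i) s t v \<noteq> 0}"
    unfolding BS by (rule finite_sum_support[OF S f1])
  have scl_Sum: "Sum_any (\<lambda>i. scl (g i n) (N n)) = scl (Sum_any (\<lambda>i. g i n)) (N n)" for n
  proof -
    have "Sum_any (\<lambda>i. scl (g i n) (N n)) = (\<Sum>i\<in>{i. g i n \<noteq> 0}. scl (g i n) (N n))"
      by (rule Sum_any.expand_superset[OF fin]) auto
    then show ?thesis by (simp add: Sum_any.expand_set scl_sum_left)
  qed
  show "Sum_any (\<lambda>i. BB p F G (g i) s t v) = BB p F G (\<lambda>l. Sum_any (\<lambda>i. g i l)) s t v"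
    unfolding BS Sum_any_sum[OF S f1] scl_Sum ..
qed

definition signs :: "(int \<times> int) set" where "signs = {1, - 1} \<times> {1, - 1}"

definition gcoef :: "int \<times> int \<Rightarrow> complex" where
  "gcoef = (\<lambda>(x, y). - (of_int (x * y) / dq h ^ 2))"

lemma signs_finite [simp]: "finite signs" by (simp add: signs_def)

text \<open>Twice a representative of the coset \<open>ZZ A\<close>; doubled, it is an integer, and
  comparing the modes of G^+ and G^- becomes a comparison of integers.\<close>

definition base2 :: "sector \<Rightarrow> int" where
  "base2 A = (case A of Neveu_Schwarz \<Rightarrow> - 1 | Ramond \<Rightarrow> 0)"

definition base :: "sector \<Rightarrow> complex" where
  "base A = of_int (base2 A) / 2"

lemma ZZ_base: "s \<in> ZZ A \<longleftrightarrow> (\<exists>i::int. s = base A + of_int i)"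
proof (cases A)
  case Ramond
  then show ?thesis by (auto simp: ZZ_def base_def base2_def elim: Ints_cases)
next
  case Neveu_Schwarz
  have "s - 1 / 2 \<in> \<int> \<longleftrightarrow> (\<exists>i::int. s = - 1 / 2 + of_int i)"
  proof
    assume "s - 1 / 2 \<in> \<int>"
    then obtain n where "s - 1 / 2 = of_int n" by (elim Ints_cases)
    then have "s = - 1 / 2 + of_int (n + 1)" by (simp add: algebra_simps)
    then show "\<exists>i::int. s = - 1 / 2 + of_int i" by blast
  next
    assume "\<exists>i::int. s = - 1 / 2 + of_int i"
    then obtain i :: int where "s = - 1 / 2 + of_int i" by blast
    then have "s - 1 / 2 = of_int (i - 1)" by simp
    then show "s - 1 / 2 \<in> \<int>" by (metis Ints_of_int)
  qed
  then show ?thesis using Neveu_Schwarz by (simp add: ZZ_def base_def base2_def)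
qed

text \<open>After a shift by i all products refer to the same two exponents, so the sum over i acts
  on the coefficient sequences only. The three cases of mode normal ordering are the cases 2i < u,
  2i = u and 2i > u of \<open>wt\<close>.\<close>

lemma normal_GG_eq:
  assumes v: "v \<in> VV p L" and u: "u = M - base2 A"
  shows "normal_GG (GG h k 1) (GG h k (- 1)) (base A + of_int i) (of_int M - base A - of_int i) v =
    (\<Sum>(x, y)\<in>signs. scl (gcoef (x, y)) (BB p (Gl 1 x) (Gl (- 1) y) (\<lambda>l. wt (u + 2 * l) (l + i) * bil x y (l + i))
      (base A + 1/2) (of_int M - base A - 1/2) v))"
proof -
  let ?m = "base A + of_int i" and ?n = "of_int M - base A - of_int i :: complex"
  let ?I = "{1, - 1 :: int}"
  have b: "base A = of_int (base2 A) / 2" by (simp add: base_def)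
  have n1: "?n + 1 / 2 - 1 = ?n - 1 / 2" by simp
  have RP: "GG h k 1 ?m (GG h k (- 1) ?n v) = (\<Sum>(x, y)\<in>signs. scl (gcoef (x, y))
      (BB p (Gl 1 x) (Gl (- 1) y) (\<lambda>n. (if n \<ge> 1 then 1 else 0) * bil x y n) (?m + 1/2) (?n - 1/2) v))"
  proof -
    have "GG h k 1 ?m (GG h k (- 1) ?n v) = (\<Sum>x\<in>?I. \<Sum>y\<in>?I. scl (gcoef (x, y))
        (nexp h k (Gl 1 x) (?m + 1/2) (nexp h k (Gl (- 1) y) (?n + 1/2) v)))"
      unfolding rep_product[OF rep_GG linr_GG rep_GG v] by (simp add: gcoef_def power2_eq_square)
    also have "\<dots> = (\<Sum>x\<in>?I. \<Sum>y\<in>?I. scl (gcoef (x, y))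
        (BB p (Gl 1 x) (Gl (- 1) y) (\<lambda>n. (if n \<ge> 1 then 1 else 0) * bil x y n) (?m + 1/2) (?n + 1/2 - 1) v))"
      by (intro sum.cong refl arg_cong[of _ _ "scl _"] GG_halves[OF v])
    finally show ?thesis by (simp only: n1 signs_def sum.cartesian_product)
  qed
  have RM: "GG h k (- 1) ?n (GG h k 1 ?m v) = (\<Sum>(x, y)\<in>signs. scl (gcoef (x, y))
      (BB p (Gl 1 x) (Gl (- 1) y) (\<lambda>n. (if n \<le> 0 then 1 else 0) * bil x y n) (?m + 1/2) (?n - 1/2) v))"
  proof -
    have "GG h k (- 1) ?n (GG h k 1 ?m v) = (\<Sum>y\<in>?I. \<Sum>x\<in>?I. scl (gcoef (x, y))
        (nexp h k (Gl (- 1) y) (?n + 1/2) (nexp h k (Gl 1 x) (?m + 1/2) v)))"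
      unfolding rep_product[OF rep_GG linr_GG rep_GG v] by (simp add: gcoef_def power2_eq_square)
    also have "\<dots> = (\<Sum>y\<in>?I. \<Sum>x\<in>?I. scl (gcoef (x, y))
        (BB p (Gl 1 x) (Gl (- 1) y) (\<lambda>n. (if n \<le> 0 then 1 else 0) * bil x y n) (?m + 1/2) (?n + 1/2 - 1) v))"
      by (intro sum.cong refl arg_cong[of _ _ "scl _"] GG_halves[OF v])
    also have "\<dots> = (\<Sum>x\<in>?I. \<Sum>y\<in>?I. scl (gcoef (x, y))
        (BB p (Gl 1 x) (Gl (- 1) y) (\<lambda>n. (if n \<le> 0 then 1 else 0) * bil x y n) (?m + 1/2) (?n + 1/2 - 1) v))"
      by (rule sum.swap)
    finally show ?thesis by (simp only: n1 signs_def sum.cartesian_product)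
  qed
  have c1: "?m = ?n \<longleftrightarrow> 2 * i = u"
  proof -
    have "?m - ?n = of_int (2 * i - u)" unfolding b u by (simp add: field_simps)
    then have "?m = ?n \<longleftrightarrow> (of_int (2 * i - u) :: complex) = 0" by (metis eq_iff_diff_eq_0)
    then show ?thesis by (simp only: of_int_eq_0_iff) simp
  qed
  have c2: "Re ?m < Re ?n \<longleftrightarrow> 2 * i < u"
  proof -
    have "Re (base A) = of_int (base2 A) / 2" by (simp add: b)
    then have "Re ?m < Re ?n \<longleftrightarrow> (of_int (2 * i) :: real) < of_int u"
      unfolding u by (simp add: field_simps)
    then show ?thesis by (simp only: of_int_less_iff)
  qed
  have "normal_GG (GG h k 1) (GG h k (- 1)) ?m ?n v = (\<Sum>(x, y)\<in>signs. scl (gcoef (x, y))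
      (BB p (Gl 1 x) (Gl (- 1) y) (\<lambda>n. wt (u + 2 * (n - i)) n * bil x y n) (?m + 1/2) (?n - 1/2) v))"
  proof -
    consider "2 * i = u" | "2 * i < u" | "2 * i > u" by linarith
    then show ?thesis
    proof cases
      case 1
      have w: "wt (u + 2 * (n - i)) n * bil x y n = 1 / 2 * ((if n \<ge> 1 then 1 else 0) * bil x y n)
          + - (1 / 2) * ((if n \<le> 0 then 1 else 0) * bil x y n)" for n x y
        using 1 by (auto simp: wt_def)
      have "?n = ?m" using 1 c1 by simp
      then have "normal_GG (GG h k 1) (GG h k (- 1)) ?m ?n v =
          scl (1 / 2) (GG h k 1 ?m (GG h k (- 1) ?n v) - GG h k (- 1) ?n (GG h k 1 ?m v))"
        by (simp only: normal_GG_def if_True simp_thms)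
      then show ?thesis unfolding RP RM
        by (simp only: w BB_add[OF v] BB_scl)
          (simp add: sum_subtractf[symmetric] scl_sum scl_scl scl_add scl_diff scl_minus_left case_prod_unfold mult.commute)
    next
      case 2
      have w: "wt (u + 2 * (n - i)) n = (if n \<ge> 1 then 1 else 0)" for n
        using 2 by (auto simp: wt_def)
      show ?thesis using 2 c1 c2 unfolding normal_GG_def RP RM w by simp
    next
      case 3
      have w: "wt (u + 2 * (n - i)) n * bil x y n = - 1 * ((if n \<le> 0 then 1 else 0) * bil x y n)" for n x y
        using 3 by (auto simp: wt_def)
      show ?thesis using 3 c1 c2 unfolding normal_GG_def RP RM
        by (simp only: w BB_scl)
          (simp add: sum_negf[symmetric] scl_scl scl_minus_left scl_minus case_prod_unfold)
    qed
  qed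
  also have "\<dots> = (\<Sum>(x, y)\<in>signs. scl (gcoef (x, y)) (BB p (Gl 1 x) (Gl (- 1) y)
      (\<lambda>l. wt (u + 2 * l) (l + i) * bil x y (l + i)) (base A + 1/2) (of_int M - base A - 1/2) v))"
  proof (intro sum.cong refl, clarify, intro arg_cong[of _ _ "scl _"])
    fix x y
    have e: "?m + 1 / 2 = base A + 1 / 2 + of_int i" "?n - 1 / 2 + of_int i = of_int M - base A - 1 / 2" by simp_all
    show "BB p (Gl 1 x) (Gl (- 1) y) (\<lambda>n. wt (u + 2 * (n - i)) n * bil x y n) (?m + 1/2) (?n - 1/2) v =
      BB p (Gl 1 x) (Gl (- 1) y) (\<lambda>l. wt (u + 2 * l) (l + i) * bil x y (l + i)) (base A + 1/2) (of_int M - base A - 1/2) v"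
      unfolding e(1) BB_shift e(2) by simp
  qed
  finally show ?thesis .
qed

end

lemma Sum_any_range:
  assumes "inj g"
  shows "Sum_any (\<lambda>x. if x \<in> range g then f x else 0) = Sum_any (\<lambda>i. f (g i))"
proof -
  have S: "{x. (if x \<in> range g then f x else 0) \<noteq> 0} = g ` {i. f (g i) \<noteq> 0}" by auto
  show ?thesis
    unfolding Sum_any.expand_set S
    by (subst sum.reindex[OF inj_on_subset[OF assms subset_UNIV]]) simp
qed

context fock_generic
begin

text \<open>The part of the residue sum that does not depend on the mode number.\<close>

definition bconst :: "int \<Rightarrow> int \<Rightarrow> complex" where
  "bconst x y = (\<Sum>a\<in>poles x y. resid x y a * (qpow h a / (1 - qpow h a)))"

text \<open>With j = l + i the cut of the inner sum lies at u/2 + l, so every boundary term is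
  geometric in l. The constant is written as the geometric sequence with exponent 0, in order that
  \<open>BB_geometric\<close> treats all terms alike.\<close>

lemma wt_bil_sum:
  "Sum_any (\<lambda>i. wt (u + 2 * l) (l + i) * bil x y (l + i)) =
    bconst x y * qpow h (0 * of_int l) + (\<Sum>a\<in>poles x y. - (resid x y a * wpole a u) * qpow h (a * of_int l))"
proof -
  have "Sum_any (\<lambda>i. wt (u + 2 * l) (l + i) * bil x y (l + i)) = Sum_any (\<lambda>j. wt (u + 2 * l) j * bil x y j)"
    using Sum_any_shift_int[of "\<lambda>j. wt (u + 2 * l) j * bil x y j" l] by (simp add: add.commute)
  also have "\<dots> = (\<Sum>j\<in>{j. wt (u + 2 * l) j \<noteq> 0}. wt (u + 2 * l) j * bil x y j)"
    by (rule Sum_any.expand_superset[OF finite_wt]) auto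
  also have "\<dots> = (\<Sum>a\<in>poles x y. \<Sum>j\<in>{j. wt (u + 2 * l) j \<noteq> 0}. resid x y a * (wt (u + 2 * l) j * qpow h (a * of_int j)))"
    unfolding bil_def sum_distrib_left by (subst sum.swap) (simp add: mult_ac)
  also have "\<dots> = (\<Sum>a\<in>poles x y. resid x y a * (qpow h a / (1 - qpow h a) - wpole a u * qpow h (a * of_int l)))"
  proof (rule sum.cong[OF refl])
    fix a assume a: "a \<in> poles x y"
    have "(\<Sum>j\<in>{j. wt (u + 2 * l) j \<noteq> 0}. wt (u + 2 * l) j * qpow h (a * of_int j)) =
        Sum_any (\<lambda>j. wt (u + 2 * l) j * qpow h (a * of_int j))"
      by (rule Sum_any.expand_superset[OF finite_wt, symmetric]) auto
    also have "\<dots> = qpow h a / (1 - qpow h a) - wpole a u * qpow h (a * of_int l)"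
      unfolding wt_sum[OF pole_ne_one[OF a]] wpole_shift ..
    finally show "(\<Sum>j\<in>{j. wt (u + 2 * l) j \<noteq> 0}. resid x y a * (wt (u + 2 * l) j * qpow h (a * of_int j))) =
        resid x y a * (qpow h a / (1 - qpow h a) - wpole a u * qpow h (a * of_int l))"
      by (simp add: sum_distrib_left[symmetric])
  qed
  also have "\<dots> = bconst x y * qpow h (0 * of_int l) + (\<Sum>a\<in>poles x y. - (resid x y a * wpole a u) * qpow h (a * of_int l))"
    by (simp add: bconst_def sum.distrib[symmetric] sum_negf[symmetric] sum_subtractf[symmetric] algebra_simps)
  finally show ?thesis .
qed

text \<open>The geometric sequence of exponent 0 produces the normally ordered product at one point,
  and the one of exponent a the product fused at the pole a.\<close>

lemma normal_GG_sum:
  assumes v: "v \<in> VV p L" and p: "sec A p" and u: "u = M - base2 A"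
  shows "Sum_any (\<lambda>i::int. normal_GG (GG h k 1) (GG h k (- 1)) (base A + of_int i) (of_int M - base A - of_int i) v) =
    (\<Sum>(x, y)\<in>signs. scl (gcoef (x, y)) (scl (bconst x y) (nexp h k (Gl 1 x \<oplus>\<^sub>l Gl (- 1) y) (of_int M) v)
      - (\<Sum>a\<in>poles x y. scl (resid x y a * (wpole a u * qpow h (a * (base A + 1/2)))) (fuse a (Gl 1 x) (Gl (- 1) y) (of_int M) v))))"
    and "finite {i::int. normal_GG (GG h k 1) (GG h k (- 1)) (base A + of_int i) (of_int M - base A - of_int i) v \<noteq> 0}"
proof -
  let ?s = "base A + 1/2" and ?t = "of_int M - base A - 1/2 :: complex"
  let ?B = "\<lambda>x y g. BB p (Gl 1 x) (Gl (- 1) y) g ?s ?t v"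
  have st: "?s + ?t = of_int M" by simp
  have fin: "finite {i. wt (u + 2 * l) (l + i) * bil x y (l + i) \<noteq> 0}" for l x y
  proof -
    have "finite ((\<lambda>i. l + i) -` {j. wt (u + 2 * l) j * bil x y j \<noteq> 0})"
      by (rule finite_vimageI[OF finite_wt_mult]) (simp add: inj_on_def)
    then show ?thesis by (simp add: vimage_def)
  qed
  note eq = normal_GG_eq[OF v u]
  have f1: "finite {i. (case z of (x, y) \<Rightarrow> scl (gcoef (x, y)) (?B x y (\<lambda>l. wt (u + 2 * l) (l + i) * bil x y (l + i)))) \<noteq> 0}" for z
  proof (cases z)
    case (Pair x y)
    have "finite {i. ?B x y (\<lambda>l. wt (u + 2 * l) (l + i) * bil x y (l + i)) \<noteq> 0}"
      by (rule BB_Sum_any(2)[OF v fin])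
    then show ?thesis by (rule rev_finite_subset) (auto simp: Pair)
  qed
  show "finite {i::int. normal_GG (GG h k 1) (GG h k (- 1)) (base A + of_int i) (of_int M - base A - of_int i) v \<noteq> 0}"
    unfolding eq by (rule finite_sum_support[OF signs_finite f1])
  have z: "?s + zeta (Gl 1 x) p \<in> \<int>" for x
  proof -
    have "base A \<in> ZZ A" unfolding ZZ_base by (rule exI[of _ 0]) simp
    then show ?thesis using sec_Gl[OF p, of 1 "base A" x] by simp
  qed
  have "Sum_any (\<lambda>i::int. normal_GG (GG h k 1) (GG h k (- 1)) (base A + of_int i) (of_int M - base A - of_int i) v) =
      (\<Sum>z\<in>signs. Sum_any (\<lambda>i. case z of (x, y) \<Rightarrow> scl (gcoef (x, y)) (?B x y (\<lambda>l. wt (u + 2 * l) (l + i) * bil x y (l + i)))))"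
    unfolding eq by (rule Sum_any_sum[OF signs_finite f1])
  also have "\<dots> = (\<Sum>(x, y)\<in>signs. scl (gcoef (x, y)) (scl (bconst x y) (nexp h k (Gl 1 x \<oplus>\<^sub>l Gl (- 1) y) (of_int M) v)
      - (\<Sum>a\<in>poles x y. scl (resid x y a * (wpole a u * qpow h (a * ?s))) (fuse a (Gl 1 x) (Gl (- 1) y) (of_int M) v))))"
  proof (rule sum.cong[OF refl], clarify)
    fix x y
    have "Sum_any (\<lambda>i. ?B x y (\<lambda>l. wt (u + 2 * l) (l + i) * bil x y (l + i))) =
        ?B x y (\<lambda>l. bconst x y * qpow h (0 * of_int l) + (\<Sum>a\<in>poles x y. - (resid x y a * wpole a u) * qpow h (a * of_int l)))"
      unfolding BB_Sum_any(1)[OF v fin] wt_bil_sum ..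
    also have "\<dots> = scl (bconst x y) (nexp h k (Gl 1 x \<oplus>\<^sub>l Gl (- 1) y) (of_int M) v)
      + (\<Sum>a\<in>poles x y. scl (- (resid x y a * wpole a u)) (scl (qpow h (a * ?s)) (fuse a (Gl 1 x) (Gl (- 1) y) (of_int M) v)))"
      unfolding BB_add[OF v] BB_sum[OF v poles_finite] BB_scl BB_geometric[OF v z] st by (simp add: lf_scale_0)
    also have "\<dots> = scl (bconst x y) (nexp h k (Gl 1 x \<oplus>\<^sub>l Gl (- 1) y) (of_int M) v)
      - (\<Sum>a\<in>poles x y. scl (resid x y a * (wpole a u * qpow h (a * ?s))) (fuse a (Gl 1 x) (Gl (- 1) y) (of_int M) v))"
      unfolding scl_scl minus_mult_left[symmetric] scl_minus_left sum_negf by (simp add: mult_ac)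
    finally show "Sum_any (\<lambda>i. scl (gcoef (x, y)) (?B x y (\<lambda>l. wt (u + 2 * l) (l + i) * bil x y (l + i)))) =
        scl (gcoef (x, y)) (scl (bconst x y) (nexp h k (Gl 1 x \<oplus>\<^sub>l Gl (- 1) y) (of_int M) v)
      - (\<Sum>a\<in>poles x y. scl (resid x y a * (wpole a u * qpow h (a * ?s))) (fuse a (Gl 1 x) (Gl (- 1) y) (of_int M) v)))"
      unfolding Sum_any_scl by simp
  qed
  finally show "Sum_any (\<lambda>i::int. normal_GG (GG h k 1) (GG h k (- 1)) (base A + of_int i) (of_int M - base A - of_int i) v) = \<dots>" .
qed

lemma ZZ_range: "\<gamma> \<in> ZZ A \<longleftrightarrow> \<gamma> \<in> range (\<lambda>i::int. - (base A + of_int i))"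
proof -
  have "base A + of_int (- base2 A - i) = - (base A + of_int i)" for i
    by (simp add: base_def)
  then show ?thesis unfolding ZZ_base
    by (metis (no_types, lifting) add.inverse_inverse rangeE rangeI add_diff_cancel_left' diff_diff_eq2)
qed

lemma normal_GG_reindex:
  "Sum_any (\<lambda>\<gamma>. if \<gamma> \<in> ZZ A then normal_GG (GG h k 1) (GG h k (- 1)) (- \<gamma>) (of_int M + \<gamma>) v else 0) =
    Sum_any (\<lambda>i::int. normal_GG (GG h k 1) (GG h k (- 1)) (base A + of_int i) (of_int M - base A - of_int i) v)"
proof -
  have e: "of_int M + - (base A + of_int i) = of_int M - base A - of_int i" for i :: int by simp
  have inj: "inj (\<lambda>i::int. - (base A + of_int i))" by (simp add: inj_on_def)
  show ?thesis unfolding ZZ_range Sum_any_range[OF inj] e minus_minus ..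
qed

text \<open>Written with q^{a/2}, the two forms of the boundary term are -1/[a/2] with or without
  the factor (q^{a/2} + q^{-a/2})/2, divided by q - q^{-1}; these are the coefficients c^A at
  a/2.\<close>

lemma wpole_cA:
  assumes a: "qpow h a \<noteq> 1"
  shows "wpole a (M - base2 A) * qpow h (a * (base A + 1/2)) =
    - (cA h A (if even M then 0 else 1) (a / 2) / dq h * qpow h (a / 2)) * qpow h (a / 2 * of_int M)"
proof -
  define B where "B = qpow h (a / 2)"
  have B0: "B \<noteq> 0" by (simp add: B_def)
  have BB: "qpow h a = B * B" by (simp add: B_def qmerge)
  have e: "qpow h (a * of_int (M - base2 A) / 2) * qpow h (a * (base A + 1/2)) = B * qpow h (a / 2 * of_int M)"
    unfolding B_def base_def by (simp add: qmerge) (rule arg_cong[of _ _ "qpow h"], simp add: field_simps)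
  have qa: "qn h (a / 2) = (B * B - 1) / (B * dq h)"
    using B0 dq_ne unfolding qn_eq B_def[symmetric] by (simp add: divide_simps)
  have b1: "B * B \<noteq> 1" using a BB by simp
  \<comment> \<open>Parity of the total mode and sector enter only through this parity, which
    exchanges c_0 and c_1 between the sectors.\<close>
  have ev: "even (M - base2 A) \<longleftrightarrow> (if A = Ramond then even M else odd M)"
    by (cases A) (simp_all add: base2_def)
  let ?w = "if even (M - base2 A) then (1 + qpow h a) / (2 * (1 - qpow h a)) else qpow h (a / 2) / (1 - qpow h a)"
  have w1: "(1 + B * B) / (2 * (1 - B * B)) = - (1 / ((B * B - 1) / (B * dq h)) * ((B + 1 / B) / 2) / dq h)"
    and w2: "B / (1 - B * B) = - (1 / ((B * B - 1) / (B * dq h)) / dq h)"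
    using B0 b1 dq_ne by (simp_all add: divide_simps) algebra+
  have w: "?w = - (cA h A (if even M then 0 else 1) (a / 2) / dq h)"
    unfolding ev cA_def qa qpow_minus B_def[symmetric] BB w1 w2 by (cases A) simp_all
  have "wpole a (M - base2 A) * qpow h (a * (base A + 1/2)) = (B * qpow h (a / 2 * of_int M)) * ?w"
    unfolding wpole_def e[symmetric] by (simp only: mult_ac)
  then show ?thesis unfolding w B_def by (simp only: mult_ac mult_minus_left mult_minus_right)
qed

lemma exp_parity: "exp (- (\<i> * of_real pi * of_int M)) = (if even M then 1 else - 1)"
proof -
  have "exp (of_int (- M) * (\<i> * of_real pi)) = exp (\<i> * of_real pi) powi (- M)"
    by (rule exp_power_int[symmetric])
  then show ?thesis by (simp add: power_int_minus_left mult_ac)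
qed

text \<open>Averaging with the reflected current projects onto even or odd modes, so on an integral
  mode just one of c_0 and c_1 acts.\<close>

lemma parity_split_int:
  "parity_split h A u X (of_int M) v = scl (cA h A (if even M then 0 else 1) u) (X (of_int M) v)"
proof -
  have "scl (1 / 2) (x + x) = x" for x by (rule poly_mapping_eqI) (simp add: lookup_add)
  then show ?thesis by (simp add: parity_split_def creflect_def exp_parity scl_minus_left scl_one)
qed

text \<open>The coefficient with which the ordinary normally ordered product of two supercurrent
  summands survives in W.\<close>

definition wcoef :: "int \<times> int \<Rightarrow> complex" where
  "wcoef = (\<lambda>(x, y). dq h * of_int (x * y) * bconst x y)"

text \<open>The boundary terms of the mode normal ordered product are fused at the three kinds of
  poles, hence proportional to K, 1 and T. Their coefficients are minus those in W, and only the
  part with \<open>bconst\<close> remains.\<close>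

lemma WW_int:
  assumes v: "v \<in> VV p L" and p: "sec A p"
  shows "WW h k A (of_int M) v = lincomb signs wcoef (\<lambda>(x, y). Gl 1 x \<oplus>\<^sub>l Gl (- 1) y) 0 (of_int M) v"
proof -
  define c where "c w = cA h A (if even M then 0 else 1) w" for w
  define f where "f a x y = fuse a (Gl 1 x) (Gl (- 1) y) (of_int M) v" for a x y
  define n where "n x y = nexp h k (Gl 1 x \<oplus>\<^sub>l Gl (- 1) y) (of_int M) v" for x y
  define C where "C x y a = dq h ^ 3 * gcoef (x, y) * (resid x y a *
      (wpole a (M - base2 A) * qpow h (a * (base A + 1/2))))" for x y a
  have C: "C x y a = of_int (x * y) * (resid x y a * qpow h (a / 2)) * (c (a / 2) * qpow h (a / 2 * of_int M))"
    if "a \<in> poles x y" for x y a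
    unfolding C_def wpole_cA[OF pole_ne_one[OF that]] gcoef_def c_def using dq_ne
    by (simp add: power3_eq_cube power2_eq_square)
  have h: "(2 * k + 2) / 2 = k + 1" "(4 * k + 4) / 2 = 2 * k + 2" "(2 * k + 4) / 2 = k + 2"
    by (simp_all add: add_divide_distrib)
  let ?q1 = "c (k + 1) * qpow h ((k + 1) * of_int M)"
  \<comment> \<open>Each value is minus the coefficient of the corresponding operator in W, with the
    power of q that undoes the rescaling in \<open>fuse\<close>; for the pole q^{2k+4} the operator
    is 1, which enters W with sign -.\<close>
  have C11: "C 1 1 (2 * k + 2) = - \<tau> (1, 1) * ?q1"
    and C11': "C 1 1 (4 * k + 4) = - (1 / qn h (k + 1)) * (c (2 * k + 2) * qpow h ((2 * k + 2) * of_int M))"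
    and C12: "C 1 (- 1) (2 * k + 2) = - \<tau> (1, - 1) * ?q1"
    and C21: "C (- 1) 1 (2 * k + 2) = - \<tau> (- 1, 1) * ?q1"
    and C22: "C (- 1) (- 1) (2 * k + 4) = c (k + 2) * qpow h ((k + 2) * of_int M)"
    by (subst C, simp add: poles_eq, subst resid_half, simp add: h \<tau>_def)+
  have w: "dq h ^ 3 * gcoef b * bconst (fst b) (snd b) = - wcoef b" for b
    using dq_ne by (cases b) (simp add: gcoef_def wcoef_def power3_eq_cube power2_eq_square)
  have fM: "f (2 * k + 4) (- 1) (- 1) = (if M = 0 then v else 0)"
    unfolding f_def fuse_one[OF v] cone_def by simp
  have K: "K0 h k (of_int M) v = scl (qpow h ((2 * k + 2) * of_int M)) (f (4 * k + 4) 1 1)"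
  proof -
    have "f (4 * k + 4) 1 1 = scl (qpow h (- ((2 * k + 2) * of_int M))) (nexp h k (Kl (- 1) \<oplus>\<^sub>l Kl 1) (of_int M) v)"
      unfolding f_def fuse_K cscale_nexp[OF v, symmetric] cscale_def by (simp add: algebra_simps)
    moreover have "K0 h k (of_int M) v = nexp h k (Kl (- 1) \<oplus>\<^sub>l Kl 1) (of_int M) v"
      using repD[OF rep_K0 v] by (simp add: scl_one)
    ultimately show ?thesis by (simp add: scl_scl qmerge scl_one)
  qed
  have T: "TT h k (of_int M) v = scl (qpow h ((k + 1) * of_int M)) (scl (\<tau> (1, - 1)) (f (2 * k + 2) 1 (- 1))
      + scl (\<tau> (1, 1)) (f (2 * k + 2) 1 1) + scl (\<tau> (- 1, 1)) (f (2 * k + 2) (- 1) 1))"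
  proof -
    have fT: "nexp h k (Tl a b) (of_int M) v = scl (qpow h ((k + 1) * of_int M)) (f (2 * k + 2) a b)" for a b
      unfolding f_def fuse_T cscale_nexp[OF v, symmetric] cscale_def by (simp add: scl_scl qmerge scl_one)
    show ?thesis
      using repD[OF rep_TT v, of "of_int M"] by (simp add: Tset_def fT scl_add scl_scl mult_ac add_ac)
  qed
  have c0: "(if M = 0 then scl (c (k + 2) * qpow h ((k + 2) * of_int M)) v else 0) = (if M = 0 then scl (cA h A 0 (k + 2)) v else 0)"
    by (simp add: c_def)
  have "scl (dq h ^ 3) (\<Sum>(x, y)\<in>signs. scl (gcoef (x, y)) (scl (bconst x y) (n x y)
      - (\<Sum>a\<in>poles x y. scl (resid x y a * (wpole a (M - base2 A) * qpow h (a * (base A + 1/2)))) (f a x y))))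
    = (\<Sum>(x, y)\<in>signs. scl (- wcoef (x, y)) (n x y) - (\<Sum>a\<in>poles x y. scl (C x y a) (f a x y)))"
    by (simp add: scl_sum case_prod_unfold scl_diff scl_scl C_def mult.assoc[symmetric] w)
  also have "\<dots> = scl (- wcoef (1, 1)) (n 1 1) + scl (- wcoef (1, - 1)) (n 1 (- 1)) + scl (- wcoef (- 1, 1)) (n (- 1) 1) + scl (- wcoef (- 1, - 1)) (n (- 1) (- 1))
      - (scl (C 1 1 (2 * k + 2)) (f (2 * k + 2) 1 1) + scl (C 1 1 (4 * k + 4)) (f (4 * k + 4) 1 1) + scl (C 1 (- 1) (2 * k + 2)) (f (2 * k + 2) 1 (- 1))
      + scl (C (- 1) 1 (2 * k + 2)) (f (2 * k + 2) (- 1) 1) + scl (C (- 1) (- 1) (2 * k + 4)) (f (2 * k + 4) (- 1) (- 1)))"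
    using pole_facts(5) by (simp add: signs_def sum.cartesian_product[symmetric] poles_eq)
  finally have G: "scl (dq h ^ 3) (Sum_any (\<lambda>i::int. normal_GG (GG h k 1) (GG h k (- 1)) (base A + of_int i) (of_int M - base A - of_int i) v)) = \<dots>"
    unfolding normal_GG_sum(1)[OF v p refl] f_def[symmetric] n_def[symmetric] .
  have L: "lincomb signs wcoef (\<lambda>(x, y). Gl 1 x \<oplus>\<^sub>l Gl (- 1) y) 0 (of_int M) v =
      scl (wcoef (1, 1)) (n 1 1) + scl (wcoef (1, - 1)) (n 1 (- 1)) + scl (wcoef (- 1, 1)) (n (- 1) 1) + scl (wcoef (- 1, - 1)) (n (- 1) (- 1))"
    by (simp add: lincomb_def signs_def n_def sum.cartesian_product'[symmetric] add_ac)
  have W: "WW h k A (of_int M) v = scl (1 / qn h (k + 1)) (scl (c (2 * k + 2)) (K0 h k (of_int M) v))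
      - (if M = 0 then scl (cA h A 0 (k + 2)) v else 0) + scl (c (k + 1)) (TT h k (of_int M) v)
      - scl (dq h ^ 3) (Sum_any (\<lambda>i::int. normal_GG (GG h k 1) (GG h k (- 1)) (base A + of_int i) (of_int M - base A - of_int i) v))"
    unfolding WW_def parity_split_int normal_GG_reindex c_def by simp
  show ?thesis
    unfolding W G K T L C11 C11' C12 C21 C22 fM c0[symmetric] scl_scl
    by (rule poly_mapping_eqI) (simp add: lookup_add lookup_minus algebra_simps)
qed

lemma WW_eq:
  assumes v: "v \<in> VV p L" and p: "sec A p"
  shows "WW h k A s v = lincomb signs wcoef (\<lambda>(x, y). Gl 1 x \<oplus>\<^sub>l Gl (- 1) y) 0 s v"
proof (cases "s \<in> \<int>")
  case True
  then show ?thesis using WW_int[OF v p] by (auto elim!: Ints_cases)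
next
  case False
  have z: "zeta (Gl 1 x \<oplus>\<^sub>l Gl (- 1) y) p = 0" for x y
    by (simp add: zeta_lf_add zeta_Gl minus_divide_left[symmetric] del: minus_add_distrib minus_divide_left)
  have n: "nexp h k F s v = 0" if "zeta F p = 0" for F
    using nexp_zero[OF v] that False by simp
  have K: "K0 h k s v = 0"
    using repD[OF rep_K0 v, of s] by (simp add: n zeta_lf_add)
  have T: "TT h k s v = 0"
    using repD[OF rep_TT v, of s] by (simp add: n case_prod_unfold)
  have "s \<noteq> 0" using False by auto
  then show ?thesis
    using False by (simp add: WW_def parity_split_def creflect_def K T lincomb_def n z case_prod_unfold)
qed

section \<open>The commutator of the energy current with itself\<close>

lemma bconst_eq:
  fixes P Q
  defines "P \<equiv> qpow h (k + 1)" and "Q \<equiv> qpow h 1"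
  shows "bconst 1 1 = P * (1 - P ^ 4 * Q ^ 2) / (Q * (1 - P ^ 2) * (1 - P ^ 4))"
    "bconst 1 (- 1) = P / (Q * (1 - P ^ 2))"
    "bconst (- 1) 1 = P * Q / (1 - P ^ 2)"
    "bconst (- 1) (- 1) = P * Q / (1 - P ^ 2 * Q ^ 2)"
proof -
  note q = qPQ[folded P_def Q_def] and f = PQ_facts[folded P_def Q_def]
  have r: "1 - P ^ 2 \<noteq> 0" "1 - P ^ 4 \<noteq> 0" "1 - P ^ 2 * Q ^ 2 \<noteq> 0" "P ^ 2 - P ^ 4 \<noteq> 0" "P ^ 4 - P ^ 2 \<noteq> 0"
    using f(1-6) pole_facts(4) unfolding q by auto
  have "bconst 1 1 = qpow h (k - (2 * k + 2)) * ((1 - qpow h (4 * k + 6 - (2 * k + 2))) / (1 - qpow h (4 * k + 4 - (2 * k + 2)))) * (P ^ 2 / (1 - P ^ 2))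
      + qpow h (k - (4 * k + 4)) * ((1 - qpow h (4 * k + 6 - (4 * k + 4))) / (1 - qpow h (2 * k + 2 - (4 * k + 4)))) * (P ^ 4 / (1 - P ^ 4))"
    using pole_facts(5) by (simp add: bconst_def poles_def resid_def q)
  also have "\<dots> = P * (1 - P ^ 4 * Q ^ 2) / (Q * (1 - P ^ 2) * (1 - P ^ 4))"
    unfolding qdiff q using f(1,2) r by (simp add: divide_simps) algebra
  finally show "bconst 1 1 = P * (1 - P ^ 4 * Q ^ 2) / (Q * (1 - P ^ 2) * (1 - P ^ 4))" .
  have "qpow h (k + 1 - 1 - (2 * k + 2)) = 1 / (P * Q)" "qpow h (k + 1 + 1 - (2 * k + 2)) = Q / P" "qpow h (k + 1 + 1 - (2 * k + 4)) = 1 / (P * Q)"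
    unfolding qdiff qpow_add[of "_ + 1" 1] q P_def[symmetric] Q_def[symmetric] using f(1,2) by (simp_all add: divide_simps power2_eq_square)
  then show "bconst 1 (- 1) = P / (Q * (1 - P ^ 2))" "bconst (- 1) 1 = P * Q / (1 - P ^ 2)"
    "bconst (- 1) (- 1) = P * Q / (1 - P ^ 2 * Q ^ 2)"
    unfolding bconst_def poles_def resid_def using f(1,2) r by (simp_all add: q) (simp_all add: divide_simps power2_eq_square)
qed

text \<open>By \<open>K_fusion\<close> the product consists of four supercurrent summands, G^+ at
  q^{3k+3} z and q^{k+1} z and G^- at q^{k+1} z and q^{-k-1} z. Regrouped, these are two summands of
  T at distance q^{2k+2}.\<close>

lemma fuse_KWK_plus:
  "nexp h k (lf_scale h (k + 1) (Kl (- 1) \<oplus>\<^sub>l ((Gl 1 x \<oplus>\<^sub>l Gl (- 1) y) \<oplus>\<^sub>l Kl 1))) s v = fuse (2 * k + 2) (Tl 1 y) (Tl x 1) s v"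
proof -
  have e: "(k + 1) + (2 * k + 2) = 2 * k + 2 + (k + 1)" "(k + 1) + - (2 * k + 2) = - (k + 1)" "2 * k + 2 + - (k + 1) = k + 1"
    by simp_all
  have "lf_eqv (lf_scale h (k + 1) (lf_scale h (2 * k + 2) (Gl 1 1) \<oplus>\<^sub>l lf_scale h (- (2 * k + 2)) (Gl (- 1) 1) \<oplus>\<^sub>l (Gl 1 x \<oplus>\<^sub>l Gl (- 1) y)))
      (lf_scale h (k + 1) (Kl (- 1) \<oplus>\<^sub>l Kl 1 \<oplus>\<^sub>l (Gl 1 x \<oplus>\<^sub>l Gl (- 1) y)))"
    by (intro lf_eqv_scale lf_eqv_add K_fusion lf_eqv_refl)
  note nexp_eqv[OF this]
  then show ?thesis by (simp only: Tl_def lf_scale_add lf_scale_scale e lf_ac)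
qed

lemma fuse_KWK_minus:
  "nexp h k (lf_scale h (- (k + 1)) (Kl (- 1) \<oplus>\<^sub>l ((Gl 1 x \<oplus>\<^sub>l Gl (- 1) y) \<oplus>\<^sub>l Kl 1))) s v = fuse (- (2 * k + 2)) (Tl x 1) (Tl 1 y) s v"
proof -
  have e: "- (k + 1) + (2 * k + 2) = k + 1" "- (2 * k + 2) + (k + 1) = - (k + 1)"
    "- (k + 1) + - (2 * k + 2) = - (2 * k + 2) + - (k + 1)"
    by simp_all
  have "lf_eqv (lf_scale h (- (k + 1)) (lf_scale h (2 * k + 2) (Gl 1 1) \<oplus>\<^sub>l lf_scale h (- (2 * k + 2)) (Gl (- 1) 1) \<oplus>\<^sub>l (Gl 1 x \<oplus>\<^sub>l Gl (- 1) y)))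
      (lf_scale h (- (k + 1)) (Kl (- 1) \<oplus>\<^sub>l Kl 1 \<oplus>\<^sub>l (Gl 1 x \<oplus>\<^sub>l Gl (- 1) y)))"
    by (intro lf_eqv_scale lf_eqv_add K_fusion lf_eqv_refl)
  note nexp_eqv[OF this]
  then show ?thesis by (simp only: Tl_def lf_scale_add lf_scale_scale e lf_ac)
qed

text \<open>The rational function with zeros xy and 1/y and poles 1 and x, in the notation of
  \<open>partial_fraction_22\<close>, has value 1 both at 0 and at infinity. Hence its two residue
  coefficients sum to zero.\<close>

lemma pole_flip:
  fixes x y :: complex
  assumes "x \<noteq> 0" "y \<noteq> 0" "x \<noteq> 1"
  shows "(1 - x * y) * (1 - 1 / y) / (1 - x) = - ((1 - y) * (1 - 1 / (x * y)) / (1 - 1 / x))"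
  using assms by (simp add: divide_simps) algebra

lemma num_swap: "num h [a, b] = num h [b, a]"
  by (simp add: num_def mult.commute)

text \<open>The currents that make up \<open>TT\<close> have the common pole \<open>0\<close>, at which the residues of the two
  orders of a pair cancel.\<close>

lemma commutator_TT:
  fixes s t v
  defines "C \<equiv> \<lambda>a b c d. nexp h k (Tl a b) s (nexp h k (Tl c d) t v) - nexp h k (Tl c d) t (nexp h k (Tl a b) s v)"
    and "f \<equiv> \<lambda>u a b c d. scl (qpow h (u * s)) (fuse u (Tl a b) (Tl c d) (s + t) v)"
    and "P \<equiv> qpow h (k + 1)" and "Q \<equiv> qpow h 1"
  defines "\<rho> \<equiv> (1 - 1 / (P ^ 2 * Q ^ 2)) * (1 - Q ^ 2) / (1 - 1 / P ^ 2)"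
    and "\<sigma> \<equiv> (1 - Q ^ 2) * (1 - 1 / (P ^ 4 * Q ^ 2)) / (1 - 1 / P ^ 4)"
  assumes v: "v \<in> VV p L" and s: "s \<in> \<int>"
  shows "C 1 (- 1) 1 (- 1) = 0" and "C (- 1) 1 (- 1) 1 = 0"
    and "C 1 1 1 1 = scl \<sigma> (f (2 * k + 2) 1 1 1 1 - f (- (2 * k + 2)) 1 1 1 1)"
    and "(a, b, c, d) \<in> {(1, - 1, 1, 1), (1, - 1, - 1, 1), (1, 1, - 1, 1)} \<Longrightarrow>
      C a b c d + C c d a b = scl \<rho> (f (2 * k + 2) a b c d - f (- (2 * k + 2)) c d a b)"
proof -
  note q = qPQ[folded P_def Q_def] and f = PQ_facts[folded P_def Q_def]
  have z: "s + zeta (Tl x y) p \<in> \<int>" for x y using s by simp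
  have p4: "P ^ 2 * P ^ 2 = P ^ 4" by (simp flip: power_add)
  show "C 1 (- 1) 1 (- 1) = 0" "C (- 1) 1 (- 1) 1 = 0"
    unfolding C_def by (rule commutator_no_poles[OF v]; simp add: gam_TT num_Nil)+
  have neq: "qpow h (2 * k + 2) \<noteq> qpow h (- (2 * k + 2))"
  proof
    assume "qpow h (2 * k + 2) = qpow h (- (2 * k + 2))"
    then have "P ^ 2 * P ^ 2 = 1" unfolding qpow_minus q using f(1) by (simp add: divide_simps)
    then show False using f(4) p4 by simp
  qed
  \<comment> \<open>This contraction is invariant under inversion of q; the factors only have to be
    listed in the order that \<open>commutator_two_poles\<close> expects.\<close>
  have g: "gam (Tl 1 1) (Tl 1 1) = num h [- (2 * k + 4), - (- (2 * k + 4))] * inverse (num h [- (2 * k + 2), - (- (2 * k + 2))])"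
    unfolding minus_minus gam_TT(3) by (simp only: num_swap)
  have kk: "qpow h (kq (Tl 1 1) (Tl 1 1)) = qpow h (kq (Tl 1 1) (Tl 1 1) + (2 * k + 4) + - (2 * k + 4) - (2 * k + 2) - - (2 * k + 2))"
    by simp
  have d1: "qpow h (2 * k + 4 - (2 * k + 2)) = Q ^ 2" "qpow h (- (2 * k + 4) - (2 * k + 2)) = 1 / (P ^ 4 * Q ^ 2)"
    "qpow h (- (2 * k + 2) - (2 * k + 2)) = 1 / P ^ 4" "qpow h (2 * k + 4 - - (2 * k + 2)) = P ^ 4 * Q ^ 2"
    "qpow h (- (2 * k + 4) - - (2 * k + 2)) = 1 / Q ^ 2" "qpow h (2 * k + 2 - - (2 * k + 2)) = P ^ 4"
    unfolding qdiff qpow_minus q using f(1,2) by (simp_all add: power4_eq_xxxx power2_eq_square)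
  have \<sigma>': "(1 - P ^ 4 * Q ^ 2) * (1 - 1 / Q ^ 2) / (1 - P ^ 4) = - \<sigma>"
    unfolding \<sigma>_def by (rule pole_flip) (use f in auto)
  have "C 1 1 1 1 = scl \<sigma> (f (2 * k + 2) 1 1 1 1) + scl (- \<sigma>) (f (- (2 * k + 2)) 1 1 1 1)"
    unfolding C_def f_def
    by (subst commutator_two_poles[OF v z _ _ gam_TT(3) g kk neq])
      (simp_all only: lam_GT kq_GT qpow_0 mult_1_left d1 \<sigma>' \<sigma>_def[symmetric] scl_scl)
  then show "C 1 1 1 1 = scl \<sigma> (f (2 * k + 2) 1 1 1 1 - f (- (2 * k + 2)) 1 1 1 1)"
    by (simp add: scl_minus_left scl_diff)
  assume "(a, b, c, d) \<in> {(1, - 1, 1, 1), (1, - 1, - 1, 1), (1, 1, - 1, 1)}"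
  then have g: "gam (Tl a b) (Tl c d) = num h [- 2, 2 * k + 4] * inverse (num h [0, 2 * k + 2])"
    "gam (Tl c d) (Tl a b) = num h [2, - (2 * k + 4)] * inverse (num h [0, - (2 * k + 2)])"
    by (auto simp: gam_TT)
  have g': "gam (Tl c d) (Tl a b) = num h [- (- 2), - (2 * k + 4)] * inverse (num h [- 0, - (2 * k + 2)])"
    "gam (Tl a b) (Tl c d) = num h [- 2, - (- (2 * k + 4))] * inverse (num h [- 0, - (- (2 * k + 2))])"
    unfolding g by (simp_all only: minus_minus minus_zero)
  have kk': "qpow h (kq (Tl c d) (Tl a b)) = qpow h (kq (Tl a b) (Tl c d) + - 2 + (2 * k + 4) - 0 - (2 * k + 2))"
    "qpow h (kq (Tl a b) (Tl c d)) = qpow h (kq (Tl c d) (Tl a b) + 2 + - (2 * k + 4) - 0 - - (2 * k + 2))"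
    by simp_all
  have ne0: "qpow h 0 \<noteq> qpow h (2 * k + 2)" "qpow h 0 \<noteq> qpow h (- (2 * k + 2))"
    unfolding qpow_minus q qpow_0 using f(1-6) by (auto simp: divide_simps)
  have d2: "qpow h (- 2 - 0) = 1 / Q ^ 2" "qpow h (2 * k + 4 - 0) = P ^ 2 * Q ^ 2" "qpow h (2 * k + 2 - 0) = P ^ 2"
    "qpow h (- 2 - (2 * k + 2)) = 1 / (P ^ 2 * Q ^ 2)" "qpow h (2 * k + 4 - (2 * k + 2)) = Q ^ 2" "qpow h (0 - (2 * k + 2)) = 1 / P ^ 2"
    "qpow h (2 - 0) = Q ^ 2" "qpow h (- (2 * k + 4) - 0) = 1 / (P ^ 2 * Q ^ 2)" "qpow h (- (2 * k + 2) - 0) = 1 / P ^ 2"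
    "qpow h (2 - - (2 * k + 2)) = P ^ 2 * Q ^ 2" "qpow h (- (2 * k + 4) - - (2 * k + 2)) = 1 / Q ^ 2" "qpow h (0 - - (2 * k + 2)) = P ^ 2"
    unfolding qdiff qpow_minus qpow_minus[of 2] q qpow_0 using f(1,2) by simp_all
  have \<rho>': "(1 - 1 / Q ^ 2) * (1 - P ^ 2 * Q ^ 2) / (1 - P ^ 2) = - \<rho>" "(1 - Q ^ 2) * (1 - 1 / (P ^ 2 * Q ^ 2)) / (1 - 1 / P ^ 2) = \<rho>"
    "(1 - P ^ 2 * Q ^ 2) * (1 - 1 / Q ^ 2) / (1 - P ^ 2) = - \<rho>"
    using pole_flip[of "P ^ 2" "Q ^ 2"] f(1-6) unfolding \<rho>_def by (simp_all add: mult.commute)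
  have c1: "C a b c d = scl (- \<rho>) (f 0 a b c d) + scl \<rho> (f (2 * k + 2) a b c d)"
    unfolding C_def f_def
    by (subst commutator_two_poles[OF v z _ _ g(1) g'(1) kk'(1) ne0(1)])
      (simp_all only: lam_GT kq_GT qpow_0 mult_1_left d2 \<rho>' \<rho>_def[symmetric] scl_scl)
  have c2: "C c d a b = scl \<rho> (f 0 c d a b) + scl (- \<rho>) (f (- (2 * k + 2)) c d a b)"
    unfolding C_def f_def
    by (subst commutator_two_poles[OF v z _ _ g(2) g'(2) kk'(2) ne0(2)])
      (simp_all only: lam_GT kq_GT qpow_0 mult_1_left d2 \<rho>' \<rho>_def[symmetric] scl_scl)
  \<comment> \<open>At the pole 1 both summands sit at the same point, and normally ordered products
    are symmetric. Since the residues there are opposite, the two contributions cancel in the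
    sum.\<close>
  have c0: "f 0 c d a b = f 0 a b c d" unfolding f_def by (simp only: lf_scale_0 lf_ac)
  show "C a b c d + C c d a b = scl \<rho> (f (2 * k + 2) a b c d - f (- (2 * k + 2)) c d a b)"
    unfolding c1 c2 c0 by (simp add: scl_minus_left scl_diff)
qed

text \<open>The coefficients of two summands of T, multiplied by the residue of their contraction,
  reproduce the coefficient of the corresponding product of supercurrents in W. This fixes the
  prefactor of the commutator.\<close>

lemma TT_scalars:
  fixes P Q D
  defines "P \<equiv> qpow h (k + 1)" and "Q \<equiv> qpow h 1"
  defines "\<rho> \<equiv> (1 - 1 / (P ^ 2 * Q ^ 2)) * (1 - Q ^ 2) / (1 - 1 / P ^ 2)"
    and "\<sigma> \<equiv> (1 - Q ^ 2) * (1 - 1 / (P ^ 4 * Q ^ 2)) / (1 - 1 / P ^ 4)"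
    and "D \<equiv> dq h * (qn h (k + 2) ^ 2 / qn h (k + 1))"
  shows "\<tau> (1, - 1) * \<tau> (- 1, 1) * \<rho> = D * wcoef (- 1, - 1)"
    and "\<tau> (1, - 1) * \<tau> (1, 1) * \<rho> = D * wcoef (1, - 1)"
    and "\<tau> (1, 1) * \<tau> (- 1, 1) * \<rho> = D * wcoef (- 1, 1)"
    and "\<tau> (1, 1) * \<tau> (1, 1) * \<sigma> = D * wcoef (1, 1)"
proof -
  note f = PQ_facts[folded P_def Q_def] and b = bconst_eq[folded P_def Q_def]
  have t: "\<tau> (1, - 1) = 1 / Q" "\<tau> (- 1, 1) = Q" "\<tau> (1, 1) = - (qn h (k + 2) / qn h (k + 1))"
    by (simp_all add: \<tau>_def Q_def qpow_minus)
  have w: "wcoef (x, y) = dq h * of_int (x * y) * bconst x y" for x y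
    by (simp add: wcoef_def)
  show "\<tau> (1, - 1) * \<tau> (- 1, 1) * \<rho> = D * wcoef (- 1, - 1)"
    unfolding t w b \<rho>_def D_def f(7-9) using f(1-6) by (simp add: divide_simps) algebra
  show "\<tau> (1, - 1) * \<tau> (1, 1) * \<rho> = D * wcoef (1, - 1)"
    unfolding t w b \<rho>_def D_def f(7-9) using f(1-6) by (simp add: divide_simps) algebra
  show "\<tau> (1, 1) * \<tau> (- 1, 1) * \<rho> = D * wcoef (- 1, 1)"
    unfolding t w b \<rho>_def D_def f(7-9) using f(1-6) by (simp add: divide_simps) algebra
  \<comment> \<open>Since \<tau>(1,1) squared already contains the squared quotient of [k+2] and
    [k+1], it remains to express \<sigma> through \<open>bconst 1 1\<close>; this is done in three
    short steps.\<close>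
  have "dq h ^ 2 * qn h (k + 1) = (Q ^ 2 - 1) * (P ^ 2 - 1) / (P * Q)"
    unfolding f(7-9) using f(1-6) by (simp add: divide_simps power2_eq_square)
  moreover have "(Q ^ 2 - 1) * (P ^ 2 - 1) / (P * Q) * bconst 1 1 = (1 - P ^ 4 * Q ^ 2) * (1 - 1 / Q ^ 2) / (P ^ 4 - 1)"
    unfolding b using f(1-6) by (simp add: divide_simps power2_eq_square) algebra
  moreover have "(1 - P ^ 4 * Q ^ 2) * (1 - 1 / Q ^ 2) / (P ^ 4 - 1) = \<sigma>"
  proof -
    have "P ^ 4 - 1 = - (1 - P ^ 4)" by simp
    then show ?thesis
      using pole_flip[of "P ^ 4" "Q ^ 2"] f(1-6) unfolding \<sigma>_def by (simp only: divide_minus_right) simp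
  qed
  ultimately have \<sigma>: "\<sigma> = dq h ^ 2 * qn h (k + 1) * bconst 1 1" by simp
  have "qn h (k + 1) \<noteq> 0" by (rule k1_ne)
  then show "\<tau> (1, 1) * \<tau> (1, 1) * \<sigma> = D * wcoef (1, 1)"
    unfolding t w \<sigma> D_def by (simp add: power2_eq_square)
qed

text \<open>The current that W becomes on a sector by \<open>WW_eq\<close>; it is linear on all of
  the Fock space.\<close>

abbreviation XX :: current where
  "XX \<equiv> lincomb signs wcoef (\<lambda>(x, y). Gl 1 x \<oplus>\<^sub>l Gl (- 1) y) 0"

lemma KXXK:
  assumes v: "v \<in> VV p L"
  shows "cscale h u (cmult (KK h k (- 1)) (cmult XX (KK h k 1))) s v =
    (\<Sum>(x, y)\<in>signs. scl (wcoef (x, y)) (nexp h k (lf_scale h u (Kl (- 1) \<oplus>\<^sub>l ((Gl 1 x \<oplus>\<^sub>l Gl (- 1) y) \<oplus>\<^sub>l Kl 1))) s v))"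
proof -
  have "rep p (cmult (KK h k (- 1)) (cmult XX (KK h k 1))) signs
      (\<lambda>z. wcoef z * qpow h (kq (Kl (- 1)) (case z of (x, y) \<Rightarrow> Gl 1 x \<oplus>\<^sub>l Gl (- 1) y)))
      (\<lambda>z. Kl (- 1) \<oplus>\<^sub>l ((case z of (x, y) \<Rightarrow> Gl 1 x \<oplus>\<^sub>l Gl (- 1) y) \<oplus>\<^sub>l Kl 1)) 0"
    by (rule rep_KXK[OF rep_lincomb]) simp_all
  from repD[OF rep_cscale[OF this] v, of u s] show ?thesis
    by (auto intro!: sum.cong simp: kq_lf_add_right kq_KG case_prod_unfold)
qed

lemma rel_TT:
  assumes v: "v \<in> VV p L" and p: "sec A p"
  shows "prod_zw (TT h k) (TT h k) s t v - prod_wz (TT h k) (TT h k) s t v =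
        scl (dq h * (qn h (k + 2) ^ 2 / qn h (k + 1)))
          (delta_mult h Ramond (2 * (k + 1))
              (cscale h (k + 1) (cmult (KK h k (- 1)) (cmult XX (KK h k 1)))) s t v
           - delta_mult h Ramond (- 2 * (k + 1))
              (cscale h (- (k + 1)) (cmult (KK h k (- 1)) (cmult XX (KK h k 1)))) s t v)"
proof -
  define D where "D = dq h * (qn h (k + 2) ^ 2 / qn h (k + 1))"
  define C where "C a b c d = nexp h k (Tl a b) s (nexp h k (Tl c d) t v) - nexp h k (Tl c d) t (nexp h k (Tl a b) s v)" for a b c d
  define f where "f u a b c d = scl (qpow h (u * s)) (fuse u (Tl a b) (Tl c d) (s + t) v)" for u a b c d
  have "TT h k s (TT h k t v) - TT h k t (TT h k s v) =
      (\<Sum>x\<in>Tset. \<Sum>y\<in>Tset. scl (\<tau> x * \<tau> y) (nexp h k (case x of (a, b) \<Rightarrow> Tl a b) (s + 0) (nexp h k (case y of (a, b) \<Rightarrow> Tl a b) (t + 0) v)))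
      - (\<Sum>x\<in>Tset. \<Sum>y\<in>Tset. scl (\<tau> x * \<tau> y) (nexp h k (case y of (a, b) \<Rightarrow> Tl a b) (t + 0) (nexp h k (case x of (a, b) \<Rightarrow> Tl a b) (s + 0) v)))"
    unfolding rep_product[OF rep_TT linr_TT rep_TT v] by (subst (2) sum.swap) (simp only: mult.commute)
  also have "\<dots> = (\<Sum>x\<in>Tset. \<Sum>y\<in>Tset. scl (\<tau> x * \<tau> y) (C (fst x) (snd x) (fst y) (snd y)))"
    unfolding C_def by (simp only: sum_subtractf[symmetric] scl_diff[symmetric] add_0_right case_prod_beta)
  \<comment> \<open>Ordered pairs of different summands are collected with their transposes, because
    the pole 1 cancels only in such sums.\<close>
  also have "\<dots> = scl (\<tau> (1, - 1) * \<tau> (- 1, 1)) (C 1 (- 1) (- 1) 1 + C (- 1) 1 1 (- 1))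
      + scl (\<tau> (1, - 1) * \<tau> (1, 1)) (C 1 (- 1) 1 1 + C 1 1 1 (- 1))
      + scl (\<tau> (1, 1) * \<tau> (- 1, 1)) (C 1 1 (- 1) 1 + C (- 1) 1 1 1)
      + scl (\<tau> (1, 1) * \<tau> (1, 1)) (C 1 1 1 1)
      + (scl (\<tau> (1, - 1) * \<tau> (1, - 1)) (C 1 (- 1) 1 (- 1)) + scl (\<tau> (- 1, 1) * \<tau> (- 1, 1)) (C (- 1) 1 (- 1) 1))"
    by (simp add: Tset_def scl_add mult_ac add_ac)
  finally have LHS: "prod_zw (TT h k) (TT h k) s t v - prod_wz (TT h k) (TT h k) s t v = \<dots>"
    by (simp add: prod_zw_def prod_wz_def)
  show ?thesis
  proof (cases "s \<in> \<int>")
    case False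
    have "s + zeta (Tl a b) p \<notin> \<int>" "lam (Tl a b) (Tl c d) = of_int 0" for a b c d using False by simp_all
    then have "C a b c d = 0" for a b c d
      unfolding C_def using nexp_nexp_zero[OF v] by (metis diff_zero)
    then show ?thesis unfolding LHS using False by (simp add: delta_mult_def ZZ_def)
  next
    case True
    have R: "delta_mult h Ramond u (cscale h w (cmult (KK h k (- 1)) (cmult XX (KK h k 1)))) s t v =
        scl (qpow h (u * s)) (\<Sum>(x, y)\<in>signs. scl (wcoef (x, y)) (nexp h k (lf_scale h w (Kl (- 1) \<oplus>\<^sub>l ((Gl 1 x \<oplus>\<^sub>l Gl (- 1) y) \<oplus>\<^sub>l Kl 1))) (s + t) v))" for u w
      using True unfolding delta_mult_def KXXK[OF v] by (simp add: ZZ_def)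
    have e: "2 * (k + 1) = 2 * k + 2" "- 2 * (k + 1) = - (2 * k + 2)" by simp_all
    have Rp: "delta_mult h Ramond (2 * (k + 1)) (cscale h (k + 1) (cmult (KK h k (- 1)) (cmult XX (KK h k 1)))) s t v =
        scl (wcoef (1, 1)) (f (2 * k + 2) 1 1 1 1) + scl (wcoef (1, - 1)) (f (2 * k + 2) 1 (- 1) 1 1)
        + scl (wcoef (- 1, 1)) (f (2 * k + 2) 1 1 (- 1) 1) + scl (wcoef (- 1, - 1)) (f (2 * k + 2) 1 (- 1) (- 1) 1)"
      unfolding R unfolding e fuse_KWK_plus f_def signs_def sum.cartesian_product[symmetric]
      by (simp add: scl_add scl_scl mult_ac add_ac)
    have Rm: "delta_mult h Ramond (- 2 * (k + 1)) (cscale h (- (k + 1)) (cmult (KK h k (- 1)) (cmult XX (KK h k 1)))) s t v =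
        scl (wcoef (1, 1)) (f (- (2 * k + 2)) 1 1 1 1) + scl (wcoef (1, - 1)) (f (- (2 * k + 2)) 1 1 1 (- 1))
        + scl (wcoef (- 1, 1)) (f (- (2 * k + 2)) (- 1) 1 1 1) + scl (wcoef (- 1, - 1)) (f (- (2 * k + 2)) (- 1) 1 1 (- 1))"
      unfolding R unfolding e fuse_KWK_minus f_def signs_def sum.cartesian_product[symmetric]
      by (simp add: scl_add scl_scl mult_ac add_ac)
    note c = commutator_TT[OF v True, where t = t, folded C_def f_def]
    have z: "C 1 (- 1) 1 (- 1) = 0" "C (- 1) 1 (- 1) 1 = 0" by (rule c)+
    note c3 = c(3) and c4 = c(4)[where a = "1" and b = "- 1" and c = "- 1" and d = "1", simplified] c(4)[where a = "1" and b = "- 1" and c = "1" and d = "1", simplified] c(4)[where a = "1" and b = "1" and c = "- 1" and d = "1", simplified]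
    show ?thesis
      unfolding LHS z c3 c4 scl_scl TT_scalars Rp Rm D_def[symmetric]
      by (simp add: scl_add scl_diff scl_scl)
  qed
qed

section \<open>The relations on the sector modules\<close>

lemma sector_module_iff: "v \<in> sector_module k A \<longleftrightarrow> (\<forall>b\<in>Poly_Mapping.keys v. sec A (fst b))"
  by (auto simp: sector_module_def sec_def split: prod.splits)

lemma sector_module_add: "v \<in> sector_module k A \<Longrightarrow> w \<in> sector_module k A \<Longrightarrow> v + w \<in> sector_module k A"
  using Poly_Mapping.keys_add[of v w] by (auto simp: sector_module_iff)

lemma sector_module_scl: "v \<in> sector_module k A \<Longrightarrow> scl c v \<in> sector_module k A"
  by (auto simp: sector_module_iff in_keys_iff)

lemma sector_module_sum: "(\<And>b. b \<in> B \<Longrightarrow> f b \<in> sector_module k A) \<Longrightarrow> sum f B \<in> sector_module k A"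
  by (induction B rule: infinite_finite_induct) (auto intro: sector_module_add simp: sector_module_iff[of 0])

lemma VV_sector_module: "v \<in> VV p L \<Longrightarrow> sec A p \<Longrightarrow> v \<in> sector_module k A"
  by (auto simp: VV_def sector_module_iff)

text \<open>A linear identity needs checking on basis vectors only, and each of these has a single
  charge and a bounded level.\<close>

lemma sector_module_eqI:
  assumes "v \<in> sector_module k A" "linr f" "linr g" "\<And>p L w. w \<in> VV p L \<Longrightarrow> sec A p \<Longrightarrow> f w = g w"
  shows "f v = g v"
proof (rule linr_eqI[OF assms(2,3)])
  fix b assume "b \<in> Poly_Mapping.keys v"
  then have "sec A (fst b)" using assms(1) by (simp add: sector_module_iff)
  with VV_basis show "f (Poly_Mapping.single b 1) = g (Poly_Mapping.single b 1)" by (rule assms(4))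
qed

lemma rep_sector_module:
  assumes X: "\<And>p. rep p X I c F u" and lX: "linr (X s)"
    and F: "\<And>x p. x \<in> I \<Longrightarrow> sec A p \<Longrightarrow> sec A (shift (cQ (F x)) p)" and v: "v \<in> sector_module k A"
  shows "X s v \<in> sector_module k A"
proof -
  have "X s (Poly_Mapping.single b 1) \<in> sector_module k A" if "b \<in> Poly_Mapping.keys v" for b
  proof -
    have p: "sec A (fst b)" using v that by (simp add: sector_module_iff)
    show ?thesis
      unfolding repD[OF X VV_basis]
    proof (intro sector_module_sum sector_module_scl)
      fix x assume x: "x \<in> I"
      show "nexp h k (F x) (s + u) (Poly_Mapping.single b 1) \<in> sector_module k A"
        using VV_nexp[OF VV_basis] VV_sector_module[OF _ F[OF x p]] by blast
    qed
  qed
  then show ?thesis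
    by (subst linr_expand[OF lX]) (intro sector_module_sum sector_module_scl)
qed

lemma acts_on_rep:
  assumes X: "\<And>p. rep p X I c F u" and lX: "\<And>s. linr (X s)"
    and F: "\<And>x p. x \<in> I \<Longrightarrow> sec A p \<Longrightarrow> sec A (shift (cQ (F x)) p)"
    and S: "\<And>x p s. x \<in> I \<Longrightarrow> sec A p \<Longrightarrow> s + u + zeta (F x) p \<in> \<int> \<Longrightarrow> s \<in> S"
  shows "acts_on (sector_module k A) S X"
  unfolding acts_on_def
proof (intro allI ballI conjI impI)
  fix s v assume v: "v \<in> sector_module k A"
  show "X s v \<in> sector_module k A" by (rule rep_sector_module[OF X lX F v])
  show "X s v = 0" if s: "s \<notin> S"
  proof (rule sector_module_eqI[OF v lX linr_const_zero])
    fix p L w assume w: "w \<in> VV p L" "sec A p"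
    have "nexp h k (F x) (s + u) w = 0" if "x \<in> I" for x
      by (rule nexp_zero[OF w(1)]) (use S[OF that w(2)] s in blast)
    then show "X s w = 0" by (simp add: repD[OF X w(1)])
  qed
qed (simp_all add: linr_add[OF lX] linr_scl[OF lX])

lemma sec_shift_zero: "sec A p \<Longrightarrow> (\<And>i. w i = 0) \<Longrightarrow> sec A (shift w p)"
  by (simp add: shift_zero)

text \<open>With the opposite sign of the commutator for \<open>ABar\<close>, the charge shifts k +
  2 and 2 combine to k, so the quotient that defines the sector changes by an integer.\<close>

lemma sec_shift_Gl:
  assumes "sec A p" "e \<in> {1, - 1}"
  shows "sec A (shift (cQ (Gl e \<epsilon>)) p)"
proof -
  have "cQ (Gl e \<epsilon>) ATilde - cQ (Gl e \<epsilon>) ABar = of_int e * k"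
    using assms(2) by (auto simp: lform_defs algebra_simps)
  then have "shift (cQ (Gl e \<epsilon>)) p ATilde + shift (cQ (Gl e \<epsilon>)) p ABar = p ATilde + p ABar + of_int e * k"
    by (simp add: shift_def Qsign_def)
  then have s: "(shift (cQ (Gl e \<epsilon>)) p ATilde + shift (cQ (Gl e \<epsilon>)) p ABar) / k = (p ATilde + p ABar) / k + of_int e"
    using k_ne by (simp add: add_divide_distrib)
  have Z: "z + of_int e - 1 / 2 = z - 1 / 2 + of_int e" for z :: complex by simp
  then show ?thesis
    using assms(1) unfolding sec_def s by (cases A) (simp_all only: sector.case mem_Collect_eq Z Ints_add_int)
qed

lemma rep_KK: "rep p (KK h k e) {()} (\<lambda>_. 1) (\<lambda>_. Kl e) 0"
  unfolding KK_eq by (rule rep_nexp)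

lemma acts_on_KK: "acts_on (sector_module k A) \<int> (KK h k e)"
  by (rule acts_on_rep[OF rep_KK linr_KK]) (auto intro: sec_shift_zero)

lemma acts_on_TT: "acts_on (sector_module k A) \<int> (TT h k)"
  by (rule acts_on_rep[OF rep_TT linr_TT]) (auto intro: sec_shift_zero)

lemma acts_on_GG: "e \<in> {1, - 1} \<Longrightarrow> acts_on (sector_module k A) (ZZ A) (GG h k e)"
  by (rule acts_on_rep[OF rep_GG linr_GG]) (auto intro: sec_shift_Gl simp: sec_Gl)

section \<open>Linearity of both sides of the relations\<close>

lemma linr_prod: "(\<And>s. linr (X s)) \<Longrightarrow> (\<And>s. linr (Y s)) \<Longrightarrow> linr (prod_zw X Y s t)"
  and linr_prod': "(\<And>s. linr (X s)) \<Longrightarrow> (\<And>s. linr (Y s)) \<Longrightarrow> linr (prod_wz X Y s t)"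
  by (simp_all add: prod_zw_def[abs_def] prod_wz_def[abs_def] linr_compose)

lemma linr_delta_mult: "(\<And>s. linr (X s)) \<Longrightarrow> linr (delta_mult h A u X s t)"
  unfolding delta_mult_def[abs_def] by (intro linr_if linr_scale linr_const_zero)

text \<open>Modes of \<open>Y\<close> of large index annihilate a given basis vector, so the series
  in z/w acts by a finite sum.\<close>

lemma linr_series_mult:
  assumes "\<And>s. linr (X s)" "\<And>s. linr (Y s)" and Y: "\<And>p. rep p Y I c F u"
  shows "linr (series_mult f (prod_wz X Y) s t)"
proof -
  have "finite {j::nat. scl (f $ j) (prod_wz X Y (s + of_nat j) (t - of_nat j) (Poly_Mapping.single b 1)) \<noteq> 0}" for b
  proof (rule finite_subset)
    have e: "Y (s + of_nat j) (Poly_Mapping.single b 1) =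
        (\<Sum>x\<in>I. scl (c x) (nexp h k (F x) (s + u + of_nat j) (Poly_Mapping.single b 1)))" for j
      unfolding repD[OF Y VV_basis] by (simp add: add_ac)
    show "finite {j::nat. Y (s + of_nat j) (Poly_Mapping.single b 1) \<noteq> 0}"
      unfolding e
      by (rule finite_sum_support[OF rep_finite[OF Y]], rule finite_subset[OF _ finite_nexp_right[OF VV_basis]]) auto
    show "{j::nat. scl (f $ j) (prod_wz X Y (s + of_nat j) (t - of_nat j) (Poly_Mapping.single b 1)) \<noteq> 0}
        \<subseteq> {j::nat. Y (s + of_nat j) (Poly_Mapping.single b 1) \<noteq> 0}"
      by (auto simp: prod_wz_def linr_zero[OF assms(1)])
  qed
  then have "linr (\<lambda>v. Sum_any (\<lambda>j::nat. scl (f $ j) (prod_wz X Y (s + of_nat j) (t - of_nat j) v)))"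
    by (intro linr_Sum_any linr_scale linr_prod' assms)
  then show ?thesis by (simp add: series_mult_def[abs_def])
qed

text \<open>Outside the sector the sum over \<open>\<gamma>\<close> in \<open>WW\<close> need not be finite, so linearity of \<open>WW\<close> is
  obtained through the projection onto the sector module.\<close>

definition sector_proj :: "sector \<Rightarrow> fock \<Rightarrow> fock" where
  "sector_proj A = linext (\<lambda>b. if sec A (fst b) then Poly_Mapping.single b 1 else 0)"

lemma linr_sector_proj: "linr (sector_proj A)"
  unfolding sector_proj_def by (rule linr_linext)

lemma sector_proj_single:
  "sector_proj A (Poly_Mapping.single b 1) = (if sec A (fst b) then Poly_Mapping.single b 1 else 0)"
  by (simp add: sector_proj_def scl_one)

lemma sector_proj_id:
  assumes "v \<in> sector_module k A"
  shows "sector_proj A v = v"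
  by (rule linr_eqI[OF linr_sector_proj linr_id]) (use assms in \<open>simp add: sector_proj_single sector_module_iff\<close>)

lemma linr_normal_GG: "linr (normal_GG (GG h k 1) (GG h k (- 1)) m n)"
  unfolding normal_GG_def[abs_def]
  by (intro linr_if linr_scale linr_minus linr_uminus linr_compose[OF linr_GG linr_GG])

lemma linr_parity_split: "(\<And>s. linr (X s)) \<Longrightarrow> linr (parity_split h A u X s)"
  unfolding parity_split_def[abs_def] creflect_def by (intro linr_plus linr_minus linr_scale)

lemma finite_normal_GG:
  assumes p: "sec A (fst b)" and s: "s \<in> \<int>"
  shows "finite {\<gamma>. (if \<gamma> \<in> ZZ A then normal_GG (GG h k 1) (GG h k (- 1)) (- \<gamma>) (s + \<gamma>) (Poly_Mapping.single b 1) else 0) \<noteq> 0}"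
proof -
  obtain M where M: "s = of_int M" using s by (elim Ints_cases)
  show ?thesis
    by (rule finite_subset[OF _ finite_imageI[OF normal_GG_sum(2)[OF VV_basis p refl, of M], of "\<lambda>i. - (base A + of_int i)"]])
      (auto simp: ZZ_range M diff_diff_eq[symmetric] simp del: minus_add_distrib split: if_splits intro!: imageI)
qed

lemma linr_WW_proj: "linr (\<lambda>v. WW h k A s (sector_proj A v))"
proof -
  have "linr (\<lambda>v. if s \<in> \<int> then Sum_any (\<lambda>\<gamma>. if \<gamma> \<in> ZZ A
      then normal_GG (GG h k 1) (GG h k (- 1)) (- \<gamma>) (s + \<gamma>) (sector_proj A v) else 0) else 0)"
  proof (intro linr_if linr_const_zero linr_Sum_any linr_compose[OF linr_normal_GG linr_sector_proj])
    fix b assume s: "s \<in> \<int>"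
    show "finite {\<gamma>. (if \<gamma> \<in> ZZ A then normal_GG (GG h k 1) (GG h k (- 1)) (- \<gamma>) (s + \<gamma>)
        (sector_proj A (Poly_Mapping.single b 1)) else 0) \<noteq> 0}"
    proof (cases "sec A (fst b)")
      case True
      then show ?thesis using finite_normal_GG[OF True s] by (simp only: sector_proj_single if_True)
    qed (simp add: sector_proj_single linr_zero[OF linr_normal_GG])
  qed
  note N = this
  show ?thesis
    unfolding WW_def
    by (intro linr_minus linr_plus linr_scale N linr_if linr_const_zero linr_sector_proj
        linr_compose[OF linr_parity_split linr_sector_proj] linr_K0 linr_TT)
qed

text \<open>Composed with the projection, W is linear everywhere and can be compared with
  \<open>XX\<close> on vectors of one charge; on the sector module the projection is the
  identity.\<close>

lemma WW_sector_module:
  assumes v: "v \<in> sector_module k A"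
  shows "WW h k A s v = XX s v"
proof -
  have "WW h k A s (sector_proj A v) = XX s v"
  proof (rule sector_module_eqI[OF v linr_WW_proj linr_lincomb])
    fix p L w assume w: "w \<in> VV p L" "sec A p"
    then have "sector_proj A w = w" by (intro sector_proj_id VV_sector_module)
    then show "WW h k A s (sector_proj A w) = XX s w" using WW_eq[OF w] by simp
  qed
  then show ?thesis by (simp add: sector_proj_id[OF v])
qed

text \<open>K^+ preserves the sector module, so W acts on vectors for which it is known.\<close>

lemma KWK_sector_module:
  assumes v: "v \<in> sector_module k A"
  shows "cmult (KK h k (- 1)) (cmult (WW h k A) (KK h k 1)) s v = cmult (KK h k (- 1)) (cmult XX (KK h k 1)) s v"
proof -
  have "KK h k 1 t v \<in> sector_module k A" for t
    using acts_on_KK[of A 1] v by (auto simp: acts_on_def)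
  then show ?thesis unfolding cmult_def by (simp only: WW_sector_module)
qed

lemma linr_KGK: "linr (cmult (KK h k (- 1)) (cmult (GG h k e) (KK h k 1)) s)"
  by (rule linr_KXK[OF linr_GG rep_GG]) simp

lemma linr_KXXK: "linr (cmult (KK h k (- 1)) (cmult XX (KK h k 1)) s)"
  by (rule linr_KXK[OF linr_lincomb rep_lincomb]) simp_all

lemma linr_cone: "linr (cone s)"
  unfolding cone_def[abs_def] by (intro linr_if linr_id linr_const_zero)

lemmas linr_relation = linr_plus linr_minus linr_scale linr_const_zero linr_prod linr_prod' linr_delta_mult
  linr_cscale linr_KK linr_TT linr_GG linr_K0 linr_KGK linr_KXXK linr_cone

context
  fixes A v assumes v: "v \<in> sector_module k A"
begin

lemma sector_KK:
  "e \<in> {1, - 1} \<Longrightarrow> prod_zw (KK h k e) (KK h k e) s t v = prod_wz (KK h k e) (KK h k e) s t v"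
  by (rule sector_module_eqI[OF v]) (auto intro!: linr_relation rel_KK)

lemma sector_K_K:
  "prod_zw (KK h k (- 1)) (KK h k 1) s t v =
    series_mult ((lin h (2 * k + 2) * lin h (- 2 * k - 2)) / (lin h 2 * lin h (- 2)))
      (prod_wz (KK h k 1) (KK h k (- 1))) s t v"
  by (rule sector_module_eqI[OF v _ linr_series_mult[OF linr_KK linr_KK rep_KK] rel_K_K]) (auto intro!: linr_relation)

lemma sector_K_T:
  "prod_zw (KK h k (- 1)) (TT h k) s t v =
    series_mult ((lin h (k + 1) * lin h (- k - 1)) / (lin h (k + 3) * lin h (- k - 3)))
      (prod_wz (TT h k) (KK h k (- 1))) s t v"
  by (rule sector_module_eqI[OF v _ linr_series_mult[OF linr_TT linr_KK rep_KK] rel_K_T]) (auto intro!: linr_relation)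

lemma sector_T_K:
  "prod_zw (TT h k) (KK h k 1) s t v =
    series_mult ((lin h (k + 1) * lin h (- k - 1)) / (lin h (k + 3) * lin h (- k - 3)))
      (prod_wz (KK h k 1) (TT h k)) s t v"
  by (rule sector_module_eqI[OF v _ linr_series_mult[OF linr_KK linr_TT rep_TT] rel_T_K]) (auto intro!: linr_relation)

lemma sector_K_G:
  assumes e: "e \<in> {1, - 1}"
  shows "prod_zw (KK h k (- 1)) (GG h k e) s t v =
    series_mult (fps_const (qpow h (of_int e * (k + 2))) * (1 - fps_X) / lin h (of_int e * 2 * (k + 2)))
      (prod_wz (GG h k e) (KK h k (- 1))) s t v"
  by (rule sector_module_eqI[OF v _ linr_series_mult[OF linr_GG linr_KK rep_KK] rel_K_G[OF _ e]]) (auto intro!: linr_relation)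

lemma sector_G_K:
  assumes e: "e \<in> {1, - 1}"
  shows "prod_zw (GG h k e) (KK h k 1) s t v =
    series_mult (fps_const (qpow h (- of_int e * (k + 2))) * (1 - fps_X) / lin h (- of_int e * 2 * (k + 2)))
      (prod_wz (KK h k 1) (GG h k e)) s t v"
  by (rule sector_module_eqI[OF v _ linr_series_mult[OF linr_KK linr_GG rep_GG] rel_G_K[OF _ e]]) (auto intro!: linr_relation)

lemma sector_GG_same:
  assumes e: "e \<in> {1, - 1}"
  shows "prod_zw (GG h k e) (GG h k e) s t v + prod_wz (GG h k e) (GG h k e) s t v = 0"
  by (rule sector_module_eqI[OF v _ _ rel_GG_same[OF _ e]]) (auto intro!: linr_relation)

lemma sector_GG_pm:
  "prod_zw (GG h k 1) (GG h k (- 1)) s t v + prod_wz (GG h k (- 1)) (GG h k 1) s t v =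
    scl (1 / dq h ^ 2)
      (delta_mult h A (4 * (k + 1)) (\<lambda>m x. scl (1 / qn h (k + 1)) (cscale h (2 * (k + 1)) (K0 h k) m x)) s t v
       - delta_mult h A (2 * (k + 2)) cone s t v
       + delta_mult h A (2 * (k + 1)) (cscale h (k + 1) (TT h k)) s t v)"
  by (rule sector_module_eqI[OF v _ _ rel_GG_pm]) (auto intro!: linr_relation)

lemma sector_GT:
  assumes e: "e \<in> {1, - 1}"
  shows "prod_zw (GG h k e) (TT h k) s t v - prod_wz (TT h k) (GG h k e) s t v =
    scl (of_int e * dq h * (qn h (k + 2) / qn h (k + 1)))
      (delta_mult h A (of_int e * 3 * (k + 1))
         (cscale h (of_int e * (k + 1)) (cmult (KK h k (- 1)) (cmult (GG h k e) (KK h k 1)))) s t v)"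
  by (rule sector_module_eqI[OF v _ _ rel_GT[OF _ _ e]]) (auto intro!: linr_relation)

lemma sector_TT:
  "prod_zw (TT h k) (TT h k) s t v - prod_wz (TT h k) (TT h k) s t v =
    scl (dq h * (qn h (k + 2) ^ 2 / qn h (k + 1)))
      (delta_mult h Ramond (2 * (k + 1))
          (cscale h (k + 1) (cmult (KK h k (- 1)) (cmult (WW h k A) (KK h k 1)))) s t v
       - delta_mult h Ramond (- 2 * (k + 1))
          (cscale h (- (k + 1)) (cmult (KK h k (- 1)) (cmult (WW h k A) (KK h k 1)))) s t v)"
proof -
  have e: "delta_mult h Ramond a (cscale h w (cmult (KK h k (- 1)) (cmult (WW h k A) (KK h k 1)))) s t v =
      delta_mult h Ramond a (cscale h w (cmult (KK h k (- 1)) (cmult XX (KK h k 1)))) s t v" for a w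
    unfolding delta_mult_def cscale_def KWK_sector_module[OF v] ..
  show ?thesis
    unfolding e by (rule sector_module_eqI[OF v _ _ rel_TT]) (auto intro!: linr_relation)
qed

end

end

theorem theorem7p16:
  fixes q h k :: complex and A :: sector
  assumes "q = exp h"
    and "norm q \<le> 1" and "norm (qpow h k) \<le> 1"
    and "k \<noteq> - 2" and "\<And>n::nat. n > 0 \<Longrightarrow> q ^ n \<noteq> 1"
    and "\<And>n::nat. n > 0 \<Longrightarrow> qn h (k * of_nat n) \<noteq> 0"
    and "qn h (k + 1) \<noteq> 0" and "qn h (k + 2) \<noteq> 0" and "qn h (2 * k + 2) \<noteq> 0"
  shows
    "(\<forall>e\<in>{1, - 1}. acts_on (sector_module k A) \<int> (KK h k e))
     \<and> acts_on (sector_module k A) \<int> (TT h k)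
     \<and> (\<forall>e\<in>{1, - 1}. acts_on (sector_module k A) (ZZ A) (GG h k e))
     \<and> (\<forall>s t. \<forall>v\<in>sector_module k A.
      (\<forall>e\<in>{1, - 1}. prod_zw (KK h k e) (KK h k e) s t v = prod_wz (KK h k e) (KK h k e) s t v)
    \<and> prod_zw (KK h k (- 1)) (KK h k 1) s t v =
        series_mult
          ((lin h (2 * k + 2) * lin h (- 2 * k - 2)) / (lin h 2 * lin h (- 2)))
          (prod_wz (KK h k 1) (KK h k (- 1))) s t v
    \<and> prod_zw (KK h k (- 1)) (TT h k) s t v =
        series_mult
          ((lin h (k + 1) * lin h (- k - 1)) / (lin h (k + 3) * lin h (- k - 3)))
          (prod_wz (TT h k) (KK h k (- 1))) s t v
    \<and> prod_zw (TT h k) (KK h k 1) s t v =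
        series_mult
          ((lin h (k + 1) * lin h (- k - 1)) / (lin h (k + 3) * lin h (- k - 3)))
          (prod_wz (KK h k 1) (TT h k)) s t v
    \<and> (\<forall>e\<in>{1, - 1}. prod_zw (KK h k (- 1)) (GG h k e) s t v =
        series_mult
          (fps_const (qpow h (of_int e * (k + 2))) * (1 - fps_X) / lin h (of_int e * 2 * (k + 2)))
          (prod_wz (GG h k e) (KK h k (- 1))) s t v)
    \<and> (\<forall>e\<in>{1, - 1}. prod_zw (GG h k e) (KK h k 1) s t v =
        series_mult
          (fps_const (qpow h (- of_int e * (k + 2))) * (1 - fps_X) / lin h (- of_int e * 2 * (k + 2)))
          (prod_wz (KK h k 1) (GG h k e)) s t v)
    \<and> (\<forall>e\<in>{1, - 1}. prod_zw (GG h k e) (GG h k e) s t v + prod_wz (GG h k e) (GG h k e) s t v = 0)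
    \<and> prod_zw (GG h k 1) (GG h k (- 1)) s t v + prod_wz (GG h k (- 1)) (GG h k 1) s t v =
        scl (1 / dq h ^ 2)
          (delta_mult h A (4 * (k + 1))
              (\<lambda>m x. scl (1 / qn h (k + 1)) (cscale h (2 * (k + 1)) (K0 h k) m x)) s t v
           - delta_mult h A (2 * (k + 2)) cone s t v
           + delta_mult h A (2 * (k + 1)) (cscale h (k + 1) (TT h k)) s t v)
    \<and> (\<forall>e\<in>{1, - 1}. prod_zw (GG h k e) (TT h k) s t v - prod_wz (TT h k) (GG h k e) s t v =
        scl (of_int e * dq h * (qn h (k + 2) / qn h (k + 1)))
          (delta_mult h A (of_int e * 3 * (k + 1))
             (cscale h (of_int e * (k + 1)) (cmult (KK h k (- 1)) (cmult (GG h k e) (KK h k 1)))) s t v))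
    \<and> prod_zw (TT h k) (TT h k) s t v - prod_wz (TT h k) (TT h k) s t v =
        scl (dq h * (qn h (k + 2) ^ 2 / qn h (k + 1)))
          (delta_mult h Ramond (2 * (k + 1))
              (cscale h (k + 1) (cmult (KK h k (- 1)) (cmult (WW h k A) (KK h k 1)))) s t v
           - delta_mult h Ramond (- 2 * (k + 1))
              (cscale h (- (k + 1)) (cmult (KK h k (- 1)) (cmult (WW h k A) (KK h k 1)))) s t v))"
proof -
  interpret fock_generic h k
    by unfold_locales (use assms in auto)
  show ?thesis
    by (intro conjI allI ballI acts_on_KK acts_on_TT acts_on_GG sector_KK sector_K_K sector_K_T sector_T_K
        sector_K_G sector_G_K sector_GG_same sector_GG_pm sector_GT sector_TT)
qed

end
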